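(* For a domain $D\subset\mathbb{C}$ let $p_D$ be any one of $c_D,\ k_D,\ b_D/\sqrt{2}$, and let $$s_D(z,w)=\sinh^{-1}\frac{|z-w|}{2\sqrt{d_D(z)d_D(w)}},\qquad z,w\in D.$$ (a) If $a\in\partial D$ is a $\mathcal{C}^1$-smooth boundary point of a domain $D\subset\mathbb{C}$, then $$\lim_{\substack{z,w\to a\\ z,w\in D,\ z\neq w}}\frac{p_D(z,w)}{s_D(z,w)}=1.$$ (b) If $D\subset\mathbb{C}$ is a $\mathcal{C}^1$-smooth bounded domain, then $$\lim_{z\to\partial D}\frac{p_D(z,w)}{s_D(z,w)}=1\quad\text{uniformly in } w\in D,\ w\neq z;$$ that is, for every $\eta>0$ there is $\delta>0$ such that $\left|\frac{p_D(z,w)}{s_D(z,w)}-1\right|<\eta$ for all $z\in D$ with $d_D(z)<\delta$ and all $w\in D\setminus\{z\}$.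
   Context: $\mathbb{D}$ is the open unit disc, $\mathcal{O}(X,Y)$ is the set of holomorphic maps from $X$ to $Y$, and $d_D(z)=\mathrm{dist}(z,\partial D)$. For a domain $D\subset\mathbb{C}$ and $z,w\in D$: - Carathéodory (pseudo)distance: $c_D(z,w)=\sup\{\tanh^{-1}|\psi(w)|:\psi\in\mathcal{O}(D,\mathbb{D}),\ \psi(z)=0\}$. - Kobayashi (pseudo)distance: $k_D$ is the largest (pseudo)distance on $D$ not exceeding the Lempert function $l_D(z,w)=\inf\{\tanh^{-1}|\alpha|:\exists\varphi\in\mathcal{O}(\mathbb{D},D)\text{ with }\varphi(0)=z,\ \varphi(\alpha)=w\}$. - Bergman distance: $b_D(z,w)=\inf_\gamma\int_0^1\beta_D(\gamma(t))\,|\gamma'(t)|\,dt$, the infimum being over all smooth curves $\gamma:[0,1]\to D$ with $\gamma(0)=z$, $\gamma(1)=w$. Here $\beta_D(z)=M_D(z)/\sqrt{K_D(z)}$ is the Bergman metric, with $K_D(z)=\sup\{|f(z)|^2: f\in L^2_h(D),\ \|f\|_{L^2(D)}\le 1\}$ and $M_D(z)=\sup\{|f'(z)|: f\in L^2_h(D),\ \|f\|_{L^2(D)}\le 1,\ f(z)=0\}$, where $L^2_h(D)$ is the space of square-integrable (with respect to Lebesgue measure) holomorphic functions on $D$ (defined when $\mathbb{C}\setminus D$ is not polar, in which case $K_D>0$). A boundary point $a$ of $D$ is $\mathcal{C}^1$-smooth if $\partial D$ near $a$ is given by a $\mathcal{C}^1$ curve $\gamma:[0,1]\to\mathbb{C}$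 with $\gamma'\neq 0$, with $D$ lying near $a$ on one side of this curve. A domain is $\mathcal{C}^1$-smooth if all its boundary points are $\mathcal{C}^1$-smooth. *)

theory Defs
  imports "HOL-Complex_Analysis.Complex_Analysis"
begin

definition domain :: "complex set \<Rightarrow> bool"
  where "domain D \<longleftrightarrow> open D \<and> connected D \<and> D \<noteq> {}"

definition bdry_dist :: "complex set \<Rightarrow> complex \<Rightarrow> real"
  where "bdry_dist D z = infdist z (frontier D)"

definition holo_maps :: "complex set \<Rightarrow> complex set \<Rightarrow> (complex \<Rightarrow> complex) set"
  where "holo_maps X Y = {f. f holomorphic_on X \<and> f ` X \<subseteq> Y}"

text \<open>On a domain the suprema and infima of reals below range over nonempty sets that are
  bounded above, respectively below, so they are the genuine ones.\<close>

definition caratheodory_dist :: "complex set \<Rightarrow> complex \<Rightarrow> complex \<Rightarrow> real"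
  where "caratheodory_dist D z w =
    Sup {artanh (cmod (\<psi> w)) |\<psi>. \<psi> \<in> holo_maps D (ball 0 1) \<and> \<psi> z = 0}"

definition lempert :: "complex set \<Rightarrow> complex \<Rightarrow> complex \<Rightarrow> real"
  where "lempert D z w =
    Inf {artanh (cmod \<alpha>) |\<alpha>. \<alpha> \<in> ball 0 1 \<and>
      (\<exists>\<phi>\<in>holo_maps (ball 0 1) D. \<phi> 0 = z \<and> \<phi> \<alpha> = w)}"

definition pseudodistance_on :: "'a set \<Rightarrow> ('a \<Rightarrow> 'a \<Rightarrow> real) \<Rightarrow> bool"
  where "pseudodistance_on D \<rho> \<longleftrightarrow>
    (\<forall>x\<in>D. \<rho> x x = 0) \<and>
    (\<forall>x\<in>D. \<forall>y\<in>D. 0 \<le> \<rho> x y \<and> \<rho> x y = \<rho> y x) \<and>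
    (\<forall>x\<in>D. \<forall>y\<in>D. \<forall>z\<in>D. \<rho> x z \<le> \<rho> x y + \<rho> y z)"

definition pseudodistances_below_lempert :: "complex set \<Rightarrow> (complex \<Rightarrow> complex \<Rightarrow> real) set"
  where "pseudodistances_below_lempert D =
    {\<rho>. pseudodistance_on D \<rho> \<and> (\<forall>x\<in>D. \<forall>y\<in>D. \<rho> x y \<le> lempert D x y)}"

text \<open>The largest pseudodistance below the Lempert function is the pointwise supremum of all
  of them; the two lemmas after the definition justify this.\<close>

definition kobayashi_dist :: "complex set \<Rightarrow> complex \<Rightarrow> complex \<Rightarrow> real"
  where "kobayashi_dist D z w = (SUP \<rho>\<in>pseudodistances_below_lempert D. \<rho> z w)"

lemma kobayashi_dist_upper:
  assumes "\<rho> \<in> pseudodistances_below_lempert D" "z \<in> D" "w \<in> D"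
  shows "\<rho> z w \<le> kobayashi_dist D z w"
  unfolding kobayashi_dist_def
  by (rule cSUP_upper[OF assms(1)], rule bdd_aboveI[of _ "lempert D z w"])
     (use assms in \<open>auto simp: pseudodistances_below_lempert_def\<close>)

lemma kobayashi_dist_in:
  assumes nonneg: "\<And>x y. x \<in> D \<Longrightarrow> y \<in> D \<Longrightarrow> 0 \<le> lempert D x y"
  shows "kobayashi_dist D \<in> pseudodistances_below_lempert D"
proof -
  let ?P = "pseudodistances_below_lempert D"
  have zero: "(\<lambda>x y. 0) \<in> ?P"
    using nonneg by (simp add: pseudodistances_below_lempert_def pseudodistance_on_def)
  then have ne: "?P \<noteq> {}" by blast
  have P: "pseudodistance_on D \<rho>" if "\<rho> \<in> ?P" for \<rho>
    using that by (simp add: pseudodistances_below_lempert_def)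
  have diag: "kobayashi_dist D x x = 0" if "x \<in> D" for x
  proof -
    have "\<rho> x x = 0" if "\<rho> \<in> ?P" for \<rho>
      using P[OF that] \<open>x \<in> D\<close> by (simp add: pseudodistance_on_def)
    then have "(\<lambda>\<rho>. \<rho> x x) ` ?P = {0}" using ne by force
    then show ?thesis by (simp add: kobayashi_dist_def)
  qed
  have pos: "0 \<le> kobayashi_dist D x y" if "x \<in> D" "y \<in> D" for x y
    using kobayashi_dist_upper[OF zero that] by simp
  have sym: "kobayashi_dist D x y = kobayashi_dist D y x" if "x \<in> D" "y \<in> D" for x y
    unfolding kobayashi_dist_def using P that
    by (intro SUP_cong) (auto simp: pseudodistance_on_def)
  have tri: "kobayashi_dist D x z \<le> kobayashi_dist D x y + kobayashi_dist D y z"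
    if xyz: "x \<in> D" "y \<in> D" "z \<in> D" for x y z
    unfolding kobayashi_dist_def[of D x z]
  proof (rule cSUP_least[OF ne])
    fix \<rho> assume r: "\<rho> \<in> ?P"
    have "\<rho> x z \<le> \<rho> x y + \<rho> y z"
      using P[OF r] xyz unfolding pseudodistance_on_def by blast
    also have "\<dots> \<le> kobayashi_dist D x y + kobayashi_dist D y z"
      by (intro add_mono kobayashi_dist_upper r xyz)
    finally show "\<rho> x z \<le> kobayashi_dist D x y + kobayashi_dist D y z" .
  qed
  have le: "kobayashi_dist D x y \<le> lempert D x y" if "x \<in> D" "y \<in> D" for x y
    unfolding kobayashi_dist_def using that
    by (intro cSUP_least[OF ne]) (auto simp: pseudodistances_below_lempert_def)
  show ?thesis
    unfolding pseudodistances_below_lempert_def pseudodistance_on_def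
    using diag pos sym tri le by blast
qed

definition L2h :: "complex set \<Rightarrow> (complex \<Rightarrow> complex) set"
  where "L2h D = {f. f holomorphic_on D \<and> set_integrable lborel D (\<lambda>z. (cmod (f z))\<^sup>2)}"

definition L2_norm_on :: "complex set \<Rightarrow> (complex \<Rightarrow> complex) \<Rightarrow> real"
  where "L2_norm_on D f = sqrt (LINT z:D|lborel. (cmod (f z))\<^sup>2)"

definition bergman_K :: "complex set \<Rightarrow> complex \<Rightarrow> real"
  where "bergman_K D z = Sup {(cmod (f z))\<^sup>2 |f. f \<in> L2h D \<and> L2_norm_on D f \<le> 1}"

definition bergman_M :: "complex set \<Rightarrow> complex \<Rightarrow> real"
  where "bergman_M D z =
    Sup {cmod (deriv f z) |f. f \<in> L2h D \<and> L2_norm_on D f \<le> 1 \<and> f z = 0}"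

definition bergman_metric :: "complex set \<Rightarrow> complex \<Rightarrow> real"
  where "bergman_metric D z = bergman_M D z / sqrt (bergman_K D z)"

definition bergman_length :: "complex set \<Rightarrow> (real \<Rightarrow> complex) \<Rightarrow> ennreal"
  where "bergman_length D \<gamma> =
    (\<integral>\<^sup>+t\<in>{0..1}. ennreal (bergman_metric D (\<gamma> t) * cmod (vector_derivative \<gamma> (at t))) \<partial>lborel)"

definition bergman_dist :: "complex set \<Rightarrow> complex \<Rightarrow> complex \<Rightarrow> real"
  where "bergman_dist D z w = enn2real (INF \<gamma>\<in>{\<gamma>. \<gamma> C1_differentiable_on {0..1} \<and>
      path_image \<gamma> \<subseteq> D \<and> pathstart \<gamma> = z \<and> pathfinish \<gamma> = w}. bergman_length D \<gamma>)"

text \<open>Inside a ball around a, the frontier of D is a regular C1 arc with a in its relative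
  interior. One-sidedness: short left normals of the arc (direction i times the tangent) enter D
  and short right normals do not. Taking the left side is no restriction, as the arc can be
  reversed. A slit, where D lies on both sides, is thereby excluded.\<close>

definition C1_smooth_boundary_point :: "complex set \<Rightarrow> complex \<Rightarrow> bool"
  where "C1_smooth_boundary_point D a \<longleftrightarrow>
    (\<exists>\<gamma> r. arc \<gamma> \<and> \<gamma> C1_differentiable_on {0..1} \<and>
       (\<forall>t\<in>{0..1}. vector_derivative \<gamma> (at t) \<noteq> 0) \<and>
       r > 0 \<and> a \<in> \<gamma> ` {0<..<1} \<and>
       frontier D \<inter> ball a r = path_image \<gamma> \<inter> ball a r \<and>
       (\<forall>t\<in>{0<..<1}. \<gamma> t \<in> ball a r \<longrightarrow>
          (\<forall>\<^sub>F s in at_right 0.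
             \<gamma> t + of_real s * \<i> * vector_derivative \<gamma> (at t) \<in> D \<and>
             \<gamma> t - of_real s * \<i> * vector_derivative \<gamma> (at t) \<notin> D)))"

definition C1_smooth_domain :: "complex set \<Rightarrow> bool"
  where "C1_smooth_domain D \<longleftrightarrow>
    domain D \<and> (\<forall>a\<in>frontier D. C1_smooth_boundary_point D a)"

definition s_fun :: "complex set \<Rightarrow> complex \<Rightarrow> complex \<Rightarrow> real"
  where "s_fun D z w = arsinh (cmod (z - w) / (2 * sqrt (bdry_dist D z * bdry_dist D w)))"

end

theory Submission imports Defs begin

text \<open>
  Near a C1 boundary point the domain looks like a half plane at every small scale, and s is
  the hyperbolic distance of a half plane. The proof makes this quantitative. C1 smoothness
  is used only in the form of cones (\<open>has_cones\<close>): at the frontier points p near a, a cone of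
  opening angle close to \<open>\<pi>\<close> and of a size independent of p lies in D, and the opposite cone lies
  outside D (lemma \<open>C1_smooth_boundary_point_has_cones\<close>). By compactness the size is uniform along
  the whole frontier of a bounded C1-smooth domain. The condition \<open>flat_along\<close> covers both
  situations.

  Moderate distances. If s(z,w) stays bounded while z approaches the boundary, then \<open>|z - w|\<close> is
  comparable to d(z) and d(w). The cones contain discs whose radius is a large multiple of d(z), one inside D
  and one outside D, and both nearly touch at the frontier point nearest to z. The hyperbolic
  distances of the inner disc and of the exterior of the outer disc agree with s up to a factor near 1
  (lemmas \<open>comparison_balls\<close>, \<open>pinched_near_boundary\<close>). Since \<open>c \<le> k\<close>, k is at most the distance
  of the inner disc, and c is at least that of the exterior, this settles c and k. The conformal
  invariance of square integrals and sharp estimates at the centre of the unit disc bound the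
  Bergman metric by the two hyperbolic metrics in the same way, so it is close to \<open>1 / (sqrt 2 d)\<close>.

  Large distances. With \<open>L = |z - w|\<close>, s is half the sum of \<open>log (L / d(z))\<close> and \<open>log (L / d(w))\<close> up
  to a constant, and constants do not affect the ratio when s is large. For the lower bound on
  c, the logarithm of \<open>(x - p) / (x - e)\<close>, with p the frontier point nearest to z and e a point outside
  D, maps D into a strip barely wider than \<open>\<pi>\<close>. Two such functions, at the nearest points of z and w, can be
  combined with almost no loss (lemma \<open>two_peaks_le_caratheodory\<close>). For the lower bound on b, a curve has
  to climb from z and from w up to height L, which costs a logarithm at each end. For the upper bound on
  k and b, this climb is made along the normals through points whose heights double at each step
  (lemma \<open>ascend_from_boundary\<close>), after which the two high points are at a bounded distance.

  In the uniform statement, points w far from z are joined through a compact part of D, on which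
  k and b are bounded; this is again a constant compared with \<open>log (1 / d(z))\<close>.
\<close>

section \<open>The Poincare distance and the distances of Caratheodory and Kobayashi\<close>

definition mob :: "complex \<Rightarrow> complex \<Rightarrow> complex"
  where "mob b u = (u - b) / (1 - cnj b * u)"

text \<open>The Poincare distance of the unit disc.\<close>

definition pd :: "complex \<Rightarrow> complex \<Rightarrow> real"
  where "pd u v = artanh (cmod (mob u v))"

lemma mob_denom_nonzero: "cmod b < 1 \<Longrightarrow> cmod u \<le> 1 \<Longrightarrow> 1 - cnj b * u \<noteq> 0"
proof
  assume b: "cmod b < 1" and u: "cmod u \<le> 1" and "1 - cnj b * u = 0"
  then have "cmod (cnj b * u) = 1" by (metis eq_iff_diff_eq_0 norm_one)
  moreover have "cmod b * cmod u < 1"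
    using b u by (metis mult_left_le norm_ge_zero order.strict_trans1)
  ultimately show False by (simp add: norm_mult)
qed

lemma mob_self [simp]: "mob b b = 0"
  by (simp add: mob_def)

lemma mob_zero [simp]: "mob 0 u = u"
  by (simp add: mob_def)

lemma cmod_one_minus_cnj_mult:
  "(cmod (1 - cnj b * u))\<^sup>2 - (cmod (u - b))\<^sup>2 = (1 - (cmod b)\<^sup>2) * (1 - (cmod u)\<^sup>2)"
  by (simp add: cmod_power2) (simp add: algebra_simps power2_eq_square)

lemma one_minus_cmod_mob:
  assumes "1 - cnj b * u \<noteq> 0"
  shows "1 - (cmod (mob b u))\<^sup>2
       = (1 - (cmod b)\<^sup>2) * (1 - (cmod u)\<^sup>2) / (cmod (1 - cnj b * u))\<^sup>2"
  using assms cmod_one_minus_cnj_mult[of b u]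
  by (simp add: mob_def norm_divide power_divide field_simps)

lemma cmod_mob_less_1:
  assumes "cmod b < 1" "cmod u < 1"
  shows "cmod (mob b u) < 1"
proof -
  have "0 < (1 - (cmod b)\<^sup>2) * (1 - (cmod u)\<^sup>2) / (cmod (1 - cnj b * u))\<^sup>2"
    using assms mob_denom_nonzero[of b u] by (simp add: power_less_one_iff abs_square_less_1)
  then have "(cmod (mob b u))\<^sup>2 < 1"
    using one_minus_cmod_mob[of b u] mob_denom_nonzero[of b u] assms by simp
  then show ?thesis by (simp add: abs_square_less_1)
qed

lemma mob_mob_minus:
  assumes "cmod b < 1" "cmod u < 1"
  shows "mob (-b) (mob b u) = u"
proof -
  have nz: "1 - cnj b * u \<noteq> 0" "1 - cnj b * b \<noteq> 0"
    using assms mob_denom_nonzero by (simp_all del: right_minus_eq)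
  have "mob (-b) (mob b u) = ((u - b) + b * (1 - cnj b * u)) / ((1 - cnj b * u) + cnj b * (u - b))"
    using nz(1) by (simp add: mob_def add_divide_eq_iff divide_simps)
  also have "(u - b) + b * (1 - cnj b * u) = u * (1 - cnj b * b)" by (simp add: algebra_simps)
  also have "(1 - cnj b * u) + cnj b * (u - b) = 1 - cnj b * b" by (simp add: algebra_simps)
  finally show ?thesis using nz by simp
qed

lemma mob_holomorphic_on [holomorphic_intros]:
  "f holomorphic_on S \<Longrightarrow> (\<And>x. x \<in> S \<Longrightarrow> 1 - cnj b * f x \<noteq> 0) \<Longrightarrow> (\<lambda>x. mob b (f x)) holomorphic_on S"
  unfolding mob_def by (intro holomorphic_intros) auto

lemma has_field_derivative_mob:
  assumes "1 - cnj b * u \<noteq> 0"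
  shows "(mob b has_field_derivative (1 - (cmod b)\<^sup>2) / (1 - cnj b * u)\<^sup>2) (at u)"
proof -
  have *: "of_real ((cmod b)\<^sup>2) = cnj b * b"
    by (metis complex_norm_square mult.commute of_real_power)
  have "(mob b has_field_derivative ((1 - 0) * (1 - cnj b * u) - (u - b) * (0 - cnj b * 1)) / ((1 - cnj b * u) * (1 - cnj b * u))) (at u)"
    unfolding mob_def using assms by (intro derivative_intros DERIV_divide DERIV_cmult) auto
  also have "(1 - 0) * (1 - cnj b * u) - (u - b) * (0 - cnj b * 1) = 1 - of_real ((cmod b)\<^sup>2)"
    unfolding * by (simp add: algebra_simps)
  finally show ?thesis by (simp add: power2_eq_square)
qed

lemma artanh_eq_arsinh:
  fixes t :: real assumes "0 \<le> t" "t < 1"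
  shows "artanh t = arsinh (t / sqrt (1 - t\<^sup>2))"
proof -
  have p: "0 < 1 - t\<^sup>2" using assms by (simp add: abs_square_less_1)
  have "(t / sqrt (1 - t\<^sup>2))\<^sup>2 + 1 = 1 / (1 - t\<^sup>2)"
    using p by (simp add: power_divide field_simps)
  then have "arsinh (t / sqrt (1 - t\<^sup>2)) = ln ((t + 1) / sqrt (1 - t\<^sup>2))"
    by (simp add: arsinh_real_def real_sqrt_divide add_divide_distrib)
  also have "(t + 1) / sqrt (1 - t\<^sup>2) = sqrt ((1 + t) / (1 - t))"
  proof -
    have "1 - t\<^sup>2 = (1 + t) * (1 - t)" by (simp add: algebra_simps power2_eq_square)
    then have "sqrt (1 - t\<^sup>2) = sqrt (1 + t) * sqrt (1 - t)" by (simp add: real_sqrt_mult)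
    then show ?thesis using assms
      by (simp add: real_sqrt_divide field_simps)
  qed
  also have "ln (sqrt ((1 + t) / (1 - t))) = artanh t"
    using assms by (simp add: artanh_def ln_sqrt)
  finally show ?thesis by simp
qed

text \<open>This form compares with s, since \<open>1 - |u|\<^sup>2\<close> is close to twice
  the distance of u from the circle when this is small.\<close>

lemma pd_eq_arsinh:
  assumes "cmod u < 1" "cmod v < 1"
  shows "pd u v = arsinh (cmod (u - v) / sqrt ((1 - (cmod u)\<^sup>2) * (1 - (cmod v)\<^sup>2)))"
proof -
  have nz: "1 - cnj u * v \<noteq> 0" using assms by (intro mob_denom_nonzero) auto
  have "pd u v = arsinh (cmod (mob u v) / sqrt (1 - (cmod (mob u v))\<^sup>2))"
    unfolding pd_def using cmod_mob_less_1[OF assms] by (intro artanh_eq_arsinh) auto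
  also have "sqrt (1 - (cmod (mob u v))\<^sup>2)
      = sqrt ((1 - (cmod u)\<^sup>2) * (1 - (cmod v)\<^sup>2)) / cmod (1 - cnj u * v)"
    by (simp add: one_minus_cmod_mob[OF nz] real_sqrt_divide)
  also have "cmod (mob u v) / (sqrt ((1 - (cmod u)\<^sup>2) * (1 - (cmod v)\<^sup>2)) / cmod (1 - cnj u * v))
     = cmod (u - v) / sqrt ((1 - (cmod u)\<^sup>2) * (1 - (cmod v)\<^sup>2))"
    using nz by (simp add: mob_def norm_divide norm_minus_commute)
  finally show ?thesis .
qed

lemma pd_commute: "cmod u < 1 \<Longrightarrow> cmod v < 1 \<Longrightarrow> pd u v = pd v u"
  by (simp add: pd_eq_arsinh norm_minus_commute mult.commute)

lemma pd_nonneg: "cmod u < 1 \<Longrightarrow> cmod v < 1 \<Longrightarrow> 0 \<le> pd u v"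
  by (simp add: pd_eq_arsinh mult_nonneg_nonneg abs_square_le_1 less_imp_le)
     (metis arsinh_real_neg_iff divide_nonneg_nonneg norm_ge_zero not_less real_sqrt_ge_zero
        abs_norm_cancel abs_square_le_1 diff_ge_0_iff_ge less_imp_le mult_nonneg_nonneg)

lemma pd_mob:
  assumes "cmod c < 1" "cmod u < 1" "cmod v < 1"
  shows "pd (mob c u) (mob c v) = pd u v"
proof -
  have nz: "1 - cnj c * u \<noteq> 0" "1 - cnj c * v \<noteq> 0"
    using assms mob_denom_nonzero by (simp_all del: right_minus_eq)
  define k where "k = 1 - (cmod c)\<^sup>2"
  have k: "k > 0" using assms by (simp add: k_def abs_square_less_1)
  have *: "of_real ((cmod c)\<^sup>2) = cnj c * c"
    by (metis complex_norm_square mult.commute of_real_power)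
  have "mob c u - mob c v = of_real k * (u - v) / ((1 - cnj c * u) * (1 - cnj c * v))"
    using nz by (simp add: mob_def k_def * divide_simps) (simp add: algebra_simps *[simplified])
  then have 1: "cmod (mob c u - mob c v) = k * cmod (u - v) / (cmod (1 - cnj c * u) * cmod (1 - cnj c * v))"
    using k by (simp add: norm_mult norm_divide)
  have "(1 - (cmod (mob c u))\<^sup>2) * (1 - (cmod (mob c v))\<^sup>2)
      = (k / (cmod (1 - cnj c * u) * cmod (1 - cnj c * v)))\<^sup>2 * ((1 - (cmod u)\<^sup>2) * (1 - (cmod v)\<^sup>2))"
    unfolding one_minus_cmod_mob[OF nz(1)] one_minus_cmod_mob[OF nz(2)] k_def
    by (simp add: power_divide power_mult_distrib power2_eq_square mult_ac)
  then have 2: "sqrt ((1 - (cmod (mob c u))\<^sup>2) * (1 - (cmod (mob c v))\<^sup>2))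
     = k / (cmod (1 - cnj c * u) * cmod (1 - cnj c * v)) * sqrt ((1 - (cmod u)\<^sup>2) * (1 - (cmod v)\<^sup>2))"
    using k by (simp add: real_sqrt_mult)
  show ?thesis using k nz
    by (simp add: pd_eq_arsinh assms cmod_mob_less_1 1 2 divide_simps)
qed

lemma artanh_mono:
  fixes x y :: real assumes "-1 < x" "x \<le> y" "y < 1" shows "artanh x \<le> artanh y"
proof -
  have "(1 + x) / (1 - x) \<le> (1 + y) / (1 - y)" "0 < (1 + x) / (1 - x)"
    using assms by (auto simp: divide_simps algebra_simps)
  then show ?thesis by (simp add: artanh_def)
qed

lemma artanh_nonneg: "0 \<le> x \<Longrightarrow> x < 1 \<Longrightarrow> 0 \<le> artanh (x::real)"
  using artanh_mono[of 0 x] by simp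

text \<open>The triangle inequality through the centre, from which automorphisms yield the general one:
  \<open>artanh x + artanh y = artanh ((x + y) / (1 + x y))\<close>, and \<open>|1 - cnj a b| \<le> 1 + |a| |b|\<close>.\<close>

lemma pd_le_add:
  assumes a: "cmod a < 1" and b: "cmod b < 1"
  shows "pd a b \<le> artanh (cmod a) + artanh (cmod b)"
proof -
  define x y where "x = cmod a" and "y = cmod b"
  have x: "0 \<le> x" "x < 1" and y: "0 \<le> y" "y < 1" using a b by (auto simp: x_def y_def)
  have xy: "0 \<le> x * y" "x * y < 1" using x y mult_strict_mono[of x 1 y 1] by auto
  have nz: "1 - cnj a * b \<noteq> 0" using a b by (intro mob_denom_nonzero) auto
  define t where "t = (x + y) / (1 + x * y)"
  have "(1 - x) * (1 - y) > 0" using x y by simp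
  then have t: "0 \<le> t" "t < 1" using x y xy by (auto simp: t_def divide_simps algebra_simps)
  have den: "1 + x * y \<noteq> 0" using xy by auto
  have "1 - t\<^sup>2 = (1 - x\<^sup>2) * (1 - y\<^sup>2) / (1 + x * y)\<^sup>2"
    unfolding t_def using den by (simp add: power_divide divide_simps) algebra
  also have "\<dots> \<le> (1 - x\<^sup>2) * (1 - y\<^sup>2) / (cmod (1 - cnj a * b))\<^sup>2"
  proof (rule divide_left_mono)
    have "cmod (1 - cnj a * b) \<le> 1 + x * y"
      by (metis norm_triangle_ineq4 norm_one norm_mult complex_mod_cnj x_def y_def)
    then show "(cmod (1 - cnj a * b))\<^sup>2 \<le> (1 + x * y)\<^sup>2" by (intro power_mono) auto
    show "0 \<le> (1 - x\<^sup>2) * (1 - y\<^sup>2)" using x y by (simp add: abs_square_le_1)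
    show "0 < (1 + x * y)\<^sup>2 * (cmod (1 - cnj a * b))\<^sup>2" using nz xy den by simp
  qed
  also have "\<dots> = 1 - (cmod (mob a b))\<^sup>2"
    using one_minus_cmod_mob[OF nz] by (simp add: x_def y_def)
  finally have "(cmod (mob a b))\<^sup>2 \<le> t\<^sup>2" by simp
  then have "cmod (mob a b) \<le> t" using t by (simp add: power2_le_iff_abs_le)
  then have "pd a b \<le> artanh t" unfolding pd_def using t by (intro artanh_mono) (auto intro: order.strict_trans2[OF _ norm_ge_zero])
  also have "artanh t = artanh x + artanh y"
  proof -
    have "(1 + t) / (1 - t) = ((1 + x) / (1 - x)) * ((1 + y) / (1 - y))"
    proof -
      have "(1 + t) / (1 - t) = ((1 + t) * (1 + x * y)) / ((1 - t) * (1 + x * y))" using den by simp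
      also have "(1 + t) * (1 + x * y) = (1 + x) * (1 + y)"
        using den by (simp add: t_def field_simps)
      also have "(1 - t) * (1 + x * y) = (1 - x) * (1 - y)"
        using den by (simp add: t_def field_simps)
      finally show ?thesis by simp
    qed
    moreover have "(1 + x) / (1 - x) > 0" "(1 + y) / (1 - y) > 0" using x y by auto
    ultimately show ?thesis by (simp add: artanh_def ln_mult add_divide_distrib)
  qed
  finally show ?thesis by (simp add: x_def y_def)
qed

lemma pd_triangle:
  assumes "cmod u < 1" "cmod v < 1" "cmod w < 1"
  shows "pd u w \<le> pd u v + pd v w"
proof -
  have "pd u w = pd (mob v u) (mob v w)" using assms by (simp add: pd_mob)
  also have "\<dots> \<le> pd v u + pd v w"
    using pd_le_add[of "mob v u" "mob v w"] assms by (simp add: cmod_mob_less_1 pd_def)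
  finally show ?thesis using assms by (simp add: pd_commute)
qed

lemma Schwarz_Pick:
  assumes h: "h \<in> holo_maps (ball 0 1) (ball 0 1)" and \<alpha>: "cmod \<alpha> < 1"
  shows "pd (h 0) (h \<alpha>) \<le> artanh (cmod \<alpha>)"
proof -
  have hol: "h holomorphic_on ball 0 1" and bd: "\<And>z. cmod z < 1 \<Longrightarrow> cmod (h z) < 1"
    using h by (auto simp: holo_maps_def image_subset_iff)
  have 0: "cmod (h 0) < 1" using bd by simp
  have "cmod ((\<lambda>z. mob (h 0) (h z)) \<alpha>) \<le> cmod \<alpha>"
  proof (rule Schwarz_Lemma(1))
    show "(\<lambda>z. mob (h 0) (h z)) holomorphic_on ball 0 1"
      using mob_denom_nonzero[OF 0] bd by (intro holomorphic_intros hol) (auto simp: less_imp_le)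
    show "cmod (mob (h 0) (h z)) < 1" if "cmod z < 1" for z using cmod_mob_less_1 0 bd that by auto
  qed (use \<alpha> in auto)
  then show ?thesis unfolding pd_def
    using \<alpha> by (intro artanh_mono) (auto intro: order.strict_trans2[OF _ norm_ge_zero])
qed

lemma holo_maps_comp:
  "f \<in> holo_maps A B \<Longrightarrow> g \<in> holo_maps B C \<Longrightarrow> (\<lambda>z. g (f z)) \<in> holo_maps A C"
  unfolding holo_maps_def using holomorphic_on_compose_gen[of f A g B] by (auto simp: o_def)

lemma real_polynomial_function_extends_holomorphic:
  "real_polynomial_function f \<Longrightarrow> \<exists>F. F holomorphic_on UNIV \<and> (\<forall>t::real. F (of_real t) = of_real (f t))"
proof (induction f rule: real_polynomial_function.induct)
  case (linear f)
  then obtain c where "f = (\<lambda>t. t * c)" using real_bounded_linear by blast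
  then show ?case by (intro exI[of _ "\<lambda>z. z * of_real c"]) (auto intro!: holomorphic_intros)
next
  case (const c)
  then show ?case by (intro exI[of _ "\<lambda>z. of_real c"]) auto
next
  case (add f g)
  then obtain F G where "F holomorphic_on UNIV" "\<forall>t. F (of_real t) = of_real (f t)"
     "G holomorphic_on UNIV" "\<forall>t. G (of_real t) = of_real (g t)" by auto
  then show ?case by (intro exI[of _ "\<lambda>z. F z + G z"]) (auto intro!: holomorphic_intros)
next
  case (mult f g)
  then obtain F G where "F holomorphic_on UNIV" "\<forall>t. F (of_real t) = of_real (f t)"
     "G holomorphic_on UNIV" "\<forall>t. G (of_real t) = of_real (g t)" by auto
  then show ?case by (intro exI[of _ "\<lambda>z. F z * G z"]) (auto intro!: holomorphic_intros)
qed

text \<open>The infimum in the Lempert function is over a nonempty set. A polynomial path from z to w extends to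
  an entire map P, which takes a thin convex neighbourhood of the segment [0,1] into D; by the Riemann
  mapping theorem that neighbourhood is a disc.\<close>

lemma ex_holomorphic_disc_through:
  assumes D: "domain D" and z: "z \<in> D" and w: "w \<in> D"
  shows "\<exists>\<phi>\<in>holo_maps (ball 0 1) D. \<exists>\<alpha>\<in>ball 0 1. \<phi> 0 = z \<and> \<phi> \<alpha> = w"
proof -
  have "open D" "connected D" using D by (auto simp: domain_def)
  then obtain g where g: "polynomial_function g" "path_image g \<subseteq> D" "pathstart g = z" "pathfinish g = w"
    using connected_open_polynomial_connected[OF _ _ z w] by blast
  have "real_polynomial_function (\<lambda>t. Re (g t))" "real_polynomial_function (\<lambda>t. Im (g t))"
    using g(1) bounded_linear_Re bounded_linear_Im unfolding polynomial_function_def o_def by blast+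
  then obtain F G where FG: "F holomorphic_on UNIV" "\<And>t::real. F (of_real t) = of_real (Re (g t))"
     "G holomorphic_on UNIV" "\<And>t::real. G (of_real t) = of_real (Im (g t))"
    using real_polynomial_function_extends_holomorphic by metis
  define P where "P = (\<lambda>x. F x + \<i> * G x)"
  have Pg: "P (of_real t) = g t" for t by (simp add: P_def FG complex_eq[of "g t", symmetric])
  have hol: "P holomorphic_on UNIV" unfolding P_def by (intro holomorphic_intros FG)
  have "open (P -` D)"
    using \<open>open D\<close> hol holomorphic_on_imp_continuous_on open_vimage by blast
  moreover have seg: "closed_segment 0 1 \<subseteq> P -` D"
    using g(2) Pg by (fastforce simp: closed_segment_def path_image_def scaleR_conv_of_real)
  ultimately obtain e where e: "0 < e" "(\<Union>x\<in>closed_segment 0 1. ball x e) \<subseteq> P -` D"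
    using compact_subset_open_imp_ball_epsilon_subset[OF compact_segment] by metis
  define V :: "complex set" where "V = (\<Union>x\<in>closed_segment 0 1. \<Union>y\<in>ball 0 e. {x + y})"
  have V2: "V = (\<Union>x\<in>closed_segment 0 1. ball x e)"
  proof (intro equalityI subsetI)
    fix y :: complex assume "y \<in> (\<Union>x\<in>closed_segment 0 1. ball x e)"
    then obtain x where x: "x \<in> closed_segment 0 1" "dist x y < e" by auto
    then have "y - x \<in> ball 0 e" by (simp add: dist_norm norm_minus_commute[of x y])
    then show "y \<in> V" using x(1) unfolding V_def by (intro UN_I[of x] UN_I[of "y - x"]) auto
  qed (force simp: V_def dist_norm intro: bexI)
  have V: "V \<subseteq> P -` D" using e(2) unfolding V2 .
  have "open V" unfolding V2 by blast
  moreover have "convex V" unfolding V_def by (intro convex_sums) auto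
  moreover have "V \<noteq> UNIV"
  proof -
    have "bounded (\<Union>x\<in>closed_segment 0 1. \<Union>y\<in>ball (0::complex) e. {x + y})"
      by (rule bounded_sums) (auto intro: compact_imp_bounded)
    then show ?thesis using not_bounded_UNIV V_def by metis
  qed
  moreover have 01: "0 \<in> V" "1 \<in> V" unfolding V2 using e(1) by force+
  ultimately have "\<exists>f g. f holomorphic_on V \<and> g holomorphic_on ball 0 1 \<and>
          (\<forall>z \<in> V. f z \<in> ball 0 1 \<and> g (f z) = z) \<and> (\<forall>z \<in> ball 0 1. g z \<in> V \<and> f (g z) = z)"
    using Riemann_mapping_theorem[of V] convex_imp_simply_connected by (metis empty_iff mem_ball_0)
  then obtain f h where fh: "h holomorphic_on ball 0 1" "\<forall>z \<in> V. f z \<in> ball 0 1 \<and> h (f z) = z"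
       "\<forall>z \<in> ball 0 1. h z \<in> V" by blast
  define b where "b = f 0"
  have b: "cmod b < 1" using fh 01 by (auto simp: b_def)
  define \<phi> where "\<phi> = (\<lambda>x. P (h (mob (-b) x)))"
  have "\<phi> \<in> holo_maps (ball 0 1) D"
  proof -
    have 1: "mob (-b) \<in> holo_maps (ball 0 1) (ball 0 1)"
      using mob_denom_nonzero[of "-b"] b unfolding holo_maps_def
      by (auto intro!: holomorphic_intros cmod_mob_less_1 mob_holomorphic_on[of "\<lambda>x. x"]
               simp: less_imp_le simp del: complex_cnj_minus)
    have 2: "h \<in> holo_maps (ball 0 1) V" using fh by (auto simp: holo_maps_def)
    have 3: "P \<in> holo_maps V D" using V hol by (auto simp: holo_maps_def intro: holomorphic_on_subset)
    show ?thesis unfolding \<phi>_def using holo_maps_comp[OF holo_maps_comp[OF 1 2] 3] by simp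
  qed
  moreover have "\<phi> 0 = z"
  proof -
    have "mob (-b) 0 = b" by (simp add: mob_def)
    then show ?thesis using Pg[of 0] fh 01 g(3) by (simp add: \<phi>_def b_def pathstart_def)
  qed
  moreover have "\<phi> (mob b (f 1)) = w" "mob b (f 1) \<in> ball 0 1"
    using Pg[of 1] fh 01 g(4) mob_mob_minus[of b "f 1"] b cmod_mob_less_1[of b "f 1"]
    by (auto simp: \<phi>_def b_def pathfinish_def)
  ultimately show ?thesis by blast
qed

lemma lempert_le:
  assumes "\<phi> \<in> holo_maps (ball 0 1) D" "\<phi> 0 = z" "\<phi> \<alpha> = w" "cmod \<alpha> < 1"
  shows "lempert D z w \<le> artanh (cmod \<alpha>)"
  unfolding lempert_def
proof (rule cInf_lower)
  show "bdd_below {artanh (cmod \<alpha>) |\<alpha>. \<alpha> \<in> ball 0 1 \<and> (\<exists>\<phi>\<in>holo_maps (ball 0 1) D. \<phi> 0 = z \<and> \<phi> \<alpha> = w)}"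
    by (rule bdd_belowI[of _ 0]) (auto intro: artanh_nonneg)
qed (use assms in auto)

lemma lempert_geI:
  assumes "domain D" "z \<in> D" "w \<in> D"
    and "\<And>\<phi> \<alpha>. \<phi> \<in> holo_maps (ball 0 1) D \<Longrightarrow> \<phi> 0 = z \<Longrightarrow> \<phi> \<alpha> = w \<Longrightarrow> cmod \<alpha> < 1 \<Longrightarrow> x \<le> artanh (cmod \<alpha>)"
  shows "x \<le> lempert D z w"
  unfolding lempert_def using ex_holomorphic_disc_through[OF assms(1-3)] assms(4)
  by (intro cInf_greatest) auto

lemma lempert_nonneg: "domain D \<Longrightarrow> z \<in> D \<Longrightarrow> w \<in> D \<Longrightarrow> 0 \<le> lempert D z w"
  by (rule lempert_geI) (auto intro: artanh_nonneg)

lemma kobayashi_pseudodistance: "domain D \<Longrightarrow> pseudodistance_on D (kobayashi_dist D)"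
  using kobayashi_dist_in[of D] lempert_nonneg by (auto simp: pseudodistances_below_lempert_def)

lemma kobayashi_le_artanh:
  assumes "domain D" "z \<in> D" "w \<in> D" "\<phi> \<in> holo_maps (ball 0 1) D" "\<phi> 0 = z" "\<phi> \<alpha> = w" "cmod \<alpha> < 1"
  shows "kobayashi_dist D z w \<le> artanh (cmod \<alpha>)"
proof -
  have "kobayashi_dist D z w \<le> lempert D z w"
    using kobayashi_dist_in[of D] lempert_nonneg assms(1-3) by (auto simp: pseudodistances_below_lempert_def)
  also have "\<dots> \<le> artanh (cmod \<alpha>)" using assms by (intro lempert_le)
  finally show ?thesis .
qed

text \<open>The Poincare distance pulled back by \<open>\<psi>\<close> is a pseudodistance, and by Schwarz-Pick it lies below the
  Lempert function.\<close>

lemma pd_le_kobayashi: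
  assumes D: "domain D" "z \<in> D" "w \<in> D" and \<psi>: "\<psi> \<in> holo_maps D (ball 0 1)"
  shows "pd (\<psi> z) (\<psi> w) \<le> kobayashi_dist D z w"
proof (rule kobayashi_dist_upper[OF _ D(2,3)])
  have 1: "cmod (\<psi> x) < 1" if "x \<in> D" for x using \<psi> that by (auto simp: holo_maps_def)
  have "pd (\<psi> x) (\<psi> y) \<le> lempert D x y" if "x \<in> D" "y \<in> D" for x y
    using Schwarz_Pick holo_maps_comp[OF _ \<psi>] by (intro lempert_geI D that) fastforce
  then show "(\<lambda>z w. pd (\<psi> z) (\<psi> w)) \<in> pseudodistances_below_lempert D"
    unfolding pseudodistances_below_lempert_def pseudodistance_on_def
    by (auto intro!: pd_triangle pd_nonneg 1) (auto simp: pd_def[of x x for x] intro!: pd_commute 1)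
qed

text \<open>A disc automorphism normalises \<open>\<psi>\<close> to vanish at z without changing the Poincare distance.\<close>

lemma caratheodory_ge:
  assumes D: "domain D" "z \<in> D" "w \<in> D" and \<psi>: "\<psi> \<in> holo_maps D (ball 0 1)"
  shows "pd (\<psi> z) (\<psi> w) \<le> caratheodory_dist D z w"
proof -
  have 1: "cmod (\<psi> x) < 1" if "x \<in> D" for x using \<psi> that by (auto simp: holo_maps_def)
  have "(\<lambda>x. mob (\<psi> z) (\<psi> x)) \<in> holo_maps D (ball 0 1)"
    using 1 D(2) mob_denom_nonzero[of "\<psi> z"] \<psi> unfolding holo_maps_def
    by (auto intro!: holomorphic_intros cmod_mob_less_1 simp: less_imp_le)
  moreover have "bdd_above {artanh (cmod (\<psi> w)) |\<psi>. \<psi> \<in> holo_maps D (ball 0 1) \<and> \<psi> z = 0}"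
  proof (rule bdd_aboveI[of _ "kobayashi_dist D z w"], clarify)
    fix \<psi> assume "\<psi> \<in> holo_maps D (ball 0 1)" "\<psi> z = 0"
    then show "artanh (cmod (\<psi> w)) \<le> kobayashi_dist D z w"
      using pd_le_kobayashi[OF D, of \<psi>] by (simp add: pd_def)
  qed
  ultimately show ?thesis unfolding caratheodory_dist_def pd_def
    by (intro cSup_upper) (force intro!: exI[of _ "\<lambda>x. mob (\<psi> z) (\<psi> x)"])+
qed

lemma caratheodory_leI:
  assumes D: "domain D" "z \<in> D" "w \<in> D"
    and "\<And>\<psi>. \<psi> \<in> holo_maps D (ball 0 1) \<Longrightarrow> pd (\<psi> z) (\<psi> w) \<le> x"
  shows "caratheodory_dist D z w \<le> x"
  unfolding caratheodory_dist_def
proof (rule cSup_least)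
  show "{artanh (cmod (\<psi> w)) |\<psi>. \<psi> \<in> holo_maps D (ball 0 1) \<and> \<psi> z = 0} \<noteq> {}"
    by (auto intro!: exI[of _ "\<lambda>_. 0"] simp: holo_maps_def)
next
  fix y assume "y \<in> {artanh (cmod (\<psi> w)) |\<psi>. \<psi> \<in> holo_maps D (ball 0 1) \<and> \<psi> z = 0}"
  then obtain \<psi> where "\<psi> \<in> holo_maps D (ball 0 1)" "\<psi> z = 0" "y = artanh (cmod (\<psi> w))" by blast
  then show "y \<le> x" using assms(4)[of \<psi>] by (simp add: pd_def)
qed

lemma caratheodory_le_kobayashi:
  "domain D \<Longrightarrow> z \<in> D \<Longrightarrow> w \<in> D \<Longrightarrow> caratheodory_dist D z w \<le> kobayashi_dist D z w"
  by (rule caratheodory_leI) (auto intro: pd_le_kobayashi)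

lemma caratheodory_commute:
  assumes "domain D" "z \<in> D" "w \<in> D"
  shows "caratheodory_dist D z w = caratheodory_dist D w z"
proof -
  have "caratheodory_dist D z w \<le> caratheodory_dist D w z" if "z \<in> D" "w \<in> D" for z w
  proof (rule caratheodory_leI[OF assms(1) that])
    fix \<psi> assume "\<psi> \<in> holo_maps D (ball 0 1)"
    then show "pd (\<psi> z) (\<psi> w) \<le> caratheodory_dist D w z"
      using caratheodory_ge[OF assms(1) that(2,1), of \<psi>] pd_commute[of "\<psi> z" "\<psi> w"] that
      by (auto simp: holo_maps_def image_subset_iff)
  qed
  then show ?thesis using assms by (simp add: order_antisym)
qed

section \<open>Square integrals and holomorphic changes of variables\<close>

definition vec_of_complex :: "complex \<Rightarrow> real^2"
  where "vec_of_complex z = (\<chi> i. if i = 1 then Re z else Im z)"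

definition complex_of_vec :: "real^2 \<Rightarrow> complex"
  where "complex_of_vec x = Complex (x $ 1) (x $ 2)"

lemma complex_of_vec_of_complex [simp]: "complex_of_vec (vec_of_complex z) = z"
  by (simp add: vec_of_complex_def complex_of_vec_def)

lemma vec_of_complex_of_vec [simp]: "vec_of_complex (complex_of_vec x) = x"
  by (simp add: vec_of_complex_def complex_of_vec_def vec_eq_iff forall_2)

lemma bounded_linear_vec_of_complex: "bounded_linear vec_of_complex"
  unfolding vec_of_complex_def
  by (intro linear_conv_bounded_linear[THEN iffD1] linearI) (auto simp: vec_eq_iff)

lemma bounded_linear_complex_of_vec: "bounded_linear complex_of_vec"
  unfolding complex_of_vec_def
  by (intro linear_conv_bounded_linear[THEN iffD1] linearI) (auto simp: complex_eq_iff)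

lemma Basis_real_2: "(Basis :: (real^2) set) = {axis 1 1, axis 2 1}"
  by (auto simp: Basis_vec_def UNIV_2 exhaust_2)

lemma set_borel_measurable_continuous_on:
  fixes f :: "'a::topological_space \<Rightarrow> 'b::real_normed_vector"
  shows "A \<in> sets borel \<Longrightarrow> continuous_on A f \<Longrightarrow> set_borel_measurable borel A f"
  unfolding set_borel_measurable_def by (rule borel_measurable_continuous_on_indicator)

lemma lborel_complex_eq_distr: "(lborel :: complex measure) = distr lborel borel complex_of_vec"
proof (rule lborel_eqI)
  fix l u :: complex assume le: "\<And>b. b \<in> Basis \<Longrightarrow> l \<bullet> b \<le> u \<bullet> b"
  have ax: "axis (1::2) (1::real) \<noteq> axis 2 1" by (simp add: axis_eq_axis)
  have m: "complex_of_vec \<in> borel_measurable lborel"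
    using bounded_linear.continuous_on[OF bounded_linear_complex_of_vec continuous_on_id]
    by (auto intro: borel_measurable_continuous_onI)
  have "complex_of_vec -` box l u = box (vec_of_complex l) (vec_of_complex u)"
    by (auto simp: box_def Basis_real_2 Basis_complex_def vec_of_complex_def complex_of_vec_def
          inner_axis inner_complex_def)
  then have "emeasure (distr lborel borel complex_of_vec) (box l u)
      = emeasure lborel (box (vec_of_complex l) (vec_of_complex u))"
    using m by (simp add: emeasure_distr)
  also have "\<dots> = (\<Prod>b\<in>Basis. (vec_of_complex u - vec_of_complex l) \<bullet> b)"
    using le[of 1] le[of \<i>] by (intro emeasure_lborel_box)
      (auto simp: Basis_real_2 Basis_complex_def vec_of_complex_def inner_axis inner_complex_def)
  also have "\<dots> = (\<Prod>b\<in>Basis. (u - l) \<bullet> b)"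
    using ax by (simp add: Basis_real_2 Basis_complex_def vec_of_complex_def inner_axis inner_complex_def)
  finally show "emeasure (distr lborel borel complex_of_vec) (box l u) = (\<Prod>b\<in>Basis. (u - l) \<bullet> b)" .
qed simp

lemma nn_integral_complex_eq_vec:
  assumes "f \<in> borel_measurable borel"
  shows "(\<integral>\<^sup>+z. f z \<partial>lborel) = (\<integral>\<^sup>+x. f (complex_of_vec x) \<partial>lborel)"
proof -
  have "complex_of_vec \<in> borel_measurable lborel"
    using bounded_linear.continuous_on[OF bounded_linear_complex_of_vec continuous_on_id]
    by (auto intro: borel_measurable_continuous_onI)
  then show ?thesis using assms by (subst lborel_complex_eq_distr) (simp add: nn_integral_distr)
qed

lemma has_integral_enn2real_nn_integral:
  fixes f :: "'a::euclidean_space \<Rightarrow> real"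
  assumes "set_borel_measurable borel A f" "\<And>x. x \<in> A \<Longrightarrow> 0 \<le> f x" "(\<integral>\<^sup>+x\<in>A. ennreal (f x) \<partial>lborel) < \<infinity>"
  shows "(f has_integral enn2real (\<integral>\<^sup>+x\<in>A. ennreal (f x) \<partial>lborel)) A"
proof -
  have eq: "(\<integral>\<^sup>+x\<in>A. ennreal (f x) \<partial>lborel) = (\<integral>\<^sup>+x. ennreal (indicator A x * f x) \<partial>lborel)"
    by (intro nn_integral_cong) (simp split: split_indicator)
  have "((\<lambda>x. indicator A x * f x) has_integral enn2real (\<integral>\<^sup>+x\<in>A. ennreal (f x) \<partial>lborel)) UNIV"
    using assms by (intro nn_integral_has_integral) (auto simp: eq[symmetric] set_borel_measurable_def split: split_indicator)
  moreover have "(\<lambda>x. indicator A x * f x) = (\<lambda>x. if x \<in> A then f x else 0)"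
    by (auto simp: indicator_def)
  ultimately show ?thesis by (simp only: has_integral_restrict_UNIV)
qed

lemma set_nn_integral_eq_has_integral:
  fixes f :: "'a::euclidean_space \<Rightarrow> real"
  assumes "(f has_integral b) A" "\<And>x. x \<in> A \<Longrightarrow> 0 \<le> f x"
  shows "(\<integral>\<^sup>+x\<in>A. ennreal (f x) \<partial>lborel) = ennreal b"
proof -
  have "(\<integral>\<^sup>+x\<in>A. ennreal (f x) \<partial>lborel) = (\<integral>\<^sup>+x. ennreal (indicator A x * f x) \<partial>lborel)"
    by (intro nn_integral_cong) (simp split: split_indicator)
  then show ?thesis using nn_integral_has_integral_lebesgue[OF assms(2,1)] by simp
qed

lemma nn_integral_change_of_variables:
  fixes F :: "real^'n::{finite,wellorder} \<Rightarrow> real" and g :: "real^'n::_ \<Rightarrow> real^'n::_"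
  assumes S: "S \<in> sets borel"
    and der: "\<And>x. x \<in> S \<Longrightarrow> (g has_derivative g' x) (at x within S)"
    and inj: "inj_on g S"
    and m1: "set_borel_measurable borel (g ` S) F"
    and m2: "set_borel_measurable borel S (\<lambda>x. \<bar>det (matrix (g' x))\<bar> * F (g x))"
    and pos: "\<And>y. y \<in> g ` S \<Longrightarrow> 0 \<le> F y"
  shows "(\<integral>\<^sup>+y\<in>g ` S. ennreal (F y) \<partial>lborel) = (\<integral>\<^sup>+x\<in>S. ennreal (\<bar>det (matrix (g' x))\<bar> * F (g x)) \<partial>lborel)"
    (is "?L = ?R")
proof -
  let ?J = "\<lambda>x. \<bar>det (matrix (g' x))\<bar> * F (g x)"
  have Sl: "S \<in> sets lebesgue" using S by simp
  have key: "(?J has_integral b) S \<longleftrightarrow> (F has_integral b) (g ` S)" for b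
  proof -
    have "?J absolutely_integrable_on S \<and> integral S ?J = b \<longleftrightarrow> F absolutely_integrable_on (g ` S) \<and> integral (g ` S) F = b"
      using has_absolute_integral_change_of_variables[OF Sl der inj, where f = "\<lambda>x. vec (F x) :: real^1" and b = "vec b"]
      by (simp add: absolutely_integrable_on_1_iff integral_on_1_eq vec_eq_iff)
    moreover have "?J absolutely_integrable_on S \<longleftrightarrow> ?J integrable_on S"
      using pos by (intro absolutely_integrable_on_iff_nonneg) auto
    moreover have "F absolutely_integrable_on (g ` S) \<longleftrightarrow> F integrable_on (g ` S)"
      using pos by (intro absolutely_integrable_on_iff_nonneg) auto
    ultimately show ?thesis by (simp add: has_integral_iff)
  qed
  note eq = set_nn_integral_eq_has_integral
  have Jpos: "\<And>x. x \<in> S \<Longrightarrow> 0 \<le> ?J x" using pos by auto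
  consider "?L < \<infinity>" | "?R < \<infinity>" | "?L = \<infinity>" "?R = \<infinity>"
    using less_top by force
  then show ?thesis
  proof cases
    case 1
    then have "(F has_integral enn2real ?L) (g ` S)"
      using m1 pos by (intro has_integral_enn2real_nn_integral)
    then have "?R = ennreal (enn2real ?L)" using key Jpos by (intro eq) auto
    then show ?thesis using 1 by simp
  next
    case 2
    then have "(?J has_integral enn2real ?R) S"
      using m2 Jpos by (intro has_integral_enn2real_nn_integral)
    then have "?L = ennreal (enn2real ?R)" using key pos by (intro eq) auto
    then show ?thesis using 2 by simp
  qed simp
qed

text \<open>By the Cauchy-Riemann equations the Jacobian of h as a map of the plane is \<open>|h'|\<^sup>2\<close>.\<close>

lemma nn_integral_holomorphic_change_of_variables:
  assumes S: "open S" and h: "h holomorphic_on S" and inj: "inj_on h S"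
    and F: "continuous_on (h ` S) F" and pos: "\<And>w. w \<in> h ` S \<Longrightarrow> 0 \<le> F w"
  shows "(\<integral>\<^sup>+w\<in>h ` S. ennreal (F w) \<partial>lborel)
       = (\<integral>\<^sup>+z\<in>S. ennreal ((cmod (deriv h z))\<^sup>2 * F (h z)) \<partial>lborel)"
proof -
  have op: "open (h ` S)" using open_mapping_thm3[OF h S inj] .
  let ?J = "\<lambda>z. (cmod (deriv h z))\<^sup>2 * F (h z)"
  have J: "continuous_on S ?J"
    by (intro continuous_intros holomorphic_on_imp_continuous_on holomorphic_deriv h S
        continuous_on_compose2[OF F]) auto
  define S' where "S' = complex_of_vec -` S"
  define g where "g = (\<lambda>x. vec_of_complex (h (complex_of_vec x)))"
  define g' where "g' = (\<lambda>x v. vec_of_complex (deriv h (complex_of_vec x) * complex_of_vec v))"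
  have cv: "continuous_on A complex_of_vec" for A
    using bounded_linear.continuous_on[OF bounded_linear_complex_of_vec continuous_on_id] .
  have op': "open S'" unfolding S'_def using cv S by (rule open_vimage[rotated])
  have gS: "g ` S' = complex_of_vec -` (h ` S)"
  proof (intro equalityI subsetI)
    fix y assume "y \<in> complex_of_vec -` (h ` S)"
    then obtain z where z: "z \<in> S" "complex_of_vec y = h z" by auto
    then have "y = g (vec_of_complex z)" unfolding g_def by (metis complex_of_vec_of_complex vec_of_complex_of_vec)
    then show "y \<in> g ` S'" using z(1) by (auto simp: S'_def)
  qed (auto simp: g_def S'_def)
  have op2: "open (g ` S')" unfolding gS using cv op by (rule open_vimage[rotated])
  have det: "\<bar>det (matrix (g' x))\<bar> = (cmod (deriv h (complex_of_vec x)))\<^sup>2" for x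
  proof -
    have "complex_of_vec (axis 1 1) = 1" "complex_of_vec (axis 2 1) = \<i>"
      by (auto simp: complex_of_vec_def axis_def complex_eq_iff)
    then have "det (matrix (g' x)) = (cmod (deriv h (complex_of_vec x)))\<^sup>2"
      by (simp add: det_2 matrix_def g'_def vec_of_complex_def cmod_power2) (simp add: power2_eq_square)
    then show ?thesis by simp
  qed
  have fi: "(\<integral>\<^sup>+z\<in>A. ennreal (f z) \<partial>lborel) = (\<integral>\<^sup>+x\<in>complex_of_vec -` A. ennreal (f (complex_of_vec x)) \<partial>lborel)"
    if "open A" "continuous_on A f" for A f
  proof -
    have "(\<lambda>z. ennreal (indicat_real A z * f z)) \<in> borel_measurable borel"
      using set_borel_measurable_continuous_on[OF _ that(2)] that(1)
      by (auto simp: set_borel_measurable_def)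
    moreover have "(\<lambda>z. ennreal (indicat_real A z * f z)) = (\<lambda>z. ennreal (f z) * indicator A z)"
      by (auto simp: indicator_def)
    ultimately have "(\<lambda>z. ennreal (f z) * indicator A z) \<in> borel_measurable borel" by simp
    from nn_integral_complex_eq_vec[OF this] show ?thesis
      by (simp add: indicator_def vimage_def of_bool_def)
  qed
  have "(\<integral>\<^sup>+w\<in>h ` S. ennreal (F w) \<partial>lborel) = (\<integral>\<^sup>+y\<in>g ` S'. ennreal (F (complex_of_vec y)) \<partial>lborel)"
    unfolding gS by (rule fi[OF op F])
  also have "\<dots> = (\<integral>\<^sup>+x\<in>S'. ennreal (\<bar>det (matrix (g' x))\<bar> * F (complex_of_vec (g x))) \<partial>lborel)"
  proof (rule nn_integral_change_of_variables)
    show "(g has_derivative g' x) (at x within S')" if "x \<in> S'" for x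
    proof -
      have "(h has_derivative (*) (deriv h (complex_of_vec x))) (at (complex_of_vec x))"
        using holomorphic_derivI[OF h S] that by (simp add: S'_def has_field_derivative_def)
      from bounded_linear.has_derivative[OF bounded_linear_vec_of_complex
         has_derivative_compose[OF bounded_linear_imp_has_derivative[OF bounded_linear_complex_of_vec] this]]
      show ?thesis unfolding g_def g'_def by (rule has_derivative_at_withinI)
    qed
    show "inj_on g S'" unfolding inj_on_def
    proof (intro ballI impI)
      fix x y assume xy: "x \<in> S'" "y \<in> S'" "g x = g y"
      then have "h (complex_of_vec x) = h (complex_of_vec y)"
        unfolding g_def by (metis complex_of_vec_of_complex)
      then have "complex_of_vec x = complex_of_vec y" using inj xy by (auto simp: inj_on_def S'_def)
      then show "x = y" by (metis vec_of_complex_of_vec)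
    qed
    show "set_borel_measurable borel (g ` S') (\<lambda>y. F (complex_of_vec y))"
      using op2 gS by (intro set_borel_measurable_continuous_on continuous_on_compose2[OF F cv]) auto
    have "continuous_on S' (\<lambda>x. ?J (complex_of_vec x))"
      by (rule continuous_on_compose2[OF J cv]) (auto simp: S'_def)
    then show "set_borel_measurable borel S' (\<lambda>x. \<bar>det (matrix (g' x))\<bar> * F (complex_of_vec (g x)))"
      unfolding det using op' by (intro set_borel_measurable_continuous_on) (auto simp: g_def)
  qed (use op' pos gS in auto)
  also have "\<dots> = (\<integral>\<^sup>+x\<in>S'. ennreal (?J (complex_of_vec x)) \<partial>lborel)"
    by (simp add: det g_def)
  also have "\<dots> = (\<integral>\<^sup>+z\<in>S. ennreal (?J z) \<partial>lborel)"
    unfolding S'_def by (rule fi[OF S J, symmetric])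
  finally show ?thesis .
qed

definition l2sq :: "complex set \<Rightarrow> (complex \<Rightarrow> complex) \<Rightarrow> ennreal"
  where "l2sq S f = (\<integral>\<^sup>+z\<in>S. ennreal ((cmod (f z))\<^sup>2) \<partial>lborel)"

lemma l2sq_change_of_variables:
  assumes "open S" "h holomorphic_on S" "inj_on h S" "continuous_on (h ` S) f"
  shows "l2sq (h ` S) f = l2sq S (\<lambda>z. f (h z) * deriv h z)"
  unfolding l2sq_def using assms
  by (subst nn_integral_holomorphic_change_of_variables)
     (auto intro!: continuous_intros simp: norm_mult power_mult_distrib mult.commute)

lemma l2sq_mono: "S \<subseteq> T \<Longrightarrow> l2sq S f \<le> l2sq T f"
  unfolding l2sq_def by (intro nn_integral_mono) (auto simp: indicator_def)

lemma l2sq_cong: "(\<And>z. z \<in> S \<Longrightarrow> cmod (f z) = cmod (g z)) \<Longrightarrow> l2sq S f = l2sq S g"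
  unfolding l2sq_def by (intro nn_integral_cong) (auto simp: indicator_def)

lemma borel_measurable_l2_integrand:
  assumes "open S" "continuous_on S f"
  shows "(\<lambda>z. ennreal ((cmod (f z))\<^sup>2) * indicator S z) \<in> borel_measurable borel"
proof -
  have "set_borel_measurable borel S (\<lambda>z. (cmod (f z))\<^sup>2)"
    using assms by (intro set_borel_measurable_continuous_on continuous_intros) auto
  then have "(\<lambda>z. ennreal (indicat_real S z * (cmod (f z))\<^sup>2)) \<in> borel_measurable borel"
    by (simp add: set_borel_measurable_def)
  moreover have "(\<lambda>z. ennreal (indicat_real S z * (cmod (f z))\<^sup>2)) = (\<lambda>z. ennreal ((cmod (f z))\<^sup>2) * indicator S z)"
    by (auto simp: indicator_def)
  ultimately show ?thesis by simp
qed

lemma l2sq_cmult: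
  assumes "open S" "continuous_on S f"
  shows "l2sq S (\<lambda>z. c * f z) = ennreal ((cmod c)\<^sup>2) * l2sq S f"
proof -
  have "l2sq S (\<lambda>z. c * f z) = (\<integral>\<^sup>+z. ennreal ((cmod c)\<^sup>2) * (ennreal ((cmod (f z))\<^sup>2) * indicator S z) \<partial>lborel)"
    unfolding l2sq_def
    by (intro nn_integral_cong) (auto simp: norm_mult power_mult_distrib ennreal_mult mult.assoc)
  also have "\<dots> = ennreal ((cmod c)\<^sup>2) * l2sq S f"
    unfolding l2sq_def using borel_measurable_l2_integrand[OF assms] by (intro nn_integral_cmult) auto
  finally show ?thesis .
qed

lemma l2sq_const: "open S \<Longrightarrow> l2sq S (\<lambda>_. c) = ennreal ((cmod c)\<^sup>2) * emeasure lborel S"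
  unfolding l2sq_def by (simp add: nn_integral_cmult_indicator)

lemma l2sq_rotate:
  assumes "cmod \<omega> = 1" "continuous_on (ball 0 1) f"
  shows "l2sq (ball 0 1) (\<lambda>z. f (\<omega> * z)) = l2sq (ball 0 1) f"
proof -
  have "\<omega> \<noteq> 0" using assms by auto
  have im: "(\<lambda>z. \<omega> * z) ` ball 0 1 = ball 0 1"
  proof (intro equalityI subsetI)
    fix z :: complex assume "z \<in> ball 0 1"
    then show "z \<in> (\<lambda>z. \<omega> * z) ` ball 0 1"
      using assms(1) \<open>\<omega> \<noteq> 0\<close> by (intro image_eqI[of _ _ "z / \<omega>"]) (auto simp: norm_divide)
  qed (use assms(1) in \<open>auto simp: norm_mult\<close>)
  have "deriv (\<lambda>z. \<omega> * z) z = \<omega>" for z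
    by (rule DERIV_imp_deriv) (auto intro!: derivative_eq_intros)
  then have "l2sq ((\<lambda>z. \<omega> * z) ` ball 0 1) f = l2sq (ball 0 1) (\<lambda>z. f (\<omega> * z) * \<omega>)"
    using l2sq_change_of_variables[of "ball 0 1" "\<lambda>z. \<omega> * z" f] assms(2) \<open>\<omega> \<noteq> 0\<close>
    by (simp add: im inj_on_def holomorphic_intros)
  also have "\<dots> = l2sq (ball 0 1) (\<lambda>z. f (\<omega> * z))"
    by (rule l2sq_cong) (simp add: norm_mult assms)
  finally show ?thesis by (simp add: im)
qed

section \<open>Square integrals of Taylor terms on the unit disc\<close>

text \<open>The projection of a power series to its term of degree j, with the integral over the circle
  replaced by the mean over the n-th roots of unity.\<close>

definition rotation_average :: "nat \<Rightarrow> nat \<Rightarrow> (complex \<Rightarrow> complex) \<Rightarrow> complex \<Rightarrow> complex"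
  where "rotation_average j n f z =
    (\<Sum>k<n. cis (- 2 * pi * real j * real k / real n) * f (cis (2 * pi * real k / real n) * z)) / of_nat n"

lemma sum_cis_eq_0:
  assumes "0 < n" "m < n" "j < n" "m \<noteq> j"
  shows "(\<Sum>k<n. cis (- 2 * pi * real j * real k / real n) * cis (2 * pi * real k / real n) ^ m) = 0"
proof -
  define q where "q = cis (2 * pi * (real m - real j) / real n)"
  have "(\<Sum>k<n. cis (- 2 * pi * real j * real k / real n) * cis (2 * pi * real k / real n) ^ m) = (\<Sum>k<n. q ^ k)"
  proof (intro sum.cong refl)
    fix k
    have "- 2 * pi * real j * real k / real n + real m * (2 * pi * real k / real n)
        = real k * (2 * pi * (real m - real j) / real n)" by (simp add: diff_divide_distrib algebra_simps)
    then show "cis (- 2 * pi * real j * real k / real n) * cis (2 * pi * real k / real n) ^ m = q ^ k"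
      unfolding q_def Complex.DeMoivre cis_mult by simp
  qed
  moreover have "q ^ n = 1"
  proof -
    have "q ^ n = cis (2 * pi * real_of_int (int m - int j))"
      using assms by (simp add: q_def Complex.DeMoivre)
    also have "\<dots> = 1" by (rule cis_multiple_2pi) auto
    finally show ?thesis .
  qed
  moreover have "q \<noteq> 1"
  proof
    assume "q = 1"
    then have "cos (2 * pi * (real m - real j) / real n) = 1"
      by (simp add: q_def complex_eq_iff)
    then obtain i :: int where "2 * pi * (real m - real j) / real n = i * 2 * pi"
      using cos_one_2pi_int by auto
    then have "(2 * pi) * (real m - real j) = (2 * pi) * (i * real n)" using assms by (simp add: field_simps)
    then have "real m - real j = i * real n" by (simp only: mult_cancel_left) simp
    then have i: "int m - int j = i * int n" by (metis of_int_diff of_int_eq_iff of_int_mult of_int_of_nat_eq)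
    then have "i \<noteq> 0" using assms by auto
    then have "\<bar>i\<bar> * int n \<ge> 1 * int n" by (intro mult_right_mono) auto
    then have "\<bar>i * int n\<bar> \<ge> int n" by (simp add: abs_mult)
    then show False using i assms by linarith
  qed
  ultimately show ?thesis by (simp add: geometric_sum)
qed

lemma rotation_average_tendsto:
  assumes f: "f holomorphic_on ball 0 1" and z: "cmod z < 1"
  shows "(\<lambda>n. rotation_average j n f z) \<longlonglongrightarrow> (deriv ^^ j) f 0 / fact j * z ^ j"
proof -
  define a where "a m = (deriv ^^ m) f 0 / fact m" for m
  have sums: "(\<lambda>m. a m * w ^ m) sums f w" if "cmod w < 1" for w
    using holomorphic_power_series[OF f, of w] that by (simp add: a_def)
  define c where "c n m = (\<Sum>k<n. cis (- 2 * pi * real j * real k / real n) * cis (2 * pi * real k / real n) ^ m) / of_nat n" for n m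
  have cn: "cmod (c n m) \<le> 1" for n m
  proof (cases "n = 0")
    case False
    have "cmod (\<Sum>k<n. cis (- 2 * pi * real j * real k / real n) * cis (2 * pi * real k / real n) ^ m) \<le> (\<Sum>k<n. 1)"
      by (rule order.trans[OF norm_sum]) (simp add: norm_mult norm_power)
    then show ?thesis using False by (simp add: c_def norm_divide)
  qed (simp add: c_def)
  have c_lim: "(\<lambda>n. c n m) \<longlonglongrightarrow> (if m = j then 1 else 0)" for m
  proof (rule tendsto_eventually, rule eventually_sequentiallyI[of "Suc (m + j)"])
    fix n assume n: "Suc (m + j) \<le> n"
    show "c n m = (if m = j then 1 else 0)"
    proof (cases "m = j")
      case True
      have "cis (- 2 * pi * real j * real k / real n) * cis (2 * pi * real k / real n) ^ j = 1" for k
        unfolding Complex.DeMoivre cis_mult by (simp add: field_simps)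
      then show ?thesis using True n by (simp add: c_def)
    next
      case False then show ?thesis using sum_cis_eq_0[of n m j] n by (simp add: c_def)
    qed
  qed
  have av: "rotation_average j n f z = (\<Sum>m. c n m * (a m * z ^ m))" for n
  proof -
    have "(\<lambda>m. (\<Sum>k<n. cis (- 2 * pi * real j * real k / real n) * (a m * (cis (2 * pi * real k / real n) * z) ^ m)) / of_nat n)
        sums (rotation_average j n f z)"
      unfolding rotation_average_def using z
      by (intro sums_divide sums_sum sums_mult sums) (simp add: norm_mult)
    moreover have "(\<Sum>k<n. cis (- 2 * pi * real j * real k / real n) * (a m * (cis (2 * pi * real k / real n) * z) ^ m)) / of_nat n
        = c n m * (a m * z ^ m)" for m
      by (simp add: c_def power_mult_distrib sum_distrib_right sum_distrib_left sum_divide_distrib mult_ac)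
    ultimately show ?thesis using sums_unique by simp
  qed
  have "summable (\<lambda>m. cmod (a m * z ^ m))"
  proof -
    obtain r where r: "cmod z < r" "r < 1" using dense z by blast
    then have r0: "0 < r" using norm_ge_zero[of z] by linarith
    have "summable (\<lambda>m. a m * of_real r ^ m)" using sums[of "of_real r"] r r0 by (auto simp: sums_iff)
    then show ?thesis using r r0 by (intro powser_insidea) auto
  qed
  then have "(\<lambda>n. \<Sum>m. c n m * (a m * z ^ m)) \<longlonglongrightarrow> (\<Sum>m. (if m = j then 1 else 0) * (a m * z ^ m))"
  proof (intro tannerys_theorem[where M = "\<lambda>m. cmod (a m * z ^ m)", THEN conjunct2, THEN conjunct2] tendsto_mult c_lim tendsto_const)
    have "cmod (c n m * (a m * z ^ m)) \<le> cmod (a m * z ^ m)" for n m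
      using cn[of n m] by (simp add: norm_mult mult_left_le_one_le)
    then show "\<forall>\<^sub>F (m, n) in sequentially \<times>\<^sub>F sequentially. cmod (c n m * (a m * z ^ m)) \<le> cmod (a m * z ^ m)"
      by (intro always_eventually) (simp split: prod.split)
  qed auto
  moreover have "(\<Sum>m. (if m = j then 1 else 0) * (a m * z ^ m)) = a j * z ^ j"
    using suminf_finite[of "{j}" "\<lambda>m. (if m = j then 1 else 0) * (a m * z ^ m)"] by simp
  ultimately show ?thesis by (simp add: av a_def)
qed

text \<open>Cauchy-Schwarz, together with the invariance of area under rotations.\<close>

lemma l2sq_rotation_average_le:
  assumes f: "f holomorphic_on ball 0 1"
  shows "l2sq (ball 0 1) (rotation_average j n f) \<le> l2sq (ball 0 1) f"
proof (cases "n = 0")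
  case True then show ?thesis by (simp add: l2sq_def rotation_average_def)
next
  case False
  let ?r = "\<lambda>k. cis (2 * pi * real k / real n)"
  have cf: "continuous_on (ball 0 1) f" using f by (rule holomorphic_on_imp_continuous_on)
  have cr: "continuous_on (ball 0 1) (\<lambda>z. f (?r k * z))" for k
    by (rule continuous_on_compose2[OF cf]) (auto intro!: continuous_intros simp: norm_mult)
  have pt: "(cmod (rotation_average j n f z))\<^sup>2 \<le> (\<Sum>k<n. (cmod (f (?r k * z)))\<^sup>2) / n" for z
  proof -
    have "cmod (rotation_average j n f z) \<le> (\<Sum>k<n. cmod (f (?r k * z))) / n"
      unfolding rotation_average_def norm_divide
      by (rule order.trans[OF divide_right_mono[OF norm_sum]]) (auto simp: norm_mult)
    then have "(cmod (rotation_average j n f z))\<^sup>2 \<le> ((\<Sum>k<n. cmod (f (?r k * z))) / n)\<^sup>2"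
      by (intro power_mono) auto
    also have "\<dots> \<le> ((\<Sum>k<n. (cmod (f (?r k * z)))\<^sup>2) * n) / (real n)\<^sup>2"
      unfolding power_divide using sum_squared_le_sum_of_squares[of "\<lambda>k. cmod (f (?r k * z))" "{..<n}"]
      by (intro divide_right_mono) auto
    finally show ?thesis using False by (simp add: power2_eq_square)
  qed
  have "l2sq (ball 0 1) (rotation_average j n f)
     \<le> (\<integral>\<^sup>+z. (\<Sum>k<n. ennreal (1 / n) * (ennreal ((cmod (f (?r k * z)))\<^sup>2) * indicator (ball 0 1) z)) \<partial>lborel)"
    unfolding l2sq_def
  proof (intro nn_integral_mono)
    fix z
    have "ennreal ((cmod (rotation_average j n f z))\<^sup>2) \<le> ennreal ((\<Sum>k<n. (cmod (f (?r k * z)))\<^sup>2) / n)"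
      using pt by (rule ennreal_leI)
    also have "(\<Sum>k<n. (cmod (f (?r k * z)))\<^sup>2) / n = (\<Sum>k<n. 1 / n * (cmod (f (?r k * z)))\<^sup>2)"
      by (simp add: sum_divide_distrib)
    also have "ennreal \<dots> = (\<Sum>k<n. ennreal (1 / n * (cmod (f (?r k * z)))\<^sup>2))"
      by (rule sum_ennreal[symmetric]) simp
    also have "\<dots> = (\<Sum>k<n. ennreal (1 / n) * ennreal ((cmod (f (?r k * z)))\<^sup>2))"
      by (intro sum.cong refl ennreal_mult) auto
    finally show "ennreal ((cmod (rotation_average j n f z))\<^sup>2) * indicator (ball 0 1) z
      \<le> (\<Sum>k<n. ennreal (1 / n) * (ennreal ((cmod (f (?r k * z)))\<^sup>2) * indicator (ball 0 1) z))"
      by (auto split: split_indicator)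
  qed
  also have "\<dots> = (\<Sum>k<n. ennreal (1 / n) * l2sq (ball 0 1) (\<lambda>z. f (?r k * z)))"
  proof -
    have m: "(\<lambda>z. ennreal ((cmod (f (?r k * z)))\<^sup>2) * indicator (ball 0 1) z) \<in> borel_measurable lborel" for k
      using borel_measurable_l2_integrand[OF open_ball cr] by simp
    show ?thesis unfolding l2sq_def nn_integral_cmult[OF m, symmetric]
      by (rule nn_integral_sum) (rule borel_measurable_times_ennreal[OF borel_measurable_const m])
  qed
  also have "\<dots> = (\<Sum>k<n. ennreal (1 / n) * l2sq (ball 0 1) f)"
    by (intro sum.cong refl arg_cong2[where f = times] l2sq_rotate cf) simp
  also have "\<dots> = l2sq (ball 0 1) f"
  proof -
    have "of_nat n * ennreal (1 / n) = 1"
      using False by (simp add: ennreal_of_nat_eq_real_of_nat ennreal_mult[symmetric])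
    then show ?thesis by (simp add: mult.assoc[symmetric])
  qed
  finally show ?thesis .
qed

text \<open>The averages converge pointwise to the Taylor term and do not increase the square integral, so
  Fatou's lemma applies. This gives Bessel's inequality for a single monomial without polar
  coordinates.\<close>

lemma l2sq_Taylor_term_le:
  assumes f: "f holomorphic_on ball 0 1"
  shows "l2sq (ball 0 1) (\<lambda>z. (deriv ^^ j) f 0 / fact j * z ^ j) \<le> l2sq (ball 0 1) f"
proof -
  let ?u = "\<lambda>n z. ennreal ((cmod (rotation_average j n f z))\<^sup>2) * indicator (ball 0 1) z"
  have cf: "continuous_on (ball 0 1) f" using f by (rule holomorphic_on_imp_continuous_on)
  have "continuous_on (ball 0 1) (\<lambda>z. f (c * z))" if "cmod c = 1" for c
    by (rule continuous_on_compose2[OF cf]) (use that in \<open>auto intro!: continuous_intros simp: norm_mult\<close>)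
  then have "continuous_on (ball 0 1) (rotation_average j n f)" for n
    unfolding rotation_average_def divide_inverse
    by (intro continuous_on_mult continuous_on_sum continuous_on_const) simp
  then have meas: "?u n \<in> borel_measurable lborel" for n
    using borel_measurable_l2_integrand[OF open_ball, of 0 1 "rotation_average j n f"] by simp
  have "l2sq (ball 0 1) (\<lambda>z. (deriv ^^ j) f 0 / fact j * z ^ j) = (\<integral>\<^sup>+z. liminf (\<lambda>n. ?u n z) \<partial>lborel)"
    unfolding l2sq_def
  proof (intro nn_integral_cong)
    fix z :: complex
    have "(\<lambda>n. ?u n z) \<longlonglongrightarrow> ennreal ((cmod ((deriv ^^ j) f 0 / fact j * z ^ j))\<^sup>2) * indicator (ball 0 1) z"
    proof (cases "z \<in> ball 0 1")
      case True
      then have "(\<lambda>n. rotation_average j n f z) \<longlonglongrightarrow> (deriv ^^ j) f 0 / fact j * z ^ j"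
        by (intro rotation_average_tendsto f) simp
      then show ?thesis using True by (auto intro!: tendsto_intros)
    qed auto
    then show "ennreal ((cmod ((deriv ^^ j) f 0 / fact j * z ^ j))\<^sup>2) * indicator (ball 0 1) z = liminf (\<lambda>n. ?u n z)"
      using lim_imp_Liminf[OF sequentially_bot] by metis
  qed
  also have "\<dots> \<le> liminf (\<lambda>n. integral\<^sup>N lborel (?u n))"
    by (rule nn_integral_liminf[OF meas])
  also have "\<dots> \<le> l2sq (ball 0 1) f"
    using l2sq_rotation_average_le[OF f] unfolding l2sq_def by (intro Liminf_le always_eventually) auto
  finally show ?thesis .
qed

lemma emeasure_unit_disc: "emeasure lborel (ball (0::complex) 1) = ennreal pi"
  by (simp add: emeasure_ball unit_ball_vol_2)

lemma AE_lborel_Re_Im_nonzero: "AE z in lborel. Re z \<noteq> 0 \<and> Im z \<noteq> 0"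
proof -
  have "{z::complex. z \<bullet> k = 0} \<in> null_sets lborel" if "k \<in> Basis" for k :: complex
  proof -
    have "closed {z::complex. z \<bullet> k = 0}" by (rule closed_Collect_eq) (auto intro!: continuous_intros)
    then show ?thesis using negligible_standard_hyperplane[OF that, of 0]
      by (simp add: negligible_iff_null_sets null_sets_completion_iff)
  qed
  from this[of 1] this[of \<i>] have "{z. Re z = 0} \<union> {z. Im z = 0} \<in> null_sets lborel"
    by (auto simp: inner_complex_def Basis_complex_def intro!: null_sets.Un)
  then show ?thesis by (rule AE_I') auto
qed

text \<open>Squaring maps the right half of the disc injectively onto the slit disc, with Jacobian \<open>4 |z|\<^sup>2\<close>. Hence
  four times the integral of \<open>|z|\<^sup>2\<close> over the half disc is the area \<open>\<pi>\<close>.\<close>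

lemma l2sq_unit_disc_id: "l2sq (ball 0 1) (\<lambda>z. z) = ennreal (pi / 2)"
proof -
  define H where "H = ball (0::complex) 1 \<inter> {z. Re z > 0}"
  have opH: "open H" unfolding H_def by (intro open_Int open_ball open_halfspace_Re_gt)
  have inj: "inj_on (\<lambda>z. z\<^sup>2) H"
    by (auto simp: inj_on_def H_def power2_eq_iff)
  have img: "(\<lambda>z. z\<^sup>2) ` H = ball 0 1 - \<real>\<^sub>\<le>\<^sub>0"
  proof (intro equalityI subsetI)
    fix w assume "w \<in> (\<lambda>z. z\<^sup>2) ` H"
    then obtain z where z: "w = z\<^sup>2" "cmod z < 1" "Re z > 0" by (auto simp: H_def)
    have "Im (z\<^sup>2) = 0 \<Longrightarrow> Re (z\<^sup>2) > 0" using z by (simp add: Re_power2 Im_power2)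
    then show "w \<in> ball 0 1 - \<real>\<^sub>\<le>\<^sub>0"
      using z by (auto simp: norm_power abs_square_less_1 complex_nonpos_Reals_iff)
  next
    fix w :: complex assume w: "w \<in> ball 0 1 - \<real>\<^sub>\<le>\<^sub>0"
    then have "cmod (csqrt w) < 1" by (auto simp: real_sqrt_lt_1_iff)
    moreover have "Re (csqrt w) \<noteq> 0"
    proof
      assume 0: "Re (csqrt w) = 0"
      define v where "v = csqrt w"
      have "Re (v\<^sup>2) \<le> 0" "Im (v\<^sup>2) = 0" using 0 unfolding v_def[symmetric] by (auto simp: Re_power2 Im_power2)
      then show False using w by (simp add: complex_nonpos_Reals_iff v_def)
    qed
    then have "Re (csqrt w) > 0" using Re_csqrt[of w] by linarith
    ultimately show "w \<in> (\<lambda>z. z\<^sup>2) ` H" by (intro image_eqI[of _ _ "csqrt w"]) (auto simp: H_def)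
  qed
  have dsq: "deriv (\<lambda>z::complex. z\<^sup>2) z = 2 * z" for z
    by (rule DERIV_imp_deriv) (auto intro!: derivative_eq_intros)
  have H1: "l2sq ((\<lambda>z. z\<^sup>2) ` H) (\<lambda>_. 1) = l2sq H (\<lambda>z. 2 * z)"
    using l2sq_change_of_variables[OF opH _ inj, of "\<lambda>_. 1"] by (simp add: dsq holomorphic_intros)
  have "l2sq ((\<lambda>z. z\<^sup>2) ` H) (\<lambda>_. 1) = l2sq (ball 0 1) (\<lambda>_. 1)"
    unfolding l2sq_def img
    by (rule nn_integral_cong_AE, rule eventually_mono[OF AE_lborel_Re_Im_nonzero])
       (auto simp: complex_nonpos_Reals_iff indicator_def)
  then have H2: "ennreal pi = 4 * l2sq H (\<lambda>z. z)"
    using H1 l2sq_cmult[OF opH, of "\<lambda>z. z" 2] by (simp add: l2sq_const emeasure_unit_disc)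
  have "deriv (\<lambda>z::complex. - z) z = -1" for z
    by (rule DERIV_imp_deriv) (auto intro!: derivative_eq_intros)
  then have H3: "l2sq (uminus ` H) (\<lambda>z. z) = l2sq H (\<lambda>z. z)"
    using l2sq_change_of_variables[OF opH, of uminus "\<lambda>z. z"]
    by (simp add: holomorphic_intros inj_on_def)
  have "l2sq (ball 0 1) (\<lambda>z. z) = (\<integral>\<^sup>+z. ennreal ((cmod z)\<^sup>2) * indicator H z + ennreal ((cmod z)\<^sup>2) * indicator (uminus ` H) z \<partial>lborel)"
    unfolding l2sq_def
  proof (rule nn_integral_cong_AE, rule eventually_mono[OF AE_lborel_Re_Im_nonzero])
    fix z :: complex assume z: "Re z \<noteq> 0 \<and> Im z \<noteq> 0"
    have "z \<in> uminus ` H \<longleftrightarrow> cmod z < 1 \<and> Re z < 0"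
      unfolding H_def by (auto intro!: image_eqI[of z uminus "-z"])
    then show "ennreal ((cmod z)\<^sup>2) * indicator (ball 0 1) z
      = ennreal ((cmod z)\<^sup>2) * indicator H z + ennreal ((cmod z)\<^sup>2) * indicator (uminus ` H) z"
      using z by (auto simp: H_def indicator_def)
  qed
  also have "\<dots> = l2sq H (\<lambda>z. z) + l2sq (uminus ` H) (\<lambda>z. z)"
    unfolding l2sq_def
    using borel_measurable_l2_integrand[OF opH continuous_on_id]
      borel_measurable_l2_integrand[OF open_negations[OF opH] continuous_on_id]
    by (intro nn_integral_add) auto
  finally have I: "l2sq (ball 0 1) (\<lambda>z. z) = 2 * l2sq H (\<lambda>z. z)"
    using H3 by (simp add: mult_2)
  then have "2 * l2sq (ball 0 1) (\<lambda>z. z) = ennreal pi" using H2 by (simp add: mult.assoc[symmetric])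
  then have "2 * l2sq (ball 0 1) (\<lambda>z. z) = 2 * ennreal (pi / 2)"
    by (metis ennreal_mult' ennreal_numeral nonzero_mult_div_cancel_left times_divide_eq_right zero_le_numeral zero_neq_numeral)
  then show ?thesis by (simp add: ennreal_mult_cancel_left)
qed

lemma disc_value_le_l2sq:
  assumes f: "f holomorphic_on ball 0 1"
  shows "ennreal (pi * (cmod (f 0))\<^sup>2) \<le> l2sq (ball 0 1) f"
proof -
  have "l2sq (ball 0 1) (\<lambda>z. f 0) = ennreal (pi * (cmod (f 0))\<^sup>2)"
    by (simp add: l2sq_const emeasure_unit_disc ennreal_mult[symmetric] mult.commute)
  then show ?thesis using l2sq_Taylor_term_le[OF f, of 0] by simp
qed

lemma disc_deriv_le_l2sq:
  assumes f: "f holomorphic_on ball 0 1"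
  shows "ennreal (pi / 2 * (cmod (deriv f 0))\<^sup>2) \<le> l2sq (ball 0 1) f"
proof -
  have "l2sq (ball 0 1) (\<lambda>z. deriv f 0 * z) = ennreal (pi / 2 * (cmod (deriv f 0))\<^sup>2)"
    by (subst l2sq_cmult) (auto simp: l2sq_unit_disc_id ennreal_mult[symmetric] mult.commute)
  then show ?thesis using l2sq_Taylor_term_le[OF f, of 1] by simp
qed

section \<open>The Bergman metric between two conformal maps\<close>

lemma L2h_norm_le_1_iff:
  assumes "open D"
  shows "f \<in> L2h D \<and> L2_norm_on D f \<le> 1 \<longleftrightarrow> f holomorphic_on D \<and> l2sq D f \<le> 1"
proof (cases "f holomorphic_on D")
  case True
  then have c: "continuous_on D f" by (rule holomorphic_on_imp_continuous_on)
  have eq: "l2sq D f = (\<integral>\<^sup>+z. ennreal (indicator D z *\<^sub>R (cmod (f z))\<^sup>2) \<partial>lborel)"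
    unfolding l2sq_def by (intro nn_integral_cong) (auto split: split_indicator)
  have "set_borel_measurable borel D (\<lambda>z. (cmod (f z))\<^sup>2)"
    using assms c by (intro set_borel_measurable_continuous_on continuous_intros) auto
  then have m: "(\<lambda>z. indicator D z *\<^sub>R (cmod (f z))\<^sup>2) \<in> borel_measurable lborel"
    by (simp add: set_borel_measurable_def)
  have nn: "AE z in lborel. 0 \<le> indicator D z *\<^sub>R (cmod (f z))\<^sup>2" by auto
  have int: "set_integrable lborel D (\<lambda>z. (cmod (f z))\<^sup>2) \<longleftrightarrow> l2sq D f < \<infinity>"
    unfolding set_integrable_def eq integrable_iff_bounded using m by (simp add: abs_mult)
  have val: "l2sq D f = ennreal (LINT z:D|lborel. (cmod (f z))\<^sup>2)" if "l2sq D f < \<infinity>"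
    using that int nn unfolding eq set_lebesgue_integral_def set_integrable_def
    by (intro nn_integral_eq_integral) auto
  have "0 \<le> (LINT z:D|lborel. (cmod (f z))\<^sup>2)"
    unfolding set_lebesgue_integral_def by (intro Bochner_Integration.integral_nonneg) auto
  then have "L2_norm_on D f \<le> 1 \<longleftrightarrow> l2sq D f \<le> 1" if "l2sq D f < \<infinity>"
    using val[OF that] by (simp add: L2_norm_on_def)
  moreover have "l2sq D f \<le> 1 \<Longrightarrow> l2sq D f < \<infinity>" using le_less_trans[of "l2sq D f" 1 \<infinity>] by simp
  ultimately show ?thesis using True int by (auto simp: L2h_def)
qed (simp add: L2h_def)

lemma bergman_K_alt:
  "open D \<Longrightarrow> bergman_K D z = Sup {(cmod (f z))\<^sup>2 |f. f holomorphic_on D \<and> l2sq D f \<le> 1}"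
  unfolding bergman_K_def by (intro arg_cong[where f = Sup]) (use L2h_norm_le_1_iff in blast)

lemma bergman_M_alt:
  "open D \<Longrightarrow> bergman_M D z = Sup {cmod (deriv f z) |f. f holomorphic_on D \<and> l2sq D f \<le> 1 \<and> f z = 0}"
  unfolding bergman_M_def by (intro arg_cong[where f = Sup]) (use L2h_norm_le_1_iff in blast)

lemma l2sq_pullback_le:
  assumes D: "open D" and f: "f holomorphic_on D"
    and \<phi>: "\<phi> holomorphic_on ball 0 1" "inj_on \<phi> (ball 0 1)" "\<phi> ` ball 0 1 \<subseteq> D"
  shows "l2sq (ball 0 1) (\<lambda>z. f (\<phi> z) * deriv \<phi> z) \<le> l2sq D f"
proof -
  have "continuous_on (\<phi> ` ball 0 1) f"
    using f \<phi>(3) by (meson continuous_on_subset holomorphic_on_imp_continuous_on)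
  then have "l2sq (ball 0 1) (\<lambda>z. f (\<phi> z) * deriv \<phi> z) = l2sq (\<phi> ` ball 0 1) f"
    using \<phi> by (intro l2sq_change_of_variables[symmetric]) auto
  then show ?thesis using l2sq_mono[OF \<phi>(3)] by simp
qed

lemma holomorphic_pullback:
  assumes "f holomorphic_on D" "\<phi> holomorphic_on ball 0 1" "\<phi> ` ball 0 1 \<subseteq> D"
  shows "(\<lambda>z. f (\<phi> z)) holomorphic_on ball 0 1"
  using holomorphic_on_compose_gen[OF assms(2,1,3)] by (simp add: o_def)

lemma value_le_bergman:
  assumes D: "open D" and f: "f holomorphic_on D" "l2sq D f \<le> 1"
    and \<phi>: "\<phi> holomorphic_on ball 0 1" "inj_on \<phi> (ball 0 1)" "\<phi> ` ball 0 1 \<subseteq> D" "deriv \<phi> 0 \<noteq> 0"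
  shows "(cmod (f (\<phi> 0)))\<^sup>2 \<le> 1 / (pi * (cmod (deriv \<phi> 0))\<^sup>2)"
proof -
  have "ennreal (pi * (cmod (f (\<phi> 0) * deriv \<phi> 0))\<^sup>2) \<le> l2sq (ball 0 1) (\<lambda>z. f (\<phi> z) * deriv \<phi> z)"
    using disc_value_le_l2sq[of "\<lambda>z. f (\<phi> z) * deriv \<phi> z"] holomorphic_pullback[OF f(1) \<phi>(1,3)] \<phi>
    by (simp add: holomorphic_intros)
  also have "\<dots> \<le> 1" using l2sq_pullback_le[OF D f(1) \<phi>(1-3)] f(2) by (rule order.trans)
  finally show ?thesis using \<phi>(4) by (simp add: norm_mult power_mult_distrib field_simps)
qed

lemma deriv_le_bergman:
  assumes D: "open D" and f: "f holomorphic_on D" "l2sq D f \<le> 1" "f (\<phi> 0) = 0"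
    and \<phi>: "\<phi> holomorphic_on ball 0 1" "inj_on \<phi> (ball 0 1)" "\<phi> ` ball 0 1 \<subseteq> D" "deriv \<phi> 0 \<noteq> 0"
  shows "cmod (deriv f (\<phi> 0)) \<le> sqrt (2 / pi) / (cmod (deriv \<phi> 0))\<^sup>2"
proof -
  have in0: "\<phi> 0 \<in> D" using \<phi>(3) by auto
  have "((\<lambda>z. f (\<phi> z)) has_field_derivative deriv f (\<phi> 0) * deriv \<phi> 0) (at 0)"
    using DERIV_chain2[OF holomorphic_derivI[OF f(1) D in0] holomorphic_derivI[OF \<phi>(1) open_ball]] by simp
  moreover have "(deriv \<phi> has_field_derivative deriv (deriv \<phi>) 0) (at 0)"
    using holomorphic_derivI[OF holomorphic_deriv[OF \<phi>(1) open_ball] open_ball, of 0] by simp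
  ultimately have "((\<lambda>z. f (\<phi> z) * deriv \<phi> z) has_field_derivative (deriv f (\<phi> 0) * (deriv \<phi> 0)\<^sup>2)) (at 0)"
    using DERIV_mult f(3) by (fastforce simp: power2_eq_square mult_ac)
  then have "deriv (\<lambda>z. f (\<phi> z) * deriv \<phi> z) 0 = deriv f (\<phi> 0) * (deriv \<phi> 0)\<^sup>2"
    by (rule DERIV_imp_deriv)
  then have "ennreal (pi / 2 * (cmod (deriv f (\<phi> 0) * (deriv \<phi> 0)\<^sup>2))\<^sup>2) \<le> l2sq (ball 0 1) (\<lambda>z. f (\<phi> z) * deriv \<phi> z)"
    using disc_deriv_le_l2sq[of "\<lambda>z. f (\<phi> z) * deriv \<phi> z"] holomorphic_pullback[OF f(1) \<phi>(1,3)] \<phi>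
    by (simp add: holomorphic_intros)
  also have "\<dots> \<le> 1" using l2sq_pullback_le[OF D f(1) \<phi>(1-3)] f(2) by (rule order.trans)
  finally have "(cmod (deriv f (\<phi> 0)) * (cmod (deriv \<phi> 0))\<^sup>2)\<^sup>2 \<le> 2 / pi"
    by (simp add: norm_mult norm_power field_simps)
  then have "cmod (deriv f (\<phi> 0)) * (cmod (deriv \<phi> 0))\<^sup>2 \<le> sqrt (2 / pi)"
    by (rule real_le_rsqrt)
  then show ?thesis using \<phi>(4) by (simp add: field_simps)
qed

text \<open>The estimate for the value at the centre of the disc is applied to the pullback \<open>(f \<circ> \<phi>) \<phi>'\<close>, whose square
  integral is at most that of f. As it holds for every competitor f, the supremum is a genuine one and
  bounds each competitor.\<close>

lemma bergman_K_upper: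
  assumes D: "open D"
    and \<phi>: "\<phi> holomorphic_on ball 0 1" "inj_on \<phi> (ball 0 1)" "\<phi> ` ball 0 1 \<subseteq> D" "deriv \<phi> 0 \<noteq> 0"
  shows "bergman_K D (\<phi> 0) \<le> 1 / (pi * (cmod (deriv \<phi> 0))\<^sup>2)"
    and "f holomorphic_on D \<Longrightarrow> l2sq D f \<le> 1 \<Longrightarrow> (cmod (f (\<phi> 0)))\<^sup>2 \<le> bergman_K D (\<phi> 0)"
proof -
  let ?S = "{(cmod (f (\<phi> 0)))\<^sup>2 |f. f holomorphic_on D \<and> l2sq D f \<le> 1}"
  have le: "x \<le> 1 / (pi * (cmod (deriv \<phi> 0))\<^sup>2)" if "x \<in> ?S" for x
    using that value_le_bergman[OF D _ _ \<phi>] by blast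
  have "0 \<in> ?S" by (auto intro!: exI[of _ "\<lambda>_. 0"] simp: l2sq_def)
  then show "bergman_K D (\<phi> 0) \<le> 1 / (pi * (cmod (deriv \<phi> 0))\<^sup>2)"
    unfolding bergman_K_alt[OF D] using le by (intro cSup_least) auto
  show "(cmod (f (\<phi> 0)))\<^sup>2 \<le> bergman_K D (\<phi> 0)" if "f holomorphic_on D" "l2sq D f \<le> 1"
    unfolding bergman_K_alt[OF D] using le that by (intro cSup_upper bdd_aboveI[of ?S]) blast+
qed

lemma bergman_M_upper:
  assumes D: "open D"
    and \<phi>: "\<phi> holomorphic_on ball 0 1" "inj_on \<phi> (ball 0 1)" "\<phi> ` ball 0 1 \<subseteq> D" "deriv \<phi> 0 \<noteq> 0"
  shows "bergman_M D (\<phi> 0) \<le> sqrt (2 / pi) / (cmod (deriv \<phi> 0))\<^sup>2"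
    and "f holomorphic_on D \<Longrightarrow> l2sq D f \<le> 1 \<Longrightarrow> f (\<phi> 0) = 0 \<Longrightarrow> cmod (deriv f (\<phi> 0)) \<le> bergman_M D (\<phi> 0)"
proof -
  let ?S = "{cmod (deriv f (\<phi> 0)) |f. f holomorphic_on D \<and> l2sq D f \<le> 1 \<and> f (\<phi> 0) = 0}"
  have le: "x \<le> sqrt (2 / pi) / (cmod (deriv \<phi> 0))\<^sup>2" if "x \<in> ?S" for x
    using that deriv_le_bergman[OF D _ _ _ \<phi>] by blast
  have "0 \<in> ?S" by (auto intro!: exI[of _ "\<lambda>_. 0"] simp: l2sq_def)
  then show "bergman_M D (\<phi> 0) \<le> sqrt (2 / pi) / (cmod (deriv \<phi> 0))\<^sup>2"
    unfolding bergman_M_alt[OF D] using le by (intro cSup_least) auto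
  show "cmod (deriv f (\<phi> 0)) \<le> bergman_M D (\<phi> 0)" if "f holomorphic_on D" "l2sq D f \<le> 1" "f (\<phi> 0) = 0"
    unfolding bergman_M_alt[OF D] using le that by (intro cSup_upper bdd_aboveI[of ?S]) blast+
qed

text \<open>The competitors are multiples of \<open>\<psi>'\<close> for K and of \<open>\<psi> \<psi>'\<close> for M: the change of variables \<open>\<psi>\<close> turns
  their square integrals into those of 1 and z over a subset of the unit disc. The map \<open>\<phi>\<close> bounds the
  suprema.\<close>

lemma bergman_lower:
  assumes D: "open D"
    and \<phi>: "\<phi> holomorphic_on ball 0 1" "inj_on \<phi> (ball 0 1)" "\<phi> ` ball 0 1 \<subseteq> D" "deriv \<phi> 0 \<noteq> 0"
    and \<psi>: "\<psi> \<in> holo_maps D (ball 0 1)" "inj_on \<psi> D" "\<psi> (\<phi> 0) = 0"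
  shows "(cmod (deriv \<psi> (\<phi> 0)))\<^sup>2 / pi \<le> bergman_K D (\<phi> 0)"
    and "sqrt (2 / pi) * (cmod (deriv \<psi> (\<phi> 0)))\<^sup>2 \<le> bergman_M D (\<phi> 0)"
proof -
  have hol: "\<psi> holomorphic_on D" and sub: "\<psi> ` D \<subseteq> ball 0 1" using \<psi>(1) by (auto simp: holo_maps_def)
  have hd: "deriv \<psi> holomorphic_on D" using hol D by (rule holomorphic_deriv)
  have cd: "continuous_on D \<psi>" "continuous_on D (deriv \<psi>)"
    using hol hd by (auto intro: holomorphic_on_imp_continuous_on)
  have in0: "\<phi> 0 \<in> D" using \<phi>(3) by auto
  define k where "k = 1 / sqrt pi"
  have "l2sq D (\<lambda>z. 1 * deriv \<psi> z) = l2sq (\<psi> ` D) (\<lambda>_. 1)"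
    using l2sq_change_of_variables[OF D hol \<psi>(2), of "\<lambda>_. 1"] by simp
  also have "\<dots> \<le> l2sq (ball 0 1) (\<lambda>_. 1)" by (rule l2sq_mono[OF sub])
  finally have 1: "l2sq D (deriv \<psi>) \<le> ennreal pi" by (simp add: l2sq_const emeasure_unit_disc)
  have "l2sq D (\<lambda>z. of_real k * deriv \<psi> z) \<le> ennreal (k\<^sup>2) * ennreal pi"
    using mult_left_mono[OF 1, of "ennreal (k\<^sup>2)"] l2sq_cmult[OF D cd(2), of "of_real k"] by simp
  also have "\<dots> = 1" by (simp add: k_def power_divide flip: ennreal_mult)
  finally have "(cmod (of_real k * deriv \<psi> (\<phi> 0)))\<^sup>2 \<le> bergman_K D (\<phi> 0)"
    by (intro bergman_K_upper[OF D \<phi>] holomorphic_intros hd)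
  then show "(cmod (deriv \<psi> (\<phi> 0)))\<^sup>2 / pi \<le> bergman_K D (\<phi> 0)"
    by (simp add: norm_mult norm_divide power_mult_distrib k_def power_divide)
  define l where "l = sqrt (2 / pi)"
  have l: "l > 0" "l\<^sup>2 = 2 / pi" by (auto simp: l_def)
  have "l2sq D (\<lambda>z. \<psi> z * deriv \<psi> z) = l2sq (\<psi> ` D) (\<lambda>z. z)"
    using l2sq_change_of_variables[OF D hol \<psi>(2), of "\<lambda>z. z"] by simp
  also have "\<dots> \<le> l2sq (ball 0 1) (\<lambda>z. z)" by (rule l2sq_mono[OF sub])
  finally have 2: "l2sq D (\<lambda>z. \<psi> z * deriv \<psi> z) \<le> ennreal (pi / 2)" by (simp add: l2sq_unit_disc_id)
  have "l2sq D (\<lambda>z. of_real l * (\<psi> z * deriv \<psi> z)) \<le> ennreal (l\<^sup>2) * ennreal (pi / 2)"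
    using mult_left_mono[OF 2, of "ennreal (l\<^sup>2)"] l2sq_cmult[OF D, of "\<lambda>z. \<psi> z * deriv \<psi> z" "of_real l"] cd
    by (simp add: continuous_intros)
  also have "\<dots> = 1" by (simp add: l flip: ennreal_mult)
  finally have *: "l2sq D (\<lambda>z. of_real l * (\<psi> z * deriv \<psi> z)) \<le> 1" .
  have "((\<lambda>z. of_real l * (\<psi> z * deriv \<psi> z)) has_field_derivative
       of_real l * (\<psi> (\<phi> 0) * deriv (deriv \<psi>) (\<phi> 0) + deriv \<psi> (\<phi> 0) * deriv \<psi> (\<phi> 0))) (at (\<phi> 0))"
    by (intro DERIV_cmult DERIV_mult' holomorphic_derivI[OF hol D in0] holomorphic_derivI[OF hd D in0])
  then have "deriv (\<lambda>z. of_real l * (\<psi> z * deriv \<psi> z)) (\<phi> 0) = of_real l * (deriv \<psi> (\<phi> 0))\<^sup>2"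
    using \<psi>(3) by (simp add: DERIV_imp_deriv power2_eq_square)
  moreover have "cmod (deriv (\<lambda>z. of_real l * (\<psi> z * deriv \<psi> z)) (\<phi> 0)) \<le> bergman_M D (\<phi> 0)"
    using * \<psi>(3) by (intro bergman_M_upper[OF D \<phi>] holomorphic_intros hd hol) auto
  ultimately show "sqrt (2 / pi) * (cmod (deriv \<psi> (\<phi> 0)))\<^sup>2 \<le> bergman_M D (\<phi> 0)"
    using l by (simp add: norm_mult norm_power l_def)
qed

lemma bergman_metric_bounds:
  assumes D: "open D"
    and \<phi>: "\<phi> holomorphic_on ball 0 1" "inj_on \<phi> (ball 0 1)" "\<phi> ` ball 0 1 \<subseteq> D" "deriv \<phi> 0 \<noteq> 0"
    and \<psi>: "\<psi> \<in> holo_maps D (ball 0 1)" "inj_on \<psi> D" "\<psi> (\<phi> 0) = 0" "deriv \<psi> (\<phi> 0) \<noteq> 0"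
  shows "bergman_metric D (\<phi> 0) \<le> sqrt 2 / ((cmod (deriv \<phi> 0))\<^sup>2 * cmod (deriv \<psi> (\<phi> 0)))"
    and "sqrt 2 * (cmod (deriv \<psi> (\<phi> 0)))\<^sup>2 * cmod (deriv \<phi> 0) \<le> bergman_metric D (\<phi> 0)"
proof -
  define A B K M where "A = cmod (deriv \<phi> 0)" and "B = cmod (deriv \<psi> (\<phi> 0))"
    and "K = bergman_K D (\<phi> 0)" and "M = bergman_M D (\<phi> 0)"
  have A: "A > 0" and B: "B > 0" using \<phi> \<psi> by (auto simp: A_def B_def)
  have K: "B\<^sup>2 / pi \<le> K" "K \<le> 1 / (pi * A\<^sup>2)"
    using bergman_lower[OF D \<phi> \<psi>(1-3)] bergman_K_upper[OF D \<phi>] by (auto simp: A_def B_def K_def)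
  have M: "sqrt (2 / pi) * B\<^sup>2 \<le> M" "M \<le> sqrt (2 / pi) / A\<^sup>2"
    using bergman_lower[OF D \<phi> \<psi>(1-3)] bergman_M_upper[OF D \<phi>] by (auto simp: A_def B_def M_def)
  have s1: "B / sqrt pi \<le> sqrt K"
    using real_sqrt_le_mono[OF K(1)] B by (simp add: real_sqrt_divide)
  have s2: "sqrt K \<le> 1 / (sqrt pi * A)"
    using real_sqrt_le_mono[OF K(2)] A by (simp add: real_sqrt_divide real_sqrt_mult)
  have sK: "sqrt K > 0" using s1 B by (meson divide_pos_pos less_le_trans pi_gt_zero real_sqrt_gt_zero)
  have M0: "0 \<le> M" using M(1) by (meson mult_nonneg_nonneg order.trans real_sqrt_ge_zero zero_le_power2 divide_nonneg_nonneg pi_ge_zero zero_le_numeral)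
  have "M / sqrt K \<le> (sqrt (2 / pi) / A\<^sup>2) / (B / sqrt pi)"
    using M M0 s1 B by (intro frac_le) auto
  also have "\<dots> = sqrt 2 / (A\<^sup>2 * B)" using A B by (simp add: real_sqrt_divide field_simps)
  finally show "bergman_metric D (\<phi> 0) \<le> sqrt 2 / ((cmod (deriv \<phi> 0))\<^sup>2 * cmod (deriv \<psi> (\<phi> 0)))"
    by (simp add: bergman_metric_def A_def B_def K_def M_def)
  have "sqrt 2 * B\<^sup>2 * A = (sqrt (2 / pi) * B\<^sup>2) / (1 / (sqrt pi * A))"
    using A by (simp add: real_sqrt_divide field_simps)
  also have "\<dots> \<le> M / sqrt K" using M(1) M0 s2 sK by (intro frac_le) auto
  finally show "sqrt 2 * (cmod (deriv \<psi> (\<phi> 0)))\<^sup>2 * cmod (deriv \<phi> 0) \<le> bergman_metric D (\<phi> 0)"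
    by (simp add: bergman_metric_def A_def B_def K_def M_def)
qed

section \<open>Discs and exteriors of discs\<close>

text \<open>The Poincare distance of the disc with centre c and radius \<rho>.\<close>

definition disc_dist :: "complex \<Rightarrow> real \<Rightarrow> complex \<Rightarrow> complex \<Rightarrow> real"
  where "disc_dist c \<rho> z w =
    arsinh (\<rho> * cmod (z - w) / sqrt ((\<rho>\<^sup>2 - (cmod (z - c))\<^sup>2) * (\<rho>\<^sup>2 - (cmod (w - c))\<^sup>2)))"

text \<open>The Poincare distance of the complement of a closed disc in the Riemann sphere.\<close>

definition exterior_dist :: "complex \<Rightarrow> real \<Rightarrow> complex \<Rightarrow> complex \<Rightarrow> real"
  where "exterior_dist c \<rho> z w =
    arsinh (\<rho> * cmod (z - w) / sqrt (((cmod (z - c))\<^sup>2 - \<rho>\<^sup>2) * ((cmod (w - c))\<^sup>2 - \<rho>\<^sup>2)))"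

definition disc_chart :: "complex \<Rightarrow> real \<Rightarrow> complex \<Rightarrow> complex \<Rightarrow> complex"
  where "disc_chart c \<rho> z \<tau> = c + of_real \<rho> * mob (- ((z - c) / of_real \<rho>)) \<tau>"

definition exterior_chart :: "complex \<Rightarrow> real \<Rightarrow> complex \<Rightarrow> complex \<Rightarrow> complex"
  where "exterior_chart c \<rho> z \<zeta> = mob (of_real \<rho> / (z - c)) (of_real \<rho> / (\<zeta> - c))"

lemma disc_normalise: "z \<in> ball c \<rho> \<Longrightarrow> cmod ((z - c) / of_real \<rho>) < 1"
  by (auto simp: norm_divide dist_norm norm_minus_commute) (smt (verit, best) divide_less_eq_1 norm_ge_zero)

lemma mob_holo_maps: "cmod b < 1 \<Longrightarrow> mob b \<in> holo_maps (ball 0 1) (ball 0 1)"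
  using mob_denom_nonzero[of b] unfolding holo_maps_def
  by (auto intro!: mob_holomorphic_on[of "\<lambda>x. x"] holomorphic_intros cmod_mob_less_1 simp: less_imp_le)

lemma inj_on_mob: "cmod b < 1 \<Longrightarrow> inj_on (mob b) (ball 0 1)"
  by (rule inj_on_inverseI[of _ "mob (-b)"]) (simp add: mob_mob_minus)

lemma disc_chart_props:
  assumes \<rho>: "0 < \<rho>" and z: "z \<in> ball c \<rho>"
  shows "disc_chart c \<rho> z \<in> holo_maps (ball 0 1) (ball c \<rho>)"
    and "inj_on (disc_chart c \<rho> z) (ball 0 1)"
    and "disc_chart c \<rho> z 0 = z"
    and "cmod \<tau> < 1 \<Longrightarrow> (disc_chart c \<rho> z has_field_derivative deriv (disc_chart c \<rho> z) \<tau>) (at \<tau>)"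
    and "cmod (deriv (disc_chart c \<rho> z) 0) = (\<rho>\<^sup>2 - (cmod (z - c))\<^sup>2) / \<rho>"
    and "cmod \<tau> < 1 \<Longrightarrow> \<rho> * cmod (deriv (disc_chart c \<rho> z) \<tau>) / (\<rho>\<^sup>2 - (cmod (disc_chart c \<rho> z \<tau> - c))\<^sup>2)
        = 1 / (1 - (cmod \<tau>)\<^sup>2)"
    and "w \<in> ball c \<rho> \<Longrightarrow> disc_chart c \<rho> z (mob ((z - c) / of_real \<rho>) ((w - c) / of_real \<rho>)) = w"
    and "w \<in> ball c \<rho> \<Longrightarrow> disc_dist c \<rho> z w = pd ((z - c) / of_real \<rho>) ((w - c) / of_real \<rho>)"
proof -
  define b where "b = (z - c) / of_real \<rho>"
  have b: "cmod b < 1" "cmod (-b) < 1" using disc_normalise[OF z] by (auto simp: b_def)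
  have f: "disc_chart c \<rho> z = (\<lambda>\<tau>. c + of_real \<rho> * mob (-b) \<tau>)" by (auto simp: disc_chart_def b_def)
  note m = mob_holo_maps[OF b(2)]
  show "disc_chart c \<rho> z \<in> holo_maps (ball 0 1) (ball c \<rho>)"
    using m \<rho> unfolding f holo_maps_def
    by (auto intro!: holomorphic_intros simp: dist_norm norm_mult image_subset_iff)
  show "inj_on (disc_chart c \<rho> z) (ball 0 1)"
    using inj_on_mob[OF b(2)] \<rho> unfolding f inj_on_def by auto
  show "disc_chart c \<rho> z 0 = z"
    using \<rho> unfolding f by (simp add: mob_def b_def)
  have der: "(disc_chart c \<rho> z has_field_derivative of_real \<rho> * ((1 - (cmod b)\<^sup>2) / (1 - cnj (-b) * \<tau>)\<^sup>2)) (at \<tau>)"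
    if "cmod \<tau> < 1" for \<tau>
  proof -
    have "(mob (-b) has_field_derivative (1 - (cmod (-b))\<^sup>2) / (1 - cnj (-b) * \<tau>)\<^sup>2) (at \<tau>)"
      using mob_denom_nonzero[OF b(2)] that by (intro has_field_derivative_mob) auto
    from DERIV_add[OF DERIV_const DERIV_cmult[OF this], of c "of_real \<rho>"] show ?thesis unfolding f by simp
  qed
  show "(disc_chart c \<rho> z has_field_derivative deriv (disc_chart c \<rho> z) \<tau>) (at \<tau>)" if "cmod \<tau> < 1"
    using der[OF that] DERIV_imp_deriv by metis
  have d: "cmod (deriv (disc_chart c \<rho> z) \<tau>) = \<rho> * (1 - (cmod b)\<^sup>2) / (cmod (1 - cnj (-b) * \<tau>))\<^sup>2" if "cmod \<tau> < 1" for \<tau>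
  proof -
    have "0 \<le> 1 - (cmod b)\<^sup>2" using b by (simp add: abs_square_le_1)
    then have "cmod (1 - (complex_of_real (cmod b))\<^sup>2) = 1 - (cmod b)\<^sup>2"
      by (metis abs_of_nonneg norm_of_real of_real_1 of_real_diff of_real_power)
    then show ?thesis
      using DERIV_imp_deriv[OF der[OF that]] \<rho> by (simp add: norm_mult norm_divide norm_power)
  qed
  have nb: "\<rho>\<^sup>2 - (cmod (z - c))\<^sup>2 = \<rho>\<^sup>2 * (1 - (cmod b)\<^sup>2)"
    using \<rho> by (simp add: b_def norm_divide power_divide field_simps)
  show "cmod (deriv (disc_chart c \<rho> z) 0) = (\<rho>\<^sup>2 - (cmod (z - c))\<^sup>2) / \<rho>"
    using d[of 0] \<rho> unfolding nb by (simp add: power2_eq_square)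
  show "\<rho> * cmod (deriv (disc_chart c \<rho> z) \<tau>) / (\<rho>\<^sup>2 - (cmod (disc_chart c \<rho> z \<tau> - c))\<^sup>2)
        = 1 / (1 - (cmod \<tau>)\<^sup>2)" if t: "cmod \<tau> < 1"
  proof -
    have nz: "1 - cnj (-b) * \<tau> \<noteq> 0" using mob_denom_nonzero[OF b(2)] t by auto
    have p: "1 - (cmod b)\<^sup>2 > 0" "1 - (cmod \<tau>)\<^sup>2 > 0" using b t by (auto simp: abs_square_less_1)
    have "\<rho>\<^sup>2 - (cmod (disc_chart c \<rho> z \<tau> - c))\<^sup>2 = \<rho>\<^sup>2 * (1 - (cmod (mob (-b) \<tau>))\<^sup>2)"
      using \<rho> by (simp add: f norm_mult power_mult_distrib algebra_simps)
    also have "\<dots> = \<rho>\<^sup>2 * ((1 - (cmod b)\<^sup>2) * (1 - (cmod \<tau>)\<^sup>2) / (cmod (1 - cnj (-b) * \<tau>))\<^sup>2)"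
      by (simp only: one_minus_cmod_mob[OF nz] norm_minus_cancel)
    finally show ?thesis
      unfolding d[OF t] using nz p \<rho> by (simp add: power2_eq_square)
  qed
  show "disc_chart c \<rho> z (mob ((z - c) / of_real \<rho>) ((w - c) / of_real \<rho>)) = w" if "w \<in> ball c \<rho>"
    using mob_mob_minus[OF b(1) disc_normalise[OF that]] \<rho> by (simp add: f b_def)
  show "disc_dist c \<rho> z w = pd ((z - c) / of_real \<rho>) ((w - c) / of_real \<rho>)" if w: "w \<in> ball c \<rho>"
  proof -
    define v where "v = (w - c) / of_real \<rho>"
    have v: "cmod v < 1" using disc_normalise[OF w] by (simp add: v_def)
    have nv: "\<rho>\<^sup>2 - (cmod (w - c))\<^sup>2 = \<rho>\<^sup>2 * (1 - (cmod v)\<^sup>2)"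
      using \<rho> by (simp add: v_def norm_divide power_divide field_simps)
    have "b - v = (z - w) / of_real \<rho>" by (simp add: b_def v_def diff_divide_distrib)
    then have bv: "cmod (z - w) = \<rho> * cmod (b - v)" using \<rho> by (simp add: norm_divide)
    have "sqrt ((\<rho>\<^sup>2 * (1 - (cmod b)\<^sup>2)) * (\<rho>\<^sup>2 * (1 - (cmod v)\<^sup>2)))
       = \<rho>\<^sup>2 * sqrt ((1 - (cmod b)\<^sup>2) * (1 - (cmod v)\<^sup>2))"
      using \<rho> by (simp add: real_sqrt_mult power2_eq_square)
    then show ?thesis
      unfolding disc_dist_def b_def[symmetric] v_def[symmetric] nb nv pd_eq_arsinh[OF b(1) v] bv
      using \<rho> by (simp add: power2_eq_square)
  qed
qed

lemma exterior_ball_disjoint: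
  assumes D: "open D" and dis: "ball c \<rho> \<inter> D = {}" and \<rho>: "0 < \<rho>" and z: "z \<in> D"
  shows "\<rho> < cmod (z - c)"
proof -
  have "D \<inter> closure (ball c \<rho>) = {}" using D dis open_Int_closure_eq_empty by blast
  then show ?thesis using z \<rho> by (auto simp: dist_norm norm_minus_commute)
qed

lemma exterior_chart_props:
  assumes D: "open D" and dis: "ball c \<rho> \<inter> D = {}" and \<rho>: "0 < \<rho>" and z: "z \<in> D"
  shows "exterior_chart c \<rho> z \<in> holo_maps D (ball 0 1)"
    and "inj_on (exterior_chart c \<rho> z) D"
    and "exterior_chart c \<rho> z z = 0"
    and "cmod (deriv (exterior_chart c \<rho> z) z) = \<rho> / ((cmod (z - c))\<^sup>2 - \<rho>\<^sup>2)"
    and "w \<in> D \<Longrightarrow> cmod (deriv (exterior_chart c \<rho> z) w) / (1 - (cmod (exterior_chart c \<rho> z w))\<^sup>2)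
          = \<rho> / ((cmod (w - c))\<^sup>2 - \<rho>\<^sup>2)"
    and "w \<in> D \<Longrightarrow> exterior_dist c \<rho> z w = artanh (cmod (exterior_chart c \<rho> z w))"
proof -
  have far: "\<rho> < cmod (w - c)" if "w \<in> D" for w using exterior_ball_disjoint[OF D dis \<rho> that] .
  have ne: "w - c \<noteq> 0" if "w \<in> D" for w using far[OF that] \<rho> by auto
  define u where "u w = of_real \<rho> / (w - c)" for w
  have u: "cmod (u w) < 1" if "w \<in> D" for w
    using far[OF that] \<rho> by (simp add: u_def norm_divide divide_less_eq)
  have f: "exterior_chart c \<rho> z = (\<lambda>w. mob (u z) (u w))" by (auto simp: exterior_chart_def u_def)
  have uh: "u holomorphic_on D" unfolding u_def using ne by (intro holomorphic_intros) auto
  have uz: "cmod (u z) < 1" using u z by auto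
  show "exterior_chart c \<rho> z \<in> holo_maps D (ball 0 1)"
    using mob_denom_nonzero[OF uz] u unfolding f holo_maps_def
    by (auto intro!: holomorphic_intros uh cmod_mob_less_1 uz simp: less_imp_le)
  show "inj_on (exterior_chart c \<rho> z) D"
  proof (rule inj_onI)
    fix x y assume xy: "x \<in> D" "y \<in> D" "exterior_chart c \<rho> z x = exterior_chart c \<rho> z y"
    then have "u x = u y" using inj_on_mob[OF uz] u unfolding f by (auto simp: inj_on_def)
    then show "x = y" using ne xy \<rho> by (auto simp: u_def)
  qed
  show "exterior_chart c \<rho> z z = 0" by (simp add: f)
  have du: "(u has_field_derivative - of_real \<rho> / (w - c)\<^sup>2) (at w)" if "w \<in> D" for w
  proof -
    have "(u has_field_derivative (0 * (w - c) - of_real \<rho> * (1 - 0)) / ((w - c) * (w - c))) (at w)"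
      unfolding u_def using ne[OF that] by (intro DERIV_divide derivative_intros) auto
    then show ?thesis by (simp add: power2_eq_square)
  qed
  have one: "1 - (cmod (u w))\<^sup>2 = ((cmod (w - c))\<^sup>2 - \<rho>\<^sup>2) / (cmod (w - c))\<^sup>2" if "w \<in> D" for w
    using ne[OF that] by (simp add: u_def norm_divide power_divide field_simps)
  have pos: "0 < (cmod (w - c))\<^sup>2 - \<rho>\<^sup>2" if "w \<in> D" for w
    using power_strict_mono[OF far[OF that], of 2] \<rho> by simp
  show *: "cmod (deriv (exterior_chart c \<rho> z) w) / (1 - (cmod (exterior_chart c \<rho> z w))\<^sup>2)
          = \<rho> / ((cmod (w - c))\<^sup>2 - \<rho>\<^sup>2)" if w: "w \<in> D" for w
  proof -
    have nz: "1 - cnj (u z) * u w \<noteq> 0" using mob_denom_nonzero[OF uz] u[OF w] by auto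
    have "(exterior_chart c \<rho> z has_field_derivative
       ((1 - (cmod (u z))\<^sup>2) / (1 - cnj (u z) * u w)\<^sup>2) * (- of_real \<rho> / (w - c)\<^sup>2)) (at w)"
      unfolding f by (rule DERIV_chain2[OF has_field_derivative_mob[OF nz] du[OF w]])
    moreover have "0 \<le> 1 - (cmod (u z))\<^sup>2" using uz by (simp add: abs_square_le_1)
    then have "cmod (1 - (complex_of_real (cmod (u z)))\<^sup>2) = 1 - (cmod (u z))\<^sup>2"
      by (metis abs_of_nonneg norm_of_real of_real_1 of_real_diff of_real_power)
    ultimately have d: "cmod (deriv (exterior_chart c \<rho> z) w)
      = (1 - (cmod (u z))\<^sup>2) / (cmod (1 - cnj (u z) * u w))\<^sup>2 * (\<rho> / (cmod (w - c))\<^sup>2)"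
      using \<rho> by (simp add: DERIV_imp_deriv norm_mult norm_divide norm_power)
    have p: "0 < 1 - (cmod (u z))\<^sup>2" "0 < 1 - (cmod (u w))\<^sup>2" using uz u[OF w] by (auto simp: abs_square_less_1)
    have "cmod (deriv (exterior_chart c \<rho> z) w) / (1 - (cmod (exterior_chart c \<rho> z w))\<^sup>2)
       = \<rho> / (cmod (w - c))\<^sup>2 / (1 - (cmod (u w))\<^sup>2)"
    proof -
      have "a / k * x / (a * q / k) = x / q" if "a \<noteq> 0" "k \<noteq> 0" for a k x q :: real
        using that by (simp add: field_simps)
      then show ?thesis unfolding d unfolding f one_minus_cmod_mob[OF nz] using p nz by simp
    qed
    also have "\<dots> = \<rho> / ((cmod (w - c))\<^sup>2 - \<rho>\<^sup>2)"
      unfolding one[OF w] using ne[OF w] by simp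
    finally show ?thesis .
  qed
  show "cmod (deriv (exterior_chart c \<rho> z) z) = \<rho> / ((cmod (z - c))\<^sup>2 - \<rho>\<^sup>2)"
    using *[OF z] by (simp add: f)
  show "exterior_dist c \<rho> z w = artanh (cmod (exterior_chart c \<rho> z w))" if w: "w \<in> D"
  proof -
    have "artanh (cmod (exterior_chart c \<rho> z w)) = pd (u z) (u w)" by (simp add: f pd_def)
    also have "\<dots> = arsinh (cmod (u z - u w) / sqrt ((1 - (cmod (u z))\<^sup>2) * (1 - (cmod (u w))\<^sup>2)))"
      by (rule pd_eq_arsinh[OF uz u[OF w]])
    also have "u z - u w = of_real \<rho> * (w - z) / ((z - c) * (w - c))"
      using ne z w by (simp add: u_def divide_simps) (simp add: algebra_simps)
    also have "sqrt ((1 - (cmod (u z))\<^sup>2) * (1 - (cmod (u w))\<^sup>2))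
        = sqrt (((cmod (z - c))\<^sup>2 - \<rho>\<^sup>2) * ((cmod (w - c))\<^sup>2 - \<rho>\<^sup>2)) / (cmod (z - c) * cmod (w - c))"
      unfolding one[OF z] one[OF w] by (simp add: real_sqrt_divide real_sqrt_mult)
    also have "cmod (of_real \<rho> * (w - z) / ((z - c) * (w - c))) /
        (sqrt (((cmod (z - c))\<^sup>2 - \<rho>\<^sup>2) * ((cmod (w - c))\<^sup>2 - \<rho>\<^sup>2)) / (cmod (z - c) * cmod (w - c)))
      = \<rho> * cmod (z - w) / sqrt (((cmod (z - c))\<^sup>2 - \<rho>\<^sup>2) * ((cmod (w - c))\<^sup>2 - \<rho>\<^sup>2))"
      using ne[OF z] ne[OF w] \<rho> by (simp add: norm_mult norm_divide norm_minus_commute)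
    finally show ?thesis by (simp add: exterior_dist_def)
  qed
qed

lemma kobayashi_le_disc_dist:
  assumes D: "domain D" and B: "ball c \<rho> \<subseteq> D" and \<rho>: "0 < \<rho>" and z: "z \<in> ball c \<rho>" and w: "w \<in> ball c \<rho>"
  shows "kobayashi_dist D z w \<le> disc_dist c \<rho> z w"
proof -
  note p = disc_chart_props[OF \<rho> z]
  have "kobayashi_dist D z w \<le> artanh (cmod (mob ((z - c) / of_real \<rho>) ((w - c) / of_real \<rho>)))"
  proof (rule kobayashi_le_artanh[OF D])
    show "disc_chart c \<rho> z \<in> holo_maps (ball 0 1) D"
      using p(1) B by (auto simp: holo_maps_def)
    show "cmod (mob ((z - c) / of_real \<rho>) ((w - c) / of_real \<rho>)) < 1"
      using disc_normalise z w by (intro cmod_mob_less_1)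
  qed (use p w z B in auto)
  then show ?thesis using p(8)[OF w] by (simp add: pd_def)
qed

lemma exterior_dist_le_caratheodory:
  assumes D: "domain D" and B: "ball c \<rho> \<inter> D = {}" and \<rho>: "0 < \<rho>" and z: "z \<in> D" and w: "w \<in> D"
  shows "exterior_dist c \<rho> z w \<le> caratheodory_dist D z w"
proof -
  have "open D" using D by (simp add: domain_def)
  note p = exterior_chart_props[OF this B \<rho> z]
  show ?thesis using caratheodory_ge[OF D z w p(1)] p(3) p(6)[OF w] by (simp add: pd_def)
qed

text \<open>The bounds of the Bergman metric by conformal maps, for the chart of a disc in D and the chart of the exterior of a
  disc outside D; \<open>\<kappa>\<close> and \<open>\<kappa>'\<close> are the densities of the two Poincare metrics.\<close>

lemma bergman_metric_between_balls:
  assumes D: "open D" and B: "ball c \<rho> \<subseteq> D" "0 < \<rho>" and z: "z \<in> ball c \<rho>"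
    and E: "ball c' \<rho>' \<inter> D = {}" "0 < \<rho>'"
  defines "\<kappa> \<equiv> \<rho> / (\<rho>\<^sup>2 - (cmod (z - c))\<^sup>2)" and "\<kappa>' \<equiv> \<rho>' / ((cmod (z - c'))\<^sup>2 - \<rho>'\<^sup>2)"
  shows "bergman_metric D z \<le> sqrt 2 * \<kappa>\<^sup>2 / \<kappa>'" and "sqrt 2 * \<kappa>'\<^sup>2 / \<kappa> \<le> bergman_metric D z"
proof -
  have zD: "z \<in> D" using B z by auto
  note p = disc_chart_props[OF B(2) z] and q = exterior_chart_props[OF D E zD]
  have zc: "0 < \<rho>\<^sup>2 - (cmod (z - c))\<^sup>2"
    using z power_strict_mono[of "cmod (z - c)" \<rho> 2] by (simp add: dist_norm norm_minus_commute)
  have zc': "0 < (cmod (z - c'))\<^sup>2 - \<rho>'\<^sup>2"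
    using power_strict_mono[OF exterior_ball_disjoint[OF D E zD], of 2] E by simp
  have k: "\<kappa> > 0" "\<kappa>' > 0" "cmod (deriv (disc_chart c \<rho> z) 0) = 1 / \<kappa>" "cmod (deriv (exterior_chart c' \<rho>' z) z) = \<kappa>'"
    using zc zc' B(2) E(2) p(5) q(4) by (auto simp: \<kappa>_def \<kappa>'_def)
  have nz: "deriv (disc_chart c \<rho> z) 0 \<noteq> 0" "deriv (exterior_chart c' \<rho>' z) z \<noteq> 0" using k by auto
  have hol: "disc_chart c \<rho> z holomorphic_on ball 0 1" "disc_chart c \<rho> z ` ball 0 1 \<subseteq> D"
    using p(1) B(1) by (auto simp: holo_maps_def)
  have q': "exterior_chart c' \<rho>' z (disc_chart c \<rho> z 0) = 0"
      "deriv (exterior_chart c' \<rho>' z) (disc_chart c \<rho> z 0) \<noteq> 0" using p(3) q(3) nz by auto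
  note r = bergman_metric_bounds[OF D hol(1) p(2) hol(2) nz(1) q(1,2) q']
  show "bergman_metric D z \<le> sqrt 2 * \<kappa>\<^sup>2 / \<kappa>'"
    using r(1) k unfolding p(3) by (simp add: field_simps)
  show "sqrt 2 * \<kappa>'\<^sup>2 / \<kappa> \<le> bergman_metric D z"
    using r(2) k unfolding p(3) by (simp add: field_simps)
qed

section \<open>Boundary distance, cones and comparison discs\<close>

lemma bdry_dist_nonneg: "0 \<le> bdry_dist D z"
  by (simp add: bdry_dist_def infdist_nonneg)

lemma ball_bdry_dist_subset:
  assumes "z \<in> D"
  shows "ball z (bdry_dist D z) \<subseteq> D"
proof (cases "bdry_dist D z > 0")
  case True
  have "ball z (bdry_dist D z) \<inter> frontier D = {}"
    using infdist_le[of _ "frontier D" z] by (fastforce simp: bdry_dist_def)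
  moreover have "z \<in> ball z (bdry_dist D z) \<inter> D" using True assms by simp
  ultimately show ?thesis
    using connected_Int_frontier[OF connected_ball, of z "bdry_dist D z" D] by blast
qed (simp add: ball_empty)

lemma bdry_dist_le_dist:
  assumes "z \<in> D" "y \<notin> D"
  shows "bdry_dist D z \<le> dist z y"
  using ball_bdry_dist_subset[OF assms(1)] assms(2) by (meson linorder_not_le mem_ball subsetD)

lemma bdry_dist_le_frontier: "p \<in> frontier D \<Longrightarrow> bdry_dist D z \<le> dist z p"
  unfolding bdry_dist_def by (rule infdist_le)

lemma bdry_dist_triangle: "bdry_dist D z \<le> bdry_dist D w + dist z w"
  unfolding bdry_dist_def by (rule infdist_triangle)

lemma bdry_dist_pos:
  assumes "open D" "z \<in> D" "frontier D \<noteq> {}"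
  shows "0 < bdry_dist D z"
proof -
  have "z \<notin> frontier D" using assms frontier_disjoint_eq by blast
  then show ?thesis unfolding bdry_dist_def
    using assms by (intro infdist_pos_not_in_closed) auto
qed

lemma ex_nearest_frontier_point:
  assumes "frontier D \<noteq> {}"
  shows "\<exists>p\<in>frontier D. dist z p = bdry_dist D z"
  using infdist_attains_inf[OF frontier_closed assms, of z] unfolding bdry_dist_def by metis

text \<open>The segment from z towards c meets the frontier of D before it enters the ball.\<close>

lemma bdry_dist_le_exterior_ball:
  assumes D: "open D" and dis: "ball c \<rho> \<inter> D = {}" and \<rho>: "0 < \<rho>" and z: "z \<in> D"
  shows "bdry_dist D z \<le> cmod (z - c) - \<rho>"
proof -
  have far: "\<rho> < cmod (z - c)" by (rule exterior_ball_disjoint[OF assms])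
  define y where "y = c + of_real (\<rho> / cmod (z - c)) * (z - c)"
  have "cmod (y - c) = \<rho>" using far \<rho> by (auto simp: y_def norm_mult norm_divide)
  then have "y \<notin> D" using exterior_ball_disjoint[OF D dis \<rho>] by force
  then have "bdry_dist D z \<le> dist z y" using z by (intro bdry_dist_le_dist)
  also have "z - y = of_real (1 - \<rho> / cmod (z - c)) * (z - c)" by (simp add: y_def algebra_simps)
  then have "dist z y = (1 - \<rho> / cmod (z - c)) * cmod (z - c)"
    using far \<rho> unfolding dist_norm by (simp only: norm_mult norm_of_real) (simp add: field_simps)
  also have "\<dots> = cmod (z - c) - \<rho>" using far \<rho> by (auto simp: field_simps)
  finally show ?thesis .
qed

lemma interior_ball_le_bdry_dist:
  assumes D: "open D" and B: "ball c \<rho> \<subseteq> D" and z: "frontier D \<noteq> {}"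
  shows "\<rho> - cmod (z - c) \<le> bdry_dist D z"
proof -
  obtain p where p: "p \<in> frontier D" "dist z p = bdry_dist D z" using ex_nearest_frontier_point[OF z] by blast
  have "p \<notin> ball c \<rho>" using D B p(1) frontier_disjoint_eq by blast
  then show ?thesis using p(2) dist_triangle[of c p z] by (simp add: dist_norm norm_minus_commute)
qed

text \<open>At p, the cone about n of half-angle arccos \<epsilon> and radius r lies in D and the opposite one outside,
  so \<epsilon> measures the deviation from half planes.\<close>

definition has_cones :: "complex set \<Rightarrow> real \<Rightarrow> real \<Rightarrow> complex \<Rightarrow> complex \<Rightarrow> bool"
  where "has_cones D \<epsilon> r p n \<longleftrightarrow> cmod n = 1 \<and>
    (\<forall>v. cmod v < r \<longrightarrow> \<epsilon> * cmod v < v \<bullet> n \<longrightarrow> p + v \<in> D \<and> p - v \<notin> D)"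

lemma has_cones_mono:
  assumes "has_cones D \<epsilon> r p n" "\<epsilon> \<le> \<epsilon>'" "r' \<le> r"
  shows "has_cones D \<epsilon>' r' p n"
proof -
  have "\<epsilon> * cmod v < v \<bullet> n" if "\<epsilon>' * cmod v < v \<bullet> n" for v
    using that mult_right_mono[OF assms(2), of "cmod v"] by simp
  then show ?thesis using assms unfolding has_cones_def by auto
qed

lemma cone_contains_ball:
  fixes n v :: complex
  assumes n: "cmod n = 1" and \<epsilon>: "0 \<le> \<epsilon>" "\<epsilon> < 1" and l: "0 < l"
    and v: "cmod (v - of_real l * n) < l * sqrt (1 - \<epsilon>\<^sup>2)"
  shows "\<epsilon> * cmod v < v \<bullet> n" and "cmod v < 2 * l"
proof -
  have e1: "0 \<le> 1 - \<epsilon>\<^sup>2" using \<epsilon> by (simp add: abs_square_le_1)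
  have "(cmod (v - of_real l * n))\<^sup>2 < (l * sqrt (1 - \<epsilon>\<^sup>2))\<^sup>2" using v by (intro power_strict_mono) auto
  also have "\<dots> = l\<^sup>2 - l\<^sup>2 * \<epsilon>\<^sup>2" using e1 by (simp add: power_mult_distrib algebra_simps)
  also have "(cmod (v - of_real l * n))\<^sup>2 = (cmod v)\<^sup>2 - 2 * l * (v \<bullet> n) + l\<^sup>2"
  proof -
    have "(cmod (v - l *\<^sub>R n))\<^sup>2 = (v - l *\<^sub>R n) \<bullet> (v - l *\<^sub>R n)" by (rule power2_norm_eq_inner)
    also have "\<dots> = v \<bullet> v - 2 * l * (v \<bullet> n) + l\<^sup>2 * (n \<bullet> n)"
      by (simp add: inner_diff_left inner_diff_right inner_commute power2_eq_square algebra_simps)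
    finally show ?thesis using n by (simp add: power2_norm_eq_inner[symmetric] scaleR_conv_of_real)
  qed
  finally have 1: "(cmod v)\<^sup>2 + l\<^sup>2 * \<epsilon>\<^sup>2 < 2 * l * (v \<bullet> n)" by simp
  have "2 * l * (\<epsilon> * cmod v) \<le> (cmod v)\<^sup>2 + l\<^sup>2 * \<epsilon>\<^sup>2"
    using zero_le_power2[of "cmod v - l * \<epsilon>"] by (simp add: power2_diff power_mult_distrib algebra_simps)
  with 1 have "2 * l * (\<epsilon> * cmod v) < 2 * l * (v \<bullet> n)" by simp
  then show "\<epsilon> * cmod v < v \<bullet> n" using l by simp
  have "cmod v \<le> cmod (v - of_real l * n) + cmod (of_real l * n)" using norm_triangle_ineq[of "v - of_real l * n" "of_real l * n"] by simp
  also have "\<dots> < l * sqrt (1 - \<epsilon>\<^sup>2) + l" using v l n by (simp add: norm_mult)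
  also have "\<dots> \<le> 2 * l" using l e1 by simp
  finally show "cmod v < 2 * l" .
qed

lemma has_cones_balls:
  assumes h: "has_cones D \<epsilon> r p n" and \<epsilon>: "0 \<le> \<epsilon>" "\<epsilon> < 1" and l: "0 < l" "2 * l \<le> r"
  shows "ball (p + of_real l * n) (l * sqrt (1 - \<epsilon>\<^sup>2)) \<subseteq> D"
    and "ball (p - of_real l * n) (l * sqrt (1 - \<epsilon>\<^sup>2)) \<inter> D = {}"
proof -
  have n: "cmod n = 1" using h by (simp add: has_cones_def)
  have *: "p + v \<in> D \<and> p - v \<notin> D" if "cmod (v - of_real l * n) < l * sqrt (1 - \<epsilon>\<^sup>2)" for v
    using cone_contains_ball[OF n \<epsilon> l(1) that] h l(2) by (auto simp: has_cones_def)
  show "ball (p + of_real l * n) (l * sqrt (1 - \<epsilon>\<^sup>2)) \<subseteq> D"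
  proof
    fix y assume "y \<in> ball (p + of_real l * n) (l * sqrt (1 - \<epsilon>\<^sup>2))"
    then have "cmod ((y - p) - of_real l * n) < l * sqrt (1 - \<epsilon>\<^sup>2)"
      by (simp add: dist_norm norm_minus_commute algebra_simps)
    from *[OF this] show "y \<in> D" by simp
  qed
  show "ball (p - of_real l * n) (l * sqrt (1 - \<epsilon>\<^sup>2)) \<inter> D = {}"
  proof (intro equals0I, clarify)
    fix y assume y: "y \<in> ball (p - of_real l * n) (l * sqrt (1 - \<epsilon>\<^sup>2))" "y \<in> D"
    then have "cmod ((p - y) - of_real l * n) < l * sqrt (1 - \<epsilon>\<^sup>2)"
      by (simp add: dist_norm algebra_simps)
    from *[OF this] y(2) show False by simp
  qed
qed

lemma one_minus_sq_le_sqrt: "0 \<le> \<epsilon> \<Longrightarrow> \<epsilon> \<le> 1 \<Longrightarrow> 1 - \<epsilon>\<^sup>2 \<le> sqrt (1 - \<epsilon>\<^sup>2)"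
proof -
  assume "0 \<le> \<epsilon>" "\<epsilon> \<le> (1::real)"
  then have "0 \<le> 1 - \<epsilon>\<^sup>2" "1 - \<epsilon>\<^sup>2 \<le> 1" by (auto simp: abs_square_le_1)
  then show ?thesis by (intro real_le_rsqrt) (simp add: power2_eq_square mult_left_le)
qed

text \<open>The direction from the nearest point p to z is almost the axis n: the ball of radius
  \<open>d sqrt (1 - \<epsilon>\<^sup>2)\<close> about \<open>p - d n\<close> misses D, so z has distance at least d from it, whereas \<open>|z - p| = d\<close>.
  The axis can therefore be turned to point at z, at the cost of a slightly narrower cone.\<close>

lemma has_cones_axis:
  assumes D: "open D" and z: "z \<in> D" and p: "p \<in> frontier D" "dist z p = bdry_dist D z" and d: "0 < bdry_dist D z"
    and h: "has_cones D \<epsilon> r p n" and \<epsilon>: "0 < \<epsilon>" "\<epsilon> < 1" and r: "2 * bdry_dist D z \<le> r"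
  shows "has_cones D (3 * \<epsilon>) r p ((z - p) / of_real (bdry_dist D z))"
proof -
  define d where "d = bdry_dist D z"
  define m where "m = (z - p) / of_real d"
  have d0: "0 < d" using d by (simp add: d_def)
  have n: "cmod n = 1" using h by (simp add: has_cones_def)
  have m: "cmod m = 1" using p(2) d0 by (simp add: m_def norm_divide dist_norm d_def)
  define \<sigma> where "\<sigma> = sqrt (1 - \<epsilon>\<^sup>2)"
  have \<sigma>: "1 - \<epsilon>\<^sup>2 \<le> \<sigma>" "0 < \<sigma>" "\<sigma>\<^sup>2 = 1 - \<epsilon>\<^sup>2"
    using \<epsilon> one_minus_sq_le_sqrt[of \<epsilon>] by (auto simp: \<sigma>_def abs_square_less_1 abs_square_le_1)
  have "d \<le> cmod (z - (p - of_real d * n)) - d * \<sigma>"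
    using bdry_dist_le_exterior_ball[OF D has_cones_balls(2)[OF h _ _ d0] _ z] \<epsilon> r d0 \<sigma>
    by (simp add: d_def \<sigma>_def)
  also have "z - (p - of_real d * n) = of_real d * (m + n)" using d0 by (simp add: m_def field_simps)
  also have "cmod (of_real d * (m + n)) = d * cmod (m + n)" using d0 by (simp add: norm_mult)
  finally have "d * (1 + \<sigma>) \<le> d * cmod (m + n)" by (simp add: algebra_simps)
  then have "1 + \<sigma> \<le> cmod (m + n)" using d0 by simp
  then have "(1 + \<sigma>)\<^sup>2 \<le> (cmod (m + n))\<^sup>2" using \<sigma> by (intro power_mono) auto
  also have "(cmod (m + n))\<^sup>2 = 2 + 2 * (m \<bullet> n)"
    using m n power2_norm_eq_inner[of "m + n"] power2_norm_eq_inner[of m] power2_norm_eq_inner[of n]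
    by (simp add: inner_add_left inner_add_right inner_commute)
  also have "(1 + \<sigma>)\<^sup>2 = 1 + 2 * \<sigma> + \<sigma>\<^sup>2" by (simp add: power2_eq_square algebra_simps)
  finally have mn: "1 - 3 / 2 * \<epsilon>\<^sup>2 \<le> m \<bullet> n" using \<sigma> by simp
  have "(cmod (m - n))\<^sup>2 = 2 - 2 * (m \<bullet> n)"
    using m n power2_norm_eq_inner[of "m - n"] power2_norm_eq_inner[of m] power2_norm_eq_inner[of n]
    by (simp add: inner_diff_left inner_diff_right inner_commute)
  also have "\<dots> \<le> 4 * \<epsilon>\<^sup>2" using mn zero_le_power2[of \<epsilon>] by linarith
  also have "\<dots> = (2 * \<epsilon>)\<^sup>2" by (simp add: power_mult_distrib)
  finally have mn2: "cmod (m - n) \<le> 2 * \<epsilon>" by (rule power2_le_imp_le) (use \<epsilon> in simp)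
  have "\<epsilon> * cmod v < v \<bullet> n" if "3 * \<epsilon> * cmod v < v \<bullet> m" for v
  proof -
    have "v \<bullet> m - v \<bullet> n \<le> cmod v * cmod (m - n)"
      by (metis inner_diff_right norm_cauchy_schwarz)
    also have "\<dots> \<le> cmod v * (2 * \<epsilon>)" using mn2 by (intro mult_left_mono) auto
    finally show ?thesis using that by (simp add: algebra_simps)
  qed
  then have "has_cones D (3 * \<epsilon>) r p m" using h m by (auto simp: has_cones_def)
  then show ?thesis by (simp add: m_def d_def)
qed

text \<open>The two discs of radius \<open>\<rho>\<close>, about \<open>d / \<epsilon>\<close>, lie in the cones at p. By the parallelogram law, the distances
  of w to their centres add up to at most \<open>2 \<rho>\<close> plus a small multiple of d, while d(w) lies between the
  distances of w from the two circles. Hence both of these are close to d(w), and the power of w with respect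
  to either circle is close to \<open>2 \<rho> d(w)\<close>.\<close>

lemma comparison_balls:
  fixes D z p \<epsilon> r C
  defines "d \<equiv> bdry_dist D z"
  defines "m \<equiv> (z - p) / of_real d" and "L \<equiv> d / \<epsilon>"
  defines "\<rho> \<equiv> L * sqrt (1 - \<epsilon>\<^sup>2)" and "c \<equiv> p + of_real L * m" and "c' \<equiv> p - of_real L * m"
    and "\<eta> \<equiv> \<epsilon> * (2 + (C + 1)\<^sup>2) * (C + 1)"
  assumes D: "open D" and z: "z \<in> D" and p: "p \<in> frontier D" "dist z p = d"
    and h: "has_cones D \<epsilon> r p m" and \<epsilon>: "0 < \<epsilon>" "\<epsilon> \<le> 1 / 2" and r: "2 * d \<le> \<epsilon> * r" and d0: "0 < d"
    and C: "1 \<le> C" "\<eta> \<le> 1 / 2"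
  shows "0 < \<rho>" and "ball c \<rho> \<subseteq> D" and "ball c' \<rho> \<inter> D = {}" and "ball c \<rho> \<subseteq> ball z (2 * L)"
    and "w \<in> D \<Longrightarrow> cmod (w - z) \<le> C * d \<Longrightarrow> d \<le> (C + 1) * bdry_dist D w \<Longrightarrow> w \<in> ball c \<rho>"
    and "w \<in> D \<Longrightarrow> cmod (w - z) \<le> C * d \<Longrightarrow> d \<le> (C + 1) * bdry_dist D w \<Longrightarrow>
      2 * \<rho> * bdry_dist D w * (1 - \<eta>)\<^sup>2 \<le> \<rho>\<^sup>2 - (cmod (w - c))\<^sup>2"
    and "w \<in> D \<Longrightarrow> cmod (w - z) \<le> C * d \<Longrightarrow> d \<le> (C + 1) * bdry_dist D w \<Longrightarrow>
      (cmod (w - c'))\<^sup>2 - \<rho>\<^sup>2 \<le> 2 * \<rho> * bdry_dist D w * (1 + 2 * \<eta>)\<^sup>2"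
proof -
  have l0: "0 < L" using d0 \<epsilon> by (simp add: L_def)
  have lr: "2 * L \<le> r" using r \<epsilon> by (simp add: L_def field_simps)
  have dl: "d = L * \<epsilon>" using \<epsilon> by (simp add: L_def)
  have m: "cmod m = 1" using h by (simp add: has_cones_def)
  define \<sigma> where "\<sigma> = sqrt (1 - \<epsilon>\<^sup>2)"
  have e1: "\<epsilon>\<^sup>2 \<le> \<epsilon> * (1 / 2)" unfolding power2_eq_square using \<epsilon> by (intro mult_left_mono) auto
  then have e2: "\<epsilon>\<^sup>2 \<le> 1 / 4" using \<epsilon> by simp
  have \<sigma>: "1 - \<epsilon>\<^sup>2 \<le> \<sigma>" "1 / 2 \<le> \<sigma>" "\<sigma> \<le> 1"
    using one_minus_sq_le_sqrt[of \<epsilon>] \<epsilon> e2 by (auto simp: \<sigma>_def)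
  have \<rho>: "\<rho> = L * \<sigma>" by (simp add: \<rho>_def \<sigma>_def)
  show \<rho>0: "0 < \<rho>" using l0 \<sigma> by (simp add: \<rho>)
  show B: "ball c \<rho> \<subseteq> D" and E: "ball c' \<rho> \<inter> D = {}"
    using has_cones_balls[OF h _ _ l0 lr] \<epsilon> by (auto simp: c_def c'_def \<rho>_def)
  have zp: "z = p + of_real d * m" using d0 by (simp add: m_def)
  show "ball c \<rho> \<subseteq> ball z (2 * L)"
  proof
    fix y assume "y \<in> ball c \<rho>"
    moreover have "cmod (z - c) = L - d"
    proof -
      have "z - c = - of_real (L - d) * m" by (simp add: zp c_def algebra_simps)
      moreover have "d \<le> L" using l0 \<epsilon> by (simp add: dl)
      ultimately show ?thesis using m by (simp add: norm_mult flip: of_real_diff)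
    qed
    moreover have "\<rho> \<le> L" using l0 \<sigma> by (simp add: \<rho>)
    ultimately show "y \<in> ball z (2 * L)"
      using dist_triangle[of z y c] d0 by (simp add: dist_norm norm_minus_commute)
  qed
  have main: "w \<in> ball c \<rho> \<and> 2 * \<rho> * bdry_dist D w * (1 - \<eta>)\<^sup>2 \<le> \<rho>\<^sup>2 - (cmod (w - c))\<^sup>2
      \<and> (cmod (w - c'))\<^sup>2 - \<rho>\<^sup>2 \<le> 2 * \<rho> * bdry_dist D w * (1 + 2 * \<eta>)\<^sup>2"
    if w: "w \<in> D" "cmod (w - z) \<le> C * d" "d \<le> (C + 1) * bdry_dist D w"
  proof -
    define e where "e = bdry_dist D w"
    define x where "x = w - p"
    define E where "E = 2 + (C + 1)\<^sup>2"
    have E0: "E > 2" using C by (simp add: E_def)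
    have dx: "cmod x \<le> (C + 1) * d"
    proof -
      have "cmod x \<le> cmod (w - z) + cmod (z - p)" using norm_triangle_ineq[of "w - z" "z - p"] by (simp add: x_def)
      then show ?thesis using w(2) p(2) by (simp add: dist_norm algebra_simps)
    qed
    have e0: "0 < e" using w(3) d0 C bdry_dist_nonneg[of D w] by (auto simp: e_def less_le)
    have A: "e \<le> cmod (w - c') - \<rho>"
      unfolding e_def by (rule bdry_dist_le_exterior_ball[OF D E \<rho>0 w(1)])
    have sum: "cmod (w - c') + cmod (w - c) - 2 * \<rho> \<le> \<epsilon> * E * d"
    proof -
      define y where "y = of_real L * m"
      have y: "cmod y = L" using l0 m by (simp add: y_def norm_mult)
      \<comment> \<open>the parallelogram law\<close>
      have "(cmod (x + y) + cmod (x - y))\<^sup>2 \<le> 2 * ((cmod (x + y))\<^sup>2 + (cmod (x - y))\<^sup>2)"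
        using zero_le_power2[of "cmod (x + y) - cmod (x - y)"] by (simp add: power2_eq_square algebra_simps)
      also have "(cmod (x + y))\<^sup>2 + (cmod (x - y))\<^sup>2 = 2 * ((cmod x)\<^sup>2 + L\<^sup>2)"
        using power2_norm_eq_inner[of "x + y"] power2_norm_eq_inner[of "x - y"] power2_norm_eq_inner[of x] power2_norm_eq_inner[of y] y
        by (simp add: inner_add_left inner_add_right inner_diff_left inner_diff_right inner_commute)
      also have "2 * (2 * ((cmod x)\<^sup>2 + L\<^sup>2)) \<le> (2 * L + (cmod x)\<^sup>2 / L)\<^sup>2"
      proof -
        define q where "q = (cmod x)\<^sup>2 / L"
        have "L * q = (cmod x)\<^sup>2" using l0 by (simp add: q_def)
        then have "(2 * L + q)\<^sup>2 = 4 * L\<^sup>2 + 4 * (cmod x)\<^sup>2 + q\<^sup>2"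
          by (simp add: power2_sum power_mult_distrib mult.assoc)
        then show ?thesis by (simp add: q_def)
      qed
      finally have "cmod (x + y) + cmod (x - y) \<le> 2 * L + (cmod x)\<^sup>2 / L"
        by (rule power2_le_imp_le) (use l0 in simp)
      moreover have "cmod (w - c') = cmod (x + y)" "cmod (w - c) = cmod (x - y)" by (auto simp: x_def y_def c_def c'_def intro!: arg_cong[where f = cmod])
      moreover have "(cmod x)\<^sup>2 / L \<le> ((C + 1) * d)\<^sup>2 / L"
        using dx l0 by (intro divide_right_mono power_mono) auto
      moreover have "((C + 1) * d)\<^sup>2 / L = \<epsilon> * (C + 1)\<^sup>2 * d"
        using l0 by (simp add: dl power2_eq_square field_simps)
      moreover have "2 * L - 2 * \<rho> \<le> 2 * \<epsilon> * d"
      proof -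
        have "L - \<rho> = L * (1 - \<sigma>)" by (simp add: \<rho> algebra_simps)
        also have "\<dots> \<le> L * \<epsilon>\<^sup>2" using \<sigma> l0 by (intro mult_left_mono) auto
        also have "\<dots> = \<epsilon> * d" by (simp add: dl power2_eq_square)
        finally show ?thesis by simp
      qed
      moreover have "\<epsilon> * E * d = 2 * \<epsilon> * d + \<epsilon> * (C + 1)\<^sup>2 * d" by (simp add: E_def algebra_simps)
      ultimately show ?thesis by linarith
    qed
    have "\<epsilon> * E * d \<le> \<epsilon> * E * ((C + 1) * e)"
      using w(3) \<epsilon> E0 by (intro mult_left_mono) (auto simp: e_def)
    also have "\<dots> = \<eta> * e" by (simp add: \<eta>_def E_def)
    finally have sum2: "cmod (w - c') + cmod (w - c) - 2 * \<rho> \<le> \<eta> * e" using sum by simp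
    have \<eta>0: "0 < \<eta>" using \<epsilon> E0 C by (simp add: \<eta>_def E_def[symmetric])
    have lo: "e * (1 - \<eta>) \<le> \<rho> - cmod (w - c)" using sum2 A by (simp add: algebra_simps)
    have "e * (1 - \<eta>) > 0" using e0 C(2) by simp
    then have in_ball: "w \<in> ball c \<rho>" using lo by (simp add: dist_norm norm_minus_commute)
    have hi0: "\<rho> - cmod (w - c) \<le> e"
      unfolding e_def by (rule interior_ball_le_bdry_dist[OF D B]) (use p in blast)
    have hi: "cmod (w - c') - \<rho> \<le> e * (1 + \<eta>)" using sum2 hi0 by (simp add: algebra_simps)
    have e\<rho>: "e \<le> 2 * \<rho> * \<eta>"
    proof -
      have "e \<le> d + cmod (w - z)"
        using bdry_dist_triangle[of D w z] by (simp add: e_def d_def dist_norm)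
      also have "\<dots> \<le> (C + 1) * d" using w(2) by (simp add: algebra_simps)
      also have "\<dots> = (\<epsilon> * (C + 1)) * L" by (simp add: dl)
      also have "\<dots> \<le> \<eta> * L"
      proof (intro mult_right_mono)
        have "(\<epsilon> * (C + 1)) * 1 \<le> (\<epsilon> * (C + 1)) * E" using \<epsilon> C E0 by (intro mult_left_mono) auto
        then show "\<epsilon> * (C + 1) \<le> \<eta>" by (simp add: \<eta>_def E_def algebra_simps)
      qed (use l0 in auto)
      also have "\<dots> \<le> \<eta> * (2 * \<rho>)" using \<sigma> l0 \<eta>0 by (intro mult_left_mono) (auto simp: \<rho>)
      finally show ?thesis by (simp add: mult_ac)
    qed
    have "\<rho>\<^sup>2 - (cmod (w - c))\<^sup>2 = (\<rho> - cmod (w - c)) * (\<rho> + cmod (w - c))"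
      by (simp add: power2_eq_square algebra_simps)
    also have "\<dots> \<ge> (e * (1 - \<eta>)) * (2 * \<rho> * (1 - \<eta>))"
    proof (rule mult_mono)
      show "2 * \<rho> * (1 - \<eta>) \<le> \<rho> + cmod (w - c)" using hi0 e\<rho> by (simp add: algebra_simps)
    qed (use lo e0 C(2) \<rho>0 in_ball in \<open>auto simp: dist_norm norm_minus_commute\<close>)
    finally have 1: "2 * \<rho> * e * (1 - \<eta>)\<^sup>2 \<le> \<rho>\<^sup>2 - (cmod (w - c))\<^sup>2"
      by (simp add: power2_eq_square mult_ac)
    have "(cmod (w - c'))\<^sup>2 - \<rho>\<^sup>2 = (cmod (w - c') - \<rho>) * (cmod (w - c') + \<rho>)"
      by (simp add: power2_eq_square algebra_simps)
    also have "\<dots> \<le> (e * (1 + 2 * \<eta>)) * (2 * \<rho> * (1 + 2 * \<eta>))"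
    proof (rule mult_mono)
      have "e * (1 + \<eta>) \<le> e * 2" using e0 C(2) by (intro mult_left_mono) auto
      then show "cmod (w - c') + \<rho> \<le> 2 * \<rho> * (1 + 2 * \<eta>)" using hi e\<rho> by (simp add: algebra_simps)
      have "e * (1 + \<eta>) \<le> e * (1 + 2 * \<eta>)" using e0 \<eta>0 by (intro mult_left_mono) auto
      then show "cmod (w - c') - \<rho> \<le> e * (1 + 2 * \<eta>)" using hi by linarith
    qed (use e0 \<eta>0 \<rho>0 in auto)
    finally have 2: "(cmod (w - c'))\<^sup>2 - \<rho>\<^sup>2 \<le> 2 * \<rho> * e * (1 + 2 * \<eta>)\<^sup>2"
      by (simp add: power2_eq_square mult_ac)
    show ?thesis using in_ball 1 2 by (simp add: e_def)
  qed
  show "w \<in> D \<Longrightarrow> cmod (w - z) \<le> C * d \<Longrightarrow> d \<le> (C + 1) * bdry_dist D w \<Longrightarrow> w \<in> ball c \<rho>"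
    and "w \<in> D \<Longrightarrow> cmod (w - z) \<le> C * d \<Longrightarrow> d \<le> (C + 1) * bdry_dist D w \<Longrightarrow>
      2 * \<rho> * bdry_dist D w * (1 - \<eta>)\<^sup>2 \<le> \<rho>\<^sup>2 - (cmod (w - c))\<^sup>2"
    and "w \<in> D \<Longrightarrow> cmod (w - z) \<le> C * d \<Longrightarrow> d \<le> (C + 1) * bdry_dist D w \<Longrightarrow>
      (cmod (w - c'))\<^sup>2 - \<rho>\<^sup>2 \<le> 2 * \<rho> * bdry_dist D w * (1 + 2 * \<eta>)\<^sup>2"
    using main by blast+
qed

text \<open>An instance of the concavity of arsinh on the nonnegative axis.\<close>

lemma arsinh_mult_le:
  assumes "1 \<le> k" "0 \<le> (x::real)"
  shows "arsinh (k * x) \<le> k * arsinh x"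
proof -
  have "(\<lambda>x. k * arsinh x - arsinh (k * x)) 0 \<le> (\<lambda>x. k * arsinh x - arsinh (k * x)) x"
  proof (rule DERIV_nonneg_imp_nondecreasing[OF assms(2)])
    fix t :: real assume t: "0 \<le> t" "t \<le> x"
    have "((\<lambda>x. k * arsinh x - arsinh (k * x)) has_real_derivative k * (1 / sqrt (t\<^sup>2 + 1)) - 1 / sqrt ((k * t)\<^sup>2 + 1) * k) (at t)"
      by (intro DERIV_diff DERIV_cmult DERIV_chain2[of arsinh] arsinh_real_has_field_derivative)
         (auto intro!: derivative_eq_intros)
    moreover have "1 / sqrt ((k * t)\<^sup>2 + 1) \<le> 1 / sqrt (t\<^sup>2 + 1)"
    proof -
      have "1 * t\<^sup>2 \<le> k\<^sup>2 * t\<^sup>2" using assms(1) by (intro mult_right_mono one_le_power) auto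
      then show ?thesis by (intro divide_left_mono) (auto simp: power_mult_distrib add_nonneg_pos)
    qed
    then have "0 \<le> k * (1 / sqrt (t\<^sup>2 + 1)) - 1 / sqrt ((k * t)\<^sup>2 + 1) * k"
      using mult_left_mono[of "1 / sqrt ((k * t)\<^sup>2 + 1)" "1 / sqrt (t\<^sup>2 + 1)" k] assms(1) by (simp add: mult.commute)
    ultimately show "\<exists>y. ((\<lambda>x. k * arsinh x - arsinh (k * x)) has_real_derivative y) (at t) \<and> 0 \<le> y" by blast
  qed
  then show ?thesis by simp
qed

lemma arsinh_div_ge:
  assumes "1 \<le> k" "0 \<le> (x::real)"
  shows "arsinh x / k \<le> arsinh (x / k)"
  using arsinh_mult_le[of k "x / k"] assms by (simp add: field_simps)

lemma arsinh_mono: "x \<le> y \<Longrightarrow> arsinh x \<le> arsinh (y::real)"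
  using arsinh_less_iff_real[of y x] by linarith

section \<open>Pinching between a disc and the exterior of a disc\<close>

lemma s_fun_nonneg: "0 \<le> s_fun D z w"
  using arsinh_mono[of 0 "cmod (z - w) / (2 * sqrt (bdry_dist D z * bdry_dist D w))"]
  by (simp add: s_fun_def bdry_dist_nonneg)

lemma s_fun_commute: "s_fun D z w = s_fun D w z"
  by (simp add: s_fun_def norm_minus_commute mult.commute)

lemma s_fun_pos:
  assumes "0 < bdry_dist D z" "0 < bdry_dist D w" "z \<noteq> w"
  shows "0 < s_fun D z w"
  using assms by (simp add: s_fun_def)

lemma dist_le_of_s_fun_le:
  assumes d: "0 < bdry_dist D z" "0 < bdry_dist D w" and s: "s_fun D z w \<le> N"
  shows "cmod (w - z) \<le> (8 * (sinh N)\<^sup>2 + 1) * bdry_dist D z"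
proof (rule ccontr)
  define L X a b C where "L = cmod (w - z)" and "X = sinh N" and "a = bdry_dist D z" and "b = bdry_dist D w"
    and "C = 8 * X\<^sup>2 + 1"
  assume "\<not> cmod (w - z) \<le> (8 * (sinh N)\<^sup>2 + 1) * bdry_dist D z"
  then have con: "C * a < L" by (simp add: L_def X_def a_def C_def)
  have ab: "0 < a" "0 < b" using d by (auto simp: a_def b_def)
  have C: "1 \<le> C" by (simp add: C_def)
  have L: "0 < L" using con C ab by (meson less_trans mult_pos_pos zero_less_one order.strict_trans2)
  have "L / (2 * sqrt (a * b)) = sinh (s_fun D z w)" by (simp add: s_fun_def L_def a_def b_def norm_minus_commute)
  also have "\<dots> \<le> X" using s by (simp add: X_def)
  finally have "L \<le> X * (2 * sqrt (a * b))" using ab by (simp add: field_simps)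
  then have "L\<^sup>2 \<le> (X * (2 * sqrt (a * b)))\<^sup>2" using L by (intro power_mono) auto
  also have "\<dots> = 4 * X\<^sup>2 * (a * b)" using ab by (simp add: power_mult_distrib)
  also have "\<dots> \<le> 4 * X\<^sup>2 * (a * (2 * L))"
  proof (intro mult_left_mono)
    have "b \<le> a + L" using bdry_dist_triangle[of D w z] by (simp add: a_def b_def L_def dist_norm)
    moreover have "1 * a \<le> C * a" using C ab by (intro mult_right_mono) auto
    ultimately show "b \<le> 2 * L" using con by linarith
  qed (use ab in auto)
  finally have "L * L \<le> (8 * X\<^sup>2 * a) * L" by (simp add: power2_eq_square mult_ac)
  then have "L \<le> 8 * X\<^sup>2 * a" using L by simp
  also have "\<dots> \<le> C * a" using ab by (simp add: C_def algebra_simps)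
  finally show False using con by simp
qed

text \<open>D lies between a disc and the exterior of a disc that are indistinguishable from D as far as
  distances from z to w and metrics at z are concerned. Stating distances and metrics together, for the same
  pair of discs, serves all three distances of the theorem.\<close>

definition pinched :: "complex set \<Rightarrow> real \<Rightarrow> real \<Rightarrow> complex \<Rightarrow> complex \<Rightarrow> bool"
  where "pinched D \<eta> R z w \<longleftrightarrow> (\<exists>c c' \<rho>. 0 < \<rho> \<and> ball c \<rho> \<subseteq> D \<and> ball c' \<rho> \<inter> D = {} \<and>
     ball c \<rho> \<subseteq> ball z R \<and> z \<in> ball c \<rho> \<and> w \<in> ball c \<rho> \<and>
     disc_dist c \<rho> z w \<le> (1 + \<eta>) * s_fun D z w \<and> (1 - \<eta>) * s_fun D z w \<le> exterior_dist c' \<rho> z w \<and>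
     \<rho> / (\<rho>\<^sup>2 - (cmod (z - c))\<^sup>2) \<le> (1 + \<eta>) / (2 * bdry_dist D z) \<and>
     (1 - \<eta>) / (2 * bdry_dist D z) \<le> \<rho> / ((cmod (z - c'))\<^sup>2 - \<rho>\<^sup>2))"

text \<open>A bound on s bounds \<open>|z - w|\<close> by multiples of d(z) and of d(w). So the comparison discs apply with a
  fixed constant C, and \<open>\<epsilon>\<close> can be chosen in dependence on C.\<close>

lemma pinched_near_boundary:
  assumes \<eta>: "0 < \<eta>" "\<eta> \<le> 1"
  shows "\<exists>\<epsilon>>0. \<forall>r>0. \<exists>\<delta>>0. \<forall>D z w p n. open D \<longrightarrow> z \<in> D \<longrightarrow> w \<in> D \<longrightarrow> p \<in> frontier D \<longrightarrow>
      dist z p = bdry_dist D z \<longrightarrow> has_cones D \<epsilon> r p n \<longrightarrow> bdry_dist D z < \<delta> \<longrightarrow> s_fun D z w \<le> N \<longrightarrow>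
      pinched D \<eta> r z w"
proof -
  define X C E \<kappa> where "X = sinh N" and "C = 8 * X\<^sup>2 + 1" and "E = (2 + (C + 1)\<^sup>2) * (C + 1)" and "\<kappa> = \<eta> / 8"
  have C: "1 \<le> C" by (simp add: C_def)
  have E: "0 < E" using C by (simp add: E_def add_pos_nonneg)
  define \<epsilon>' where "\<epsilon>' = min (1 / 2) (\<kappa> / E)"
  have \<epsilon>': "0 < \<epsilon>'" "\<epsilon>' \<le> 1 / 2" "\<epsilon>' * E \<le> \<kappa>"
    using E \<eta> by (auto simp: \<epsilon>'_def \<kappa>_def min_mult_distrib_right)
  define k where "k = (1 - \<epsilon>' * E)\<^sup>2"
  define k' where "k' = (1 + 2 * (\<epsilon>' * E))\<^sup>2"
  have kE: "0 \<le> \<epsilon>' * E" "\<epsilon>' * E \<le> 1 / 2" using \<epsilon>' E \<eta> by (auto simp: \<kappa>_def)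
  have k: "0 < k" "1 / k \<le> 1 + \<eta>" "1 \<le> 1 / k"
  proof -
    have "(1 - \<kappa>)\<^sup>2 \<le> k" unfolding k_def using \<epsilon>' kE \<eta> by (intro power_mono) (auto simp: \<kappa>_def)
    moreover have "(1 - \<kappa>)\<^sup>2 = 1 - \<eta> / 4 + \<kappa>\<^sup>2" by (simp add: \<kappa>_def power2_eq_square field_simps)
    ultimately have k1: "1 - \<eta> / 4 \<le> k" using zero_le_power2[of \<kappa>] by linarith
    then show k0: "0 < k" using \<eta> by linarith
    have "1 \<le> (1 + \<eta>) * (1 - \<eta> / 4)" using \<eta> by (simp add: algebra_simps)
    also have "\<dots> \<le> (1 + \<eta>) * k" using k1 \<eta> by (intro mult_left_mono) auto
    finally show "1 / k \<le> 1 + \<eta>" using k0 by (simp add: field_simps)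
    have "k \<le> 1\<^sup>2" unfolding k_def using kE by (intro power_mono) auto
    then show "1 \<le> 1 / k" using k0 by simp
  qed
  have k': "1 \<le> k'" "1 - \<eta> \<le> 1 / k'"
  proof -
    show k0: "1 \<le> k'" unfolding k'_def using kE by (intro one_le_power) auto
    have "k' \<le> (1 + 2 * \<kappa>)\<^sup>2" unfolding k'_def using kE \<epsilon>' by (intro power_mono) auto
    also have "\<dots> = 1 + \<eta> / 2 + \<eta> * \<eta> / 16" by (simp add: \<kappa>_def power2_eq_square field_simps)
    also have "\<dots> \<le> 1 + \<eta>"
    proof -
      have "\<eta> * \<eta> \<le> \<eta>" using mult_left_mono[OF \<eta>(2), of \<eta>] \<eta> by simp
      then show ?thesis using \<eta> by linarith
    qed
    finally have "(1 - \<eta>) * k' \<le> (1 - \<eta>) * (1 + \<eta>)" using \<eta> by (intro mult_left_mono) auto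
    also have "\<dots> \<le> 1" by (simp add: algebra_simps)
    finally show "1 - \<eta> \<le> 1 / k'" using k0 by (simp add: field_simps)
  qed
  show ?thesis
  proof (rule exI[of _ "\<epsilon>' / 3"], intro conjI allI impI)
    fix r :: real assume r: "0 < r"
    show "\<exists>\<delta>>0. \<forall>D z w p n. open D \<longrightarrow> z \<in> D \<longrightarrow> w \<in> D \<longrightarrow> p \<in> frontier D \<longrightarrow>
      dist z p = bdry_dist D z \<longrightarrow> has_cones D (\<epsilon>' / 3) r p n \<longrightarrow> bdry_dist D z < \<delta> \<longrightarrow> s_fun D z w \<le> N \<longrightarrow>
      pinched D \<eta> r z w"
    proof (rule exI[of _ "\<epsilon>' * r / 2"], intro conjI allI impI)
      show "0 < \<epsilon>' * r / 2" using r \<epsilon>' by simp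
      fix D z w p n
      assume D: "open D" and z: "z \<in> D" and w: "w \<in> D" and p: "p \<in> frontier D" "dist z p = bdry_dist D z"
        and h: "has_cones D (\<epsilon>' / 3) r p n" and small: "bdry_dist D z < \<epsilon>' * r / 2" and s: "s_fun D z w \<le> N"
      define d e where "d = bdry_dist D z" and "e = bdry_dist D w"
      have fr: "frontier D \<noteq> {}" using p by auto
      have d0: "0 < d" and e0: "0 < e" using bdry_dist_pos[OF D _ fr] z w by (auto simp: d_def e_def)
      have "\<epsilon>' * r \<le> 1 / 2 * r" using \<epsilon>' r by (intro mult_right_mono) auto
      then have dr: "2 * d \<le> r" "2 * d \<le> \<epsilon>' * r" using small r unfolding d_def by linarith+
      define m where "m = (z - p) / of_real d"
      have hm: "has_cones D \<epsilon>' r p m"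
        using has_cones_axis[OF D z p _ h] d0 dr \<epsilon>' by (simp add: d_def m_def)
      have Lz: "cmod (w - z) \<le> C * d"
        using dist_le_of_s_fun_le[of D z w N] d0 e0 s by (simp add: d_def e_def C_def X_def)
      have Lw: "cmod (w - z) \<le> C * e"
        using dist_le_of_s_fun_le[of D w z N] d0 e0 s
        by (simp add: d_def e_def C_def X_def s_fun_commute norm_minus_commute)
      have dw: "d \<le> (C + 1) * e"
        using Lw bdry_dist_triangle[of D z w] by (simp add: d_def e_def dist_norm norm_minus_commute algebra_simps)
      define l where "l = d / \<epsilon>'"
      define \<rho> c c' where "\<rho> = l * sqrt (1 - \<epsilon>'\<^sup>2)" and "c = p + of_real l * m" and "c' = p - of_real l * m"
      have EE: "\<epsilon>' * (2 + (C + 1)\<^sup>2) * (C + 1) = \<epsilon>' * E" by (simp add: E_def)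
      note cb = comparison_balls[OF D z p, of \<epsilon>' r C, folded d_def, folded m_def l_def, folded \<rho>_def c_def c'_def,
         unfolded EE, OF hm \<epsilon>'(1,2) dr(2) d0 C kE(2)]
      have zz: "cmod (z - z) \<le> C * d" "d \<le> (C + 1) * d"
        using C d0 by (auto simp: algebra_simps)
      note zc = cb(5-7)[of z, folded d_def k_def k'_def, OF z zz]
      note wc = cb(5-7)[of w, folded e_def k_def k'_def, OF w Lz dw]
      have \<rho>0: "0 < \<rho>" by (rule cb(1))
      let ?L = "cmod (z - w)"
      define x where "x = ?L / (2 * sqrt (d * e))"
      have sx: "s_fun D z w = arsinh x" by (simp add: s_fun_def x_def d_def e_def)
      have x0: "0 \<le> x" using d0 e0 by (simp add: x_def)
      have "0 < 2 * \<rho> * d * k" "0 < 2 * \<rho> * e * k" using \<rho>0 d0 e0 k(1) by auto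
      then have qz: "0 < \<rho>\<^sup>2 - (cmod (z - c))\<^sup>2" and qw: "0 < \<rho>\<^sup>2 - (cmod (w - c))\<^sup>2"
        using zc(2) wc(2) by linarith+
      have "disc_dist c \<rho> z w \<le> arsinh (1 / k * x)"
        unfolding disc_dist_def
      proof (rule arsinh_mono)
        have "(2 * \<rho> * d * k) * (2 * \<rho> * e * k) \<le> (\<rho>\<^sup>2 - (cmod (z - c))\<^sup>2) * (\<rho>\<^sup>2 - (cmod (w - c))\<^sup>2)"
          using \<rho>0 d0 e0 k(1) by (intro mult_mono zc(2) wc(2) less_imp_le[OF qz]) auto
        moreover have "(2 * \<rho> * d * k) * (2 * \<rho> * e * k) = (2 * \<rho> * k)\<^sup>2 * (d * e)" by (simp add: power2_eq_square)
        ultimately have "sqrt ((2 * \<rho> * k)\<^sup>2 * (d * e)) \<le> sqrt ((\<rho>\<^sup>2 - (cmod (z - c))\<^sup>2) * (\<rho>\<^sup>2 - (cmod (w - c))\<^sup>2))"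
          by (metis real_sqrt_le_mono)
        moreover have "sqrt ((2 * \<rho> * k)\<^sup>2 * (d * e)) = 2 * \<rho> * k * sqrt (d * e)"
          using \<rho>0 k(1) by (simp add: real_sqrt_mult)
        ultimately have "\<rho> * ?L / sqrt ((\<rho>\<^sup>2 - (cmod (z - c))\<^sup>2) * (\<rho>\<^sup>2 - (cmod (w - c))\<^sup>2)) \<le> \<rho> * ?L / (2 * \<rho> * k * sqrt (d * e))"
          using \<rho>0 k(1) d0 e0 mult_pos_pos[OF qz qw] by (intro divide_left_mono mult_pos_pos) auto
        also have "\<dots> = 1 / k * x" using \<rho>0 by (simp add: x_def)
        finally show "\<rho> * ?L / sqrt ((\<rho>\<^sup>2 - (cmod (z - c))\<^sup>2) * (\<rho>\<^sup>2 - (cmod (w - c))\<^sup>2)) \<le> 1 / k * x" .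
      qed
      also have "\<dots> \<le> 1 / k * arsinh x" by (rule arsinh_mult_le[OF k(3) x0])
      also have "\<dots> \<le> (1 + \<eta>) * arsinh x" using k(2) s_fun_nonneg[of D z w] by (intro mult_right_mono) (auto simp: sx)
      finally have 1: "disc_dist c \<rho> z w \<le> (1 + \<eta>) * s_fun D z w" by (simp add: sx)
      have pz: "0 < (cmod (z - c'))\<^sup>2 - \<rho>\<^sup>2" and pw: "0 < (cmod (w - c'))\<^sup>2 - \<rho>\<^sup>2"
        using power_strict_mono[OF exterior_ball_disjoint[OF D cb(3) \<rho>0], of _ 2] z w \<rho>0 by auto
      have "(1 - \<eta>) * arsinh x \<le> arsinh x / k'"
        using mult_right_mono[OF k'(2), of "arsinh x"] s_fun_nonneg[of D z w] by (simp add: sx)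
      also have "\<dots> \<le> arsinh (x / k')" by (rule arsinh_div_ge[OF k'(1) x0])
      also have "\<dots> \<le> exterior_dist c' \<rho> z w"
        unfolding exterior_dist_def
      proof (rule arsinh_mono)
        have "((cmod (z - c'))\<^sup>2 - \<rho>\<^sup>2) * ((cmod (w - c'))\<^sup>2 - \<rho>\<^sup>2) \<le> (2 * \<rho> * d * k') * (2 * \<rho> * e * k')"
          using \<rho>0 d0 e0 k'(1) by (intro mult_mono zc(3) wc(3) less_imp_le[OF pw]) auto
        moreover have "(2 * \<rho> * d * k') * (2 * \<rho> * e * k') = (2 * \<rho> * k')\<^sup>2 * (d * e)" by (simp add: power2_eq_square)
        ultimately have "sqrt (((cmod (z - c'))\<^sup>2 - \<rho>\<^sup>2) * ((cmod (w - c'))\<^sup>2 - \<rho>\<^sup>2)) \<le> sqrt ((2 * \<rho> * k')\<^sup>2 * (d * e))"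
          by (metis real_sqrt_le_mono)
        moreover have "sqrt ((2 * \<rho> * k')\<^sup>2 * (d * e)) = 2 * \<rho> * k' * sqrt (d * e)"
          using \<rho>0 k'(1) by (simp add: real_sqrt_mult)
        ultimately have "\<rho> * ?L / (2 * \<rho> * k' * sqrt (d * e)) \<le> \<rho> * ?L / sqrt (((cmod (z - c'))\<^sup>2 - \<rho>\<^sup>2) * ((cmod (w - c'))\<^sup>2 - \<rho>\<^sup>2))"
          using \<rho>0 k'(1) d0 e0 pz pw by (intro divide_left_mono) auto
        moreover have "\<rho> * ?L / (2 * \<rho> * k' * sqrt (d * e)) = x / k'" using \<rho>0 by (simp add: x_def)
        ultimately show "x / k' \<le> \<rho> * ?L / sqrt (((cmod (z - c'))\<^sup>2 - \<rho>\<^sup>2) * ((cmod (w - c'))\<^sup>2 - \<rho>\<^sup>2))" by simp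
      qed
      finally have 2: "(1 - \<eta>) * s_fun D z w \<le> exterior_dist c' \<rho> z w" by (simp add: sx)
      have "\<rho> / (\<rho>\<^sup>2 - (cmod (z - c))\<^sup>2) \<le> \<rho> / (2 * \<rho> * d * k)"
        using \<rho>0 d0 k(1) qz by (intro divide_left_mono zc(2) mult_pos_pos) auto
      also have "\<dots> = 1 / k / (2 * d)" using \<rho>0 by simp
      also have "\<dots> \<le> (1 + \<eta>) / (2 * d)" using k(2) d0 by (intro divide_right_mono) auto
      finally have 3: "\<rho> / (\<rho>\<^sup>2 - (cmod (z - c))\<^sup>2) \<le> (1 + \<eta>) / (2 * d)" .
      have "(1 - \<eta>) / (2 * d) \<le> 1 / k' / (2 * d)" using k'(2) d0 by (intro divide_right_mono) auto
      also have "\<dots> = \<rho> / (2 * \<rho> * d * k')" using \<rho>0 by simp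
      also have "\<dots> \<le> \<rho> / ((cmod (z - c'))\<^sup>2 - \<rho>\<^sup>2)"
        using zc(3) \<rho>0 d0 k'(1) pz by (intro divide_left_mono) auto
      finally have 4: "(1 - \<eta>) / (2 * d) \<le> \<rho> / ((cmod (z - c'))\<^sup>2 - \<rho>\<^sup>2)" .
      have "2 * l \<le> r" using dr(2) \<epsilon>' by (simp add: l_def field_simps)
      then have "ball c \<rho> \<subseteq> ball z r" using cb(4) by (auto simp: subset_iff)
      then show "pinched D \<eta> r z w"
        unfolding pinched_def using cb(1-3) zc(1) wc(1) 1 2 3 4 d_def by blast
    qed
  qed (use \<epsilon>' in auto)
qed

lemma C1_arc_chord_bound:
  fixes \<gamma> :: "real \<Rightarrow> complex"
  assumes \<gamma>: "\<And>t. t \<in> S \<Longrightarrow> (\<gamma> has_vector_derivative g t) (at t)" and S: "convex S"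
    and B: "\<And>t. t \<in> S \<Longrightarrow> cmod (g t - v) \<le> B" and st: "s \<in> S" "t \<in> S"
  shows "cmod (\<gamma> t - \<gamma> s - of_real (t - s) * v) \<le> B * \<bar>t - s\<bar>"
proof -
  have "cmod ((\<lambda>x. \<gamma> x - x *\<^sub>R v) t - (\<lambda>x. \<gamma> x - x *\<^sub>R v) s) \<le> B * norm (t - s)"
  proof (rule differentiable_bound[OF S _ _ st(2,1)])
    fix x assume x: "x \<in> S"
    have "((\<lambda>x. x *\<^sub>R v) has_vector_derivative v) (at x within S)"
      by (auto intro!: derivative_eq_intros)
    from has_vector_derivative_diff[OF has_vector_derivative_at_within[OF \<gamma>[OF x]] this]
    have "((\<lambda>x. \<gamma> x - x *\<^sub>R v) has_vector_derivative g x - v) (at x within S)" .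
    then show "((\<lambda>x. \<gamma> x - x *\<^sub>R v) has_derivative (\<lambda>h. h *\<^sub>R (g x - v))) (at x within S)"
      by (simp add: has_vector_derivative_def)
    show "onorm (\<lambda>h. h *\<^sub>R (g x - v)) \<le> B"
    proof (rule onorm_le)
      fix h :: real
      have "\<bar>h\<bar> * cmod (g x - v) \<le> \<bar>h\<bar> * B" using B[OF x] by (intro mult_left_mono) auto
      then show "cmod (h *\<^sub>R (g x - v)) \<le> B * norm h" by (simp add: mult.commute)
    qed
  qed
  then show ?thesis by (simp add: scaleR_conv_of_real algebra_simps)
qed

lemma convex_cone_ball: 
  fixes n :: complex
  assumes "0 \<le> \<epsilon>"
  shows "convex {v. cmod v < r \<and> \<epsilon> * cmod v < v \<bullet> n}"
proof -
  have "convex {v. \<epsilon> * cmod v < v \<bullet> n}"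
  proof (rule convexI)
    fix x y and a b :: real
    assume x: "x \<in> {v. \<epsilon> * cmod v < v \<bullet> n}" and y: "y \<in> {v. \<epsilon> * cmod v < v \<bullet> n}"
      and ab: "0 \<le> a" "0 \<le> b" "a + b = 1"
    have "\<epsilon> * cmod (a *\<^sub>R x + b *\<^sub>R y) \<le> \<epsilon> * (a * cmod x + b * cmod y)"
      using assms norm_triangle_ineq[of "a *\<^sub>R x" "b *\<^sub>R y"] ab by (intro mult_left_mono) auto
    also have "\<dots> = a * (\<epsilon> * cmod x) + b * (\<epsilon> * cmod y)" by (simp add: algebra_simps)
    also have "\<dots> < a * (x \<bullet> n) + b * (y \<bullet> n)"
    proof (cases "a = 0")
      case True then show ?thesis using ab y by simp
    next
      case False
      then have "a * (\<epsilon> * cmod x) < a * (x \<bullet> n)" using ab x by simp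
      moreover have "b * (\<epsilon> * cmod y) \<le> b * (y \<bullet> n)" using ab y by (intro mult_left_mono) auto
      ultimately show ?thesis by simp
    qed
    finally show "a *\<^sub>R x + b *\<^sub>R y \<in> {v. \<epsilon> * cmod v < v \<bullet> n}" by (simp add: inner_add_left)
  qed
  then have "convex (ball 0 r \<inter> {v. \<epsilon> * cmod v < v \<bullet> n})" by (intro convex_Int convex_ball)
  moreover have "ball 0 r \<inter> {v. \<epsilon> * cmod v < v \<bullet> n} = {v. cmod v < r \<and> \<epsilon> * cmod v < v \<bullet> n}" by auto
  ultimately show ?thesis by simp
qed

text \<open>Near a, all chords of the boundary arc are almost parallel to the tangent v at a, so the two
  cones about the normal direction n at a frontier point p do not meet the frontier. Being connected,
  each of them lies in D or outside D, and a short normal at p shows which.\<close>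

lemma C1_smooth_boundary_point_has_cones:
  assumes a: "C1_smooth_boundary_point D a" and \<epsilon>: "0 < \<epsilon>" "\<epsilon> \<le> 1 / 2"
  shows "\<exists>r>0. \<forall>p\<in>frontier D \<inter> ball a r. \<exists>n. has_cones D \<epsilon> r p n"
proof -
  obtain \<gamma> r0 where arc: "arc \<gamma>" and C1: "\<gamma> C1_differentiable_on {0..1}"
    and nz: "\<forall>t\<in>{0..1}. vector_derivative \<gamma> (at t) \<noteq> 0" and r0: "r0 > 0"
    and "a \<in> \<gamma> ` {0<..<1}" and fr: "frontier D \<inter> ball a r0 = path_image \<gamma> \<inter> ball a r0"
    and side: "\<forall>t\<in>{0<..<1}. \<gamma> t \<in> ball a r0 \<longrightarrow> (\<forall>\<^sub>F s in at_right 0.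
             \<gamma> t + of_real s * \<i> * vector_derivative \<gamma> (at t) \<in> D \<and>
             \<gamma> t - of_real s * \<i> * vector_derivative \<gamma> (at t) \<notin> D)"
    using a unfolding C1_smooth_boundary_point_def by blast
  then obtain t0 where t0: "0 < t0" "t0 < 1" "a = \<gamma> t0" by auto
  define g where "g t = vector_derivative \<gamma> (at t)" for t
  have der: "(\<gamma> has_vector_derivative g t) (at t)" if "t \<in> {0..1}" for t
    using C1 that unfolding C1_differentiable_on_eq g_def by (auto simp: vector_derivative_works)
  have cont: "continuous_on {0..1} g" using C1 unfolding C1_differentiable_on_eq g_def by auto
  define v K where "v = g t0" and "K = cmod v"
  have K: "0 < K" using nz t0 by (auto simp: K_def v_def g_def)
  have "0 < \<epsilon> / 4 * K" using \<epsilon> K by simp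
  then obtain h0 where h0: "0 < h0" "\<And>t. t \<in> {0..1} \<Longrightarrow> dist t t0 < h0 \<Longrightarrow> dist (g t) (g t0) < \<epsilon> / 4 * K"
    using cont t0 unfolding continuous_on_iff by (metis atLeastAtMost_iff less_imp_le)
  define h where "h = min h0 (min t0 (1 - t0))"
  have h: "0 < h" using h0 t0 by (simp add: h_def)
  define S where "S = {t0 - h<..<t0 + h}"
  have S01: "S \<subseteq> {0<..<1}" by (auto simp: S_def h_def)
  have gS: "cmod (g t - v) \<le> \<epsilon> / 4 * K" if "t \<in> S" for t
  proof -
    have "dist t t0 < h0" using that by (auto simp: S_def h_def dist_real_def)
    moreover have "t \<in> {0..1}" using that S01 by auto
    ultimately show ?thesis using h0(2) by (force simp: v_def dist_norm)
  qed
  define n where "n = \<i> * v / of_real K"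
  have n: "cmod n = 1" using K by (simp add: n_def norm_mult norm_divide K_def)
  have vn: "v \<bullet> n = 0" by (simp add: n_def inner_complex_def field_simps)
  \<comment> \<open>chords have a component along n of at most \<epsilon> times their length\<close>
  have chord: "\<bar>(\<gamma> t - \<gamma> s) \<bullet> n\<bar> \<le> \<epsilon> * cmod (\<gamma> t - \<gamma> s)" if st: "s \<in> S" "t \<in> S" for s t
  proof -
    define u where "u = \<gamma> t - \<gamma> s - of_real (t - s) * v"
    have u: "cmod u \<le> \<epsilon> / 4 * K * \<bar>t - s\<bar>"
      unfolding u_def by (rule C1_arc_chord_bound[of S \<gamma> g]) (use der S01 gS st in \<open>auto simp: S_def\<close>)
    have "(\<gamma> t - \<gamma> s) \<bullet> n = u \<bullet> n + ((t - s) *\<^sub>R v) \<bullet> n"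
      by (simp add: u_def inner_diff_left scaleR_conv_of_real)
    then have "(\<gamma> t - \<gamma> s) \<bullet> n = u \<bullet> n" using vn by simp
    then have 1: "\<bar>(\<gamma> t - \<gamma> s) \<bullet> n\<bar> \<le> \<epsilon> / 4 * K * \<bar>t - s\<bar>"
      using Cauchy_Schwarz_ineq2[of u n] n u by simp
    have "K * \<bar>t - s\<bar> = cmod (of_real (t - s) * v)" by (simp add: norm_mult K_def flip: of_real_diff)
    also have "\<dots> \<le> cmod (\<gamma> t - \<gamma> s) + cmod u"
      using norm_triangle_ineq4[of "\<gamma> t - \<gamma> s" u] by (simp add: u_def)
    also have "cmod u \<le> 1 / 4 * (K * \<bar>t - s\<bar>)"
    proof -
      have "\<epsilon> / 4 * (K * \<bar>t - s\<bar>) \<le> 1 / 4 * (K * \<bar>t - s\<bar>)" using \<epsilon> K by (intro mult_right_mono) auto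
      then show ?thesis using u by (simp add: mult.assoc)
    qed
    finally have 2: "3 / 4 * (K * \<bar>t - s\<bar>) \<le> cmod (\<gamma> t - \<gamma> s)" by simp
    have "\<epsilon> / 4 * K * \<bar>t - s\<bar> \<le> \<epsilon> * (3 / 4 * (K * \<bar>t - s\<bar>))" using \<epsilon> K by simp
    also have "\<dots> \<le> \<epsilon> * cmod (\<gamma> t - \<gamma> s)" using 2 \<epsilon> by (intro mult_left_mono) auto
    finally show ?thesis using 1 by simp
  qed
  \<comment> \<open>the rest of the arc keeps a positive distance from a, because the arc is injective\<close>
  have "continuous_on {0..1} \<gamma>" using arc_imp_path[OF arc] by (simp add: path_def)
  then have "continuous_on ({0..1} - S) \<gamma>" by (rule continuous_on_subset) auto
  moreover have "compact ({0..1} - S)" unfolding S_def by (intro compact_diff) auto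
  ultimately have "compact (\<gamma> ` ({0..1} - S))" by (rule compact_continuous_image)
  then have "closed (\<gamma> ` ({0..1} - S))" by (rule compact_imp_closed)
  moreover have "a \<notin> \<gamma> ` ({0..1} - S)"
  proof
    assume "a \<in> \<gamma> ` ({0..1} - S)"
    then obtain t where t: "t \<in> {0..1}" "t \<notin> S" "\<gamma> t = \<gamma> t0" using t0 by auto
    have "inj_on \<gamma> {0..1}" using arc by (simp add: arc_def)
    then have "t = t0" using inj_onD[of \<gamma> "{0..1}" t t0] t t0 by simp
    then show False using t h by (simp add: S_def)
  qed
  ultimately have "\<exists>d>0. \<forall>x\<in>\<gamma> ` ({0..1} - S). d \<le> dist a x" by (rule separate_point_closed)
  then obtain r1 where r1: "0 < r1" "\<And>x. x \<in> \<gamma> ` ({0..1} - S) \<Longrightarrow> r1 \<le> dist a x" by blast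
  define r2 r where "r2 = min r0 r1" and "r = r2 / 2"
  have r: "0 < r" using r0 r1 by (simp add: r_def r2_def)
  have param: "\<exists>s\<in>S. p = \<gamma> s" if "p \<in> frontier D" "dist a p < r2" for p
  proof -
    have "p \<in> frontier D \<inter> ball a r0" using that by (simp add: r2_def)
    then have "p \<in> path_image \<gamma>" unfolding fr by blast
    then obtain s where "s \<in> {0..1}" "p = \<gamma> s" by (auto simp: path_image_def)
    moreover have "s \<in> S"
    proof (rule ccontr)
      assume "s \<notin> S"
      then have "r1 \<le> dist a p" using r1(2)[of p] calculation by blast
      then show False using that by (simp add: r2_def)
    qed
    ultimately show ?thesis by blast
  qed
  have "has_cones D \<epsilon> r p n" if p: "p \<in> frontier D" "dist a p < r" for p
  proof -
    obtain s where s: "s \<in> S" "p = \<gamma> s" using param[OF p(1)] p(2) r by (auto simp: r_def)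
    define W where "W = {v. cmod v < r \<and> \<epsilon> * cmod v < v \<bullet> n}"
    have conn: "connected ((\<lambda>v. p + v) ` W)" "connected ((\<lambda>v. p - v) ` W)"
      using convex_connected[OF convex_cone_ball[of \<epsilon> r n]] \<epsilon> unfolding W_def
      by (auto intro!: connected_continuous_image continuous_intros)
    have nofr: "p + v \<notin> frontier D \<and> p - v \<notin> frontier D" if "v \<in> W" for v
    proof -
      have "q \<notin> frontier D" if q: "q - p = v \<or> q - p = - v" for q
      proof
        assume qf: "q \<in> frontier D"
        have qp: "cmod (q - p) = cmod v" using q by auto
        then have "dist a q < r2"
          using dist_triangle[of a q p] p(2) \<open>v \<in> W\<close> by (simp add: W_def r_def dist_norm norm_minus_commute)
        then obtain t where "t \<in> S" "q = \<gamma> t" using param[OF qf] by blast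
        then have "\<bar>(q - p) \<bullet> n\<bar> \<le> \<epsilon> * cmod (q - p)" using chord[OF s(1)] s(2) by blast
        then show False using q qp \<open>v \<in> W\<close> by (auto simp: W_def)
      qed
      from this[of "p + v"] this[of "p - v"] show ?thesis by auto
    qed
    have s01: "s \<in> {0<..<1}" using s(1) S01 by auto
    have "\<gamma> s \<in> ball a r0" using p(2) s(2) r0 by (simp add: r_def r2_def)
    then have "\<forall>\<^sub>F x in at_right 0. p + of_real x * \<i> * g s \<in> D \<and> p - of_real x * \<i> * g s \<notin> D"
      using side s01 s(2) by (simp add: g_def)
    then obtain b where b: "0 < b" "\<And>x. 0 < x \<Longrightarrow> x < b \<Longrightarrow> p + of_real x * \<i> * g s \<in> D \<and> p - of_real x * \<i> * g s \<notin> D"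
      unfolding eventually_at_right_field by auto
    have gs: "0 < cmod (g s)" using nz s01 by (auto simp: g_def)
    \<comment> \<open>a short normal at p, which belongs to the cone since g s is close to v\<close>
    define x where "x = min (b / 2) (r / (2 * cmod (g s)))"
    have x: "0 < x" "x < b" using b r gs by (auto simp: x_def)
    define y where "y = of_real x * \<i> * g s"
    have "y \<in> W"
    proof -
      have ny: "cmod y = x * cmod (g s)" using x by (simp add: y_def norm_mult)
      also have "\<dots> \<le> r / (2 * cmod (g s)) * cmod (g s)" using gs by (intro mult_right_mono) (auto simp: x_def)
      also have "\<dots> < r" using gs r by simp
      finally have 1: "cmod y < r" .
      have "y \<bullet> n = x * ((g s \<bullet> v) / K)"
        by (simp add: y_def n_def inner_complex_def add_divide_distrib algebra_simps)
      moreover have "g s \<bullet> v = v \<bullet> v + (g s - v) \<bullet> v" by (simp add: inner_diff_left)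
      moreover have "\<bar>(g s - v) \<bullet> v\<bar> \<le> \<epsilon> / 4 * K * K"
        using Cauchy_Schwarz_ineq2[of "g s - v" v] mult_right_mono[OF gS[OF s(1)], of K] K
        unfolding K_def[symmetric] by linarith
      moreover have "v \<bullet> v = K * K" by (simp add: K_def power2_norm_eq_inner[symmetric] power2_eq_square[symmetric])
      ultimately have "y \<bullet> n \<ge> x * ((K * K - \<epsilon> / 4 * K * K) / K)"
        using x K by (auto intro!: mult_left_mono divide_right_mono)
      also have "(K * K - \<epsilon> / 4 * K * K) / K = K * (1 - \<epsilon> / 4)" using K by (simp add: field_simps)
      finally have 2: "x * (K * (1 - \<epsilon> / 4)) \<le> y \<bullet> n" .
      have "cmod (g s) \<le> cmod v + cmod (g s - v)" using norm_triangle_ineq[of v "g s - v"] by simp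
      then have "cmod (g s) \<le> K * (1 + \<epsilon> / 4)" using gS[OF s(1)] by (simp add: K_def algebra_simps)
      then have "\<epsilon> * cmod y \<le> \<epsilon> * (x * (K * (1 + \<epsilon> / 4)))" unfolding ny using x \<epsilon> by (intro mult_left_mono) auto
      also have "\<dots> = x * K * (\<epsilon> * (1 + \<epsilon> / 4))" by simp
      also have "\<dots> < x * K * (1 - \<epsilon> / 4)"
      proof (intro mult_strict_left_mono)
        have "\<epsilon> * (1 + \<epsilon> / 4) \<le> (1 / 2) * (1 + \<epsilon> / 4)" using \<epsilon> by (intro mult_right_mono) auto
        also have "\<dots> < 1 - \<epsilon> / 4" using \<epsilon> by simp
        finally show "\<epsilon> * (1 + \<epsilon> / 4) < 1 - \<epsilon> / 4" .
      qed (use x K in auto)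
      finally show ?thesis using 1 2 by (simp add: W_def)
    qed
    moreover have "p + y \<in> D" "p - y \<notin> D" using b(2)[OF x] by (auto simp: y_def)
    ultimately have "(\<lambda>v. p + v) ` W \<inter> D \<noteq> {}" "\<not> (\<lambda>v. p - v) ` W \<subseteq> D" by auto
    then have "(\<lambda>v. p + v) ` W \<subseteq> D" "(\<lambda>v. p - v) ` W \<inter> D = {}"
      using connected_Int_frontier[OF conn(1), of D] connected_Int_frontier[OF conn(2), of D] nofr by auto
    then show ?thesis using n by (auto simp: has_cones_def W_def)
  qed
  then have "\<forall>p\<in>frontier D \<inter> ball a r. \<exists>n. has_cones D \<epsilon> r p n"
    by (intro ballI exI[of _ n]) auto
  then show ?thesis using r by blast
qed

lemma compact_frontier_has_cones:
  assumes "C1_smooth_domain D" "bounded D" and \<epsilon>: "0 < \<epsilon>" "\<epsilon> \<le> 1 / 2"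
  shows "\<exists>r>0. \<forall>p\<in>frontier D. \<exists>n. has_cones D \<epsilon> r p n"
proof -
  have "\<forall>a\<in>frontier D. \<exists>r>0. \<forall>p\<in>frontier D \<inter> ball a r. \<exists>n. has_cones D \<epsilon> r p n"
    using assms C1_smooth_boundary_point_has_cones by (auto simp: C1_smooth_domain_def)
  then obtain R where R: "\<And>a. a \<in> frontier D \<Longrightarrow> 0 < R a"
     "\<And>a p. a \<in> frontier D \<Longrightarrow> p \<in> frontier D \<inter> ball a (R a) \<Longrightarrow> \<exists>n. has_cones D \<epsilon> (R a) p n"
    by metis
  have "compact (frontier D)" using \<open>bounded D\<close> by (simp add: compact_frontier_bounded)
  moreover have "frontier D \<subseteq> (\<Union>a\<in>frontier D. ball a (R a))" using R(1) by force
  ultimately obtain F where F: "F \<subseteq> frontier D" "finite F" "frontier D \<subseteq> (\<Union>a\<in>F. ball a (R a))"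
    using compactE_image[of "frontier D" "frontier D" "\<lambda>a. ball a (R a)"] by (metis open_ball)
  define r where "r = Min (insert 1 (R ` F))"
  have "0 < r" using F R(1) by (auto simp: r_def)
  moreover have "\<exists>n. has_cones D \<epsilon> r p n" if p: "p \<in> frontier D" for p
  proof -
    obtain a where "a \<in> F" "p \<in> ball a (R a)" using F p by blast
    then have "\<exists>n. has_cones D \<epsilon> (R a) p n" "r \<le> R a" using R(2) F p by (auto simp: r_def)
    then show ?thesis using has_cones_mono by blast
  qed
  ultimately show ?thesis by blast
qed

section \<open>Peak functions and the Caratheodory distance\<close>

lemma caratheodory_nonneg:
  assumes "domain D" "z \<in> D" "w \<in> D"
  shows "0 \<le> caratheodory_dist D z w"
  using caratheodory_ge[OF assms, of "\<lambda>_. 0"] by (simp add: holo_maps_def pd_def image_subset_iff)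

text \<open>The function exp l maps D into the right half plane, where the hyperbolic distance of A and B is at least
  half the logarithm of \<open>|B| / |A|\<close>.\<close>

lemma strip_map_le_caratheodory:
  assumes D: "domain D" "z \<in> D" "w \<in> D"
    and l: "l holomorphic_on D" "\<And>x. x \<in> D \<Longrightarrow> \<bar>Im (l x)\<bar> < pi / 2"
  shows "(Re (l w) - Re (l z)) / 2 \<le> caratheodory_dist D z w"
proof (cases "Re (l z) < Re (l w)")
  case True
  define F where "F = (\<lambda>x. exp (l x))"
  define A B where "A = F z" and "B = F w"
  have Re: "0 < Re (F x)" if "x \<in> D" for x
    using l(2)[OF that] by (simp add: F_def Re_exp cos_gt_zero_pi)
  have nz: "F x + cnj A \<noteq> 0" if "x \<in> D" for x
  proof
    assume "F x + cnj A = 0"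
    then have "Re (F x + cnj A) = 0" by simp
    then show False using Re[OF that] Re[OF D(2)] by (simp add: A_def)
  qed
  define \<psi> where "\<psi> = (\<lambda>x. (F x - A) / (F x + cnj A))"
  have "\<psi> \<in> holo_maps D (ball 0 1)"
    unfolding holo_maps_def
  proof (intro CollectI conjI image_subsetI)
    show "\<psi> holomorphic_on D" unfolding \<psi>_def F_def using nz by (intro holomorphic_intros l) (auto simp: F_def)
    fix x assume x: "x \<in> D"
    have "(cmod (F x + cnj A))\<^sup>2 - (cmod (F x - A))\<^sup>2 = 4 * Re (F x) * Re A"
      by (simp only: cmod_power2) (simp add: power2_eq_square algebra_simps)
    then have "(cmod (F x - A))\<^sup>2 < (cmod (F x + cnj A))\<^sup>2"
      using mult_pos_pos[OF Re[OF x] Re[OF D(2)]] by (simp add: A_def)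
    then have "cmod (F x - A) < cmod (F x + cnj A)" by (rule power2_less_imp_less) simp
    then show "\<psi> x \<in> ball 0 1" using nz[OF x] by (simp add: \<psi>_def norm_divide divide_less_eq)
  qed
  from caratheodory_ge[OF D this] have c: "artanh (cmod (\<psi> w)) \<le> caratheodory_dist D z w"
    by (simp add: pd_def \<psi>_def A_def)
  have "cmod (\<psi> w) < 1" using \<open>\<psi> \<in> holo_maps D (ball 0 1)\<close> D(3) by (auto simp: holo_maps_def)
  define a b where "a = cmod A" and "b = cmod B"
  have ab: "0 < a" "a < b" using True by (auto simp: a_def b_def A_def B_def F_def)
  have "(b - a) / (b + a) \<le> cmod (B - A) / cmod (B + cnj A)"
  proof (rule frac_le)
    show "b - a \<le> cmod (B - A)" unfolding a_def b_def by (rule norm_triangle_ineq2)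
    show "cmod (B + cnj A) \<le> b + a" using norm_triangle_ineq[of B "cnj A"] by (simp add: a_def b_def)
    show "0 < cmod (B + cnj A)" using nz[OF D(3)] by (simp add: B_def)
  qed (use ab in auto)
  also have "\<dots> = cmod (\<psi> w)" by (simp add: \<psi>_def B_def norm_divide)
  finally have "artanh ((b - a) / (b + a)) \<le> artanh (cmod (\<psi> w))"
    using \<open>cmod (\<psi> w) < 1\<close> ab by (intro artanh_mono) (auto simp: less_divide_eq)
  moreover have "artanh ((b - a) / (b + a)) = ln (b / a) / 2"
  proof -
    have "1 + (b - a) / (b + a) = 2 * b / (b + a)" "1 - (b - a) / (b + a) = 2 * a / (b + a)"
      using ab by (simp_all add: field_simps)
    then have "(1 + (b - a) / (b + a)) / (1 - (b - a) / (b + a)) = b / a" using ab by simp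
    then show ?thesis by (simp add: artanh_def)
  qed
  moreover have "ln (b / a) = Re (l w) - Re (l z)"
    using ab by (simp add: ln_div) (simp add: a_def b_def A_def B_def F_def)
  ultimately show ?thesis using c by simp
next
  case False
  then show ?thesis using caratheodory_nonneg[OF D] by simp
qed

text \<open>A point for which u is too close to the negative axis lies close to the segment from p to e, in comparison
  with its distance to p, and thus in the cone outside D.\<close>

lemma cone_sector:
  assumes h: "has_cones D \<epsilon> r p n" and \<epsilon>: "0 < \<epsilon>" "\<epsilon> < 1" and l: "0 < l" "l < r"
    and p: "p \<notin> D" and \<zeta>: "\<zeta> \<in> D"
  defines "e \<equiv> p - of_real l * n"
  defines "u \<equiv> (\<zeta> - p) / (\<zeta> - e)"
  shows "\<zeta> \<noteq> p" and "\<zeta> \<noteq> e" and "- \<epsilon> * cmod u \<le> Re u"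
proof -
  have n: "cmod n = 1" using h by (simp add: has_cones_def)
  then have n0: "n \<noteq> 0" by auto
  have nn: "n \<bullet> n = 1" using n by (simp add: power2_norm_eq_inner[symmetric])
  show "\<zeta> \<noteq> p" using p \<zeta> by auto
  have "\<epsilon> * cmod (of_real l * n) < (of_real l * n) \<bullet> n"
    using n nn l \<epsilon> by (simp add: norm_mult scaleR_conv_of_real[symmetric])
  moreover have "cmod (of_real l * n) < r" using n l by (simp add: norm_mult)
  ultimately have "e \<notin> D" using h by (auto simp: has_cones_def e_def)
  then show ne: "\<zeta> \<noteq> e" using \<zeta> by auto
  show "- \<epsilon> * cmod u \<le> Re u"
  proof (rule ccontr)
    assume "\<not> - \<epsilon> * cmod u \<le> Re u"
    then have neg: "Re u < - \<epsilon> * cmod u" by simp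
    define x where "x = (p - \<zeta>) / (of_real l * n)"
    have x1: "1 - x = (\<zeta> - e) / (of_real l * n)" using n0 l by (simp add: x_def e_def field_simps)
    have x1n: "1 - x \<noteq> 0" using x1 ne n0 l by auto
    have u: "u = - x / (1 - x)" unfolding x1 unfolding x_def u_def using n0 l ne by (simp add: field_simps)
    have "Re (x * cnj (1 - x)) = (cmod (1 - x))\<^sup>2 * Re (- u)"
    proof -
      have "- u = x * cnj (1 - x) / of_real ((cmod (1 - x))\<^sup>2)"
        unfolding u using complex_div_cnj[of x "1 - x"] by simp
      then show ?thesis using x1n by (simp del: of_real_power)
    qed
    also have "\<dots> > (cmod (1 - x))\<^sup>2 * (\<epsilon> * cmod u)"
      using neg x1n by (intro mult_strict_left_mono) auto
    also have "(cmod (1 - x))\<^sup>2 * (\<epsilon> * cmod u) = \<epsilon> * cmod x * cmod (1 - x)"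
      using x1n by (simp add: u norm_divide power2_eq_square)
    also have "Re (x * cnj (1 - x)) = Re x - (cmod x)\<^sup>2"
      by (simp only: cmod_power2) (simp add: power2_eq_square algebra_simps)
    finally have 1: "\<epsilon> * cmod x * cmod (1 - x) + (cmod x)\<^sup>2 < Re x" by simp
    have "0 \<le> \<epsilon> * cmod x * cmod (1 - x)" using \<epsilon> by simp
    then have "cmod x * cmod x < cmod x * 1" using 1 complex_Re_le_cmod[of x] unfolding power2_eq_square by linarith
    then have x_lt: "cmod x < 1" unfolding mult_less_cancel_left by simp
    have "1 - cmod x \<le> cmod (1 - x)" using norm_triangle_ineq2[of 1 x] by simp
    then have "\<epsilon> * cmod x * (1 - cmod x) \<le> \<epsilon> * cmod x * cmod (1 - x)" using \<epsilon> by (intro mult_left_mono) auto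
    moreover have "\<epsilon> * (cmod x)\<^sup>2 \<le> 1 * (cmod x)\<^sup>2" using \<epsilon> by (intro mult_right_mono) auto
    ultimately have 2: "\<epsilon> * cmod x < Re x" using 1 by (simp add: algebra_simps power2_eq_square)
    define v where "v = p - \<zeta>"
    have v: "v = of_real l * n * x" using n0 l by (simp add: v_def x_def)
    have "v \<bullet> n = l * Re x * (n \<bullet> n)" by (simp add: v inner_complex_def algebra_simps)
    then have "\<epsilon> * cmod v < v \<bullet> n" using 2 l n nn by (simp add: v norm_mult)
    moreover have "cmod v < r"
    proof -
      have "cmod v = l * cmod x" using l n by (simp add: v norm_mult)
      also have "\<dots> \<le> l * 1" using x_lt l by (intro mult_left_mono) auto
      finally show ?thesis using l by simp
    qed
    ultimately have "p - v \<notin> D" using h by (auto simp: has_cones_def)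
    then show False using \<zeta> by (simp add: v_def)
  qed
qed

text \<open>On D the quotient \<open>(x - p) / (x - e)\<close> avoids a sector of half-angle \<open>\<pi>/2 - \<theta>\<close> about the negative axis, so its
  logarithm has imaginary part at most \<open>\<pi>/2 + \<theta>\<close>; the factor \<open>\<alpha> < 1\<close> brings it below \<open>\<pi>/2\<close>.\<close>

lemma sector_log:
  assumes \<alpha>: "0 < \<alpha>" "\<alpha> < 1"
  shows "\<exists>\<epsilon>>0. \<epsilon> < 1 \<and> (\<forall>D r p n l. open D \<longrightarrow> p \<in> frontier D \<longrightarrow> has_cones D \<epsilon> r p n \<longrightarrow> 0 < l \<longrightarrow> l < r \<longrightarrow>
     (\<exists>f e. f holomorphic_on D \<and> dist p e = l \<and>
        (\<forall>x\<in>D. x \<noteq> p \<and> x \<noteq> e \<and> \<bar>Im (f x)\<bar> < pi / 2 \<and> Re (f x) = \<alpha> * ln (cmod (x - p) / cmod (x - e)))))"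
proof -
  define \<theta> where "\<theta> = min (pi / 4) (pi / 4 * (1 / \<alpha> - 1))"
  have "\<theta> \<le> pi / 4" unfolding \<theta>_def by (rule min.cobounded1)
  moreover have "0 < \<theta>" using \<alpha> pi_gt_zero by (auto simp: \<theta>_def)
  ultimately have \<theta>: "0 < \<theta>" "\<theta> < pi / 2" using pi_gt_zero by linarith+
  have \<alpha>\<theta>: "\<alpha> * (pi / 2 + \<theta>) < pi / 2"
  proof -
    have "\<alpha> * (pi / 2 + \<theta>) \<le> \<alpha> * (pi / 2 + pi / 4 * (1 / \<alpha> - 1))"
      using \<alpha> unfolding \<theta>_def by (intro mult_left_mono add_left_mono min.cobounded2) auto
    also have "\<dots> = pi / 4 * (1 + \<alpha>)" using \<alpha> by (simp add: field_simps)
    also have "\<dots> < pi / 4 * 2" using \<alpha> by (intro mult_strict_left_mono) auto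
    finally show ?thesis by simp
  qed
  define \<epsilon> where "\<epsilon> = sin \<theta>"
  have \<epsilon>: "0 < \<epsilon>" "\<epsilon> < 1"
  proof -
    show "0 < \<epsilon>" using \<theta> pi_gt_zero by (auto simp: \<epsilon>_def intro!: sin_gt_zero)
    have "sin \<theta> < sin (pi / 2)" using \<theta> by (intro sin_monotone_2pi) auto
    then show "\<epsilon> < 1" by (simp add: \<epsilon>_def)
  qed
  show ?thesis
  proof (intro exI[of _ \<epsilon>] conjI allI impI)
    fix D r p n and l :: real
    assume D: "open D" and p: "p \<in> frontier D" and h: "has_cones D \<epsilon> r p n" and l: "0 < l" "l < r"
    have pD: "p \<notin> D" using p D frontier_disjoint_eq by blast
    define e where "e = p - of_real l * n"
    define u where "u x = (x - p) / (x - e)" for x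
    note cs = cone_sector[OF h \<epsilon> l pD, folded e_def, folded u_def]
    have u0: "u x \<noteq> 0" if "x \<in> D" for x using cs(1,2)[OF that] by (simp add: u_def)
    have Arg: "\<bar>Im (Ln (u x))\<bar> \<le> pi / 2 + \<theta>" if "x \<in> D" for x
    proof (rule ccontr)
      define t where "t = Im (Ln (u x))"
      assume "\<not> \<bar>Im (Ln (u x))\<bar> \<le> pi / 2 + \<theta>"
      then have t: "pi / 2 + \<theta> < \<bar>t\<bar>" by (simp add: t_def)
      have tpi: "\<bar>t\<bar> \<le> pi" using mpi_less_Im_Ln[OF u0[OF that]] Im_Ln_le_pi[OF u0[OF that]] by (simp add: t_def)
      have "Re (u x) = cmod (u x) * cos t"
      proof -
        have "Re (u x) = Re (exp (Ln (u x)))" using u0[OF that] by simp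
        also have "\<dots> = cmod (exp (Ln (u x))) * cos t" by (simp only: Re_exp norm_exp_eq_Re t_def)
        finally show ?thesis using u0[OF that] by simp
      qed
      moreover have "cos t < cos (pi / 2 + \<theta>)"
        using cos_monotone_0_pi[of "pi / 2 + \<theta>" "\<bar>t\<bar>"] t tpi \<theta> by simp
      moreover have "cos (pi / 2 + \<theta>) = - \<epsilon>" by (simp add: cos_add \<epsilon>_def)
      ultimately have "Re (u x) < cmod (u x) * (- \<epsilon>)"
        using u0[OF that] by (metis mult_strict_left_mono zero_less_norm_iff)
      then show False using cs(3)[OF that] by (simp add: mult.commute)
    qed
    have nn: "u x \<notin> \<real>\<^sub>\<le>\<^sub>0" if "x \<in> D" for x
    proof
      assume "u x \<in> \<real>\<^sub>\<le>\<^sub>0"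
      then have "Im (Ln (u x)) = pi" using u0[OF that] Im_Ln_eq_pi by (auto simp: complex_nonpos_Reals_iff complex_eq_iff less_le)
      then show False using Arg[OF that] \<theta> by simp
    qed
    show "\<exists>f e. f holomorphic_on D \<and> dist p e = l \<and>
        (\<forall>x\<in>D. x \<noteq> p \<and> x \<noteq> e \<and> \<bar>Im (f x)\<bar> < pi / 2 \<and> Re (f x) = \<alpha> * ln (cmod (x - p) / cmod (x - e)))"
    proof (intro exI[of _ "\<lambda>x. of_real \<alpha> * Ln (u x)"] exI[of _ e] conjI ballI)
      show "(\<lambda>x. of_real \<alpha> * Ln (u x)) holomorphic_on D"
        using nn cs(2) unfolding u_def by (intro holomorphic_intros) auto
      show "dist p e = l" using l h by (simp add: e_def has_cones_def norm_mult dist_norm)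
      fix x assume x: "x \<in> D"
      show "x \<noteq> p" "x \<noteq> e" using cs(1,2)[OF x] by auto
      have "\<bar>Im (of_real \<alpha> * Ln (u x))\<bar> = \<alpha> * \<bar>Im (Ln (u x))\<bar>" using \<alpha> by (simp add: abs_mult)
      also have "\<dots> \<le> \<alpha> * (pi / 2 + \<theta>)" using Arg[OF x] \<alpha> by (intro mult_left_mono) auto
      finally show "\<bar>Im (of_real \<alpha> * Ln (u x))\<bar> < pi / 2" using \<alpha>\<theta> by simp
      show "Re (of_real \<alpha> * Ln (u x)) = \<alpha> * ln (cmod (x - p) / cmod (x - e))"
        using u0[OF x] by (simp add: u_def norm_divide)
    qed
  qed (use \<epsilon> in auto)
qed

lemma abs_arctan_le_abs: "\<bar>arctan x\<bar> \<le> \<bar>x\<bar>"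
proof -
  have *: "arctan t \<le> t" if "0 \<le> t" for t
  proof -
    have "(\<lambda>t. t - arctan t) 0 \<le> (\<lambda>t. t - arctan t) t"
    proof (rule DERIV_nonneg_imp_nondecreasing[OF that])
      fix s :: real
      have "((\<lambda>t. t - arctan t) has_real_derivative 1 - inverse (1 + s\<^sup>2)) (at s)"
        by (intro DERIV_diff DERIV_ident DERIV_arctan)
      moreover have "0 \<le> 1 - inverse (1 + s\<^sup>2)" by (simp add: inverse_le_1_iff)
      ultimately show "\<exists>y. ((\<lambda>t. t - arctan t) has_real_derivative y) (at s) \<and> 0 \<le> y" by blast
    qed
    then show ?thesis by simp
  qed
  show ?thesis using *[of x] *[of "-x"] by (cases "0 \<le> x") (auto simp: arctan_minus)
qed

lemma arg_one_plus_small: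
  assumes "0 < Re y"
  shows "\<bar>Im (Ln (1 + y))\<bar> < pi / 2" and "\<bar>Im (Ln (1 + y))\<bar> \<le> cmod y"
proof -
  have "0 < Re (1 + y)" using assms by simp
  then have eq: "Im (Ln (1 + y)) = arctan (Im y / (1 + Re y))"
    using arg_conv_arctan[of "1 + y"] Arg_eq_Im_Ln[of "1 + y"] by (auto simp: complex_eq_iff)
  then show "\<bar>Im (Ln (1 + y))\<bar> < pi / 2"
    unfolding eq abs_less_iff using arctan_bounded[of "Im y / (1 + Re y)"] by linarith
  have "\<bar>arctan (Im y / (1 + Re y))\<bar> \<le> \<bar>Im y / (1 + Re y)\<bar>" by (rule abs_arctan_le_abs)
  also have "\<dots> \<le> \<bar>Im y\<bar> / 1" unfolding abs_divide using assms by (intro frac_le) auto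
  also have "\<dots> \<le> cmod y" using abs_Im_le_cmod by simp
  finally show "\<bar>Im (Ln (1 + y))\<bar> \<le> cmod y" by (simp add: eq)
qed

text \<open>In the application the real parts of f and g tend to minus infinity at two different frontier points, so \<open>exp (k - f)\<close> and
  \<open>exp (k - g)\<close> are large only near one of these points each. The difference of the logarithms of
  \<open>1 + exp (k - g)\<close> and \<open>1 + exp (k - f)\<close> behaves like \<open>f - k\<close> near the first point and like \<open>k - g\<close> near
  the second one. Its imaginary part is not the sum of two angles of size \<open>\<pi>/2\<close>, because at each x one of
  the two logarithms has an imaginary part of modulus at most \<open>\<iota>\<close>.
  Both peaks thus contribute to the distance with almost full weight.\<close>

lemma two_peaks_le_caratheodory:
  assumes D: "domain D" "z \<in> D" "w \<in> D"
    and f: "f holomorphic_on D" "\<And>x. x \<in> D \<Longrightarrow> \<bar>Im (f x)\<bar> < pi / 2"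
    and g: "g holomorphic_on D" "\<And>x. x \<in> D \<Longrightarrow> \<bar>Im (g x)\<bar> < pi / 2"
    and \<iota>: "0 < \<iota>" "\<iota> \<le> 1"
    and sep: "\<And>x. x \<in> D \<Longrightarrow> exp (k - Re (f x)) \<le> \<iota> \<or> exp (k - Re (g x)) \<le> \<iota>"
    and zw: "exp (k - Re (g z)) \<le> 1" "exp (k - Re (f w)) \<le> 1"
  shows "(pi / 2) / (pi / 2 + \<iota>) * (((k - Re (f z)) + (k - Re (g w))) / 2 - ln 2) \<le> caratheodory_dist D z w"
proof -
  define b where "b = (pi / 2) / (pi / 2 + \<iota>)"
  have P: "pi / 2 + \<iota> > 0" using \<iota> pi_gt_zero by linarith
  then have b: "0 < b" "b * (pi / 2 + \<iota>) = pi / 2"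
  proof -
    define P where "P = pi / 2 + \<iota>"
    have "0 < P" using P by (simp add: P_def)
    then show "0 < b" "b * (pi / 2 + \<iota>) = pi / 2" unfolding b_def P_def[symmetric] by simp_all
  qed
  define Y where "Y h x = exp (of_real k - h x)" for h :: "complex \<Rightarrow> complex" and x
  have ReY: "0 < Re (Y h x)" if "\<bar>Im (h x)\<bar> < pi / 2" for h x
    using that by (simp add: Y_def Re_exp cos_gt_zero_pi)
  have nY: "cmod (Y h x) = exp (k - Re (h x))" for h x by (simp add: Y_def)
  define T where "T x = Ln (1 + Y g x) - Ln (1 + Y f x)" for x
  have np: "1 + Y f x \<notin> \<real>\<^sub>\<le>\<^sub>0" "1 + Y g x \<notin> \<real>\<^sub>\<le>\<^sub>0" if "x \<in> D" for x
    using ReY[of f x, OF f(2)[OF that]] ReY[of g x, OF g(2)[OF that]] by (auto simp: complex_nonpos_Reals_iff)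
  have "(\<lambda>x. of_real b * T x) holomorphic_on D"
    unfolding T_def using np unfolding Y_def by (intro holomorphic_intros f g) auto
  moreover have "\<bar>Im (of_real b * T x)\<bar> < pi / 2" if x: "x \<in> D" for x
  proof -
    note F = arg_one_plus_small[OF ReY[of f x, OF f(2)[OF x]]] and G = arg_one_plus_small[OF ReY[of g x, OF g(2)[OF x]]]
    have "\<bar>Im (T x)\<bar> < pi / 2 + \<iota>"
      using sep[OF x] F G unfolding T_def nY by auto
    then have "b * \<bar>Im (T x)\<bar> < b * (pi / 2 + \<iota>)" using b by simp
    then show ?thesis using b by (simp add: abs_mult)
  qed
  ultimately have "(Re (of_real b * T w) - Re (of_real b * T z)) / 2 \<le> caratheodory_dist D z w"
    by (rule strip_map_le_caratheodory[OF D])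
  have upper: "ln (cmod (1 + Y h x)) \<le> ln 2" if "exp (k - Re (h x)) \<le> 1" "\<bar>Im (h x)\<bar> < pi / 2" for h x
  proof -
    have "cmod (1 + Y h x) \<le> 2" using norm_triangle_ineq[of 1 "Y h x"] that(1) nY[of h x] unfolding norm_one by linarith
    moreover have "0 < cmod (1 + Y h x)" using ReY[of h x] that(2) by (auto simp: complex_eq_iff)
    ultimately show ?thesis by simp
  qed
  have lower: "k - Re (h x) \<le> ln (cmod (1 + Y h x))" if "\<bar>Im (h x)\<bar> < pi / 2" for h x
  proof -
    have "(cmod (Y h x))\<^sup>2 \<le> (cmod (1 + Y h x))\<^sup>2"
      using ReY[of h x] that by (simp only: cmod_power2) (simp add: power2_eq_square algebra_simps)
    then have "cmod (Y h x) \<le> cmod (1 + Y h x)" by (rule power2_le_imp_le) simp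
    moreover have "0 < cmod (Y h x)" by (simp add: nY)
    ultimately have "ln (cmod (Y h x)) \<le> ln (cmod (1 + Y h x))" by (meson ln_le_cancel_iff less_le_trans)
    then show ?thesis by (simp add: nY)
  qed
  have nz: "1 + Y f x \<noteq> 0" "1 + Y g x \<noteq> 0" if "x \<in> D" for x using np[OF that] by auto
  have ReT: "Re (T x) = ln (cmod (1 + Y g x)) - ln (cmod (1 + Y f x))" if "x \<in> D" for x
    using nz[OF that] by (simp add: T_def)
  have 1: "Re (T z) \<le> ln 2 - (k - Re (f z))"
    unfolding ReT[OF D(2)] using upper[of g z, OF zw(1) g(2)[OF D(2)]] lower[of f z, OF f(2)[OF D(2)]] by simp
  have 2: "(k - Re (g w)) - ln 2 \<le> Re (T w)"
    unfolding ReT[OF D(3)] using upper[of f w, OF zw(2) f(2)[OF D(3)]] lower[of g w, OF g(2)[OF D(3)]] by simp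
  have "(x + y) / 2 - c \<le> (B - A) / 2" if "A \<le> c - x" "y - c \<le> B" for A B c x y :: real
    using that by (simp add: field_simps)
  from this[OF 1 2] have "((k - Re (f z)) + (k - Re (g w))) / 2 - ln 2 \<le> (Re (T w) - Re (T z)) / 2" .
  then have "b * (((k - Re (f z)) + (k - Re (g w))) / 2 - ln 2) \<le> b * ((Re (T w) - Re (T z)) / 2)"
    using b by (intro mult_left_mono) auto
  also have "\<dots> = (Re (of_real b * T w) - Re (of_real b * T z)) / 2" by (simp add: algebra_simps)
  also have "\<dots> \<le> caratheodory_dist D z w" by fact
  finally show ?thesis unfolding b_def .
qed

section \<open>The lower bound for the Caratheodory distance\<close>

text \<open>The bound \<open>arsinh x \<le> log (2 x) + log (3/2)\<close> for \<open>x \<ge> 1\<close>.\<close>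

lemma s_fun_le_ln:
  assumes d: "0 < bdry_dist D z" "0 < bdry_dist D w" and x: "1 \<le> sinh (s_fun D z w)"
  defines "L \<equiv> cmod (z - w)"
  shows "0 < L" and "s_fun D z w \<le> ln (L / bdry_dist D z) / 2 + ln (L / bdry_dist D w) / 2 + ln (3 / 2)"
proof -
  define a b where "a = bdry_dist D z" and "b = bdry_dist D w"
  have ab: "0 < a" "0 < b" using d by (auto simp: a_def b_def)
  define X where "X = L / (2 * sqrt (a * b))"
  have X: "s_fun D z w = arsinh X" by (simp add: s_fun_def X_def a_def b_def L_def)
  then have X1: "1 \<le> X" using x by simp
  then show L: "0 < L" using mult_pos_pos[OF ab] by (auto simp: X_def L_def)
  have "sqrt (X\<^sup>2 + 1) \<le> 2 * X"
  proof (rule real_le_lsqrt)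
    have "1 \<le> X\<^sup>2" using X1 by (rule one_le_power)
    then show "X\<^sup>2 + 1 \<le> (2 * X)\<^sup>2" by (simp add: power_mult_distrib)
  qed (use X1 in auto)
  moreover have "0 < X + sqrt (X\<^sup>2 + 1)" using X1 by (simp add: add_pos_nonneg)
  ultimately have "arsinh X \<le> ln (3 * X)" using X1 by (simp add: arsinh_real_def)
  also have "3 * X = (3 / 2) * sqrt ((L / a) * (L / b))"
    using ab L by (simp add: X_def real_sqrt_divide real_sqrt_mult)
  also have "ln \<dots> = ln (3 / 2) + ln (sqrt ((L / a) * (L / b)))"
    using ab L by (subst ln_mult_pos) auto
  also have "ln (sqrt ((L / a) * (L / b))) = (ln (L / a) + ln (L / b)) / 2"
  proof -
    have "ln ((L / a) * (L / b)) = ln (L / a) + ln (L / b)" using ab L by (intro ln_mult_pos) auto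
    moreover have "0 < (L / a) * (L / b)" using ab L by auto
    ultimately show ?thesis by (simp only: ln_sqrt)
  qed
  finally show "s_fun D z w \<le> ln (L / bdry_dist D z) / 2 + ln (L / bdry_dist D w) / 2 + ln (3 / 2)"
    by (simp add: X a_def b_def add_divide_distrib)
qed

lemma min_bdry_dist_small:
  assumes d: "0 < bdry_dist D z" "0 < bdry_dist D w" and le: "bdry_dist D z \<le> bdry_dist D w"
    and X: "0 < X" "X \<le> sinh (s_fun D z w)"
  shows "bdry_dist D z \<le> cmod (z - w) / (2 * X)"
proof -
  define a b L where "a = bdry_dist D z" and "b = bdry_dist D w" and "L = cmod (z - w)"
  have ab: "0 < a" "0 < b" "a \<le> b" using d le by (auto simp: a_def b_def)
  have "X \<le> L / (2 * sqrt (a * b))" using X by (simp add: s_fun_def a_def b_def L_def)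
  then have "sqrt (a * b) \<le> L / (2 * X)" using ab X by (simp add: field_simps)
  moreover have "a \<le> sqrt (a * b)"
    using ab by (intro real_le_rsqrt) (auto simp: power2_eq_square)
  ultimately show ?thesis by (simp add: a_def L_def)
qed

text \<open>When w is not much closer to the boundary than \<open>L = |z - w|\<close>, the peak function at the point p next
  to z suffices. Otherwise p and the point q next to w are at least \<open>3 L / 4\<close> apart, and the peaks at p and q
  are separated. The constants C1 and C2 collect the losses, which are small compared with \<open>s \<ge> N\<close>.\<close>

lemma caratheodory_far:
  assumes \<eta>: "0 < \<eta>" "\<eta> \<le> 1"
  shows "\<exists>\<epsilon>>0. \<forall>r>0. \<forall>K\<ge>1. \<exists>N. \<forall>D z w p q n n'. domain D \<longrightarrow> z \<in> D \<longrightarrow> w \<in> D \<longrightarrow>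
     p \<in> frontier D \<longrightarrow> q \<in> frontier D \<longrightarrow> dist z p = bdry_dist D z \<longrightarrow> dist w q = bdry_dist D w \<longrightarrow>
     has_cones D \<epsilon> r p n \<longrightarrow> has_cones D \<epsilon> r q n' \<longrightarrow> bdry_dist D z \<le> bdry_dist D w \<longrightarrow>
     cmod (z - w) \<le> K * r \<longrightarrow> N \<le> s_fun D z w \<longrightarrow> (1 - \<eta>) * s_fun D z w \<le> caratheodory_dist D z w"
proof -
  define \<alpha> where "\<alpha> = 1 - \<eta> / 4"
  define \<iota> where "\<iota> = pi / 2 * (1 / \<alpha> - 1)"
  have \<alpha>: "3 / 4 \<le> \<alpha>" "\<alpha> < 1" using \<eta> by (auto simp: \<alpha>_def)
  have \<iota>: "0 < \<iota>" "\<iota> \<le> 1"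
  proof -
    show "0 < \<iota>" using \<alpha> by (simp add: \<iota>_def)
    have "1 / \<alpha> \<le> 1 / (3 / 4)" using \<alpha> by (intro divide_left_mono) auto
    then have "\<iota> \<le> pi / 2 * (4 / 3 - 1)" unfolding \<iota>_def by (intro mult_left_mono) auto
    also have "\<dots> \<le> 1" using pi_less_4 by simp
    finally show "\<iota> \<le> 1" .
  qed
  have b\<alpha>: "(pi / 2) / (pi / 2 + \<iota>) = \<alpha>"
  proof -
    have "pi / 2 + \<iota> = pi / 2 / \<alpha>" using \<alpha> by (simp add: \<iota>_def field_simps)
    then show ?thesis using \<alpha> by simp
  qed
  obtain \<epsilon> where \<epsilon>: "0 < \<epsilon>" "\<epsilon> < 1" and sector: "\<And>D r p n l. open D \<Longrightarrow> p \<in> frontier D \<Longrightarrow> has_cones D \<epsilon> r p n \<Longrightarrow> 0 < l \<Longrightarrow> l < r \<Longrightarrow>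
     (\<exists>f e. f holomorphic_on D \<and> dist p e = l \<and>
        (\<forall>x\<in>D. x \<noteq> p \<and> x \<noteq> e \<and> \<bar>Im (f x)\<bar> < pi / 2 \<and> Re (f x) = \<alpha> * ln (cmod (x - p) / cmod (x - e))))"
  proof -
    have "0 < \<alpha>" using \<alpha> by simp
    from sector_log[OF this \<alpha>(2)] show ?thesis using that by blast
  qed
  show ?thesis
  proof (rule exI[of _ \<epsilon>], intro conjI \<epsilon>(1) allI impI)
    fix r K :: real assume r: "0 < r" and K: "1 \<le> K"
    define C1 where "C1 = ln (8 * K) / 2 + ln (3 / 2) + ln (4 * (4 * K + 1)) / 2"
    define C2 where "C2 = ln (3 / 2) + ln (32 * K) - ln \<iota> + ln 2"
    have "0 \<le> ln (8 * K)" "0 \<le> ln (3 / 2 :: real)" "0 \<le> ln (4 * (4 * K + 1))" "0 \<le> ln (32 * K)" "ln \<iota> \<le> 0" "0 \<le> ln (2 :: real)"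
      using K \<iota> by auto
    then have C: "0 \<le> C1" "0 \<le> C2" unfolding C1_def C2_def by linarith+
    define N where "N = max (arsinh (4 * K)) (2 * (C1 + C2) / \<eta>)"
    show "\<exists>N. \<forall>D z w p q n n'. domain D \<longrightarrow> z \<in> D \<longrightarrow> w \<in> D \<longrightarrow>
     p \<in> frontier D \<longrightarrow> q \<in> frontier D \<longrightarrow> dist z p = bdry_dist D z \<longrightarrow> dist w q = bdry_dist D w \<longrightarrow>
     has_cones D \<epsilon> r p n \<longrightarrow> has_cones D \<epsilon> r q n' \<longrightarrow> bdry_dist D z \<le> bdry_dist D w \<longrightarrow>
     cmod (z - w) \<le> K * r \<longrightarrow> N \<le> s_fun D z w \<longrightarrow> (1 - \<eta>) * s_fun D z w \<le> caratheodory_dist D z w"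
    proof (rule exI[of _ N], intro allI impI)
      fix D z w p q n n'
      assume D: "domain D" and z: "z \<in> D" and w: "w \<in> D" and p: "p \<in> frontier D" and q: "q \<in> frontier D"
        and zp: "dist z p = bdry_dist D z" and wq: "dist w q = bdry_dist D w"
        and hp: "has_cones D \<epsilon> r p n" and hq: "has_cones D \<epsilon> r q n'"
        and le: "bdry_dist D z \<le> bdry_dist D w" and LK: "cmod (z - w) \<le> K * r" and N: "N \<le> s_fun D z w"
      have oD: "open D" using D by (simp add: domain_def)
      have fr: "frontier D \<noteq> {}" using p by auto
      define a b L s l where "a = bdry_dist D z" and "b = bdry_dist D w" and "L = cmod (z - w)"
        and "s = s_fun D z w" and "l = r / 2"
      have ab: "0 < a" "0 < b" "a \<le> b" using bdry_dist_pos[OF oD _ fr] z w le by (auto simp: a_def b_def)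
      have l: "0 < l" "l < r" "L \<le> 2 * K * l" using r LK by (auto simp: l_def L_def)
      have "arsinh (4 * K) \<le> s" using N by (simp add: N_def s_def)
      then have "sinh (arsinh (4 * K)) \<le> sinh s" by (simp only: sinh_real_le_iff)
      then have sK: "4 * K \<le> sinh s" by simp
      then have L0: "0 < L" and s_le: "s \<le> ln (L / a) / 2 + ln (L / b) / 2 + ln (3 / 2)"
        using s_fun_le_ln[of D z w] ab K by (auto simp: a_def b_def L_def s_def)
      have a_le: "a \<le> L / (8 * K)"
        using min_bdry_dist_small[of D z w "4 * K"] ab K sK by (simp add: a_def b_def L_def s_def)
      have aL: "a \<le> L / 8"
        using a_le divide_left_mono[of 8 "8 * K" L] K L0 by simp
      have al: "a \<le> l / 4"
      proof -
        have "L / (8 * K) \<le> (2 * K * l) / (8 * K)" using l K by (intro divide_right_mono) auto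
        then show ?thesis using a_le K by simp
      qed
      have s0: "0 \<le> s" by (simp add: s_def s_fun_nonneg)
      have zpa: "cmod (z - p) = a" and wqb: "cmod (w - q) = b" using zp wq by (auto simp: dist_norm a_def b_def)
      have suffices: "(1 - \<eta>) * s \<le> caratheodory_dist D z w"
        if "\<alpha> * \<alpha> * s - (C1 + C2) \<le> caratheodory_dist D z w"
      proof -
        have "2 * (C1 + C2) / \<eta> \<le> s" using N by (simp add: N_def s_def)
        then have "C1 + C2 \<le> \<eta> / 2 * s" using \<eta> by (simp add: field_simps)
        moreover have "1 - \<eta> / 2 \<le> \<alpha> * \<alpha>" by (simp add: \<alpha>_def algebra_simps)
        then have "(1 - \<eta> / 2) * s \<le> \<alpha> * \<alpha> * s" using s0 by (intro mult_right_mono) auto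
        ultimately show ?thesis using that by (simp add: algebra_simps)
      qed
      obtain f e where f: "f holomorphic_on D" and e: "dist p e = l"
        and fp: "\<And>x. x \<in> D \<Longrightarrow> x \<noteq> p \<and> x \<noteq> e \<and> \<bar>Im (f x)\<bar> < pi / 2 \<and> Re (f x) = \<alpha> * ln (cmod (x - p) / cmod (x - e))"
        using sector[OF oD p hp l(1,2)] by blast
      have ze: "l / 2 \<le> cmod (z - e)"
        using dist_triangle[of p e z] e zpa al l(1) by (simp add: dist_norm norm_minus_commute)
      have wp: "L / 2 \<le> cmod (w - p)" "cmod (w - p) \<le> 2 * L"
        using dist_triangle[of z w p] dist_triangle[of w p z] zpa aL L0 by (auto simp: dist_norm L_def norm_minus_commute)
      show "(1 - \<eta>) * s_fun D z w \<le> caratheodory_dist D z w"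
        unfolding s_def[symmetric]
      proof (rule suffices, cases "L / (8 * K) \<le> b")
        case True
        have we: "cmod (w - e) \<le> (4 * K + 1) * l"
          using dist_triangle[of w e p] e wp(2) l by (simp add: dist_norm algebra_simps)
        have we0: "0 < cmod (w - e)" and wp0: "0 < cmod (w - p)" and ze0: "0 < cmod (z - e)"
          using fp[OF w] fp[OF z] by auto
        have "(L / 2) * (l / 2) / (((4 * K + 1) * l) * a) \<le> (cmod (w - p) * cmod (z - e)) / (cmod (w - e) * a)"
          using wp(1) ze we we0 ab l L0 K by (intro frac_le mult_mono mult_pos_pos) auto
        moreover have "(L / 2) * (l / 2) / (((4 * K + 1) * l) * a) = (L / a) / (4 * (4 * K + 1))"
        proof -
          have "(L / 2) * (l / 2) / ((k * l) * a) = (L / a) / (4 * k)" for k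
            using l(1) by (simp add: mult_ac)
          then show ?thesis .
        qed
        ultimately have "ln ((L / a) / (4 * (4 * K + 1))) \<le> ln ((cmod (w - p) * cmod (z - e)) / (cmod (w - e) * a))"
          using L0 ab K by (intro ln_mono) auto
        also have "\<dots> = ln (cmod (w - p) / cmod (w - e)) - ln (cmod (z - p) / cmod (z - e))"
          using we0 wp0 ze0 ab by (simp add: zpa ln_div ln_mult)
        finally have F0: "ln ((L / a) / (4 * (4 * K + 1))) \<le> ln (cmod (w - p) / cmod (w - e)) - ln (cmod (z - p) / cmod (z - e))" .
        have 1: "ln (L / a) - ln (4 * (4 * K + 1)) \<le> ln (cmod (w - p) / cmod (w - e)) - ln (cmod (z - p) / cmod (z - e))"
        proof -
          have "ln ((L / a) / (4 * (4 * K + 1))) = ln (L / a) - ln (4 * (4 * K + 1))"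
            using L0 ab K by (intro ln_divide_pos) auto
          then show ?thesis using F0 by linarith
        qed
        have "L / b \<le> 8 * K" using True ab K by (simp add: field_simps)
        then have "ln (L / b) \<le> ln (8 * K)" using L0 ab by (intro ln_mono) auto
        then have "s - C1 \<le> (ln (L / a) - ln (4 * (4 * K + 1))) / 2"
          using s_le by (simp add: C1_def field_simps)
        also have "\<dots> \<le> (ln (cmod (w - p) / cmod (w - e)) - ln (cmod (z - p) / cmod (z - e))) / 2" using 1 by simp
        finally have "\<alpha> * (s - C1) \<le> \<alpha> * ((ln (cmod (w - p) / cmod (w - e)) - ln (cmod (z - p) / cmod (z - e))) / 2)"
          using \<alpha> by (intro mult_left_mono) auto
        also have "\<dots> = (Re (f w) - Re (f z)) / 2" using fp[OF w] fp[OF z] by (simp add: algebra_simps)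
        also have "\<dots> \<le> caratheodory_dist D z w" using fp by (intro strip_map_le_caratheodory D z w f) auto
        finally have 2: "\<alpha> * (s - C1) \<le> caratheodory_dist D z w" .
        have "\<alpha> * (\<alpha> * s) \<le> 1 * (\<alpha> * s)" using \<alpha> s0 by (intro mult_right_mono) auto
        moreover have "\<alpha> * C1 \<le> 1 * C1" using \<alpha> C by (intro mult_right_mono) auto
        ultimately show "\<alpha> * \<alpha> * s - (C1 + C2) \<le> caratheodory_dist D z w" using 2 C by (simp add: algebra_simps)
      next
        case False
        then have b_le: "b < L / (8 * K)" by simp
        then have bL: "b \<le> L / 8"
          using divide_left_mono[of 8 "8 * K" L] K L0 by simp
        have bl: "b \<le> l / 4"
        proof -
          have "L / (8 * K) \<le> (2 * K * l) / (8 * K)" using l K by (intro divide_right_mono) auto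
          then show ?thesis using b_le K by simp
        qed
        obtain g e' where g: "g holomorphic_on D" and e': "dist q e' = l"
          and gp: "\<And>x. x \<in> D \<Longrightarrow> x \<noteq> q \<and> x \<noteq> e' \<and> \<bar>Im (g x)\<bar> < pi / 2 \<and> Re (g x) = \<alpha> * ln (cmod (x - q) / cmod (x - e'))"
          using sector[OF oD q hq l(1,2)] by blast
        have we': "l / 2 \<le> cmod (w - e')"
          using dist_triangle[of q e' w] e' wqb bl l(1) by (simp add: dist_norm norm_minus_commute)
        \<comment> \<open>\<mu> bounds |x - p| / |x - e| from below where |x - p| \<ge> L / 8\<close>
        define \<mu> where "\<mu> = L / (16 * K * l)"
        have \<mu>: "0 < \<mu>" "\<mu> \<le> 1 / 8" using L0 l K by (auto simp: \<mu>_def field_simps)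
        define k where "k = \<alpha> * ln \<mu> + ln \<iota>"
        have small: "exp (k - h) \<le> \<iota>"
          if "h = \<alpha> * ln (cmod (x - P) / cmod (x - E))" "x \<noteq> P" "x \<noteq> E" "dist P E = l" "L / 8 \<le> cmod (x - P)" for h x P E
        proof -
          have "cmod (x - E) \<le> cmod (x - P) + l"
            using dist_triangle[of x E P] that(4) by (simp add: dist_norm)
          then have "\<mu> * cmod (x - E) \<le> \<mu> * cmod (x - P) + \<mu> * l" using \<mu> by (metis distrib_left mult_left_mono less_imp_le)
          also have "\<mu> * cmod (x - P) \<le> 1 / 8 * cmod (x - P)" using \<mu> by (intro mult_right_mono) auto
          also have "\<mu> * l = L / (16 * K)" using l by (simp add: \<mu>_def)
          also have "L / (16 * K) \<le> L / 16" using K L0 divide_left_mono[of 16 "16 * K" L] by simp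
          also have "L / 16 \<le> 1 / 2 * cmod (x - P)" using that(5) by simp
          finally have "\<mu> * cmod (x - E) \<le> cmod (x - P)" using norm_ge_zero[of "x - P"] by linarith
          then have "\<mu> \<le> cmod (x - P) / cmod (x - E)" using that(3) by (simp add: field_simps)
          then have "ln \<mu> \<le> ln (cmod (x - P) / cmod (x - E))" using \<mu> by (intro ln_mono) auto
          then have "k - h \<le> ln \<iota>" using \<alpha> that(1) by (simp add: k_def mult_left_mono)
          then show ?thesis using \<iota>(1) by (metis exp_le_cancel_iff exp_ln)
        qed
        have "L \<le> cmod (z - q) + b"
          using dist_triangle[of z w q] wqb by (simp add: dist_norm L_def norm_minus_commute)
        then have zq: "L / 8 \<le> cmod (z - q)" using bL L0 by linarith
        have pq: "3 / 4 * L \<le> cmod (p - q)"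
        proof -
          have "L \<le> a + cmod (p - w)" using dist_triangle[of z w p] zpa by (simp add: dist_norm L_def)
          moreover have "cmod (p - w) \<le> cmod (p - q) + b"
            using dist_triangle[of p w q] wqb by (simp add: dist_norm norm_minus_commute)
          ultimately show ?thesis using aL bL by linarith
        qed
        have "(pi / 2) / (pi / 2 + \<iota>) * (((k - Re (f z)) + (k - Re (g w))) / 2 - ln 2) \<le> caratheodory_dist D z w"
        proof (rule two_peaks_le_caratheodory[OF D z w f _ g _ \<iota>])
          have "exp (k - Re (g z)) \<le> \<iota>" by (rule small[of _ z q e']) (use gp[OF z] e' zq in auto)
          then show "exp (k - Re (g z)) \<le> 1" using \<iota>(2) by linarith
          have "exp (k - Re (f w)) \<le> \<iota>" by (rule small[of _ w p e]) (use fp[OF w] e wp L0 in auto)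
          then show "exp (k - Re (f w)) \<le> 1" using \<iota>(2) by linarith
          fix x assume x: "x \<in> D"
          have "L / 8 \<le> cmod (x - p) \<or> L / 8 \<le> cmod (x - q)"
          proof -
            have "cmod (p - q) \<le> cmod (x - p) + cmod (x - q)"
              using dist_triangle[of p q x] by (simp add: dist_norm norm_minus_commute)
            then show ?thesis using pq L0 by linarith
          qed
          then show "exp (k - Re (f x)) \<le> \<iota> \<or> exp (k - Re (g x)) \<le> \<iota>"
          proof
            assume "L / 8 \<le> cmod (x - p)"
            then have "exp (k - Re (f x)) \<le> \<iota>" by (intro small[of _ x p e]) (use fp[OF x] e in auto)
            then show ?thesis ..
          next
            assume "L / 8 \<le> cmod (x - q)"
            then have "exp (k - Re (g x)) \<le> \<iota>" by (intro small[of _ x q e']) (use gp[OF x] e' in auto)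
            then show ?thesis ..
          qed
        qed (use fp gp in auto)
        then have 1: "\<alpha> * (((k - Re (f z)) + (k - Re (g w))) / 2 - ln 2) \<le> caratheodory_dist D z w"
          by (simp only: b\<alpha>)
        have bound: "\<alpha> * (ln (L / y) - ln (32 * K)) + ln \<iota> \<le> k - \<alpha> * ln (y / t)"
          if "0 < y" "l / 2 \<le> t" for y t
        proof -
          have t: "0 < t" using that l by linarith
          have "\<mu> * (l / 2) / y \<le> \<mu> * t / y" using \<mu> that by (intro divide_right_mono mult_left_mono) auto
          moreover have "\<mu> * (l / 2) / y = (L / y) / (32 * K)" using l by (simp add: \<mu>_def)
          ultimately have "ln ((L / y) / (32 * K)) \<le> ln (\<mu> * t / y)" using L0 K that by (intro ln_mono) auto
          then have "ln (L / y) - ln (32 * K) \<le> ln \<mu> - ln (y / t)"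
          proof -
            have "ln ((L / y) / (32 * K)) = ln (L / y) - ln (32 * K)" using L0 K that by (intro ln_divide_pos) auto
            moreover have "ln (\<mu> * t / y) = ln \<mu> + ln t - ln y" using \<mu> t that
              by (simp add: ln_divide_pos ln_mult_pos)
            moreover have "ln (y / t) = ln y - ln t" using t that by (simp add: ln_divide_pos)
            ultimately show ?thesis using \<open>ln ((L / y) / (32 * K)) \<le> ln (\<mu> * t / y)\<close> by linarith
          qed
          then have "\<alpha> * (ln (L / y) - ln (32 * K)) \<le> \<alpha> * (ln \<mu> - ln (y / t))" using \<alpha> by (intro mult_left_mono) auto
          then show ?thesis by (simp add: k_def algebra_simps)
        qed
        have "\<alpha> * (ln (L / a) - ln (32 * K)) + ln \<iota> \<le> k - Re (f z)"
          using bound[OF ab(1) ze] fp[OF z] zpa by simp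
        have "\<alpha> * (ln (L / b) - ln (32 * K)) + ln \<iota> \<le> k - Re (g w)"
          using bound[OF ab(2) we'] gp[OF w] wqb by simp
        have arith: "X - (m - i + c) \<le> V - c" if "P + i \<le> V" "Q \<le> P" "R \<le> 1 * m" "Q = X - R" for X m i c V P Q R :: real
          using that by linarith
        from \<open>\<alpha> * (ln (L / a) - ln (32 * K)) + ln \<iota> \<le> k - Re (f z)\<close> \<open>\<alpha> * (ln (L / b) - ln (32 * K)) + ln \<iota> \<le> k - Re (g w)\<close>
        have "\<alpha> * ((ln (L / a) + ln (L / b)) / 2 - ln (32 * K)) + ln \<iota> \<le> ((k - Re (f z)) + (k - Re (g w))) / 2"
        proof -
          have "\<alpha> * ((A + B) / 2 - c) + i = ((\<alpha> * (A - c) + i) + (\<alpha> * (B - c) + i)) / 2" for A B c i :: real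
            by (simp add: field_simps)
          then show ?thesis using add_mono[OF \<open>\<alpha> * (ln (L / a) - ln (32 * K)) + ln \<iota> \<le> k - Re (f z)\<close>
              \<open>\<alpha> * (ln (L / b) - ln (32 * K)) + ln \<iota> \<le> k - Re (g w)\<close>] by (simp only: divide_right_mono)
        qed
        moreover have "\<alpha> * (s - ln (3 / 2) - ln (32 * K)) \<le> \<alpha> * ((ln (L / a) + ln (L / b)) / 2 - ln (32 * K))"
          using s_le \<alpha> by (intro mult_left_mono) auto
        moreover have "\<alpha> * (ln (3 / 2) + ln (32 * K)) \<le> 1 * (ln (3 / 2) + ln (32 * K))"
          using \<alpha> K by (intro mult_right_mono) auto
        moreover have "\<alpha> * (s - ln (3 / 2) - ln (32 * K)) = \<alpha> * s - \<alpha> * (ln (3 / 2) + ln (32 * K))"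
          by (simp add: algebra_simps)
        ultimately have "\<alpha> * s - C2 \<le> ((k - Re (f z)) + (k - Re (g w))) / 2 - ln 2"
          unfolding C2_def by (rule arith)
        then have "\<alpha> * (\<alpha> * s - C2) \<le> caratheodory_dist D z w"
          using \<alpha> by (intro order.trans[OF mult_left_mono 1]) auto
        moreover have "\<alpha> * C2 \<le> 1 * C2" using \<alpha> C by (intro mult_right_mono) auto
        ultimately show "\<alpha> * \<alpha> * s - (C1 + C2) \<le> caratheodory_dist D z w" using C by (simp add: algebra_simps)
      qed
    qed
  qed
qed

text \<open>The set S is a single boundary point for the limit at that point, and the whole frontier for the
  uniform statement; smoothness enters the estimates of the distances only in this form.\<close>

definition flat_along :: "complex set \<Rightarrow> complex set \<Rightarrow> bool"
  where "flat_along D S \<longleftrightarrow> S \<subseteq> frontier D \<and> S \<noteq> {} \<and>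
    (\<forall>\<epsilon>>0. \<exists>r>0. \<forall>p\<in>frontier D. infdist p S < r \<longrightarrow> (\<exists>n. has_cones D \<epsilon> r p n))"

text \<open>When S is the whole frontier, the cones are available at the point nearest to any z, even to a z far
  from the boundary.\<close>

lemma flat_along_nearest:
  assumes "flat_along D S" "0 < \<epsilon>"
  shows "\<exists>r>0. \<forall>z p. infdist z S < r \<or> S = frontier D \<longrightarrow> p \<in> frontier D \<longrightarrow> dist z p = bdry_dist D z \<longrightarrow>
     (\<exists>n. has_cones D \<epsilon> r p n)"
proof -
  have S: "S \<subseteq> frontier D" "S \<noteq> {}" using assms(1) by (auto simp: flat_along_def)
  obtain r where r: "0 < r" "\<And>p. p \<in> frontier D \<Longrightarrow> infdist p S < r \<Longrightarrow> \<exists>n. has_cones D \<epsilon> r p n"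
    using assms unfolding flat_along_def by blast
  show ?thesis
  proof (rule exI[of _ "r / 2"], intro conjI allI impI)
    fix z p assume z: "infdist z S < r / 2 \<or> S = frontier D" and p: "p \<in> frontier D" "dist z p = bdry_dist D z"
    have "infdist p S < r"
    proof (cases "S = frontier D")
      case True then show ?thesis using p(1) r(1) by (simp add: infdist_zero)
    next
      case False
      have "infdist p S \<le> infdist z S + dist p z" by (rule infdist_triangle)
      moreover have "bdry_dist D z \<le> infdist z S" unfolding bdry_dist_def using S by (rule infdist_mono)
      ultimately show ?thesis using False z p(2) by (simp add: dist_commute)
    qed
    then obtain n where "has_cones D \<epsilon> r p n" using r(2) p(1) by blast
    then show "\<exists>n. has_cones D \<epsilon> (r / 2) p n" using has_cones_mono[of D \<epsilon> r p n \<epsilon> "r / 2"] r(1) by auto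
  qed (use r in auto)
qed

lemma flat_along_pinched:
  assumes flat: "flat_along D S" and D: "domain D" and \<eta>: "0 < \<eta>" "\<eta> \<le> 1" and R: "0 < R"
  shows "\<exists>\<delta>>0. \<forall>z\<in>D. \<forall>w\<in>D. infdist z S < \<delta> \<longrightarrow> s_fun D z w \<le> N \<longrightarrow> pinched D \<eta> R z w"
proof -
  have oD: "open D" and S: "S \<subseteq> frontier D" "S \<noteq> {}" using flat D by (auto simp: flat_along_def domain_def)
  obtain \<epsilon> where \<epsilon>: "0 < \<epsilon>" and pn: "\<And>r. 0 < r \<Longrightarrow> \<exists>\<delta>>0. \<forall>D z w p n. open D \<longrightarrow> z \<in> D \<longrightarrow> w \<in> D \<longrightarrow> p \<in> frontier D \<longrightarrow>
      dist z p = bdry_dist D z \<longrightarrow> has_cones D \<epsilon> r p n \<longrightarrow> bdry_dist D z < \<delta> \<longrightarrow> s_fun D z w \<le> N \<longrightarrow>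
      pinched D \<eta> r z w"
    using pinched_near_boundary[OF \<eta>, of N] by blast
  obtain r where r: "0 < r" "\<And>z p. infdist z S < r \<or> S = frontier D \<Longrightarrow> p \<in> frontier D \<Longrightarrow> dist z p = bdry_dist D z \<Longrightarrow>
     (\<exists>n. has_cones D \<epsilon> r p n)"
    using flat_along_nearest[OF flat \<epsilon>] by blast
  define r' where "r' = min r R"
  have r': "0 < r'" using r R by (simp add: r'_def)
  obtain \<delta> where \<delta>: "0 < \<delta>" "\<And>D z w p n. open D \<Longrightarrow> z \<in> D \<Longrightarrow> w \<in> D \<Longrightarrow> p \<in> frontier D \<Longrightarrow>
      dist z p = bdry_dist D z \<Longrightarrow> has_cones D \<epsilon> r' p n \<Longrightarrow> bdry_dist D z < \<delta> \<Longrightarrow> s_fun D z w \<le> N \<Longrightarrow>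
      pinched D \<eta> r' z w"
    using pn[OF r'] by blast
  show ?thesis
  proof (rule exI[of _ "min \<delta> r"], intro conjI ballI impI)
    fix z w assume z: "z \<in> D" and w: "w \<in> D" and dz: "infdist z S < min \<delta> r" and s: "s_fun D z w \<le> N"
    obtain p where p: "p \<in> frontier D" "dist z p = bdry_dist D z"
      using ex_nearest_frontier_point S by blast
    then obtain n where "has_cones D \<epsilon> r p n" using r(2)[of z p] dz by auto
    then have "has_cones D \<epsilon> r' p n" by (rule has_cones_mono) (auto simp: r'_def)
    moreover have "bdry_dist D z < \<delta>"
      using infdist_mono[OF S, of z] dz by (simp add: bdry_dist_def)
    ultimately have "pinched D \<eta> r' z w" using \<delta>(2) oD z w p s by blast
    moreover have "ball z r' \<subseteq> ball z R" by (rule subset_ball) (simp add: r'_def)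
    ultimately show "pinched D \<eta> R z w" unfolding pinched_def by (meson order.trans)
  qed (use \<delta> r in auto)
qed

text \<open>Exterior discs handle moderate s, and peak functions handle large s.\<close>

lemma caratheodory_lower_bound:
  assumes flat: "flat_along D S" and D: "domain D" and \<eta>: "0 < \<eta>" "\<eta> \<le> 1"
  shows "\<exists>\<delta>>0. \<forall>z\<in>D. \<forall>w\<in>D. infdist z S < \<delta> \<longrightarrow> infdist w S < \<delta> \<or> S = frontier D \<longrightarrow> cmod (z - w) \<le> M \<longrightarrow>
     (1 - \<eta>) * s_fun D z w \<le> caratheodory_dist D z w"
proof -
  have oD: "open D" and S: "S \<subseteq> frontier D" "S \<noteq> {}" using flat D by (auto simp: flat_along_def domain_def)
  obtain \<epsilon> where \<epsilon>: "0 < \<epsilon>" and far: "\<forall>r>0. \<forall>K\<ge>1. \<exists>N. \<forall>D z w p q n n'. domain D \<longrightarrow> z \<in> D \<longrightarrow> w \<in> D \<longrightarrow>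
     p \<in> frontier D \<longrightarrow> q \<in> frontier D \<longrightarrow> dist z p = bdry_dist D z \<longrightarrow> dist w q = bdry_dist D w \<longrightarrow>
     has_cones D \<epsilon> r p n \<longrightarrow> has_cones D \<epsilon> r q n' \<longrightarrow> bdry_dist D z \<le> bdry_dist D w \<longrightarrow>
     cmod (z - w) \<le> K * r \<longrightarrow> N \<le> s_fun D z w \<longrightarrow> (1 - \<eta>) * s_fun D z w \<le> caratheodory_dist D z w"
    using caratheodory_far[OF \<eta>] by blast
  obtain r where r: "0 < r" "\<And>z p. infdist z S < r \<or> S = frontier D \<Longrightarrow> p \<in> frontier D \<Longrightarrow> dist z p = bdry_dist D z \<Longrightarrow>
     (\<exists>n. has_cones D \<epsilon> r p n)"
    using flat_along_nearest[OF flat \<epsilon>] by blast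
  define K where "K = max 1 (M / r)"
  have "M / r * r \<le> K * r" using r by (intro mult_right_mono) (auto simp: K_def)
  then have K: "1 \<le> K" "M \<le> K * r" using r by (auto simp: K_def)
  obtain N where N: "\<And>z w p q n n'. z \<in> D \<Longrightarrow> w \<in> D \<Longrightarrow>
     p \<in> frontier D \<Longrightarrow> q \<in> frontier D \<Longrightarrow> dist z p = bdry_dist D z \<Longrightarrow> dist w q = bdry_dist D w \<Longrightarrow>
     has_cones D \<epsilon> r p n \<Longrightarrow> has_cones D \<epsilon> r q n' \<Longrightarrow> bdry_dist D z \<le> bdry_dist D w \<Longrightarrow>
     cmod (z - w) \<le> K * r \<Longrightarrow> N \<le> s_fun D z w \<Longrightarrow> (1 - \<eta>) * s_fun D z w \<le> caratheodory_dist D z w"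
    using far[rule_format, OF r(1) K(1)] D by blast
  obtain \<delta> where \<delta>: "0 < \<delta>" "\<forall>z\<in>D. \<forall>w\<in>D. infdist z S < \<delta> \<longrightarrow> s_fun D z w \<le> N \<longrightarrow> pinched D \<eta> 1 z w"
    using flat_along_pinched[OF flat D \<eta>, of 1 N] by auto
  show ?thesis
  proof (rule exI[of _ "min \<delta> r"], intro conjI ballI impI)
    fix z w assume z: "z \<in> D" and w: "w \<in> D" and dz: "infdist z S < min \<delta> r"
      and dw: "infdist w S < min \<delta> r \<or> S = frontier D" and M: "cmod (z - w) \<le> M"
    show "(1 - \<eta>) * s_fun D z w \<le> caratheodory_dist D z w"
    proof (cases "s_fun D z w \<le> N")
      case True
      then have "pinched D \<eta> 1 z w" using \<delta> z w dz by auto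
      then obtain c' \<rho> where "0 < \<rho>" "ball c' \<rho> \<inter> D = {}" "(1 - \<eta>) * s_fun D z w \<le> exterior_dist c' \<rho> z w"
        unfolding pinched_def by blast
      then show ?thesis using exterior_dist_le_caratheodory[OF D _ _ z w] by fastforce
    next
      case False
      obtain p where p: "p \<in> frontier D" "dist z p = bdry_dist D z" using ex_nearest_frontier_point S by blast
      obtain q where q: "q \<in> frontier D" "dist w q = bdry_dist D w" using ex_nearest_frontier_point S by blast
      obtain n where n: "has_cones D \<epsilon> r p n" using r(2)[of z p] p dz by auto
      obtain n' where n': "has_cones D \<epsilon> r q n'" using r(2)[of w q] q dw by auto
      have M': "cmod (z - w) \<le> K * r" "cmod (w - z) \<le> K * r" using M K by (auto simp: norm_minus_commute)
      show ?thesis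
      proof (cases "bdry_dist D z \<le> bdry_dist D w")
        case True
        then show ?thesis using N[OF z w p(1) q(1) p(2) q(2) n n' _ M'(1)] False by simp
      next
        case 2: False
        then show ?thesis using N[OF w z q(1) p(1) q(2) p(2) n' n _ M'(2)] False
          by (simp add: s_fun_commute caratheodory_commute[OF D z w])
      qed
    qed
  qed (use \<delta> r in auto)
qed

section \<open>Length estimates for the Bergman metric\<close>

text \<open>The fundamental theorem of calculus on the two ends of [0,1]: a curve is estimated there, whereas in between it may
  run where nothing is known about the metric.\<close>

lemma nn_integral_ge_increments:
  fixes f1 f2 h :: "real \<Rightarrow> real"
  assumes t: "0 \<le> t1" "t1 \<le> t2" "t2 \<le> 1"
    and d1: "\<And>t. t \<in> {0..t1} \<Longrightarrow> (f1 has_real_derivative f1' t) (at t)" and c1: "continuous_on {0..t1} f1'"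
    and d2: "\<And>t. t \<in> {t2..1} \<Longrightarrow> (f2 has_real_derivative f2' t) (at t)" and c2: "continuous_on {t2..1} f2'"
    and h1: "\<And>t. t \<in> {0..t1} \<Longrightarrow> f1' t \<le> h t" and h2: "\<And>t. t \<in> {t2..1} \<Longrightarrow> f2' t \<le> h t"
  shows "ennreal ((f1 t1 - f1 0) + (f2 1 - f2 t2)) \<le> (\<integral>\<^sup>+t\<in>{0..1}. ennreal (h t) \<partial>lborel)"
proof -
  have inc: "ennreal (f b - f a) \<le> (\<integral>\<^sup>+t\<in>{a..b}. ennreal (f' t) \<partial>lborel)"
    and meas: "(\<lambda>t. ennreal (f' t) * indicator {a..b} t) \<in> borel_measurable lborel"
    if ab: "a \<le> b" and d: "\<And>t. t \<in> {a..b} \<Longrightarrow> (f has_real_derivative f' t) (at t)" and c: "continuous_on {a..b} f'"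
    for f f' :: "real \<Rightarrow> real" and a b
  proof -
    have cp: "continuous_on {a..b} (\<lambda>t. max 0 (f' t))" using c by (intro continuous_intros)
    have m: "set_borel_measurable borel {a..b} (\<lambda>t. max 0 (f' t))"
      using cp by (intro set_borel_measurable_continuous_on) auto
    have e: "(\<lambda>t. ennreal (f' t) * indicator {a..b} t) = (\<lambda>t. ennreal (indicat_real {a..b} t *\<^sub>R max 0 (f' t)))"
      by (auto simp: fun_eq_iff max_def ennreal_neg split: split_indicator)
    show "(\<lambda>t. ennreal (f' t) * indicator {a..b} t) \<in> borel_measurable lborel"
      unfolding e using m unfolding set_borel_measurable_def by measurable
    have "(f' has_integral (f b - f a)) {a..b}"
      using ab d by (intro fundamental_theorem_of_calculus)
        (auto simp: has_real_derivative_iff_has_vector_derivative[symmetric] intro: has_field_derivative_at_within)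
    moreover obtain I where I: "((\<lambda>t. max 0 (f' t)) has_integral I) {a..b}"
      using integrable_continuous_interval[OF cp] by (auto simp: integrable_on_def)
    ultimately have "f b - f a \<le> I" by (rule has_integral_le) auto
    then have "ennreal (f b - f a) \<le> ennreal I" by (rule ennreal_leI)
    also have "\<dots> = (\<integral>\<^sup>+t\<in>{a..b}. ennreal (max 0 (f' t)) \<partial>lborel)"
      by (rule set_nn_integral_eq_has_integral[OF I, symmetric]) auto
    also have "\<dots> = (\<integral>\<^sup>+t\<in>{a..b}. ennreal (f' t) \<partial>lborel)"
      by (intro nn_integral_cong) (auto simp: max_def ennreal_neg)
    finally show "ennreal (f b - f a) \<le> (\<integral>\<^sup>+t\<in>{a..b}. ennreal (f' t) \<partial>lborel)" .
  qed
  have "ennreal ((f1 t1 - f1 0) + (f2 1 - f2 t2)) \<le> ennreal (f1 t1 - f1 0) + ennreal (f2 1 - f2 t2)"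
  proof (cases "0 \<le> f1 t1 - f1 0 \<and> 0 \<le> f2 1 - f2 t2")
    case True then show ?thesis by (simp flip: ennreal_plus)
  next
    case False
    then have "ennreal ((f1 t1 - f1 0) + (f2 1 - f2 t2)) \<le> ennreal (f1 t1 - f1 0) \<or>
      ennreal ((f1 t1 - f1 0) + (f2 1 - f2 t2)) \<le> ennreal (f2 1 - f2 t2)"
      by (cases "f1 t1 - f1 0 < 0") (auto intro!: ennreal_leI)
    then show ?thesis by (metis add.commute add_increasing2 zero_le)
  qed
  also have "\<dots> \<le> (\<integral>\<^sup>+t\<in>{0..t1}. ennreal (f1' t) \<partial>lborel) + (\<integral>\<^sup>+t\<in>{t2..1}. ennreal (f2' t) \<partial>lborel)"
    using t d1 d2 c1 c2 by (intro add_mono inc)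
  also have "\<dots> = (\<integral>\<^sup>+t. ennreal (f1' t) * indicator {0..t1} t + ennreal (f2' t) * indicator {t2..1} t \<partial>lborel)"
    using meas[OF t(1) d1 c1] meas[OF t(3) d2 c2] by (intro nn_integral_add[symmetric])
  also have "\<dots> \<le> (\<integral>\<^sup>+t\<in>{0..1}. ennreal (h t) \<partial>lborel)"
  proof (rule nn_integral_mono_AE, rule eventually_mono[OF AE_lborel_singleton[of t1]])
    fix t assume "t \<noteq> t1"
    then show "ennreal (f1' t) * indicator {0..t1} t + ennreal (f2' t) * indicator {t2..1} t \<le> ennreal (h t) * indicator {0..1} t"
      using h1[of t] h2[of t] t by (auto intro!: ennreal_leI split: split_indicator)
  qed
  finally show ?thesis .
qed

definition curve_in :: "complex set \<Rightarrow> complex \<Rightarrow> complex \<Rightarrow> (real \<Rightarrow> complex) \<Rightarrow> bool"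
  where "curve_in D z w \<gamma> \<longleftrightarrow> \<gamma> C1_differentiable_on {0..1} \<and> path_image \<gamma> \<subseteq> D \<and> pathstart \<gamma> = z \<and> pathfinish \<gamma> = w"

lemma curve_in_D:
  assumes "curve_in D z w \<gamma>"
  shows "\<gamma> 0 = z" "\<gamma> 1 = w" "t \<in> {0..1} \<Longrightarrow> \<gamma> t \<in> D"
    "t \<in> {0..1} \<Longrightarrow> (\<gamma> has_vector_derivative vector_derivative \<gamma> (at t)) (at t)"
    "continuous_on {0..1} (\<lambda>t. vector_derivative \<gamma> (at t))" "continuous_on {0..1} \<gamma>"
proof -
  show 1: "\<gamma> 0 = z" "\<gamma> 1 = w" "t \<in> {0..1} \<Longrightarrow> \<gamma> t \<in> D"
    using assms by (auto simp: curve_in_def path_image_def pathstart_def pathfinish_def)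
  have C1: "\<gamma> C1_differentiable_on {0..1}" using assms by (simp add: curve_in_def)
  then show d: "t \<in> {0..1} \<Longrightarrow> (\<gamma> has_vector_derivative vector_derivative \<gamma> (at t)) (at t)" for t
    unfolding C1_differentiable_on_eq by (simp add: vector_derivative_works)
  show "continuous_on {0..1} (\<lambda>t. vector_derivative \<gamma> (at t))" using C1 unfolding C1_differentiable_on_eq by simp
  show "continuous_on {0..1} \<gamma>"
    using d by (intro continuous_at_imp_continuous_on ballI has_vector_derivative_continuous) auto
qed

lemma ln_dist_along_curve:
  fixes \<gamma> :: "real \<Rightarrow> complex"
  assumes d: "(\<gamma> has_vector_derivative v) (at t)" and q: "\<gamma> t \<noteq> q"
  shows "((\<lambda>t. ln (cmod (\<gamma> t - q))) has_real_derivative ((\<gamma> t - q) \<bullet> v) / (cmod (\<gamma> t - q))\<^sup>2) (at t)"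
    and "\<bar>((\<gamma> t - q) \<bullet> v) / (cmod (\<gamma> t - q))\<^sup>2\<bar> \<le> cmod v / cmod (\<gamma> t - q)"
proof -
  let ?y = "\<lambda>t. \<gamma> t - q"
  have y: "(?y has_derivative (\<lambda>h. h *\<^sub>R v)) (at t)"
    using d by (auto simp: has_vector_derivative_def intro!: derivative_eq_intros)
  have "((\<lambda>t. ?y t \<bullet> ?y t) has_derivative (\<lambda>h. ?y t \<bullet> (h *\<^sub>R v) + (h *\<^sub>R v) \<bullet> ?y t)) (at t)"
    by (rule has_derivative_inner[OF y y])
  then have "((\<lambda>t. ?y t \<bullet> ?y t) has_real_derivative 2 * (?y t \<bullet> v)) (at t)"
  proof -
    have "(\<lambda>h. ?y t \<bullet> (h *\<^sub>R v) + (h *\<^sub>R v) \<bullet> ?y t) = (*) (2 * (?y t \<bullet> v))"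
      by (auto simp: fun_eq_iff inner_commute)
    then show ?thesis using \<open>((\<lambda>t. ?y t \<bullet> ?y t) has_derivative (\<lambda>h. ?y t \<bullet> (h *\<^sub>R v) + (h *\<^sub>R v) \<bullet> ?y t)) (at t)\<close>
      unfolding has_field_derivative_def by metis
  qed
  moreover have p: "0 < ?y t \<bullet> ?y t" using q by simp
  ultimately have "((\<lambda>t. ln (?y t \<bullet> ?y t) * (1 / 2)) has_real_derivative 1 / (?y t \<bullet> ?y t) * (2 * (?y t \<bullet> v)) * (1 / 2)) (at t)"
    by (intro DERIV_cmult_right DERIV_chain2[OF DERIV_ln_divide])
  moreover have "ln (x \<bullet> x) * (1 / 2) = ln (cmod x)" for x
    by (cases "x = 0") (auto simp: power2_norm_eq_inner[symmetric] ln_realpow)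
  ultimately show "((\<lambda>t. ln (cmod (\<gamma> t - q))) has_real_derivative ((\<gamma> t - q) \<bullet> v) / (cmod (\<gamma> t - q))\<^sup>2) (at t)"
    by (simp add: power2_norm_eq_inner)
  have "\<bar>?y t \<bullet> v\<bar> / (cmod (?y t))\<^sup>2 \<le> cmod (?y t) * cmod v / (cmod (?y t))\<^sup>2"
    by (intro divide_right_mono Cauchy_Schwarz_ineq2) auto
  then show "\<bar>((\<gamma> t - q) \<bullet> v) / (cmod (\<gamma> t - q))\<^sup>2\<bar> \<le> cmod v / cmod (\<gamma> t - q)"
    using q by (simp add: abs_divide power2_eq_square)
qed

lemma bergman_metric_nonneg:
  assumes D: "open D" and z: "z \<in> D"
  shows "0 \<le> bergman_metric D z"
proof -
  obtain r where r: "0 < r" "ball z r \<subseteq> D" using D z open_contains_ball by blast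
  have zb: "z \<in> ball z r" using r by simp
  note p = disc_chart_props[OF r(1) zb]
  have hol: "disc_chart z r z holomorphic_on ball 0 1" "disc_chart z r z ` ball 0 1 \<subseteq> D"
    using p(1) r(2) by (auto simp: holo_maps_def)
  have nz: "deriv (disc_chart z r z) 0 \<noteq> 0" using p(5) r by auto
  have 0: "(\<lambda>_. 0) holomorphic_on D" "l2sq D (\<lambda>_. 0) \<le> 1" by (auto simp: l2sq_def)
  have "0 \<le> bergman_M D z" using bergman_M_upper(2)[OF D hol(1) p(2) hol(2) nz 0] p(3) by simp
  moreover have "0 \<le> bergman_K D z" using bergman_K_upper(2)[OF D hol(1) p(2) hol(2) nz 0] p(3) by simp
  ultimately show ?thesis by (simp add: bergman_metric_def)
qed

text \<open>Since \<open>d(x) \<le> |x - p|\<close>, the function \<open>log |x - p|\<close> changes along a curve by at most the integral of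
  \<open>|dx| / d(x)\<close>. The number e is 0 when only the initial piece of the curve is used.\<close>

lemma bergman_length_ge_ln:
  assumes \<gamma>: "curve_in D z w \<gamma>" and D: "open D" "frontier D \<noteq> {}" and W: "W \<subseteq> D"
    and \<kappa>: "0 \<le> \<kappa>" "\<And>x. x \<in> W \<Longrightarrow> \<kappa> / bdry_dist D x \<le> bergman_metric D x"
    and t: "0 \<le> t1" "t1 \<le> t2" "t2 \<le> 1"
    and inW: "\<And>t. t \<in> {0..t1} \<Longrightarrow> \<gamma> t \<in> W" "e = 0 \<or> e = 1 \<and> (\<forall>t\<in>{t2..1}. \<gamma> t \<in> W)"
    and p: "p \<in> frontier D" and q: "q \<in> frontier D"
  shows "ennreal (\<kappa> * (ln (cmod (\<gamma> t1 - p)) - ln (cmod (z - p)) + e * (ln (cmod (\<gamma> t2 - q)) - ln (cmod (w - q)))))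
     \<le> bergman_length D \<gamma>"
proof -
  note g = curve_in_D[OF \<gamma>]
  let ?v = "\<lambda>t. vector_derivative \<gamma> (at t)"
  have pq: "p \<notin> D" "q \<notin> D" using p q D frontier_disjoint_eq by blast+
  have "ennreal ((\<kappa> * ln (cmod (\<gamma> t1 - p)) - \<kappa> * ln (cmod (\<gamma> 0 - p))) +
      (- (\<kappa> * e) * ln (cmod (\<gamma> 1 - q)) - - (\<kappa> * e) * ln (cmod (\<gamma> t2 - q))))
    \<le> (\<integral>\<^sup>+t\<in>{0..1}. ennreal (bergman_metric D (\<gamma> t) * cmod (?v t)) \<partial>lborel)"
  proof (rule nn_integral_ge_increments[OF t])
    have bound: "\<kappa> * (cmod (?v t) / cmod (\<gamma> t - x)) \<le> bergman_metric D (\<gamma> t) * cmod (?v t)"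
      if "\<gamma> t \<in> W" "x \<in> frontier D" for t x
    proof -
      have d: "0 < bdry_dist D (\<gamma> t)" "bdry_dist D (\<gamma> t) \<le> cmod (\<gamma> t - x)"
        using bdry_dist_pos[OF D(1) _ D(2)] bdry_dist_le_frontier[OF that(2), of "\<gamma> t"] W that by (auto simp: dist_norm)
      have "\<kappa> / cmod (\<gamma> t - x) \<le> \<kappa> / bdry_dist D (\<gamma> t)" using d \<kappa>(1) less_le_trans[OF d] by (intro divide_left_mono mult_pos_pos) auto
      also have "\<dots> \<le> bergman_metric D (\<gamma> t)" using \<kappa>(2) that(1) .
      finally have "\<kappa> / cmod (\<gamma> t - x) * cmod (?v t) \<le> bergman_metric D (\<gamma> t) * cmod (?v t)" by (intro mult_right_mono) auto
      then show ?thesis by simp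
    qed
    have in01: "{0..t1} \<subseteq> {0..1}" "{t2..1} \<subseteq> {0..1}" using t by auto
    have cont: "continuous_on A (\<lambda>t. k * (((\<gamma> t - x) \<bullet> ?v t) / (cmod (\<gamma> t - x))\<^sup>2))"
      if "A \<subseteq> {0..1}" "x \<notin> D" for A k x
      using that g(3) by (intro continuous_intros continuous_on_subset[OF g(5)] continuous_on_subset[OF g(6)]) auto
    show "continuous_on {0..t1} (\<lambda>t. \<kappa> * (((\<gamma> t - p) \<bullet> ?v t) / (cmod (\<gamma> t - p))\<^sup>2))"
      "continuous_on {t2..1} (\<lambda>t. - (\<kappa> * e) * (((\<gamma> t - q) \<bullet> ?v t) / (cmod (\<gamma> t - q))\<^sup>2))"
      using cont in01 pq by blast+
    fix t
    show "((\<lambda>t. \<kappa> * ln (cmod (\<gamma> t - p))) has_real_derivative \<kappa> * (((\<gamma> t - p) \<bullet> ?v t) / (cmod (\<gamma> t - p))\<^sup>2)) (at t)"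
      if "t \<in> {0..t1}"
      using g(3,4)[of t] that in01 pq by (intro DERIV_cmult ln_dist_along_curve(1)) auto
    show "((\<lambda>t. - (\<kappa> * e) * ln (cmod (\<gamma> t - q))) has_real_derivative - (\<kappa> * e) * (((\<gamma> t - q) \<bullet> ?v t) / (cmod (\<gamma> t - q))\<^sup>2)) (at t)"
      if "t \<in> {t2..1}"
      using g(3,4)[of t] that in01 pq by (intro DERIV_cmult ln_dist_along_curve(1)) auto
    show "\<kappa> * (((\<gamma> t - p) \<bullet> ?v t) / (cmod (\<gamma> t - p))\<^sup>2) \<le> bergman_metric D (\<gamma> t) * cmod (?v t)" if t: "t \<in> {0..t1}"
    proof -
      have "t \<in> {0..1}" "\<gamma> t \<noteq> p" using t in01 g(3)[of t] pq by auto
      from ln_dist_along_curve(2)[OF g(4)[OF this(1)] this(2)]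
      have "\<kappa> * (((\<gamma> t - p) \<bullet> ?v t) / (cmod (\<gamma> t - p))\<^sup>2) \<le> \<kappa> * (cmod (?v t) / cmod (\<gamma> t - p))"
        by (intro mult_left_mono[OF _ \<kappa>(1)]) linarith
      also have "\<dots> \<le> bergman_metric D (\<gamma> t) * cmod (?v t)" by (rule bound[OF inW(1)[OF t] p])
      finally show ?thesis .
    qed
    show "- (\<kappa> * e) * (((\<gamma> t - q) \<bullet> ?v t) / (cmod (\<gamma> t - q))\<^sup>2) \<le> bergman_metric D (\<gamma> t) * cmod (?v t)" if t: "t \<in> {t2..1}"
    proof -
      have t01: "t \<in> {0..1}" and nq: "\<gamma> t \<noteq> q" using t in01 g(3)[of t] pq by auto
      show ?thesis
      proof (cases "e = 0")
        case True
        then show ?thesis using bergman_metric_nonneg[OF D(1) g(3)[OF t01]] by simp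
      next
        case False
        then have e: "e = 1" "\<gamma> t \<in> W" using inW(2) t by auto
        from ln_dist_along_curve(2)[OF g(4)[OF t01] nq]
        have "\<kappa> * (- (((\<gamma> t - q) \<bullet> ?v t) / (cmod (\<gamma> t - q))\<^sup>2)) \<le> \<kappa> * (cmod (?v t) / cmod (\<gamma> t - q))"
          by (intro mult_left_mono[OF _ \<kappa>(1)]) linarith
        also have "\<dots> \<le> bergman_metric D (\<gamma> t) * cmod (?v t)" by (rule bound[OF e(2) q])
        finally show ?thesis using e by simp
      qed
    qed
  qed
  then show ?thesis unfolding bergman_length_def g(1,2) by (simp add: algebra_simps)
qed

text \<open>D lies in the exterior of the ball, so \<open>1 / (2 d)\<close> bounds the density of the Poincare metric of that
  exterior. To avoid lengths of curves in the disc, the image curve is projected to the radius through \<open>\<psi> w\<close>, on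
  which the Poincare distance is artanh.\<close>

lemma bergman_length_ge_exterior_dist:
  assumes \<gamma>: "curve_in D z w \<gamma>" and D: "open D" "frontier D \<noteq> {}" and z: "z \<in> D" and w: "w \<in> D"
    and \<kappa>: "0 \<le> \<kappa>" "\<And>x. x \<in> path_image \<gamma> \<Longrightarrow> \<kappa> / bdry_dist D x \<le> bergman_metric D x"
    and E: "ball c \<rho> \<inter> D = {}" "0 < \<rho>"
  shows "ennreal (2 * \<kappa> * exterior_dist c \<rho> z w) \<le> bergman_length D \<gamma>"
proof -
  note g = curve_in_D[OF \<gamma>]
  let ?v = "\<lambda>t. vector_derivative \<gamma> (at t)"
  define \<psi> where "\<psi> = exterior_chart c \<rho> z"
  note ex = exterior_chart_props[OF D(1) E z, folded \<psi>_def]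
  have hol: "\<psi> holomorphic_on D" and bd: "\<And>x. x \<in> D \<Longrightarrow> cmod (\<psi> x) < 1"
    using ex(1) by (auto simp: holo_maps_def)
  \<comment> \<open>the direction of the radius to project to\<close>
  define u where "u = sgn (\<psi> w)"
  have u: "cmod u \<le> 1" by (simp add: u_def norm_sgn)
  define f where "f t = Re (cnj u * \<psi> (\<gamma> t))" for t
  define f' where "f' t = Re (cnj u * (deriv \<psi> (\<gamma> t) * ?v t))" for t
  have f_lt: "\<bar>f t\<bar> \<le> cmod (\<psi> (\<gamma> t))" for t
  proof -
    have "\<bar>f t\<bar> \<le> cmod (cnj u * \<psi> (\<gamma> t))" unfolding f_def by (rule abs_Re_le_cmod)
    also have "\<dots> \<le> 1 * cmod (\<psi> (\<gamma> t))" unfolding norm_mult using u by (intro mult_right_mono) auto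
    finally show ?thesis by simp
  qed
  have f1: "\<bar>f t\<bar> < 1" if "t \<in> {0..1}" for t using f_lt[of t] bd[OF g(3)[OF that]] by linarith
  have df: "(f has_real_derivative f' t) (at t)" if t: "t \<in> {0..1}" for t
  proof -
    have "(\<psi> has_field_derivative deriv \<psi> (\<gamma> t)) (at (\<gamma> t))" using holomorphic_derivI[OF hol D(1) g(3)[OF t]] .
    from field_vector_diff_chain_at[OF g(4)[OF t] this]
    have "((\<lambda>t. \<psi> (\<gamma> t)) has_vector_derivative ?v t * deriv \<psi> (\<gamma> t)) (at t)" by (simp add: o_def)
    then have "((\<lambda>t. cnj u * \<psi> (\<gamma> t)) has_vector_derivative cnj u * (?v t * deriv \<psi> (\<gamma> t))) (at t)"
      by (rule has_vector_derivative_mult_right)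
    from bounded_linear.has_vector_derivative[OF bounded_linear_Re this]
    show ?thesis unfolding has_real_derivative_iff_has_vector_derivative f_def f'_def by (simp add: mult.commute)
  qed
  have cf: "continuous_on {0..1} f"
    using df by (intro continuous_at_imp_continuous_on ballI) (blast intro: DERIV_isCont)
  have cf': "continuous_on {0..1} f'"
  proof -
    have "continuous_on D (deriv \<psi>)" using holomorphic_deriv[OF hol D(1)] by (rule holomorphic_on_imp_continuous_on)
    from continuous_on_compose2[OF this g(6)] have "continuous_on {0..1} (\<lambda>t. deriv \<psi> (\<gamma> t))" using g(3) by blast
    then show ?thesis unfolding f'_def by (intro continuous_on_Re continuous_on_mult continuous_on_const g(5))
  qed
  have "ennreal ((2 * \<kappa> * artanh (f 1) - 2 * \<kappa> * artanh (f 0)) + (0 - 0)) \<le>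
      (\<integral>\<^sup>+t\<in>{0..1}. ennreal (bergman_metric D (\<gamma> t) * cmod (?v t)) \<partial>lborel)"
  proof (rule nn_integral_ge_increments[where ?t1.0 = 1 and ?t2.0 = 1])
    fix t :: real assume t: "t \<in> {0..1}"
    have t': "t \<in> {0..1}" using t by simp
    show "((\<lambda>t. 2 * \<kappa> * artanh (f t)) has_real_derivative 2 * \<kappa> * (1 / (1 - (f t)\<^sup>2) * f' t)) (at t)"
      using f1[OF t'] by (intro DERIV_cmult DERIV_chain2[OF artanh_real_has_field_derivative df[OF t']]) auto
    have G: "\<gamma> t \<in> D" using g(3)[OF t'] .
    have d: "0 < bdry_dist D (\<gamma> t)" using bdry_dist_pos[OF D(1) G D(2)] .
    have q: "0 < 1 - (cmod (\<psi> (\<gamma> t)))\<^sup>2" using bd[OF G] by (simp add: abs_square_less_1)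
    have "(f t)\<^sup>2 \<le> (cmod (\<psi> (\<gamma> t)))\<^sup>2" using f_lt[of t] by (metis abs_le_square_iff abs_norm_cancel)
    moreover have "f' t \<le> cmod (deriv \<psi> (\<gamma> t)) * cmod (?v t)"
    proof -
      have "f' t \<le> cmod (cnj u * (deriv \<psi> (\<gamma> t) * ?v t))" unfolding f'_def by (rule complex_Re_le_cmod)
      also have "\<dots> \<le> 1 * cmod (deriv \<psi> (\<gamma> t) * ?v t)" using u by (subst norm_mult) (intro mult_right_mono, auto)
      finally show ?thesis by (simp add: norm_mult)
    qed
    ultimately have "f' t / (1 - (f t)\<^sup>2) \<le> cmod (deriv \<psi> (\<gamma> t)) * cmod (?v t) / (1 - (cmod (\<psi> (\<gamma> t)))\<^sup>2)"
      using q by (intro frac_le) auto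
    also have "\<dots> = \<rho> / ((cmod (\<gamma> t - c))\<^sup>2 - \<rho>\<^sup>2) * cmod (?v t)"
      unfolding ex(5)[OF G, symmetric] by simp
    also have "\<dots> \<le> 1 / (2 * bdry_dist D (\<gamma> t)) * cmod (?v t)"
    proof (rule mult_right_mono)
      have a: "bdry_dist D (\<gamma> t) \<le> cmod (\<gamma> t - c) - \<rho>" by (rule bdry_dist_le_exterior_ball[OF D(1) E G])
      have "bdry_dist D (\<gamma> t) * (2 * \<rho>) \<le> (cmod (\<gamma> t - c) - \<rho>) * (cmod (\<gamma> t - c) + \<rho>)"
        using a d E(2) by (intro mult_mono) auto
      also have "\<dots> = (cmod (\<gamma> t - c))\<^sup>2 - \<rho>\<^sup>2" by (simp add: power2_eq_square algebra_simps)
      finally have b: "bdry_dist D (\<gamma> t) * (2 * \<rho>) \<le> (cmod (\<gamma> t - c))\<^sup>2 - \<rho>\<^sup>2" .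
      have "\<rho> / ((cmod (\<gamma> t - c))\<^sup>2 - \<rho>\<^sup>2) \<le> \<rho> / (bdry_dist D (\<gamma> t) * (2 * \<rho>))"
        using E(2) d by (intro divide_left_mono[OF b]) (auto intro!: mult_pos_pos less_le_trans[OF _ b])
      then show "\<rho> / ((cmod (\<gamma> t - c))\<^sup>2 - \<rho>\<^sup>2) \<le> 1 / (2 * bdry_dist D (\<gamma> t))" using E(2) by (simp add: mult.commute)
    qed auto
    finally have "2 * \<kappa> * (f' t / (1 - (f t)\<^sup>2)) \<le> 2 * \<kappa> * (1 / (2 * bdry_dist D (\<gamma> t)) * cmod (?v t))"
      using \<kappa>(1) by (intro mult_left_mono) auto
    also have "\<dots> = \<kappa> / bdry_dist D (\<gamma> t) * cmod (?v t)" by simp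
    also have "\<dots> \<le> bergman_metric D (\<gamma> t) * cmod (?v t)"
      using \<kappa>(2)[of "\<gamma> t"] t' by (intro mult_right_mono) (auto simp: path_image_def)
    finally show "2 * \<kappa> * (1 / (1 - (f t)\<^sup>2) * f' t) \<le> bergman_metric D (\<gamma> t) * cmod (?v t)" by simp
  next
    show "continuous_on {0..1} (\<lambda>t. 2 * \<kappa> * (1 / (1 - (f t)\<^sup>2) * f' t))"
    proof -
      have "1 - (f t)\<^sup>2 \<noteq> 0" if "t \<in> {0..1}" for t using f1[OF that] abs_square_less_1[of "f t"] by linarith
      then show ?thesis by (intro continuous_on_mult continuous_on_divide continuous_on_diff continuous_on_power continuous_on_const cf cf') auto
    qed
    show "((\<lambda>t. 0) has_real_derivative 0) (at t)" for t by simp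
    show "0 \<le> bergman_metric D (\<gamma> t) * cmod (?v t)" if t: "t \<in> {1..1}" for t
    proof -
      have "0 \<le> \<kappa> / bdry_dist D (\<gamma> t)" using \<kappa>(1) by (simp add: bdry_dist_nonneg)
      also have "\<dots> \<le> bergman_metric D (\<gamma> t)" using \<kappa>(2) t by (auto simp: path_image_def)
      finally show ?thesis by simp
    qed
  qed auto
  moreover have "f 0 = 0" by (simp add: f_def g(1) ex(3))
  moreover have "f 1 = cmod (\<psi> w)"
  proof (cases "\<psi> w = 0")
    case False
    have "cnj u * \<psi> w = of_real (cmod (\<psi> w))"
      using False complex_norm_square[of "\<psi> w"]
      by (simp add: u_def sgn_eq field_simps power2_eq_square)
    then show ?thesis by (simp add: f_def g(2))
  qed (simp add: f_def g(2))
  ultimately show ?thesis using ex(6)[OF w] by (simp add: bergman_length_def)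
qed

text \<open>Pinching at the pair (z,z), where \<open>\<kappa>\<close> and \<open>\<kappa>'\<close> are both close to \<open>1 / (2 d)\<close>.\<close>

lemma flat_along_bergman_metric:
  assumes flat: "flat_along D S" and D: "domain D" and \<eta>: "0 < \<eta>" "\<eta> \<le> 1"
  shows "\<exists>\<delta>>0. \<forall>z\<in>D. infdist z S < \<delta> \<longrightarrow>
     (1 - \<eta>) / sqrt 2 / bdry_dist D z \<le> bergman_metric D z \<and>
     bergman_metric D z \<le> (1 + \<eta>) / sqrt 2 / bdry_dist D z"
proof -
  define h where "h = \<eta> / 8"
  have h: "0 < h" "h \<le> 1 / 8" using \<eta> by (auto simp: h_def)
  have oD: "open D" and S: "S \<subseteq> frontier D" "S \<noteq> {}" using flat D by (auto simp: flat_along_def domain_def)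
  obtain \<delta> where \<delta>: "0 < \<delta>" "\<forall>z\<in>D. \<forall>w\<in>D. infdist z S < \<delta> \<longrightarrow> s_fun D z w \<le> 0 \<longrightarrow> pinched D h 1 z w"
    using flat_along_pinched[OF flat D, of h 1 0] h by auto
  have hh: "h * h \<le> h" using mult_left_mono[of h 1 h] h by simp
  have up: "(1 + h)\<^sup>2 / (1 - h) \<le> 1 + \<eta>"
  proof -
    have "(1 + h)\<^sup>2 \<le> 1 + 3 * h" using hh by (simp add: power2_eq_square algebra_simps)
    also have "\<dots> \<le> (1 + \<eta>) * (1 - h)" 
    proof -
      have "\<eta> * h \<le> 1 * h" using \<eta> h by (intro mult_right_mono) auto
      moreover have "(1 + \<eta>) * (1 - h) = 1 + \<eta> - h - \<eta> * h" by (simp add: algebra_simps)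
      moreover have "\<eta> = 8 * h" by (simp add: h_def)
      ultimately show ?thesis using h by linarith
    qed
    finally show ?thesis using h by (simp add: divide_le_eq)
  qed
  have lo: "1 - \<eta> \<le> (1 - h)\<^sup>2 / (1 + h)"
  proof -
    have "(1 - \<eta>) * (1 + h) \<le> 1 - 2 * h"
    proof -
      have "0 \<le> \<eta> * h" using \<eta> h by simp
      moreover have "(1 - \<eta>) * (1 + h) = 1 - \<eta> + h - \<eta> * h" by (simp add: algebra_simps)
      moreover have "\<eta> = 8 * h" by (simp add: h_def)
      ultimately show ?thesis using h by linarith
    qed
    also have "\<dots> \<le> (1 - h)\<^sup>2" by (simp add: power2_eq_square algebra_simps)
    finally show ?thesis using h by (simp add: le_divide_eq)
  qed
  show ?thesis
  proof (rule exI[of _ \<delta>], intro conjI \<delta>(1) ballI impI)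
    fix z assume z: "z \<in> D" and dz: "infdist z S < \<delta>"
    have "s_fun D z z \<le> 0" by (simp add: s_fun_def)
    then have "pinched D h 1 z z" using \<delta> z dz by blast
    then obtain c c' \<rho> where B: "0 < \<rho>" "ball c \<rho> \<subseteq> D" "ball c' \<rho> \<inter> D = {}" "z \<in> ball c \<rho>"
      and k: "\<rho> / (\<rho>\<^sup>2 - (cmod (z - c))\<^sup>2) \<le> (1 + h) / (2 * bdry_dist D z)"
        "(1 - h) / (2 * bdry_dist D z) \<le> \<rho> / ((cmod (z - c'))\<^sup>2 - \<rho>\<^sup>2)"
      unfolding pinched_def by blast
    define d where "d = bdry_dist D z"
    have d: "0 < d" using bdry_dist_pos[OF oD z] S by (auto simp: d_def)
    define x y where "x = \<rho> / (\<rho>\<^sup>2 - (cmod (z - c))\<^sup>2)" and "y = \<rho> / ((cmod (z - c'))\<^sup>2 - \<rho>\<^sup>2)"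
    have "0 < \<rho>\<^sup>2 - (cmod (z - c))\<^sup>2"
      using B power_strict_mono[of "cmod (z - c)" \<rho> 2] by (simp add: dist_norm norm_minus_commute)
    then have x: "0 < x" "x \<le> (1 + h) / (2 * d)" using k(1) B(1) by (auto simp: x_def d_def)
    have y: "(1 - h) / (2 * d) \<le> y" using k(2) by (simp add: y_def d_def)
    have y0: "0 < (1 - h) / (2 * d)" using h d by simp
    have half: "sqrt 2 / 2 = 1 / sqrt (2::real)" by (metis real_div_sqrt zero_le_numeral divide_divide_eq_left' inverse_eq_divide real_sqrt_mult_self mult.commute sqrt_divide_self_eq)
    note bb = bergman_metric_between_balls[OF oD B(2,1,4,3,1), folded x_def y_def]
    have "bergman_metric D z \<le> sqrt 2 * x\<^sup>2 / y" by (rule bb(1))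
    also have "\<dots> \<le> sqrt 2 * ((1 + h) / (2 * d))\<^sup>2 / ((1 - h) / (2 * d))"
      using x y y0 by (intro frac_le mult_left_mono power_mono) auto
    also have "\<dots> = (sqrt 2 / 2) * ((1 + h)\<^sup>2 / (1 - h)) / d"
      using d h by (simp add: power2_eq_square field_simps)
    also have "\<dots> \<le> (sqrt 2 / 2) * (1 + \<eta>) / d" using up d by (intro divide_right_mono mult_left_mono) auto
    finally have 1: "bergman_metric D z \<le> (1 + \<eta>) / sqrt 2 / d" unfolding half by simp
    have gen: "(s / 2) * (u\<^sup>2 / v) / d = s * (u / (2 * d))\<^sup>2 / (v / (2 * d))" if "v \<noteq> 0" for s u v :: real
      using that d by (simp add: power2_eq_square field_simps)
    have "(1 - \<eta>) / sqrt 2 / d = (sqrt 2 / 2) * (1 - \<eta>) / d" unfolding half by simp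
    also have "\<dots> \<le> (sqrt 2 / 2) * ((1 - h)\<^sup>2 / (1 + h)) / d" using lo d by (intro divide_right_mono mult_left_mono) auto
    also have "\<dots> = sqrt 2 * ((1 - h) / (2 * d))\<^sup>2 / ((1 + h) / (2 * d))"
      by (rule gen) (use h in simp)
    also have "\<dots> \<le> sqrt 2 * y\<^sup>2 / x"
      using x y y0 by (intro frac_le mult_left_mono power_mono) auto
    also have "\<dots> \<le> bergman_metric D z" by (rule bb(2))
    finally show "(1 - \<eta>) / sqrt 2 / bdry_dist D z \<le> bergman_metric D z" by (simp add: d_def)
    show "bergman_metric D z \<le> (1 + \<eta>) / sqrt 2 / bdry_dist D z" using 1 by (simp add: d_def)
  qed
qed

lemma ex_first_exit:
  fixes \<gamma> :: "real \<Rightarrow> complex"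
  assumes c: "continuous_on {0..1} \<gamma>" and t: "t \<in> {0..1}" and r: "0 < r" "r \<le> cmod (\<gamma> t - \<gamma> 0)"
  shows "\<exists>t1\<in>{0..t}. cmod (\<gamma> t1 - \<gamma> 0) = r \<and> (\<forall>u\<in>{0..t1}. cmod (\<gamma> u - \<gamma> 0) \<le> r)"
proof -
  let ?g = "\<lambda>u. cmod (\<gamma> u - \<gamma> 0)"
  have cg: "continuous_on {0..t} ?g"
    using t by (intro continuous_intros continuous_on_subset[OF c]) auto
  define T where "T = {u\<in>{0..t}. r \<le> ?g u}"
  have "T = {0..t} \<inter> ?g -` {r..}" by (auto simp: T_def)
  then have "closed T" using continuous_closed_preimage[OF cg] by simp
  moreover have "t \<in> T" using t r by (auto simp: T_def)
  moreover have bb: "bdd_below T" by (rule bdd_belowI[of _ 0]) (auto simp: T_def)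
  ultimately have InfT: "Inf T \<in> T" using closed_contains_Inf by blast
  define t1 where "t1 = Inf T"
  have t1: "0 \<le> t1" "t1 \<le> t" "r \<le> ?g t1" using InfT by (auto simp: T_def t1_def)
  have min: "t1 \<le> u" if "u \<in> T" for u unfolding t1_def using that bb by (rule cInf_lower)
  have "continuous_on {0..t1} ?g" using t1 by (intro continuous_on_subset[OF cg]) auto
  then obtain u where u: "0 \<le> u" "u \<le> t1" "?g u = r" using IVT'[of ?g 0 r t1] t1 r by auto
  then have t1u: "t1 = u" using min[of u] t1 by (auto simp: T_def)
  moreover have "?g u \<le> r" if "u \<in> {0..t1}" for u
  proof (cases "u = t1")
    case False
    then have "u \<notin> T" using min[of u] that by auto
    then show ?thesis using that t1 by (auto simp: T_def)
  qed (use u t1u in simp)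
  ultimately show ?thesis using t1 u by (intro bexI[of _ t1]) auto
qed

text \<open>The Bergman metric is known only in a collar W of S. For a curve inside W, moderate s is handled by the exterior
  disc and large s by the logarithms at both ends. A curve that leaves W moves away from z by a fixed
  distance r, which costs about \<open>log (r / d(z))\<close>, and likewise at w if w is close to S; this exceeds any
  moderate s because \<open>d(z) < \<delta>\<close>, and it accounts for a large s up to the constant C.\<close>

lemma bergman_lower_bound:
  assumes flat: "flat_along D S" and D: "domain D" and \<eta>: "0 < \<eta>" "\<eta> \<le> 1"
  shows "\<exists>\<delta>>0. \<forall>z\<in>D. \<forall>w\<in>D. infdist z S < \<delta> \<longrightarrow> infdist w S < \<delta> \<or> S = frontier D \<longrightarrow> cmod (z - w) \<le> M \<longrightarrow>
     (\<forall>\<gamma>. curve_in D z w \<gamma> \<longrightarrow> ennreal (sqrt 2 * ((1 - \<eta>) * s_fun D z w)) \<le> bergman_length D \<gamma>)"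
proof -
  have oD: "open D" and S: "S \<subseteq> frontier D" "S \<noteq> {}" using flat D by (auto simp: flat_along_def domain_def)
  then have fr: "frontier D \<noteq> {}" by auto
  define h where "h = \<eta> / 2"
  have h: "0 < h" "h \<le> 1 / 2" using \<eta> by (auto simp: h_def)
  define \<kappa> where "\<kappa> = (1 - h) / sqrt 2"
  have \<kappa>: "0 \<le> \<kappa>" using h by (simp add: \<kappa>_def)
  have \<kappa>2: "2 * \<kappa> = sqrt 2 * (1 - h)" unfolding \<kappa>_def by (simp add: field_simps)
  obtain \<delta>0 where \<delta>0: "0 < \<delta>0" "\<And>z. z \<in> D \<Longrightarrow> infdist z S < \<delta>0 \<Longrightarrow> \<kappa> / bdry_dist D z \<le> bergman_metric D z"
    using flat_along_bergman_metric[OF flat D, of h] h unfolding \<kappa>_def by auto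
  define W where "W = {x\<in>D. infdist x S < \<delta>0}"
  have WD: "W \<subseteq> D" by (auto simp: W_def)
  have \<kappa>W: "\<kappa> / bdry_dist D x \<le> bergman_metric D x" if "x \<in> W" for x using \<delta>0(2) that by (auto simp: W_def)
  define r K where "r = \<delta>0 / 4" and "K = max 1 (M / r)"
  have r: "0 < r" using \<delta>0 by (simp add: r_def)
  have K: "1 \<le> K" "M \<le> K * r" 
  proof -
    have "M / r \<le> K" by (simp add: K_def)
    then show "M \<le> K * r" using r by (simp add: divide_le_eq)
  qed (simp add: K_def)
  define C where "C = ln 6 + ln K"
  have lnK: "0 \<le> ln K" "0 \<le> ln (6::real)" using K by auto
  then have C: "0 \<le> C" by (simp add: C_def)
  define N where "N = max (arsinh 4) (C / h)"
  have N0: "0 \<le> N" using C h by (simp add: N_def le_max_iff_disj)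
  obtain \<delta>1 where \<delta>1: "0 < \<delta>1" "\<forall>z\<in>D. \<forall>w\<in>D. infdist z S < \<delta>1 \<longrightarrow> s_fun D z w \<le> N \<longrightarrow> pinched D h 1 z w"
    using flat_along_pinched[OF flat D, of h 1 N] h by auto
  \<comment> \<open>this choice makes log (r / d(z)) at least 2 N\<close>
  define \<delta> where "\<delta> = min \<delta>1 (r * exp (- 2 * N))"
  have \<delta>: "0 < \<delta>" "\<delta> \<le> \<delta>1" "\<delta> \<le> r * exp (- 2 * N)" "\<delta> \<le> r"
  proof -
    show "0 < \<delta>" "\<delta> \<le> \<delta>1" using \<delta>1 r by (auto simp: \<delta>_def)
    show 1: "\<delta> \<le> r * exp (- 2 * N)" unfolding \<delta>_def by (rule min.cobounded2)
    have "r * exp (- 2 * N) \<le> r * 1" using r N0 by (intro mult_left_mono) auto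
    then show "\<delta> \<le> r" using 1 by linarith
  qed
  show ?thesis
  proof (rule exI[of _ \<delta>], intro conjI \<delta>(1) ballI impI allI)
    fix z w \<gamma> assume z: "z \<in> D" and w: "w \<in> D" and dz: "infdist z S < \<delta>"
      and dw: "infdist w S < \<delta> \<or> S = frontier D" and M: "cmod (z - w) \<le> M" and \<gamma>: "curve_in D z w \<gamma>"
    define a b L s where "a = bdry_dist D z" and "b = bdry_dist D w" and "L = cmod (z - w)" and "s = s_fun D z w"
    have ab: "0 < a" "0 < b" using bdry_dist_pos[OF oD _ fr] z w by (auto simp: a_def b_def)
    have a_le: "a < \<delta>" using infdist_mono[OF S, of z] dz by (simp add: a_def bdry_dist_def)
    have s0: "0 \<le> s" by (simp add: s_def s_fun_nonneg)
    obtain p where p: "p \<in> frontier D" "cmod (z - p) = a" using ex_nearest_frontier_point[OF fr, of z] by (auto simp: a_def dist_norm)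
    obtain q where q: "q \<in> frontier D" "cmod (w - q) = b" using ex_nearest_frontier_point[OF fr, of w] by (auto simp: b_def dist_norm)
    note g = curve_in_D[OF \<gamma>]
    note len1 = bergman_length_ge_ln[OF \<gamma> oD fr WD \<kappa> \<kappa>W _ _ _ _ _ p(1) q(1), unfolded p(2) q(2)]
    note len = len1[where e = 1, unfolded mult_1]
    have suff: "ennreal (sqrt 2 * ((1 - \<eta>) * s)) \<le> bergman_length D \<gamma>"
      if "ennreal (\<kappa> * Y) \<le> bergman_length D \<gamma>" "2 * ((1 - h) * s) \<le> Y" for Y
    proof -
      have "(1 - \<eta>) \<le> (1 - h) * (1 - h)" by (simp add: h_def algebra_simps)
      then have "sqrt 2 * ((1 - \<eta>) * s) \<le> sqrt 2 * (((1 - h) * (1 - h)) * s)"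
        using s0 by (intro mult_left_mono mult_right_mono) auto
      also have "\<dots> = \<kappa> * (2 * ((1 - h) * s))"
        using \<kappa>2 by (metis (no_types, opaque_lifting) mult.assoc mult.commute mult.left_commute)
      also have "\<dots> \<le> \<kappa> * Y" using that(2) \<kappa> by (intro mult_left_mono) auto
      finally show ?thesis using that(1) by (meson ennreal_leI order.trans)
    qed
    have big: "2 * ((1 - h) * s) \<le> Y" if "N < s" "2 * (s - C) \<le> Y" for Y
    proof -
      have "C / h < s" using that(1) by (simp add: N_def)
      then have "C \<le> h * s" using h by (simp add: divide_less_eq mult.commute)
      then show ?thesis using that(2) by (simp add: algebra_simps)
    qed
    have large: "0 < L \<and> s \<le> ln (L / a) / 2 + ln (L / b) / 2 + ln (3 / 2) \<and> (a \<le> L / 8 \<or> b \<le> L / 8)" if "N < s"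
    proof -
      have "arsinh 4 \<le> s" using that by (simp add: N_def)
      then have "sinh (arsinh 4) \<le> sinh s" by (simp only: sinh_real_le_iff)
      then have s4: "4 \<le> sinh s" by simp
      have "a \<le> L / (2 * 4) \<or> b \<le> L / (2 * 4)"
        using min_bdry_dist_small[of D z w 4] min_bdry_dist_small[of D w z 4] ab s4
        unfolding a_def b_def L_def s_def s_fun_commute[of D w z] norm_minus_commute[of w z] by linarith
      then show ?thesis using s_fun_le_ln[of D z w] ab s4 by (simp add: a_def b_def L_def s_def)
    qed
    have ln6: "ln (6::real) = ln 4 + ln (3 / 2)" using ln_mult_pos[of 4 "3 / 2 :: real"] by simp
    have ln16: "ln (16::real) = 2 * ln 4" "ln (16::real) = ln 8 + ln 2"
      using ln_mult_pos[of 4 "4 :: real"] ln_mult_pos[of 8 "2 :: real"] by simp_all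
    define c32 l2 l4 l8 l6 l16 :: real where "c32 = ln (3 / 2)" and "l2 = ln 2" and "l4 = ln 4" and "l8 = ln 8" and "l6 = ln 6" and "l16 = ln 16"
    note folds = l2_def[symmetric] l4_def[symmetric] l8_def[symmetric] l6_def[symmetric] l16_def[symmetric] c32_def[symmetric]
    have lnd: "ln (x / y) = ln x - ln y" if "0 < x" "0 < y" for x y :: real using that by (rule ln_divide_pos)
    show "ennreal (sqrt 2 * ((1 - \<eta>) * s_fun D z w)) \<le> bergman_length D \<gamma>"
      unfolding s_def[symmetric]
    proof (cases "path_image \<gamma> \<subseteq> W")
      case True
      have inW: "\<gamma> t \<in> W" if "t \<in> {0..1}" for t using True that by (auto simp: path_image_def)
      show "ennreal (sqrt 2 * ((1 - \<eta>) * s)) \<le> bergman_length D \<gamma>"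
      proof (cases "s \<le> N")
        case sN: True
        then have "pinched D h 1 z w" using \<delta>1 \<delta>(2) z w dz by (auto simp: s_def)
        then obtain c' \<rho> where E: "0 < \<rho>" "ball c' \<rho> \<inter> D = {}" "(1 - h) * s \<le> exterior_dist c' \<rho> z w"
          unfolding pinched_def s_def by blast
        have "ennreal (2 * \<kappa> * exterior_dist c' \<rho> z w) \<le> bergman_length D \<gamma>"
          using True by (intro bergman_length_ge_exterior_dist[OF \<gamma> oD fr z w \<kappa> _ E(2,1)] \<kappa>W) auto
        then have "ennreal (\<kappa> * (2 * exterior_dist c' \<rho> z w)) \<le> bergman_length D \<gamma>" by (simp only: mult_ac)
        moreover have "2 * ((1 - h) * s) \<le> 2 * exterior_dist c' \<rho> z w" using E(3) by linarith
        ultimately show ?thesis by (rule suff)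
      next
        case False
        then have sN: "N < s" by simp
        have L: "0 < L" and s_le: "s \<le> ln (L / a) / 2 + ln (L / b) / 2 + ln (3 / 2)" and sm: "a \<le> L / 8 \<or> b \<le> L / 8"
          using large[OF sN] by auto
        have lna: "ln (L / a) = ln L - ln a" "ln (L / b) = ln L - ln b" using lnd L ab by auto
        consider "a \<le> L / 8" "b \<le> L / 8" | "a \<le> L / 8" "L / 8 < b" | "L / 8 < a" "b \<le> L / 8" using sm by linarith
        then show ?thesis
        proof cases
          case 1
          \<comment> \<open>up to the first point at distance L / 2 from z the curve climbs from p, and afterwards it descends to q\<close>
          have "L / 2 \<le> cmod (\<gamma> 1 - \<gamma> 0)" using L g by (simp add: L_def norm_minus_commute)
          then obtain t where t: "t \<in> {0..1}" "cmod (\<gamma> t - z) = L / 2"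
            using ex_first_exit[OF g(6), of 1 "L / 2"] L g by auto
          have e: "L / 4 \<le> cmod (\<gamma> t - p)" "L / 4 \<le> cmod (\<gamma> t - q)"
          proof -
            have "cmod (\<gamma> t - z) \<le> cmod (\<gamma> t - p) + cmod (z - p)"
              using dist_triangle[of "\<gamma> t" z p] by (simp add: dist_norm norm_minus_commute)
            then show "L / 4 \<le> cmod (\<gamma> t - p)" using t p 1 L by linarith
            have "cmod (z - w) \<le> cmod (\<gamma> t - z) + (cmod (\<gamma> t - q) + cmod (w - q))"
              using dist_triangle[of z w "\<gamma> t"] dist_triangle[of "\<gamma> t" w q] by (simp add: dist_norm norm_minus_commute)
            then show "L / 4 \<le> cmod (\<gamma> t - q)" using t q 1 L unfolding L_def by linarith
          qed
          have "ln L - ln 4 \<le> ln (cmod (\<gamma> t - p))" "ln L - ln 4 \<le> ln (cmod (\<gamma> t - q))"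
            using ln_mono[OF e(1)] ln_mono[OF e(2)] lnd[of L 4] L by auto
          then have "2 * (s - C) \<le> ln (cmod (\<gamma> t - p)) - ln a + (ln (cmod (\<gamma> t - q)) - ln b)"
            using s_le lnK unfolding C_def lna ln6 folds by argo
          then show ?thesis using t inW by (intro suff[OF len big[OF sN]]) auto
        next
          case 2
          \<comment> \<open>w is so far from the boundary that the climb from p alone accounts for s\<close>
          have "L \<le> a + cmod (\<gamma> 1 - p)" using dist_triangle[of z w p] p g by (simp add: L_def dist_norm norm_minus_commute)
          then have "L / 2 \<le> cmod (\<gamma> 1 - p)" using 2 L by linarith
          then have "ln L - ln 2 \<le> ln (cmod (\<gamma> 1 - p))" using ln_mono[of "L / 2"] lnd[of L 2] L by auto
          moreover have "ln L - ln 8 \<le> ln b" using ln_mono[of "L / 8" b] lnd[of L 8] L 2 by auto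
          moreover have "ln (cmod (\<gamma> 1 - q)) = ln b" using g q by simp
          ultimately have "2 * (s - C) \<le> ln (cmod (\<gamma> 1 - p)) - ln a + (ln (cmod (\<gamma> 1 - q)) - ln b)"
            using s_le lnK ln16 unfolding C_def lna ln6 folds by argo
          then show ?thesis using inW by (intro suff[OF len big[OF sN]]) auto
        next
          case 3
          have "L \<le> b + cmod (\<gamma> 0 - q)" using dist_triangle[of z w q] q g by (simp add: L_def dist_norm norm_minus_commute)
          then have "L / 2 \<le> cmod (\<gamma> 0 - q)" using 3 L by linarith
          then have "ln L - ln 2 \<le> ln (cmod (\<gamma> 0 - q))" using ln_mono[of "L / 2"] lnd[of L 2] L by auto
          moreover have "ln L - ln 8 \<le> ln a" using ln_mono[of "L / 8" a] lnd[of L 8] L 3 by auto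
          moreover have "ln (cmod (\<gamma> 0 - p)) = ln a" using g p by simp
          ultimately have "2 * (s - C) \<le> ln (cmod (\<gamma> 0 - p)) - ln a + (ln (cmod (\<gamma> 0 - q)) - ln b)"
            using s_le lnK ln16 unfolding C_def lna ln6 folds by argo
          then show ?thesis using inW by (intro suff[OF len big[OF sN]]) auto
        qed
      qed
    next
      case False
      then obtain t where t: "t \<in> {0..1}" "\<gamma> t \<notin> W" unfolding path_image_def by blast
      then have far: "\<delta>0 \<le> infdist (\<gamma> t) S" using g(3) by (auto simp: W_def)
      have nearW: "x \<in> W" if "x \<in> D" "infdist y S < r" "cmod (x - y) \<le> 2 * r" for x y
        using that infdist_triangle[of x S y] \<delta>0(1) by (auto simp: W_def r_def dist_norm)
      have "infdist (\<gamma> t) S \<le> infdist z S + cmod (\<gamma> t - z)" using infdist_triangle[of "\<gamma> t" S z] by (simp add: dist_norm)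
      then have "2 * r \<le> cmod (\<gamma> t - \<gamma> 0)" using far dz \<delta>(4) r unfolding g(1) r_def by linarith
      then obtain t1 where t1: "t1 \<in> {0..t}" "cmod (\<gamma> t1 - z) = 2 * r" "\<And>u. u \<in> {0..t1} \<Longrightarrow> cmod (\<gamma> u - z) \<le> 2 * r"
        using ex_first_exit[OF g(6) t(1), of "2 * r"] r g(1) by auto
      have inW1: "\<gamma> u \<in> W" if "u \<in> {0..t1}" for u
        using that t1 t dz \<delta>(4) g(3) by (intro nearW[of _ z]) auto
      have "cmod (\<gamma> t1 - z) \<le> cmod (\<gamma> t1 - p) + cmod (z - p)"
        using dist_triangle[of "\<gamma> t1" z p] by (simp add: dist_norm norm_minus_commute)
      then have "r \<le> cmod (\<gamma> t1 - p)" using t1(2) p(2) a_le \<delta>(4) by linarith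
      then have lnp: "ln r \<le> ln (cmod (\<gamma> t1 - p))" using r by (intro ln_mono) linarith+
      have "a \<le> r * exp (- 2 * N)" using a_le \<delta>(3) by linarith
      then have "ln a \<le> ln (r * exp (- 2 * N))" using ab by (intro ln_mono) auto
      also have "\<dots> = ln r - 2 * N" using r by (simp add: ln_mult_pos)
      finally have lna: "ln a \<le> ln r - 2 * N" .
      have LKr: "L \<le> K * r" using M K(2) by (simp add: L_def)
      have lnL: "ln L \<le> ln K + ln r" if "0 < L"
        using ln_mono[OF LKr that] K r by (simp add: ln_mult_pos)
      have l32: "ln (3 / 2 :: real) \<le> ln 6" by simp
      show "ennreal (sqrt 2 * ((1 - \<eta>) * s)) \<le> bergman_length D \<gamma>"
      proof (cases "infdist w S < r")
        case True
        have b_le: "b \<le> r" using infdist_mono[OF S, of w] True by (simp add: b_def bdry_dist_def)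
        \<comment> \<open>the last exit from the neighbourhood of w is the first one of the reversed curve\<close>
        define \<gamma>' where "\<gamma>' u = \<gamma> (1 - u)" for u
        have c': "continuous_on {0..1} \<gamma>'"
          unfolding \<gamma>'_def by (rule continuous_on_compose2[OF g(6)]) (auto intro!: continuous_intros)
        have "infdist (\<gamma> t) S \<le> infdist w S + cmod (\<gamma> t - w)" using infdist_triangle[of "\<gamma> t" S w] by (simp add: dist_norm)
        then have "2 * r \<le> cmod (\<gamma>' (1 - t) - \<gamma>' 0)" using far True r by (simp add: r_def \<gamma>'_def g(2))
        then obtain u2 where u2: "u2 \<in> {0..1 - t}" "cmod (\<gamma>' u2 - w) = 2 * r" "\<And>u. u \<in> {0..u2} \<Longrightarrow> cmod (\<gamma>' u - w) \<le> 2 * r"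
          using ex_first_exit[OF c', of "1 - t" "2 * r"] r g(2) t(1) by (auto simp: \<gamma>'_def)
        define t2 where "t2 = 1 - u2"
        have t2: "t \<le> t2" "t2 \<le> 1" "cmod (\<gamma> t2 - w) = 2 * r" using u2 by (auto simp: t2_def \<gamma>'_def)
        have inW2: "\<gamma> u \<in> W" if u: "u \<in> {t2..1}" for u
        proof (rule nearW[OF _ True])
          show "\<gamma> u \<in> D" using u t2 t g(3) by auto
          show "cmod (\<gamma> u - w) \<le> 2 * r" using u2(3)[of "1 - u"] u by (auto simp: t2_def \<gamma>'_def)
        qed
        have "cmod (\<gamma> t2 - w) \<le> cmod (\<gamma> t2 - q) + cmod (w - q)"
          using dist_triangle[of "\<gamma> t2" w q] by (simp add: dist_norm norm_minus_commute)
        then have "r \<le> cmod (\<gamma> t2 - q)" using t2(3) q(2) b_le by linarith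
        then have lnq: "ln r \<le> ln (cmod (\<gamma> t2 - q))" using r by (intro ln_mono) linarith+
        have lnb: "ln b \<le> ln r" using ab b_le by (intro ln_mono) auto
        have len': "ennreal (\<kappa> * (ln (cmod (\<gamma> t1 - p)) - ln a + (ln (cmod (\<gamma> t2 - q)) - ln b))) \<le> bergman_length D \<gamma>"
          using t1 t2 t inW1 inW2 by (intro len) auto
        show ?thesis
        proof (rule suff[OF len'], cases "s \<le> N")
          case True
          have "(1 - h) * s \<le> 1 * s" using h s0 by (intro mult_right_mono) auto
          then show "2 * ((1 - h) * s) \<le> ln (cmod (\<gamma> t1 - p)) - ln a + (ln (cmod (\<gamma> t2 - q)) - ln b)"
            using True lnp lnq lna lnb by linarith
        next
          case False
          then have sN: "N < s" by simp
          have L: "0 < L" and s_le: "s \<le> ln (L / a) / 2 + ln (L / b) / 2 + ln (3 / 2)" using large[OF sN] by auto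
          have "ln (L / a) = ln L - ln a" "ln (L / b) = ln L - ln b" using lnd L ab by auto
          then show "2 * ((1 - h) * s) \<le> ln (cmod (\<gamma> t1 - p)) - ln a + (ln (cmod (\<gamma> t2 - q)) - ln b)"
            using s_le lnp lnq lnL[OF L] l32 by (intro big[OF sN]) (unfold C_def folds, argo)
        qed
      next
        case wfar: False
        then have b_ge: "r \<le> b" using dw \<delta>(4) by (auto simp: b_def bdry_dist_def)
        have len': "ennreal (\<kappa> * (ln (cmod (\<gamma> t1 - p)) - ln a)) \<le> bergman_length D \<gamma>"
          using len1[where e = 0 and ?t1.0 = t1 and ?t2.0 = 1] t1 t inW1 by simp
        show ?thesis
        proof (rule suff[OF len'], cases "s \<le> N")
          case True
          have "(1 - h) * s \<le> 1 * s" using h s0 by (intro mult_right_mono) auto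
          then show "2 * ((1 - h) * s) \<le> ln (cmod (\<gamma> t1 - p)) - ln a"
            using True lnp lna by linarith
        next
          case False
          then have sN: "N < s" by simp
          have L: "0 < L" and s_le: "s \<le> ln (L / a) / 2 + ln (L / b) / 2 + ln (3 / 2)" using large[OF sN] by auto
          have "ln (L / a) = ln L - ln a" "ln (L / b) = ln L - ln b" using lnd L ab by auto
          moreover have "ln r \<le> ln b" using b_ge r by (intro ln_mono) auto
          ultimately show "2 * ((1 - h) * s) \<le> ln (cmod (\<gamma> t1 - p)) - ln a"
            using s_le lnp lnL[OF L] l32 by (intro big[OF sN]) (unfold C_def folds, argo)
        qed
      qed
    qed
  qed
qed

section \<open>Distances induced by a weight\<close>

text \<open>Lengths for general weights allow the Bergman metric to be replaced by a Borel majorant, for which the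
  lengths of two pieces of a curve add up.\<close>

definition weighted_length :: "(complex \<Rightarrow> real) \<Rightarrow> (real \<Rightarrow> complex) \<Rightarrow> ennreal"
  where "weighted_length \<rho> \<gamma> = (\<integral>\<^sup>+t\<in>{0..1}. ennreal (\<rho> (\<gamma> t) * cmod (vector_derivative \<gamma> (at t))) \<partial>lborel)"

definition weighted_dist :: "complex set \<Rightarrow> (complex \<Rightarrow> real) \<Rightarrow> complex \<Rightarrow> complex \<Rightarrow> ennreal"
  where "weighted_dist D \<rho> z w = (INF \<gamma>\<in>Collect (curve_in D z w). weighted_length \<rho> \<gamma>)"

lemma bergman_dist_eq: "bergman_dist D z w = enn2real (weighted_dist D (bergman_metric D) z w)"
  unfolding bergman_dist_def weighted_dist_def curve_in_def bergman_length_def weighted_length_def ..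

lemma bergman_length_eq: "bergman_length D = weighted_length (bergman_metric D)"
  by (auto simp: bergman_length_def weighted_length_def)

lemma weighted_dist_mono:
  assumes "\<And>x. x \<in> D \<Longrightarrow> \<rho> x \<le> \<rho>' x"
  shows "weighted_dist D \<rho> z w \<le> weighted_dist D \<rho>' z w"
  unfolding weighted_dist_def
proof (rule INF_mono)
  fix \<gamma> assume \<gamma>: "\<gamma> \<in> Collect (curve_in D z w)"
  have "weighted_length \<rho> \<gamma> \<le> weighted_length \<rho>' \<gamma>"
    unfolding weighted_length_def
  proof (rule nn_integral_mono)
    fix t
    have "\<rho> (\<gamma> t) * cmod (vector_derivative \<gamma> (at t)) \<le> \<rho>' (\<gamma> t) * cmod (vector_derivative \<gamma> (at t))" if "t \<in> {0..1}"
      using curve_in_D(3)[of D z w \<gamma> t] \<gamma> that by (intro mult_right_mono assms) auto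
    then show "ennreal (\<rho> (\<gamma> t) * cmod (vector_derivative \<gamma> (at t))) * indicator {0..1} t
       \<le> ennreal (\<rho>' (\<gamma> t) * cmod (vector_derivative \<gamma> (at t))) * indicator {0..1} t"
      by (auto intro!: ennreal_leI split: split_indicator)
  qed
  then show "\<exists>\<gamma>'\<in>Collect (curve_in D z w). weighted_length \<rho> \<gamma>' \<le> weighted_length \<rho>' \<gamma>"
    using \<gamma> by blast
qed

definition pos_square :: "real \<Rightarrow> real"
  where "pos_square t = (max 0 t)\<^sup>2"

lemma pos_square_has_derivative: "(pos_square has_real_derivative 2 * max 0 t) (at t)"
proof -
  consider "t < 0" | "t = 0" | "0 < t" by linarith
  then show ?thesis
  proof cases
    case 1
    have "((\<lambda>_. 0) has_real_derivative 0) (at t)" by simp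
    then have "(pos_square has_real_derivative 0) (at t)"
      by (rule has_field_derivative_transform_within_open[of _ _ _ "{..<0}"]) (use 1 in \<open>auto simp: pos_square_def\<close>)
    then show ?thesis using 1 by simp
  next
    case 2
    have "((\<lambda>h. max 0 h) \<longlongrightarrow> max 0 (0::real)) (at 0)" by (intro tendsto_intros)
    then have "((\<lambda>h. max 0 h) \<longlongrightarrow> (0::real)) (at 0)" by simp
    then have "((\<lambda>h. (pos_square (0 + h) - pos_square 0) / h) \<longlongrightarrow> 0) (at 0)"
      by (rule Lim_transform_eventually)
         (auto simp: pos_square_def max_def power2_eq_square eventually_at_filter)
    then show ?thesis using 2 by (simp add: DERIV_def)
  next
    case 3
    have "((\<lambda>t. t\<^sup>2) has_real_derivative 2 * t) (at t)" by (auto intro!: derivative_eq_intros)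
    then have "(pos_square has_real_derivative 2 * t) (at t)"
      by (rule has_field_derivative_transform_within_open[of _ _ _ "{0<..}"]) (use 3 in \<open>auto simp: pos_square_def\<close>)
    then show ?thesis using 3 by simp
  qed
qed

text \<open>Reparametrised by a C1 step function that is constant outside [0,1], two C1 curves are joined without a
  corner.\<close>

definition smoothstep :: "real \<Rightarrow> real"
  where "smoothstep t = 2 * pos_square t - 4 * pos_square (t - 1 / 2) + 2 * pos_square (t - 1)"

definition smoothstep' :: "real \<Rightarrow> real"
  where "smoothstep' t = 4 * max 0 t - 8 * max 0 (t - 1 / 2) + 4 * max 0 (t - 1)"

lemma smoothstep_has_derivative: "(smoothstep has_real_derivative smoothstep' t) (at t)"
proof -
  have sh: "((\<lambda>t. pos_square (t - c)) has_real_derivative 2 * max 0 (t - c) * 1) (at t)" for c t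
    by (rule DERIV_chain2[OF pos_square_has_derivative]) (auto intro!: derivative_eq_intros)
  have "(smoothstep has_real_derivative 2 * (2 * max 0 t) - 4 * (2 * max 0 (t - 1 / 2) * 1) + 2 * (2 * max 0 (t - 1) * 1)) (at t)"
    unfolding smoothstep_def
    by (intro DERIV_add DERIV_diff DERIV_cmult pos_square_has_derivative sh)
  then show ?thesis by (simp add: smoothstep'_def)
qed

lemma smoothstep'_nonneg: "0 \<le> smoothstep' t"
  by (auto simp: smoothstep'_def max_def)

lemma continuous_on_smoothstep': "continuous_on A smoothstep'"
  unfolding smoothstep'_def by (intro continuous_intros)

lemma smoothstep_simps: "t \<le> 0 \<Longrightarrow> smoothstep t = 0" "1 \<le> t \<Longrightarrow> smoothstep t = 1"
  "t \<le> 0 \<Longrightarrow> smoothstep' t = 0" "1 \<le> t \<Longrightarrow> smoothstep' t = 0"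
  by (auto simp: smoothstep_def smoothstep'_def pos_square_def max_def power2_eq_square algebra_simps)

lemma smoothstep_in: "smoothstep t \<in> {0..1}"
proof -
  have mono: "smoothstep s \<le> smoothstep t" if "s \<le> t" for s t
    by (rule DERIV_nonneg_imp_nondecreasing[OF that]) (use smoothstep_has_derivative smoothstep'_nonneg in blast)
  have "smoothstep (min 0 t) \<le> smoothstep t" "smoothstep t \<le> smoothstep (max 1 t)" by (auto intro: mono)
  then show ?thesis by (simp add: smoothstep_simps)
qed

text \<open>Each curve is run through on one half of [0,1] with the speed profile of the step function, so that the velocity
  vanishes at the junction; the lengths do not depend on the parametrisation.\<close>

lemma curve_join:
  assumes \<gamma>1: "curve_in D x y \<gamma>1" and \<gamma>2: "curve_in D y z \<gamma>2" and m: "\<rho> \<in> borel_measurable borel"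
  shows "\<exists>\<gamma>. curve_in D x z \<gamma> \<and> weighted_length \<rho> \<gamma> \<le> weighted_length \<rho> \<gamma>1 + weighted_length \<rho> \<gamma>2"
proof -
  note g1 = curve_in_D[OF \<gamma>1] and g2 = curve_in_D[OF \<gamma>2]
  let ?v1 = "\<lambda>t. vector_derivative \<gamma>1 (at t)" and ?v2 = "\<lambda>t. vector_derivative \<gamma>2 (at t)"
  define a b where "a t = smoothstep (2 * t)" and "b t = smoothstep (2 * t - 1)" for t
  define a' b' where "a' t = 2 * smoothstep' (2 * t)" and "b' t = 2 * smoothstep' (2 * t - 1)" for t
  have a_eq: "a = (\<lambda>t. smoothstep (2 * t))" and b_eq: "b = (\<lambda>t. smoothstep (2 * t - 1))" by (auto simp: a_def b_def)
  have ab: "a t \<in> {0..1}" "b t \<in> {0..1}" for t by (auto simp only: a_def b_def smoothstep_in)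
  have da: "(a has_real_derivative a' t) (at t)" for t
  proof -
    have "((\<lambda>t. 2 * t) has_real_derivative 2) (at t)" by (auto intro!: derivative_eq_intros)
    from DERIV_chain2[OF smoothstep_has_derivative this] show ?thesis unfolding a_eq a'_def by (simp only: mult.commute[of _ 2])
  qed
  have db: "(b has_real_derivative b' t) (at t)" for t
  proof -
    have "((\<lambda>t. 2 * t - 1) has_real_derivative 2) (at t)" by (auto intro!: derivative_eq_intros)
    from DERIV_chain2[OF smoothstep_has_derivative this] show ?thesis unfolding b_eq b'_def by (simp only: mult.commute[of _ 2])
  qed
  have cab: "continuous_on A a" "continuous_on A b" for A
    using da db by (auto intro!: continuous_at_imp_continuous_on DERIV_isCont)
  have cab': "continuous_on A a'" "continuous_on A b'" for A
    unfolding a'_def b'_def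
    by (intro continuous_intros continuous_on_compose2[OF continuous_on_smoothstep'[of UNIV]]; simp)+
  define \<gamma> where "\<gamma> t = \<gamma>1 (a t) + \<gamma>2 (b t) - y" for t
  define v where "v t = a' t *\<^sub>R ?v1 (a t) + b' t *\<^sub>R ?v2 (b t)" for t
  have d: "(\<gamma> has_vector_derivative v t) (at t)" for t
  proof -
    have 1: "((\<lambda>t. \<gamma>1 (a t)) has_vector_derivative a' t *\<^sub>R ?v1 (a t)) (at t)"
      using vector_diff_chain_at[OF da[of t, unfolded has_real_derivative_iff_has_vector_derivative] g1(4)[OF ab(1)]]
      by (simp add: o_def)
    have 2: "((\<lambda>t. \<gamma>2 (b t)) has_vector_derivative b' t *\<^sub>R ?v2 (b t)) (at t)"
      using vector_diff_chain_at[OF db[of t, unfolded has_real_derivative_iff_has_vector_derivative] g2(4)[OF ab(2)]]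
      by (simp add: o_def)
    from has_vector_derivative_diff[OF has_vector_derivative_add[OF 1 2] has_vector_derivative_const[of y]]
    show ?thesis unfolding \<gamma>_def v_def by simp
  qed
  have vd: "vector_derivative \<gamma> (at t) = v t" for t using d by (rule vector_derivative_at)
  have lo: "b t = 0 \<and> b' t = 0" if "t \<le> 1 / 2" for t using that by (simp add: b_def b'_def smoothstep_simps)
  have hi: "a t = 1 \<and> a' t = 0" if "1 / 2 \<le> t" for t using that by (simp add: a_def a'_def smoothstep_simps)
  have \<gamma>lo: "\<gamma> t = \<gamma>1 (a t) \<and> v t = a' t *\<^sub>R ?v1 (a t)" if "t \<le> 1 / 2" for t
    using lo[OF that] g2(1) by (simp add: \<gamma>_def v_def)
  have \<gamma>hi: "\<gamma> t = \<gamma>2 (b t) \<and> v t = b' t *\<^sub>R ?v2 (b t)" if "1 / 2 \<le> t" for t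
    using hi[OF that] g1(2) by (simp add: \<gamma>_def v_def)
  have "curve_in D x z \<gamma>"
    unfolding curve_in_def
  proof (intro conjI)
    have "continuous_on {0..1} v"
      unfolding v_def
      by (intro continuous_intros cab' continuous_on_compose2[OF g1(5) cab(1)] continuous_on_compose2[OF g2(5) cab(2)])
         (use ab in auto)
    then show "\<gamma> C1_differentiable_on {0..1}" unfolding C1_differentiable_on_def using d by blast
    have "\<gamma> t \<in> D" for t
      using \<gamma>lo[of t] \<gamma>hi[of t] g1(3)[OF ab(1)[of t]] g2(3)[OF ab(2)[of t]] by (cases "t \<le> 1 / 2") auto
    then show "path_image \<gamma> \<subseteq> D" by (auto simp: path_image_def)
    show "pathstart \<gamma> = x" "pathfinish \<gamma> = z"
      using \<gamma>lo[of 0] \<gamma>hi[of 1] g1(1) g2(2) by (auto simp: pathstart_def pathfinish_def a_def b_def smoothstep_simps)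
  qed
  moreover have "weighted_length \<rho> \<gamma> \<le> weighted_length \<rho> \<gamma>1 + weighted_length \<rho> \<gamma>2"
  proof -
    have mm: "set_borel_measurable borel {0..1} (\<lambda>t. \<rho> (\<eta> t) * cmod (vector_derivative \<eta> (at t)))" if "curve_in D p q \<eta>" for \<eta> p q
    proof -
      note g = curve_in_D[OF that]
      have "(\<lambda>t. indicat_real {0..1} t *\<^sub>R \<eta> t) \<in> borel_measurable borel"
        "(\<lambda>t. indicat_real {0..1} t *\<^sub>R vector_derivative \<eta> (at t)) \<in> borel_measurable borel"
        using borel_measurable_continuous_on_indicator[of "{0..1::real}"] g(5,6) by auto
      then have "(\<lambda>t. \<rho> (indicat_real {0..1} t *\<^sub>R \<eta> t) * cmod (indicat_real {0..1} t *\<^sub>R vector_derivative \<eta> (at t))) \<in> borel_measurable borel"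
        using m by measurable
      moreover have "(\<lambda>t. \<rho> (indicat_real {0..1} t *\<^sub>R \<eta> t) * cmod (indicat_real {0..1} t *\<^sub>R vector_derivative \<eta> (at t)))
          = (\<lambda>t. indicat_real {0..1} t *\<^sub>R (\<rho> (\<eta> t) * cmod (vector_derivative \<eta> (at t))))"
        by (auto simp: fun_eq_iff split: split_indicator)
      ultimately show ?thesis by (simp add: set_borel_measurable_def)
    qed
    have s1: "weighted_length \<rho> \<gamma>1 = (\<integral>\<^sup>+t. ennreal (\<rho> (\<gamma>1 (a t)) * cmod (?v1 (a t)) * a' t * indicator {0..1/2} t) \<partial>lborel)"
      using nn_integral_substitution[of a 0 "1/2" "\<lambda>t. \<rho> (\<gamma>1 t) * cmod (?v1 t)" a'] mm[OF \<gamma>1] da cab'(1)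
      by (simp add: weighted_length_def a_def a'_def smoothstep_simps smoothstep'_nonneg nn_integral_set_ennreal)
    have s2: "weighted_length \<rho> \<gamma>2 = (\<integral>\<^sup>+t. ennreal (\<rho> (\<gamma>2 (b t)) * cmod (?v2 (b t)) * b' t * indicator {1/2..1} t) \<partial>lborel)"
      using nn_integral_substitution[of b "1/2" 1 "\<lambda>t. \<rho> (\<gamma>2 t) * cmod (?v2 t)" b'] mm[OF \<gamma>2] db cab'(2)
      by (simp add: weighted_length_def b_def b'_def smoothstep_simps smoothstep'_nonneg nn_integral_set_ennreal)
    have c1: "continuous_on UNIV (\<lambda>t. \<gamma>1 (a t))" "continuous_on UNIV (\<lambda>t. ?v1 (a t))"
      by (rule continuous_on_compose2[OF g1(6) cab(1)], use ab in blast, rule continuous_on_compose2[OF g1(5) cab(1)], use ab in blast)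
    have c2: "continuous_on UNIV (\<lambda>t. \<gamma>2 (b t))" "continuous_on UNIV (\<lambda>t. ?v2 (b t))"
      by (rule continuous_on_compose2[OF g2(6) cab(2)], use ab in blast, rule continuous_on_compose2[OF g2(5) cab(2)], use ab in blast)
    note bm = borel_measurable_continuous_onI
    define F1 where "F1 t = \<rho> (\<gamma>1 (a t)) * cmod (?v1 (a t)) * a' t * indicator {0..1/2} t" for t :: real
    define F2 where "F2 t = \<rho> (\<gamma>2 (b t)) * cmod (?v2 (b t)) * b' t * indicator {1/2..1} t" for t :: real
    have mF: "F1 \<in> borel_measurable lborel" "F2 \<in> borel_measurable lborel"
      unfolding F1_def F2_def using bm[OF c1(1)] bm[OF c1(2)] bm[OF c2(1)] bm[OF c2(2)] bm[OF cab'(1)] bm[OF cab'(2)] m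
      by measurable
    have a0: "0 \<le> a' t" "0 \<le> b' t" for t by (auto simp: a'_def b'_def smoothstep'_nonneg)
    have "weighted_length \<rho> \<gamma> \<le> (\<integral>\<^sup>+t. ennreal (F1 t) + ennreal (F2 t) \<partial>lborel)"
      unfolding weighted_length_def vd
    proof (rule nn_integral_mono)
      fix t :: real
      show "ennreal (\<rho> (\<gamma> t) * cmod (v t)) * indicator {0..1} t \<le> ennreal (F1 t) + ennreal (F2 t)"
      proof (cases "t \<in> {0..1}")
        case True
        show ?thesis
        proof (cases "t \<le> 1 / 2")
          case lt: True
          then have "\<rho> (\<gamma> t) * cmod (v t) = F1 t"
            using \<gamma>lo[OF lt] True a0(1)[of t] by (simp add: F1_def)
          then show ?thesis using True by simp
        next
          case False
          then have "\<rho> (\<gamma> t) * cmod (v t) = F2 t"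
            using \<gamma>hi[of t] True a0(2)[of t] by (simp add: F2_def)
          then show ?thesis using True by simp
        qed
      qed simp
    qed
    also have "\<dots> = (\<integral>\<^sup>+t. ennreal (F1 t) \<partial>lborel) + (\<integral>\<^sup>+t. ennreal (F2 t) \<partial>lborel)"
      using mF by (intro nn_integral_add) auto
    also have "\<dots> = weighted_length \<rho> \<gamma>1 + weighted_length \<rho> \<gamma>2" unfolding s1 s2 F1_def F2_def ..
    finally show ?thesis .
  qed
  ultimately show ?thesis by blast
qed

lemma weighted_dist_le: "curve_in D z w \<gamma> \<Longrightarrow> weighted_dist D \<rho> z w \<le> weighted_length \<rho> \<gamma>"
  unfolding weighted_dist_def by (rule INF_lower) simp

lemma weighted_dist_triangle:
  assumes m: "\<rho> \<in> borel_measurable borel"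
  shows "weighted_dist D \<rho> x z \<le> weighted_dist D \<rho> x y + weighted_dist D \<rho> y z"
proof (rule ennreal_le_epsilon)
  fix e :: real
  assume fin: "weighted_dist D \<rho> x y + weighted_dist D \<rho> y z < top" and e: "0 < e"
  have lt: "a < a + ennreal (e / 2)" if "a < top" for a
    using that e by (cases a) (auto simp: ennreal_plus[symmetric] ennreal_less_iff simp del: ennreal_plus)
  have "weighted_dist D \<rho> x y < weighted_dist D \<rho> x y + ennreal (e / 2)"
    "weighted_dist D \<rho> y z < weighted_dist D \<rho> y z + ennreal (e / 2)"
    using fin e by (auto intro!: lt simp: less_top)
  then obtain \<gamma>1 \<gamma>2 where c: "curve_in D x y \<gamma>1" "curve_in D y z \<gamma>2"
    and l: "weighted_length \<rho> \<gamma>1 < weighted_dist D \<rho> x y + ennreal (e / 2)"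
      "weighted_length \<rho> \<gamma>2 < weighted_dist D \<rho> y z + ennreal (e / 2)"
    unfolding weighted_dist_def INF_less_iff by auto
  obtain \<gamma> where \<gamma>: "curve_in D x z \<gamma>" "weighted_length \<rho> \<gamma> \<le> weighted_length \<rho> \<gamma>1 + weighted_length \<rho> \<gamma>2"
    using curve_join[OF c m] by blast
  have "weighted_dist D \<rho> x z \<le> weighted_length \<rho> \<gamma>1 + weighted_length \<rho> \<gamma>2"
    using weighted_dist_le[OF \<gamma>(1)] \<gamma>(2) by (rule order.trans)
  also have "\<dots> \<le> (weighted_dist D \<rho> x y + ennreal (e / 2)) + (weighted_dist D \<rho> y z + ennreal (e / 2))"
    using l by (intro add_mono) auto
  also have "\<dots> = weighted_dist D \<rho> x y + weighted_dist D \<rho> y z + (ennreal (e / 2) + ennreal (e / 2))" by (simp only: ac_simps)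
  also have "ennreal (e / 2) + ennreal (e / 2) = ennreal e" using e by (subst ennreal_plus[symmetric]) auto
  finally show "weighted_dist D \<rho> x z \<le> weighted_dist D \<rho> x y + weighted_dist D \<rho> y z + ennreal e" .
qed

text \<open>The image of a radius under the chart of the disc centred at z is a curve of Poincare length
  \<open>disc_dist c r z w\<close>, and the density \<open>r / (r\<^sup>2 - |x - c|\<^sup>2)\<close> is at least \<open>1 / (2 d(x))\<close> because
  \<open>r - |x - c| \<le> d(x)\<close>.\<close>

lemma weighted_dist_le_disc_dist:
  assumes D: "open D" "frontier D \<noteq> {}" and B: "ball c r \<subseteq> D" "0 < r" and z: "z \<in> ball c r" and w: "w \<in> ball c r"
    and \<kappa>: "0 \<le> \<kappa>" "\<And>x. x \<in> ball c r \<Longrightarrow> \<rho> x \<le> \<kappa> / bdry_dist D x"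
  shows "weighted_dist D \<rho> z w \<le> ennreal (2 * \<kappa> * disc_dist c r z w)"
proof -
  note p = disc_chart_props[OF B(2) z]
  define \<phi> where "\<phi> = disc_chart c r z"
  define \<alpha> where "\<alpha> = mob ((z - c) / of_real r) ((w - c) / of_real r)"
  have \<alpha>: "cmod \<alpha> < 1" unfolding \<alpha>_def using disc_normalise z w by (intro cmod_mob_less_1)
  define \<gamma> where "\<gamma> t = \<phi> (of_real t * \<alpha>)" for t :: real
  have t\<alpha>: "cmod (of_real t * \<alpha>) < 1" if "t \<in> {0..1}" for t
  proof -
    have "cmod (of_real t * \<alpha>) \<le> 1 * cmod \<alpha>" unfolding norm_mult using that by (intro mult_right_mono) auto
    then show ?thesis using \<alpha> by linarith
  qed
  have d: "(\<gamma> has_vector_derivative \<alpha> * deriv \<phi> (of_real t * \<alpha>)) (at t)" if t: "t \<in> {0..1}" for t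
  proof -
    have "((\<lambda>t. of_real t * \<alpha>) has_vector_derivative \<alpha>) (at t)"
    proof -
      have "((\<lambda>t. t *\<^sub>R \<alpha>) has_vector_derivative \<alpha>) (at t)" by (auto intro!: derivative_eq_intros)
      then show ?thesis by (simp add: scaleR_conv_of_real)
    qed
    from field_vector_diff_chain_at[OF this p(4)[OF t\<alpha>[OF t]]]
    show ?thesis by (simp add: \<gamma>_def[abs_def] \<phi>_def o_def)
  qed
  have hol: "\<phi> holomorphic_on ball 0 1" and im: "\<And>x. cmod x < 1 \<Longrightarrow> \<phi> x \<in> ball c r"
    using p(1) by (auto simp: holo_maps_def \<phi>_def image_subset_iff)
  have in_ball: "\<gamma> t \<in> ball c r" if "t \<in> {0..1}" for t using im[OF t\<alpha>[OF that]] by (simp add: \<gamma>_def)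
  have "curve_in D z w \<gamma>"
    unfolding curve_in_def
  proof (intro conjI)
    have c1: "continuous_on (ball 0 1) (deriv \<phi>)"
      using holomorphic_deriv[OF hol open_ball] by (rule holomorphic_on_imp_continuous_on)
    have c2: "continuous_on {0..1} (\<lambda>t::real. of_real t * \<alpha>)"
      by (intro continuous_on_mult continuous_on_of_real continuous_on_id continuous_on_const)
    have c3: "(\<lambda>t::real. of_real t * \<alpha>) ` {0..1} \<subseteq> ball 0 1" using t\<alpha> unfolding image_subset_iff mem_ball_0 by blast
    note continuous_on_compose2[OF c1 c2 c3]
    from continuous_on_mult[OF continuous_on_const this]
    have c4: "continuous_on {0..1} (\<lambda>t::real. \<alpha> * deriv \<phi> (of_real t * \<alpha>))" .
    show "\<gamma> C1_differentiable_on {0..1}" unfolding C1_differentiable_on_def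
      by (rule exI[of _ "\<lambda>t::real. \<alpha> * deriv \<phi> (of_real t * \<alpha>)"]) (intro conjI ballI d c4)
    show "path_image \<gamma> \<subseteq> D" using in_ball B(1) by (auto simp: path_image_def)
    show "pathstart \<gamma> = z" using p(3) by (simp add: pathstart_def \<gamma>_def \<phi>_def)
    show "pathfinish \<gamma> = w" using p(7)[OF w] by (simp add: pathfinish_def \<gamma>_def \<phi>_def \<alpha>_def)
  qed
  then have "weighted_dist D \<rho> z w \<le> weighted_length \<rho> \<gamma>" by (rule weighted_dist_le)
  also have "\<dots> \<le> (\<integral>\<^sup>+t\<in>{0..1}. ennreal (2 * \<kappa> * (cmod \<alpha> / (1 - (t * cmod \<alpha>)\<^sup>2))) \<partial>lborel)"
    unfolding weighted_length_def
  proof (rule nn_integral_mono)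
    fix t :: real
    have "\<rho> (\<gamma> t) * cmod (vector_derivative \<gamma> (at t)) \<le> 2 * \<kappa> * (cmod \<alpha> / (1 - (t * cmod \<alpha>)\<^sup>2))" if t: "t \<in> {0..1}"
    proof -
      define x where "x = \<gamma> t"
      have xb: "x \<in> ball c r" using in_ball[OF t] by (simp add: x_def)
      have xc: "cmod (x - c) < r" using xb by (simp add: dist_norm norm_minus_commute)
      have low: "r - cmod (x - c) \<le> bdry_dist D x" by (rule interior_ball_le_bdry_dist[OF D(1) B(1) D(2)])
      have "r\<^sup>2 - (cmod (x - c))\<^sup>2 = (r - cmod (x - c)) * (r + cmod (x - c))" by (simp add: power2_eq_square algebra_simps)
      also have "\<dots> \<le> bdry_dist D x * (2 * r)" using low xc B(2) bdry_dist_nonneg by (intro mult_mono add_nonneg_nonneg) auto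
      finally have le: "r\<^sup>2 - (cmod (x - c))\<^sup>2 \<le> bdry_dist D x * (2 * r)" .
      have q: "0 < r\<^sup>2 - (cmod (x - c))\<^sup>2" using power_strict_mono[OF xc, of 2] by simp
      have dpos: "0 < bdry_dist D x" using low xc by linarith
      have "1 / bdry_dist D x \<le> 2 * (r / (r\<^sup>2 - (cmod (x - c))\<^sup>2))"
        using le q dpos by (simp add: le_divide_eq divide_le_eq mult.commute)
      then have "\<kappa> * (1 / bdry_dist D x) \<le> \<kappa> * (2 * (r / (r\<^sup>2 - (cmod (x - c))\<^sup>2)))" by (rule mult_left_mono[OF _ \<kappa>(1)])
      then have "\<rho> x \<le> 2 * \<kappa> * (r / (r\<^sup>2 - (cmod (x - c))\<^sup>2))" using \<kappa>(2)[OF xb] by (simp add: mult_ac)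
      then have "\<rho> x * cmod (vector_derivative \<gamma> (at t)) \<le> 2 * \<kappa> * (r / (r\<^sup>2 - (cmod (x - c))\<^sup>2)) * cmod (vector_derivative \<gamma> (at t))"
        by (intro mult_right_mono) auto
      also have "cmod (vector_derivative \<gamma> (at t)) = cmod \<alpha> * cmod (deriv \<phi> (of_real t * \<alpha>))"
        using vector_derivative_at[OF d[OF t]] by (simp add: norm_mult)
      also have "2 * \<kappa> * (r / (r\<^sup>2 - (cmod (x - c))\<^sup>2)) * (cmod \<alpha> * cmod (deriv \<phi> (of_real t * \<alpha>)))
         = 2 * \<kappa> * (cmod \<alpha> * (r * cmod (deriv \<phi> (of_real t * \<alpha>)) / (r\<^sup>2 - (cmod (x - c))\<^sup>2)))" by simp
      also have "r * cmod (deriv \<phi> (of_real t * \<alpha>)) / (r\<^sup>2 - (cmod (x - c))\<^sup>2) = 1 / (1 - (t * cmod \<alpha>)\<^sup>2)"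
        using p(6)[OF t\<alpha>[OF t]] t by (simp add: x_def \<gamma>_def \<phi>_def norm_mult)
      finally show ?thesis using vector_derivative_at[OF d[OF t]] by (simp add: x_def norm_mult)
    qed
    then show "ennreal (\<rho> (\<gamma> t) * cmod (vector_derivative \<gamma> (at t))) * indicator {0..1} t
      \<le> ennreal (2 * \<kappa> * (cmod \<alpha> / (1 - (t * cmod \<alpha>)\<^sup>2))) * indicator {0..1} t"
      by (auto intro!: ennreal_leI split: split_indicator)
  qed
  also have "\<dots> = ennreal (2 * \<kappa> * artanh (cmod \<alpha>))"
  proof (rule set_nn_integral_eq_has_integral)
    have t1: "t * cmod \<alpha> < 1" "0 \<le> t * cmod \<alpha>" if "t \<in> {0..1}" for t
      using t\<alpha>[OF that] that by (auto simp: norm_mult)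
    have der: "((\<lambda>t. 2 * \<kappa> * artanh (t * cmod \<alpha>)) has_vector_derivative 2 * \<kappa> * (cmod \<alpha> / (1 - (t * cmod \<alpha>)\<^sup>2))) (at t within {0..1})"
      if t: "t \<in> {0..1}" for t
    proof -
      have "((\<lambda>t. t * cmod \<alpha>) has_real_derivative cmod \<alpha>) (at t)" by (auto intro!: derivative_eq_intros)
      from DERIV_cmult[OF DERIV_chain2[OF artanh_real_has_field_derivative this], of "2 * \<kappa>"]
      have "((\<lambda>t. 2 * \<kappa> * artanh (t * cmod \<alpha>)) has_real_derivative 2 * \<kappa> * (1 / (1 - (t * cmod \<alpha>)\<^sup>2) * cmod \<alpha>)) (at t)"
        using t1[OF t] by auto
      from has_field_derivative_at_within[OF this, of "{0..1}"] show ?thesis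
        unfolding has_real_derivative_iff_has_vector_derivative[symmetric] by simp
    qed
    have "((\<lambda>t. 2 * \<kappa> * (cmod \<alpha> / (1 - (t * cmod \<alpha>)\<^sup>2))) has_integral
       (2 * \<kappa> * artanh (1 * cmod \<alpha>) - 2 * \<kappa> * artanh (0 * cmod \<alpha>))) {0..1}"
      by (rule fundamental_theorem_of_calculus) (use der in auto)
    then show "((\<lambda>t. 2 * \<kappa> * (cmod \<alpha> / (1 - (t * cmod \<alpha>)\<^sup>2))) has_integral 2 * \<kappa> * artanh (cmod \<alpha>)) {0..1}" by simp
    fix t :: real assume "t \<in> {0..1}"
    from t1[OF this] have "0 \<le> 1 - (t * cmod \<alpha>)\<^sup>2" by (simp add: abs_square_le_1)
    then show "0 \<le> 2 * \<kappa> * (cmod \<alpha> / (1 - (t * cmod \<alpha>)\<^sup>2))" using \<kappa>(1) by simp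
  qed
  also have "artanh (cmod \<alpha>) = disc_dist c r z w" using p(8)[OF w] by (simp add: pd_def \<alpha>_def)
  finally show ?thesis .
qed

lemma weighted_dist_le_segment:
  assumes seg: "closed_segment x y \<subseteq> D" and C: "\<And>u. u \<in> closed_segment x y \<Longrightarrow> \<rho> u \<le> C"
  shows "weighted_dist D \<rho> x y \<le> ennreal (C * cmod (y - x))"
proof -
  have d: "(linepath x y has_vector_derivative (y - x)) (at t)" for t
    by (rule has_vector_derivative_linepath_within)
  have "curve_in D x y (linepath x y)"
    unfolding curve_in_def C1_differentiable_on_def using d seg by (auto intro!: exI[of _ "\<lambda>_. y - x"])
  then have "weighted_dist D \<rho> x y \<le> weighted_length \<rho> (linepath x y)" by (rule weighted_dist_le)
  also have "\<dots> \<le> (\<integral>\<^sup>+t. ennreal (C * cmod (y - x)) * indicator {0..1} t \<partial>(lborel :: real measure))"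
    unfolding weighted_length_def
  proof (rule nn_integral_mono)
    fix t :: real
    have "\<rho> (linepath x y t) \<le> C" if "t \<in> {0..1}" by (rule C) (use that linepath_in_path in auto)
    then show "ennreal (\<rho> (linepath x y t) * cmod (vector_derivative (linepath x y) (at t))) * indicator {0..1} t
       \<le> ennreal (C * cmod (y - x)) * indicator {0..1} t"
      using vector_derivative_at[OF d[of t]] by (auto intro!: ennreal_leI mult_right_mono split: split_indicator)
  qed
  also have "\<dots> = ennreal (C * cmod (y - x))" by (simp add: nn_integral_cmult_indicator)
  finally show ?thesis .
qed

text \<open>Near S the weight is the sharp bound of the Bergman metric. Elsewhere it is the bound by the ball of
  radius d(x) inside D and one fixed ball outside D, which exists next to any point of S.\<close>

lemma bergman_weight:
  assumes flat: "flat_along D S" and D: "domain D" and \<eta>: "0 < \<eta>" "\<eta> \<le> 1"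
  shows "\<exists>\<rho> \<delta>. 0 < \<delta> \<and> \<rho> \<in> borel_measurable borel \<and> (\<forall>x\<in>D. bergman_metric D x \<le> \<rho> x) \<and>
     (\<forall>x\<in>D. infdist x S < \<delta> \<longrightarrow> \<rho> x \<le> (1 + \<eta>) / sqrt 2 / bdry_dist D x) \<and>
     (\<forall>x\<in>D. \<exists>e>0. \<exists>C. \<forall>y\<in>ball x e. y \<in> D \<and> \<rho> y \<le> C)"
proof -
  have oD: "open D" and S: "S \<subseteq> frontier D" "S \<noteq> {}" using flat D by (auto simp: flat_along_def domain_def)
  then have fr: "frontier D \<noteq> {}" by auto
  obtain \<delta> where \<delta>: "0 < \<delta>" "\<And>z. z \<in> D \<Longrightarrow> infdist z S < \<delta> \<Longrightarrow> bergman_metric D z \<le> (1 + \<eta>) / sqrt 2 / bdry_dist D z"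
    using flat_along_bergman_metric[OF flat D \<eta>] by auto
  obtain p where p: "p \<in> S" using S by blast
  have half: "0 < (1 / 2 :: real)" by simp
  obtain r where r: "0 < r" "\<And>p. p \<in> frontier D \<Longrightarrow> infdist p S < r \<Longrightarrow> \<exists>n. has_cones D (1 / 2) r p n"
    using flat half unfolding flat_along_def by meson
  obtain n where n: "has_cones D (1 / 2) r p n" using r(2)[of p] p S r(1) by (auto simp: infdist_zero)
  define c R where "c = p - of_real (r / 2) * n" and "R = r / 2 * sqrt (1 - (1 / 2)\<^sup>2)"
  have R: "0 < R" using r(1) by (simp add: R_def power2_eq_square)
  have dis: "ball c R \<inter> D = {}"
    using has_cones_balls(2)[OF n, of "r / 2"] r(1) by (simp add: c_def R_def)
  define g where "g x = sqrt 2 * ((cmod (x - c))\<^sup>2 - R\<^sup>2) / (R * (bdry_dist D x)\<^sup>2)" for x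
  define f where "f x = (1 + \<eta>) / sqrt 2 / bdry_dist D x" for x
  have g: "bergman_metric D x \<le> g x" if x: "x \<in> D" for x
  proof -
    have d: "0 < bdry_dist D x" by (rule bdry_dist_pos[OF oD x fr])
    then have "x \<in> ball x (bdry_dist D x)" by simp
    from bergman_metric_between_balls(1)[OF oD ball_bdry_dist_subset[OF x] d this dis R]
    show ?thesis using d R by (simp add: g_def power2_eq_square field_simps)
  qed
  define \<rho> where "\<rho> x = (if infdist x S < \<delta> then f x else g x)" for x
  have cb: "continuous_on UNIV (bdry_dist D)" unfolding bdry_dist_def[abs_def] by (intro continuous_intros)
  have "(\<lambda>x. infdist x S) \<in> borel_measurable borel" "bdry_dist D \<in> borel_measurable borel"
    by (intro borel_measurable_continuous_onI continuous_intros, rule borel_measurable_continuous_onI[OF cb])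
  then have meas: "\<rho> \<in> borel_measurable borel"
    unfolding \<rho>_def[abs_def] f_def g_def by measurable
  have loc: "\<exists>e>0. \<exists>C. \<forall>y\<in>ball x e. y \<in> D \<and> \<rho> y \<le> C" if x: "x \<in> D" for x
  proof -
    define d where "d = bdry_dist D x"
    have d: "0 < d" unfolding d_def by (rule bdry_dist_pos[OF oD x fr])
    define C where "C = (1 + \<eta>) / sqrt 2 / (d / 2) + sqrt 2 * (cmod (x - c) + d)\<^sup>2 / (R * (d / 2)\<^sup>2)"
    show ?thesis
    proof (rule exI[of _ "d / 2"], rule conjI, use d in simp, rule exI[of _ C], intro ballI conjI)
      fix y assume y: "y \<in> ball x (d / 2)"
      then have "y \<in> ball x (bdry_dist D x)" using d by (simp add: d_def)
      then show "y \<in> D" using ball_bdry_dist_subset[OF x] by blast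
      have dy: "d / 2 \<le> bdry_dist D y"
        using bdry_dist_triangle[of D x y] y by (simp add: d_def)
      have f: "f y \<le> (1 + \<eta>) / sqrt 2 / (d / 2)" unfolding f_def using dy d \<eta> by (intro divide_left_mono) (auto intro!: mult_pos_pos)
      have "cmod (y - c) \<le> cmod (x - c) + d"
        using dist_triangle[of y c x] y d by (simp add: dist_norm norm_minus_commute)
      then have "(cmod (y - c))\<^sup>2 \<le> (cmod (x - c) + d)\<^sup>2" by (intro power_mono) auto
      then have "(cmod (y - c))\<^sup>2 - R\<^sup>2 \<le> (cmod (x - c) + d)\<^sup>2" using zero_le_power2[of R] by linarith
      moreover have "(d / 2)\<^sup>2 \<le> (bdry_dist D y)\<^sup>2" using dy d by (intro power_mono) auto
      ultimately have "g y \<le> sqrt 2 * (cmod (x - c) + d)\<^sup>2 / (R * (d / 2)\<^sup>2)"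
        unfolding g_def using R d by (intro frac_le mult_left_mono mult_pos_pos) auto
      moreover have "0 \<le> (1 + \<eta>) / sqrt 2 / (d / 2)" "0 \<le> sqrt 2 * (cmod (x - c) + d)\<^sup>2 / (R * (d / 2)\<^sup>2)"
        using d \<eta> R by auto
      ultimately show "\<rho> y \<le> C" using f unfolding \<rho>_def C_def by auto
    qed
  qed
  show ?thesis
    using \<delta> g meas loc by (intro exI[of _ \<rho>] exI[of _ \<delta>]) (auto simp: \<rho>_def f_def)
qed

section \<open>Upper bounds by chains of discs\<close>

text \<open>These two properties give the upper bounds, so that the Kobayashi distance (k = 1) and the distance of the
  weight majorising the Bergman metric (k close to sqrt 2) are treated at once. The values are extended
  real numbers, as infima of lengths are.\<close>

definition disc_dominated :: "complex set \<Rightarrow> complex set \<Rightarrow> real \<Rightarrow> (complex \<Rightarrow> complex \<Rightarrow> ennreal) \<Rightarrow> bool"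
  where "disc_dominated D S k P \<longleftrightarrow> 0 \<le> k \<and>
    (\<forall>x\<in>D. \<forall>y\<in>D. \<forall>z\<in>D. P x z \<le> P x y + P y z) \<and>
    (\<exists>\<delta>>0. \<forall>c r z w. 0 < r \<longrightarrow> ball c r \<subseteq> D \<longrightarrow> (\<forall>x\<in>ball c r. infdist x S < \<delta>) \<longrightarrow>
       z \<in> ball c r \<longrightarrow> w \<in> ball c r \<longrightarrow> P z w \<le> ennreal (k * disc_dist c r z w))"

lemma disc_dominated_triangle:
  "disc_dominated D S k P \<Longrightarrow> x \<in> D \<Longrightarrow> y \<in> D \<Longrightarrow> z \<in> D \<Longrightarrow> P x z \<le> P x y + P y z"
  by (auto simp: disc_dominated_def)

text \<open>The inner disc of a pinched pair.\<close>

lemma disc_dominated_mid_range: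
  assumes P: "disc_dominated D S k P" and flat: "flat_along D S" and D: "domain D" and h: "0 < h" "h \<le> 1"
  shows "\<exists>\<delta>>0. \<forall>z\<in>D. \<forall>w\<in>D. infdist z S < \<delta> \<longrightarrow> s_fun D z w \<le> N \<longrightarrow> P z w \<le> ennreal (k * ((1 + h) * s_fun D z w))"
proof -
  have k: "0 \<le> k" using P by (simp add: disc_dominated_def)
  obtain \<delta> where \<delta>: "0 < \<delta>" "\<And>c r z w. 0 < r \<Longrightarrow> ball c r \<subseteq> D \<Longrightarrow> (\<forall>x\<in>ball c r. infdist x S < \<delta>) \<Longrightarrow>
       z \<in> ball c r \<Longrightarrow> w \<in> ball c r \<Longrightarrow> P z w \<le> ennreal (k * disc_dist c r z w)"
    using P unfolding disc_dominated_def by blast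
  obtain \<delta>' where \<delta>': "0 < \<delta>'" "\<forall>z\<in>D. \<forall>w\<in>D. infdist z S < \<delta>' \<longrightarrow> s_fun D z w \<le> N \<longrightarrow> pinched D h (\<delta> / 2) z w"
    using flat_along_pinched[OF flat D h, of "\<delta> / 2" N] \<delta>(1) by auto
  show ?thesis
  proof (rule exI[of _ "min \<delta>' (\<delta> / 2)"], intro conjI ballI impI)
    fix z w assume z: "z \<in> D" and w: "w \<in> D" and dz: "infdist z S < min \<delta>' (\<delta> / 2)" and s: "s_fun D z w \<le> N"
    have "pinched D h (\<delta> / 2) z w" using \<delta>'(2) z w dz s by auto
    then obtain c r where B: "0 < r" "ball c r \<subseteq> D" "ball c r \<subseteq> ball z (\<delta> / 2)" "z \<in> ball c r" "w \<in> ball c r"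
      "disc_dist c r z w \<le> (1 + h) * s_fun D z w" unfolding pinched_def by blast
    have "infdist x S < \<delta>" if "x \<in> ball c r" for x
    proof -
      have "dist x z < \<delta> / 2" using B(3) that by (auto simp: dist_commute)
      then show ?thesis using infdist_triangle[of x S z] dz by auto
    qed
    then have "P z w \<le> ennreal (k * disc_dist c r z w)" using \<delta>(2) B by blast
    also have "\<dots> \<le> ennreal (k * ((1 + h) * s_fun D z w))" using B(6) k by (intro ennreal_leI mult_left_mono)
    finally show "P z w \<le> ennreal (k * ((1 + h) * s_fun D z w))" .
  qed (use \<delta> \<delta>' in auto)
qed

text \<open>In a half plane, points on a normal whose heights have the ratio 2 are at the distance
  \<open>log 2 / 2\<close>.\<close>

lemma arsinh_half_ln2: "arsinh (1 / (2 * sqrt 2)) = ln 2 / (2::real)"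
proof -
  have "(1 / (2 * sqrt 2))\<^sup>2 + 1 = (3 / (2 * sqrt 2))\<^sup>2" for x :: real by (simp add: power_divide power_mult_distrib)
  then have "sqrt ((1 / (2 * sqrt 2))\<^sup>2 + 1) = 3 / (2 * sqrt 2)" by (simp only: real_sqrt_abs) simp
  then have "arsinh (1 / (2 * sqrt 2)) = ln (4 / (2 * sqrt 2))" by (simp add: arsinh_real_def add_divide_distrib[symmetric])
  also have "4 / (2 * sqrt 2) = sqrt (2::real)" by (simp add: field_simps)
  finally show ?thesis by (simp add: ln_sqrt)
qed

text \<open>The points at heights \<open>2\<^sup>i d(z)\<close> on the normal through z form a chain in which each step costs about
  \<open>log 2 / 2\<close>. The chain stops at the first height that is at least l.\<close>

lemma ascend_from_boundary:
  assumes P: "disc_dominated D S k P" and flat: "flat_along D S" and D: "domain D" and h: "0 < h" "h \<le> 1"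
  shows "\<exists>\<delta>>0. \<forall>z\<in>D. \<forall>l. infdist z S < \<delta> \<longrightarrow> 0 < l \<longrightarrow> l < \<delta> \<longrightarrow>
    (\<exists>z'\<in>D. cmod (z' - z) \<le> 2 * l \<and> l / 2 \<le> bdry_dist D z' \<and>
       P z z' \<le> ennreal (k * ((1 + h) * (max 0 (ln (2 * l / bdry_dist D z)) / 2))) \<and>
       P z' z \<le> ennreal (k * ((1 + h) * (max 0 (ln (2 * l / bdry_dist D z)) / 2))))"
proof -
  have oD: "open D" and S: "S \<subseteq> frontier D" "S \<noteq> {}" using flat D by (auto simp: flat_along_def domain_def)
  then have fr: "frontier D \<noteq> {}" by auto
  have k: "0 \<le> k" using P by (simp add: disc_dominated_def)
  define h1 where "h1 = h / 4"
  have h1: "0 < h1" "h1 \<le> 1 / 4" using h by (auto simp: h1_def)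
  define \<epsilon> where "\<epsilon> = h1 / 6"
  have \<epsilon>: "0 < \<epsilon>" "\<epsilon> < 1" using h1 by (auto simp: \<epsilon>_def)
  define \<sigma> where "\<sigma> = sqrt (1 - (3 * \<epsilon>)\<^sup>2)"
  have \<sigma>: "1 - h1 \<le> \<sigma>" "3 / 4 \<le> \<sigma>" "0 < \<sigma>"
  proof -
    have e: "3 * \<epsilon> = h1 / 2" by (simp add: \<epsilon>_def)
    have "(h1 / 2)\<^sup>2 \<le> h1 * 1" unfolding power2_eq_square using h1 by (auto intro!: mult_mono)
    then have "1 - h1 \<le> 1 - (3 * \<epsilon>)\<^sup>2" unfolding e by linarith
    then show 1: "1 - h1 \<le> \<sigma>" using one_minus_sq_le_sqrt[of "3 * \<epsilon>"] h1 unfolding \<sigma>_def by (auto simp: \<epsilon>_def)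
    then show "3 / 4 \<le> \<sigma>" "0 < \<sigma>" using h1 by linarith+
  qed
  obtain r where r: "0 < r" "\<And>z p. infdist z S < r \<or> S = frontier D \<Longrightarrow> p \<in> frontier D \<Longrightarrow> dist z p = bdry_dist D z \<Longrightarrow>
     (\<exists>n. has_cones D \<epsilon> r p n)"
    using flat_along_nearest[OF flat \<epsilon>(1)] by blast
  obtain \<delta>1 where \<delta>1: "0 < \<delta>1" "\<forall>z\<in>D. \<forall>w\<in>D. infdist z S < \<delta>1 \<longrightarrow> s_fun D z w \<le> 1 \<longrightarrow> P z w \<le> ennreal (k * ((1 + h1) * s_fun D z w))"
    using disc_dominated_mid_range[OF P flat D, of h1 1] h1 by auto
  define \<delta> where "\<delta> = min (r / 4) (\<delta>1 / 4)"
  have \<delta>: "0 < \<delta>" "4 * \<delta> \<le> r" "4 * \<delta> \<le> \<delta>1" using r \<delta>1 by (auto simp: \<delta>_def)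
  show ?thesis
  proof (rule exI[of _ \<delta>], intro conjI \<delta>(1) ballI allI impI)
    fix z l assume z: "z \<in> D" and dz: "infdist z S < \<delta>" and l: "0 < l" "l < \<delta>"
    define a where "a = bdry_dist D z"
    have a: "0 < a" unfolding a_def by (rule bdry_dist_pos[OF oD z fr])
    have a\<delta>: "a < \<delta>" using infdist_mono[OF S, of z] dz by (simp add: a_def bdry_dist_def)
    obtain p where p: "p \<in> frontier D" "dist z p = bdry_dist D z" using ex_nearest_frontier_point[OF fr] by blast
    obtain n where n: "has_cones D \<epsilon> r p n" using r(2)[of z p] p dz \<delta> by auto
    define m where "m = (z - p) / of_real a"
    have hm: "has_cones D (3 * \<epsilon>) r p m"
      using has_cones_axis[OF oD z p _ n \<epsilon>] a a\<delta> \<delta> by (simp add: a_def m_def)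
    have m: "cmod m = 1" using hm by (simp add: has_cones_def)
    have zm: "z = p + of_real a * m" using a by (simp add: m_def)
    \<comment> \<open>the chain of points on the ray from the nearest frontier point p through z\<close>
    define y where "y i = p + of_real (2 ^ i * a) * m" for i :: nat
    have y0: "y 0 = z" by (simp add: y_def zm)
    have y: "y i \<in> D" "\<sigma> * (2 ^ i * a) \<le> bdry_dist D (y i)" "infdist (y i) S < \<delta>1" if "2 ^ i * a < 2 * \<delta>" for i
    proof -
      define t where "t = 2 ^ i * a"
      have t: "0 < t" "2 * t \<le> r" "t < 2 * \<delta>" using a that \<delta> by (auto simp: t_def)
      have B: "ball (y i) (t * \<sigma>) \<subseteq> D"
        using has_cones_balls(1)[OF hm _ _ t(1,2)] \<epsilon> h1 by (simp add: y_def t_def \<sigma>_def \<epsilon>_def)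
      then show "y i \<in> D" using t \<sigma> by (auto simp: subset_iff)
      show "\<sigma> * (2 ^ i * a) \<le> bdry_dist D (y i)"
        using interior_ball_le_bdry_dist[OF oD B fr, of "y i"] by (simp add: t_def mult.commute)
      have "1 * a \<le> 2 ^ i * a" using a by (intro mult_right_mono) auto
      then have "cmod (y i - z) \<le> t"
      proof -
        have "y i - z = of_real (t - a) * m" by (simp add: y_def zm t_def algebra_simps)
        then have "cmod (y i - z) = \<bar>t - a\<bar>" using m by (simp only: norm_mult norm_of_real) simp
        then show ?thesis using a \<open>1 * a \<le> 2 ^ i * a\<close> by (simp add: t_def)
      qed
      then show "infdist (y i) S < \<delta>1"
        using infdist_triangle[of "y i" S z] dz t \<delta> by (simp add: dist_norm)
    qed
    define q where "q = k * ((1 + h) * (ln 2 / 2))"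
    have q: "0 \<le> q" using k h by (simp add: q_def)
    have step: "P (y i) (y (Suc i)) \<le> ennreal q \<and> P (y (Suc i)) (y i) \<le> ennreal q" if "2 ^ Suc i * a < 2 * \<delta>" for i
    proof -
      define t where "t = 2 ^ i * a"
      have t: "0 < t" "2 ^ Suc i * a = 2 * t" using a by (auto simp: t_def)
      have i: "2 ^ i * a < 2 * \<delta>" using that t unfolding t_def by linarith
      define u v where "u = bdry_dist D (y i)" and "v = bdry_dist D (y (Suc i))"
      have uv: "\<sigma> * t \<le> u" "\<sigma> * (2 * t) \<le> v" using y(2)[OF i] y(2)[OF that] t by (auto simp: u_def v_def t_def)
      have st: "0 < \<sigma> * t" using \<sigma> t by simp
      have "s_fun D (y i) (y (Suc i)) = arsinh (t / (2 * sqrt (u * v)))"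
      proof -
        have "y i - y (Suc i) = of_real (- t) * m" by (simp add: y_def t_def algebra_simps)
        then have "cmod (y i - y (Suc i)) = t" using t m by (simp only: norm_mult norm_of_real)
        then show ?thesis by (simp add: s_fun_def u_def v_def)
      qed
      also have "\<dots> \<le> arsinh (1 / \<sigma> * (1 / (2 * sqrt 2)))"
      proof (rule arsinh_mono)
        have "(\<sigma> * t) * (\<sigma> * (2 * t)) \<le> u * v" using uv st by (intro mult_mono) auto
        then have "sqrt ((\<sigma> * t)\<^sup>2 * 2) \<le> sqrt (u * v)" by (intro real_sqrt_le_mono) (simp add: power2_eq_square mult_ac)
        then have le: "\<sigma> * t * sqrt 2 \<le> sqrt (u * v)" using st by (simp add: real_sqrt_mult)
        have "t / (2 * sqrt (u * v)) \<le> t / (2 * (\<sigma> * t * sqrt 2))"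
        proof (rule frac_le)
          have "0 < (\<sigma> * t) * sqrt 2" using st by (rule mult_pos_pos) simp
          then show "0 < 2 * (\<sigma> * t * sqrt 2)" by linarith
        qed (use le t in auto)
        also have "\<dots> = 1 / \<sigma> * (1 / (2 * sqrt 2))" using t \<sigma> by simp
        finally show "t / (2 * sqrt (u * v)) \<le> 1 / \<sigma> * (1 / (2 * sqrt 2))" .
      qed
      also have "\<dots> \<le> 1 / \<sigma> * (ln 2 / 2)"
      proof -
        have "\<sigma> \<le> 1" by (simp add: \<sigma>_def)
        then have "1 \<le> 1 / \<sigma>" using \<sigma> by simp
        from arsinh_mult_le[OF this, of "1 / (2 * sqrt 2)"] show ?thesis by (simp only: arsinh_half_ln2) simp
      qed
      finally have s: "s_fun D (y i) (y (Suc i)) \<le> 1 / \<sigma> * (ln 2 / 2)" .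
      have "1 / \<sigma> \<le> 4 / 3" using \<sigma> by (simp add: field_simps)
      moreover have "ln 2 \<le> (1::real)" using ln_le_minus_one[of 2] by simp
      ultimately have "1 / \<sigma> * (ln 2 / 2) \<le> 4 / 3 * (1 / 2)" by (intro mult_mono) auto
      then have s1: "s_fun D (y i) (y (Suc i)) \<le> 1" using s by linarith
      have "(1 + h1) * s_fun D (y i) (y (Suc i)) \<le> (1 + h1) * (1 / \<sigma> * (ln 2 / 2))" using s h1 by (intro mult_left_mono) auto
      also have "\<dots> = ((1 + h1) / \<sigma>) * (ln 2 / 2)" by simp
      also have "(1 + h1) / \<sigma> \<le> 1 + h"
      proof -
        have "h * h \<le> 1 * h" using h by (intro mult_right_mono) auto
        moreover have "(1 + h) * (1 - h1) = 1 + h - h / 4 - h * h / 4" by (simp add: h1_def field_simps)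
        ultimately have "1 + h1 \<le> (1 + h) * (1 - h1)" using h by (simp add: h1_def)
        also have "\<dots> \<le> (1 + h) * \<sigma>" using \<sigma> h by (intro mult_left_mono) auto
        finally show ?thesis using \<sigma> by (simp add: divide_le_eq)
      qed
      finally have "k * ((1 + h1) * s_fun D (y i) (y (Suc i))) \<le> q"
        unfolding q_def using k by (intro mult_left_mono) auto
      then have "ennreal (k * ((1 + h1) * s_fun D (y i) (y (Suc i)))) \<le> ennreal q" by (rule ennreal_leI)
      moreover have "P (y i) (y (Suc i)) \<le> ennreal (k * ((1 + h1) * s_fun D (y i) (y (Suc i))))"
        using \<delta>1(2) y[OF i] y[OF that] s1 by blast
      moreover have "P (y (Suc i)) (y i) \<le> ennreal (k * ((1 + h1) * s_fun D (y (Suc i)) (y i)))"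
        using \<delta>1(2) y[OF i] y[OF that] s1 by (metis s_fun_commute)
      ultimately show ?thesis unfolding s_fun_commute[of D "y (Suc i)"] by (meson order.trans)
    qed
    have chain: "P (y 0) (y j) \<le> ennreal (real j * q) \<and> P (y j) (y 0) \<le> ennreal (real j * q)" if "2 ^ j * a < 2 * \<delta>" for j
      using that
    proof (induction j)
      case 0
      have "s_fun D (y 0) (y 0) = 0" by (simp add: s_fun_def)
      then have "P (y 0) (y 0) \<le> ennreal (k * ((1 + h1) * 0))" using \<delta>1(2) y[OF 0] by (metis zero_le_one)
      then show ?case by simp
    next
      case (Suc j)
      have "0 < 2 ^ j * a" using a by simp
      then have j: "2 ^ j * a < 2 * \<delta>" using Suc.prems by (simp only: power_Suc)
      have 0: "2 ^ 0 * a < 2 * \<delta>" using a\<delta> \<delta> by simp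
      have eq: "ennreal (real j * q) + ennreal q = ennreal (real (Suc j) * q)"
        using q by (simp add: ennreal_plus[symmetric] algebra_simps del: ennreal_plus)
      have "P (y 0) (y (Suc j)) \<le> P (y 0) (y j) + P (y j) (y (Suc j))"
        using disc_dominated_triangle[OF P] y(1)[OF j] y(1)[OF Suc.prems] y(1)[OF 0] by blast
      also have "\<dots> \<le> ennreal (real j * q) + ennreal q" using Suc.IH[OF j] step[OF Suc.prems] by (intro add_mono) auto
      finally have 1: "P (y 0) (y (Suc j)) \<le> ennreal (real (Suc j) * q)" unfolding eq .
      have "P (y (Suc j)) (y 0) \<le> P (y (Suc j)) (y j) + P (y j) (y 0)"
        using disc_dominated_triangle[OF P] y(1)[OF j] y(1)[OF Suc.prems] y(1)[OF 0] by blast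
      also have "\<dots> \<le> ennreal q + ennreal (real j * q)" using Suc.IH[OF j] step[OF Suc.prems] by (intro add_mono) auto
      finally have "P (y (Suc j)) (y 0) \<le> ennreal (real (Suc j) * q)" unfolding add.commute[of "ennreal q"] eq .
      then show ?case using 1 by simp
    qed
    obtain j0 :: nat where "l / a < 2 ^ j0" using real_arch_pow[of 2 "l / a"] by auto
    then have ex: "\<exists>j::nat. l \<le> 2 ^ j * a" using a by (intro exI[of _ j0]) (simp add: divide_less_eq)
    define j where "j = (LEAST j::nat. l \<le> 2 ^ j * a)"
    have lj: "l \<le> 2 ^ j * a" unfolding j_def using ex by (rule LeastI_ex)
    have j_cases: "j = 0 \<or> 2 ^ j * a < 2 * l"
    proof (cases j)
      case (Suc i)
      then have "\<not> l \<le> 2 ^ i * a" using not_less_Least[of i "\<lambda>j. l \<le> 2 ^ j * a"] by (simp add: j_def)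
      then show ?thesis using Suc by simp
    qed simp
    then have jd: "2 ^ j * a < 2 * \<delta>" using l a\<delta> a by auto
    have rj: "real j * ln 2 \<le> max 0 (ln (2 * l / a))"
    proof (cases "j = 0")
      case False
      then have "2 ^ j \<le> 2 * l / a" using j_cases a by (simp add: le_divide_eq)
      then have "ln (2 ^ j) \<le> ln (2 * l / a)" by (intro ln_mono) auto
      then show ?thesis by (simp add: ln_realpow)
    qed simp
    have "real j * q = k * ((1 + h) * (real j * ln 2 / 2))" by (simp add: q_def)
    also have "\<dots> \<le> k * ((1 + h) * (max 0 (ln (2 * l / a)) / 2))" using rj k h by (intro mult_left_mono divide_right_mono) auto
    finally have qj: "ennreal (real j * q) \<le> ennreal (k * ((1 + h) * (max 0 (ln (2 * l / bdry_dist D z)) / 2)))"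
      unfolding a_def by (rule ennreal_leI)
    show "\<exists>z'\<in>D. cmod (z' - z) \<le> 2 * l \<and> l / 2 \<le> bdry_dist D z' \<and>
       P z z' \<le> ennreal (k * ((1 + h) * (max 0 (ln (2 * l / bdry_dist D z)) / 2))) \<and>
       P z' z \<le> ennreal (k * ((1 + h) * (max 0 (ln (2 * l / bdry_dist D z)) / 2)))"
    proof (intro bexI[of _ "y j"] conjI)
      show "P z (y j) \<le> ennreal (k * ((1 + h) * (max 0 (ln (2 * l / bdry_dist D z)) / 2)))"
        "P (y j) z \<le> ennreal (k * ((1 + h) * (max 0 (ln (2 * l / bdry_dist D z)) / 2)))"
        using chain[OF jd] qj unfolding y0 by (meson order.trans)+
      have "1 / 2 * l \<le> \<sigma> * (2 ^ j * a)" using \<sigma> lj l by (intro mult_mono) auto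
      then show "l / 2 \<le> bdry_dist D (y j)" using y(2)[OF jd] by linarith
      have "y j - z = of_real (2 ^ j * a - a) * m" by (simp add: y_def zm algebra_simps)
      then have "cmod (y j - z) = \<bar>2 ^ j * a - a\<bar>" using m by (simp only: norm_mult norm_of_real) simp
      moreover have "1 * a \<le> 2 ^ j * a" using a by (intro mult_right_mono) auto
      ultimately show "cmod (y j - z) \<le> 2 * l" using j_cases a l by auto
      show "y j \<in> D" using y(1)[OF jd] .
    qed
  qed
qed

text \<open>The bound \<open>log (2 x) \<le> arsinh x\<close>.\<close>

lemma s_fun_ge_ln:
  assumes a: "0 < bdry_dist D z" and b: "0 < bdry_dist D w" and L: "z \<noteq> w"
  shows "(ln (cmod (z - w) / bdry_dist D z) + ln (cmod (z - w) / bdry_dist D w)) / 2 \<le> s_fun D z w"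
proof -
  define L a b where "L = cmod (z - w)" and "a = bdry_dist D z" and "b = bdry_dist D w"
  have p: "0 < L" "0 < a" "0 < b" using assms by (auto simp: L_def a_def b_def)
  define x where "x = L / (2 * sqrt (a * b))"
  have x: "0 < x" using p by (simp add: x_def)
  have "2 * x = L / sqrt (a * b)" by (simp add: x_def)
  also have "\<dots> = sqrt ((L / a) * (L / b))" using p by (simp add: real_sqrt_divide real_sqrt_mult)
  finally have "ln (2 * x) = ln (sqrt ((L / a) * (L / b)))" by simp
  also have "\<dots> = ln ((L / a) * (L / b)) / 2" using p by (intro ln_sqrt) auto
  also have "ln ((L / a) * (L / b)) = ln (L / a) + ln (L / b)" using p by (intro ln_mult_pos) auto
  finally have eq: "ln (2 * x) = (ln (L / a) + ln (L / b)) / 2" .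
  have "sqrt (x\<^sup>2) \<le> sqrt (x\<^sup>2 + 1)" by (rule real_sqrt_le_mono) simp
  then have "2 * x \<le> x + sqrt (x\<^sup>2 + 1)" using x by simp
  then have "ln (2 * x) \<le> arsinh x" unfolding arsinh_real_def using x by (intro ln_mono) auto
  then show ?thesis unfolding eq by (simp add: s_fun_def x_def L_def a_def b_def)
qed

text \<open>A constant that is small compared with s changes the factor \<open>1 + h / 4\<close> to at most \<open>1 + h\<close>.\<close>

lemma absorb_constant:
  fixes h s C k :: real
  assumes h: "0 < h" "h \<le> 1" and k: "0 \<le> k" and s: "0 \<le> s" and C: "C \<le> h / 4 * s" and X: "X \<le> s + C"
  shows "k * ((1 + h / 4) * X) \<le> k * ((1 + h) * s)"
proof -
  have "X \<le> (1 + h / 4) * s" using C X by (simp add: algebra_simps)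
  then have "(1 + h / 4) * X \<le> (1 + h / 4) * ((1 + h / 4) * s)" using h by (intro mult_left_mono) auto
  also have "\<dots> = (1 + h / 2 + h * h / 16) * s" by (simp add: field_simps)
  also have "\<dots> \<le> (1 + h) * s"
  proof (rule mult_right_mono[OF _ s])
    have "h * h \<le> 1 * h" using h by (intro mult_right_mono) auto
    then show "1 + h / 2 + h * h / 16 \<le> 1 + h" using h by linarith
  qed
  finally show ?thesis using k by (intro mult_left_mono)
qed

text \<open>For large s, ascending from both points to the height \<open>L = |z - w|\<close> costs half the sum of \<open>log (2 L / d)\<close>
  over both points, which is s up to a constant; the points z' and w' reached satisfy \<open>s \<le> arsinh 5\<close>.\<close>

lemma disc_dominated_upper_near:
  assumes P: "disc_dominated D S k P" and flat: "flat_along D S" and D: "domain D" and h: "0 < h" "h \<le> 1"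
  shows "\<exists>\<delta>>0. \<forall>z\<in>D. \<forall>w\<in>D. infdist z S < \<delta> \<longrightarrow> infdist w S < \<delta> \<longrightarrow> cmod (z - w) < \<delta> \<longrightarrow>
    P z w \<le> ennreal (k * ((1 + h) * s_fun D z w))"
proof -
  have oD: "open D" and S: "S \<subseteq> frontier D" "S \<noteq> {}" using flat D by (auto simp: flat_along_def domain_def)
  then have fr: "frontier D \<noteq> {}" by auto
  have k: "0 \<le> k" using P by (simp add: disc_dominated_def)
  define h1 where "h1 = h / 4"
  have h1: "0 < h1" "h1 \<le> 1" "h1 \<le> h" using h by (auto simp: h1_def)
  define C where "C = ln 2 + arsinh (5::real)"
  have ars: "0 \<le> arsinh (5::real)" using arsinh_mono[of 0 5] by simp
  have C: "0 \<le> C" using ars by (simp add: C_def)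
  define N where "N = C / h1 + arsinh 5"
  have N: "C / h1 \<le> N" "arsinh 5 \<le> N" using C h1 ars by (auto simp: N_def)
  obtain \<delta>1 where \<delta>1: "0 < \<delta>1" "\<And>z w. z \<in> D \<Longrightarrow> w \<in> D \<Longrightarrow> infdist z S < \<delta>1 \<Longrightarrow> s_fun D z w \<le> N \<Longrightarrow>
      P z w \<le> ennreal (k * ((1 + h1) * s_fun D z w))"
    using disc_dominated_mid_range[OF P flat D h1(1,2), of N] by blast
  obtain \<delta>2 where \<delta>2: "0 < \<delta>2" "\<And>z l. z \<in> D \<Longrightarrow> infdist z S < \<delta>2 \<Longrightarrow> 0 < l \<Longrightarrow> l < \<delta>2 \<Longrightarrow>
    (\<exists>z'\<in>D. cmod (z' - z) \<le> 2 * l \<and> l / 2 \<le> bdry_dist D z' \<and>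
       P z z' \<le> ennreal (k * ((1 + h1) * (max 0 (ln (2 * l / bdry_dist D z)) / 2))) \<and>
       P z' z \<le> ennreal (k * ((1 + h1) * (max 0 (ln (2 * l / bdry_dist D z)) / 2))))"
    using ascend_from_boundary[OF P flat D h1(1,2)] by blast
  define \<delta> where "\<delta> = min \<delta>2 (\<delta>1 / 4)"
  have \<delta>: "0 < \<delta>" "\<delta> \<le> \<delta>2" "4 * \<delta> \<le> \<delta>1" using \<delta>1 \<delta>2 by (auto simp: \<delta>_def)
  show ?thesis
  proof (rule exI[of _ \<delta>], intro conjI \<delta>(1) ballI impI)
    fix z w assume z: "z \<in> D" and w: "w \<in> D" and dz: "infdist z S < \<delta>" and dw: "infdist w S < \<delta>" and zw: "cmod (z - w) < \<delta>"
    define a b L s where "a = bdry_dist D z" and "b = bdry_dist D w" and "L = cmod (z - w)" and "s = s_fun D z w"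
    have ab: "0 < a" "0 < b" using bdry_dist_pos[OF oD _ fr] z w by (auto simp: a_def b_def)
    have s0: "0 \<le> s" unfolding s_def by (rule s_fun_nonneg)
    show "P z w \<le> ennreal (k * ((1 + h) * s_fun D z w))"
    proof (cases "s \<le> N")
      case True
      then have "P z w \<le> ennreal (k * ((1 + h1) * s))" using \<delta>1(2)[OF z w] dz \<delta> by (simp add: s_def)
      also have "\<dots> \<le> ennreal (k * ((1 + h) * s))" using k s0 h1 by (intro ennreal_leI mult_left_mono mult_right_mono) auto
      finally show ?thesis by (simp add: s_def)
    next
      case False
      have "z \<noteq> w"
      proof
        assume "z = w"
        then have "s = 0" by (simp add: s_def s_fun_def)
        then show False using False N ars by linarith
      qed
      then have L: "0 < L" by (simp add: L_def)
      have "5 \<le> sinh s"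
      proof -
        have "sinh (arsinh 5) \<le> sinh s" using False N by (subst sinh_real_le_iff) linarith
        then show ?thesis by simp
      qed
      then have min_ab: "a \<le> L / 10 \<or> b \<le> L / 10"
        using min_bdry_dist_small[of D z w 5] min_bdry_dist_small[of D w z 5] ab
        by (cases "a \<le> b") (auto simp: a_def b_def L_def s_def s_fun_commute norm_minus_commute)
      have "\<bar>a - b\<bar> \<le> L" using bdry_dist_triangle[of D z w] bdry_dist_triangle[of D w z]
        by (simp add: a_def b_def L_def dist_norm norm_minus_commute)
      then have ab2: "a \<le> 2 * L" "b \<le> 2 * L" using min_ab L by linarith+
      define A B where "A = ln (L / a)" and "B = ln (L / b)"
      have mx: "max 0 (ln (2 * L / a)) = ln 2 + A" "max 0 (ln (2 * L / b)) = ln 2 + B"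
      proof -
        have "ln (2 * L / a) = ln 2 + A" "ln (2 * L / b) = ln 2 + B"
          using L ab ln_mult_pos[of 2 "L / a"] ln_mult_pos[of 2 "L / b"] by (simp_all add: A_def B_def)
        moreover have "0 \<le> ln (2 * L / a)" "0 \<le> ln (2 * L / b)" using ab ab2 by auto
        ultimately show "max 0 (ln (2 * L / a)) = ln 2 + A" "max 0 (ln (2 * L / b)) = ln 2 + B" by linarith+
      qed
      have AB0: "0 \<le> ln 2 + A" "0 \<le> ln 2 + B" unfolding mx[symmetric] by auto
      have Ld: "L < \<delta>2" using zw \<delta> by (simp add: L_def)
      obtain z' where z': "z' \<in> D" "cmod (z' - z) \<le> 2 * L" "L / 2 \<le> bdry_dist D z'"
        "P z z' \<le> ennreal (k * ((1 + h1) * ((ln 2 + A) / 2)))"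
        using \<delta>2(2)[OF z _ L Ld] dz \<delta> unfolding a_def[symmetric] mx by auto
      obtain w' where w': "w' \<in> D" "cmod (w' - w) \<le> 2 * L" "L / 2 \<le> bdry_dist D w'"
        "P w' w \<le> ennreal (k * ((1 + h1) * ((ln 2 + B) / 2)))"
        using \<delta>2(2)[OF w _ L Ld] dw \<delta> unfolding b_def[symmetric] mx by auto
      have s': "s_fun D z' w' \<le> arsinh 5"
        unfolding s_fun_def
      proof (rule arsinh_mono)
        have "cmod (z' - w') \<le> cmod (z' - z) + cmod (z - w) + cmod (w - w')"
          using norm_triangle_ineq[of "z' - z" "z - w"] norm_triangle_ineq[of "z' - w" "w - w'"] by simp
        then have n: "cmod (z' - w') \<le> 5 * L" using z'(2) w'(2) by (simp add: L_def norm_minus_commute)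
        have "(L / 2) * (L / 2) \<le> bdry_dist D z' * bdry_dist D w'" using z'(3) w'(3) L by (intro mult_mono) auto
        then have "sqrt ((L / 2)\<^sup>2) \<le> sqrt (bdry_dist D z' * bdry_dist D w')" by (intro real_sqrt_le_mono) (simp add: power2_eq_square)
        then have "L \<le> 2 * sqrt (bdry_dist D z' * bdry_dist D w')" using L by simp
        then have "cmod (z' - w') / (2 * sqrt (bdry_dist D z' * bdry_dist D w')) \<le> (5 * L) / L"
          using n L by (intro frac_le) auto
        then show "cmod (z' - w') / (2 * sqrt (bdry_dist D z' * bdry_dist D w')) \<le> 5" using L by simp
      qed
      have "infdist z' S < \<delta>1" using infdist_triangle[of z' S z] z'(2) dz zw \<delta> by (simp add: dist_norm L_def)
      then have "P z' w' \<le> ennreal (k * ((1 + h1) * s_fun D z' w'))" using \<delta>1(2)[OF z'(1) w'(1)] s' N by simp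
      also have "\<dots> \<le> ennreal (k * ((1 + h1) * arsinh 5))" using k s' h1 by (intro ennreal_leI mult_left_mono) auto
      finally have mid: "P z' w' \<le> ennreal (k * ((1 + h1) * arsinh 5))" .
      have "P z w \<le> P z z' + P z' w" "P z' w \<le> P z' w' + P w' w"
        using disc_dominated_triangle[OF P] z w z' w' by blast+
      then have "P z w \<le> P z z' + (P z' w' + P w' w)" by (meson add_left_mono order.trans)
      also have "\<dots> \<le> ennreal (k * ((1 + h1) * ((ln 2 + A) / 2))) + (ennreal (k * ((1 + h1) * arsinh 5)) + ennreal (k * ((1 + h1) * ((ln 2 + B) / 2))))"
        using z'(4) mid w'(4) by (intro add_mono)
      also have "\<dots> = ennreal (k * ((1 + h1) * ((ln 2 + A) / 2)) + (k * ((1 + h1) * arsinh 5) + k * ((1 + h1) * ((ln 2 + B) / 2))))"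
        using k h1 AB0 ars by (simp add: ennreal_plus[symmetric] del: ennreal_plus)
      also have "k * ((1 + h1) * ((ln 2 + A) / 2)) + (k * ((1 + h1) * arsinh 5) + k * ((1 + h1) * ((ln 2 + B) / 2)))
         = k * ((1 + h / 4) * ((A + B) / 2 + C))" by (simp add: C_def h1_def algebra_simps add_divide_distrib)
      also have "ennreal \<dots> \<le> ennreal (k * ((1 + h) * s))"
      proof (intro ennreal_leI absorb_constant[OF h k s0, of C])
        have "C / h1 \<le> s" using False N by linarith
        then show "C \<le> h / 4 * s" using h by (simp add: h1_def field_simps)
        show "(A + B) / 2 + C \<le> s + C"
          using s_fun_ge_ln[of D z w] ab \<open>z \<noteq> w\<close> by (simp add: A_def B_def a_def b_def L_def s_def)
      qed
      finally show ?thesis by (simp add: s_def)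
    qed
  qed
qed

text \<open>Finiteness of P on D x D propagates along the connected set D; local boundedness and a finite cover of
  the compact set of points at depth c then give a common bound.\<close>

lemma bounded_on_interior_compact:
  assumes P: "disc_dominated D S k P" and D: "domain D" "bounded D" and c: "0 < c"
    and loc: "\<And>x. x \<in> D \<Longrightarrow> \<exists>e>0. \<exists>C. \<forall>y\<in>ball x e. y \<in> D \<and> P x y \<le> ennreal C \<and> P y x \<le> ennreal C"
  shows "\<exists>C\<ge>0. \<forall>x\<in>D. \<forall>y\<in>D. c \<le> bdry_dist D x \<longrightarrow> c \<le> bdry_dist D y \<longrightarrow> P x y \<le> ennreal C"
proof -
  have oD: "open D" and cD: "connected D" using D by (auto simp: domain_def)
  obtain x0 where x0: "x0 \<in> D" using D by (auto simp: domain_def)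
  note tri = disc_dominated_triangle[OF P]
  define R where "R x y \<longleftrightarrow> x \<in> D \<and> y \<in> D \<and> P x y < top \<and> P y x < top" for x y
  have fin: "R x0 x" if x: "x \<in> D" for x
  proof (rule connected_equivalence_relation[OF cD x0 x])
    show "R y x" if "R x y" for x y using that by (simp add: R_def)
    show "R x z" if "R x y" "R y z" for x y z
    proof -
      have m: "x \<in> D" "y \<in> D" "z \<in> D" using that by (auto simp: R_def)
      have "P x y + P y z < top" "P z y + P y x < top" using that by (auto simp: R_def)
      then show ?thesis using tri[OF m] tri[OF m(3,2,1)] m unfolding R_def by (meson le_less_trans)
    qed
    fix a assume a: "a \<in> D"
    then obtain e C where e: "0 < e" "\<forall>y\<in>ball a e. y \<in> D \<and> P a y \<le> ennreal C \<and> P y a \<le> ennreal C" using loc by blast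
    have "R a y" if "y \<in> ball a e" for y
      using e(2) that a le_less_trans[OF _ ennreal_less_top] unfolding R_def by blast
    moreover have "openin (top_of_set D) (ball a e)" using e(2) oD by (simp add: openin_open_eq subset_iff)
    ultimately show "\<exists>T. openin (top_of_set D) T \<and> a \<in> T \<and> (\<forall>x\<in>T. R a x)"
      using e(1) by (intro exI[of _ "ball a e"]) auto
  qed
  have "\<exists>e>0. \<exists>C. \<forall>y\<in>ball x e. P x0 y \<le> ennreal C \<and> P y x0 \<le> ennreal C" if x: "x \<in> D" for x
  proof -
    obtain e C where e: "0 < e" "\<forall>y\<in>ball x e. y \<in> D \<and> P x y \<le> ennreal C \<and> P y x \<le> ennreal C" using loc[OF x] by blast
    obtain u v where uv: "P x0 x = ennreal u" "0 \<le> u" "P x x0 = ennreal v" "0 \<le> v"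
      using fin[OF x] unfolding R_def by (metis ennreal_cases less_irrefl infinity_ennreal_def)
    define M where "M = u + v + max 0 C"
    have "P x0 y \<le> ennreal M \<and> P y x0 \<le> ennreal M" if y: "y \<in> ball x e" for y
    proof -
      have m: "y \<in> D" and PC: "P x y \<le> ennreal (max 0 C)" "P y x \<le> ennreal (max 0 C)" using e(2) y by (auto simp: max_def ennreal_neg)
      have "P x0 y \<le> ennreal u + ennreal (max 0 C)" using tri[OF x0 x m] PC(1) uv(1) by (metis add_left_mono order.trans)
      also have "\<dots> \<le> ennreal M" using uv by (subst ennreal_plus[symmetric]) (auto simp: M_def intro!: ennreal_leI simp del: ennreal_plus)
      finally have 1: "P x0 y \<le> ennreal M" .
      have "P y x0 \<le> ennreal (max 0 C) + ennreal v" using tri[OF m x x0] PC(2) uv(3) by (metis add_right_mono order.trans)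
      also have "\<dots> \<le> ennreal M" using uv by (subst ennreal_plus[symmetric]) (auto simp: M_def intro!: ennreal_leI simp del: ennreal_plus)
      finally show ?thesis using 1 by blast
    qed
    then show ?thesis using e(1) by blast
  qed
  then obtain e B where e: "\<And>x. x \<in> D \<Longrightarrow> 0 < e x"
    "\<And>x y. x \<in> D \<Longrightarrow> y \<in> ball x (e x) \<Longrightarrow> P x0 y \<le> ennreal (B x) \<and> P y x0 \<le> ennreal (B x)" by metis
  define K where "K = closure D \<inter> {x. c \<le> bdry_dist D x}"
  have KD: "K \<subseteq> D"
  proof
    fix x assume x: "x \<in> K"
    have "x \<notin> frontier D" using x c by (auto simp: K_def bdry_dist_def infdist_zero)
    then show "x \<in> D" using x oD by (auto simp: K_def frontier_def interior_open)
  qed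
  have "closed {x. c \<le> bdry_dist D x}"
    unfolding bdry_dist_def by (intro closed_Collect_le continuous_intros)
  then have "compact K" unfolding K_def using D(2) by (intro compact_Int_closed) auto
  moreover have "K \<subseteq> (\<Union>x\<in>K. ball x (e x))"
  proof
    fix x assume x: "x \<in> K"
    then have "x \<in> ball x (e x)" using e(1) KD by auto
    then show "x \<in> (\<Union>x\<in>K. ball x (e x))" using x by blast
  qed
  ultimately obtain F where F: "F \<subseteq> K" "finite F" "K \<subseteq> (\<Union>x\<in>F. ball x (e x))"
    using compactE_image[of K K "\<lambda>x. ball x (e x)"] by (metis open_ball)
  define M where "M = (\<Sum>x\<in>F. \<bar>B x\<bar>)"
  have M: "P x0 y \<le> ennreal M \<and> P y x0 \<le> ennreal M" if yK: "y \<in> K" for y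
  proof -
    obtain x where x: "x \<in> F" "y \<in> ball x (e x)" using F(3) yK by blast
    have "B x \<le> \<bar>B x\<bar>" by simp
    also have "\<dots> \<le> M" unfolding M_def using F(2) x(1) by (intro member_le_sum) auto
    finally have "ennreal (B x) \<le> ennreal M" by (rule ennreal_leI)
    then show ?thesis using e(2)[of x y] x F(1) KD by (meson order.trans subsetD)
  qed
  have M0: "0 \<le> M" unfolding M_def by (intro sum_nonneg) auto
  show ?thesis
  proof (rule exI[of _ "M + M"], intro conjI ballI impI)
    show "0 \<le> M + M" using M0 by simp
    fix x y assume x: "x \<in> D" and y: "y \<in> D" and cxy: "c \<le> bdry_dist D x" "c \<le> bdry_dist D y"
    have "x \<in> K" "y \<in> K" using x y cxy closure_subset by (auto simp: K_def)
    then have "P x y \<le> ennreal M + ennreal M" using tri[OF x x0 y] M by (meson add_mono order.trans)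
    then show "P x y \<le> ennreal (M + M)" unfolding ennreal_plus[OF M0 M0] .
  qed
qed

text \<open>Pairs at distance at least l are joined through the set of points of depth l / 2, on which P is bounded by a
  constant C. The small \<open>\<delta>\<close> makes \<open>log (l / d(z))\<close>, and hence s, large compared with C.\<close>

lemma disc_dominated_upper_uniform:
  assumes P: "disc_dominated D (frontier D) k P" and flat: "flat_along D (frontier D)" and D: "domain D" "bounded D"
    and h: "0 < h" "h \<le> 1" and k: "0 < k"
    and loc: "\<And>x. x \<in> D \<Longrightarrow> \<exists>e>0. \<exists>C. \<forall>y\<in>ball x e. y \<in> D \<and> P x y \<le> ennreal C \<and> P y x \<le> ennreal C"
  shows "\<exists>\<delta>>0. \<forall>z\<in>D. \<forall>w\<in>D. bdry_dist D z < \<delta> \<longrightarrow> P z w \<le> ennreal (k * ((1 + h) * s_fun D z w))"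
proof -
  have oD: "open D" and fr: "frontier D \<noteq> {}" using flat D by (auto simp: flat_along_def domain_def)
  define h1 where "h1 = h / 4"
  have h1: "0 < h1" "h1 \<le> 1" using h by (auto simp: h1_def)
  obtain \<delta>1 where \<delta>1: "0 < \<delta>1" "\<And>z w. z \<in> D \<Longrightarrow> w \<in> D \<Longrightarrow> bdry_dist D z < \<delta>1 \<Longrightarrow> bdry_dist D w < \<delta>1 \<Longrightarrow> cmod (z - w) < \<delta>1 \<Longrightarrow>
      P z w \<le> ennreal (k * ((1 + h) * s_fun D z w))"
    using disc_dominated_upper_near[OF P flat D(1) h] unfolding bdry_dist_def by blast
  obtain \<delta>2 where \<delta>2: "0 < \<delta>2" "\<And>z l. z \<in> D \<Longrightarrow> bdry_dist D z < \<delta>2 \<Longrightarrow> 0 < l \<Longrightarrow> l < \<delta>2 \<Longrightarrow>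
    (\<exists>z'\<in>D. cmod (z' - z) \<le> 2 * l \<and> l / 2 \<le> bdry_dist D z' \<and>
       P z z' \<le> ennreal (k * ((1 + h1) * (max 0 (ln (2 * l / bdry_dist D z)) / 2))) \<and>
       P z' z \<le> ennreal (k * ((1 + h1) * (max 0 (ln (2 * l / bdry_dist D z)) / 2))))"
    using ascend_from_boundary[OF P flat D(1) h1] unfolding bdry_dist_def by blast
  define l where "l = min (\<delta>1 / 2) (\<delta>2 / 2)"
  have l: "0 < l" "2 * l \<le> \<delta>1" "l < \<delta>2" using \<delta>1 \<delta>2 by (auto simp: l_def)
  have l2: "0 < l / 2" using l by simp
  obtain C where C: "0 \<le> C" "\<And>x y. x \<in> D \<Longrightarrow> y \<in> D \<Longrightarrow> l / 2 \<le> bdry_dist D x \<Longrightarrow> l / 2 \<le> bdry_dist D y \<Longrightarrow> P x y \<le> ennreal C"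
    using bounded_on_interior_compact[OF P D l2 loc] by blast
  define C' where "C' = C / (k * (1 + h1))"
  define Q where "Q = ln 2 + C'"
  have C': "0 \<le> C'" "C = k * ((1 + h1) * C')" using C k h1 by (auto simp: C'_def)
  have Q: "0 \<le> Q" using C' by (simp add: Q_def)
  define \<delta> where "\<delta> = l * exp (- (ln 2 + 2 * Q / h1))"
  have "0 \<le> ln (2::real) + 2 * Q / h1" using Q h1 by (intro add_nonneg_nonneg divide_nonneg_nonneg) auto
  then have "exp (- (ln 2 + 2 * Q / h1)) \<le> 1" by simp
  then have "l * exp (- (ln 2 + 2 * Q / h1)) \<le> l * 1" using l by (intro mult_left_mono) auto
  then have \<delta>: "0 < \<delta>" "\<delta> \<le> l" using l by (auto simp: \<delta>_def)
  show ?thesis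
  proof (rule exI[of _ \<delta>], intro conjI \<delta>(1) ballI impI)
    fix z w assume z: "z \<in> D" and w: "w \<in> D" and dz: "bdry_dist D z < \<delta>"
    define a b L s where "a = bdry_dist D z" and "b = bdry_dist D w" and "L = cmod (z - w)" and "s = s_fun D z w"
    have ab: "0 < a" "0 < b" using bdry_dist_pos[OF oD _ fr] z w by (auto simp: a_def b_def)
    have s0: "0 \<le> s" unfolding s_def by (rule s_fun_nonneg)
    have ba: "b \<le> a + L" using bdry_dist_triangle[of D w z] by (simp add: a_def b_def L_def dist_norm norm_minus_commute)
    show "P z w \<le> ennreal (k * ((1 + h) * s_fun D z w))"
    proof (cases "L < l")
      case True
      then show ?thesis using \<delta>1(2)[OF z w] dz ba \<delta> l by (simp add: a_def b_def L_def)
    next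
      case False
      then have L: "0 < L" "l \<le> L" using l by auto
      then have zw: "z \<noteq> w" by (auto simp: L_def)
      have al: "a < l" using dz \<delta> by (simp add: a_def)
      have b2: "b \<le> 2 * L" "a \<le> 2 * L" using ba al L by linarith+
      define A B where "A = ln (L / a)" and "B = ln (L / b)"
      have ln2: "ln (2 * L / a) = ln 2 + A" "ln (2 * L / b) = ln 2 + B"
        using L ab ln_mult_pos[of 2 "L / a"] ln_mult_pos[of 2 "L / b"] by (simp_all add: A_def B_def)
      have AB0: "0 \<le> ln 2 + A" "0 \<le> ln 2 + B" unfolding ln2[symmetric] using ab b2 by auto
      have mx: "max 0 (ln (2 * l / a)) \<le> ln 2 + A" "max 0 (ln (2 * l / b)) \<le> ln 2 + B"
      proof -
        have "ln (2 * l / a) \<le> ln 2 + A" "ln (2 * l / b) \<le> ln 2 + B"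
          unfolding ln2[symmetric] using l L ab by (auto intro!: ln_mono divide_right_mono)
        then show "max 0 (ln (2 * l / a)) \<le> ln 2 + A" "max 0 (ln (2 * l / b)) \<le> ln 2 + B" using AB0 by auto
      qed
      have weaken: "ennreal (k * ((1 + h1) * (max 0 x / 2))) \<le> ennreal (k * ((1 + h1) * (y / 2)))" if "max 0 x \<le> y" for x y
        using that k h1 by (intro ennreal_leI mult_left_mono divide_right_mono) auto
      obtain z' where z': "z' \<in> D" "l / 2 \<le> bdry_dist D z'" "P z z' \<le> ennreal (k * ((1 + h1) * ((ln 2 + A) / 2)))"
        using \<delta>2(2)[OF z _ l(1,3)] al l(3) weaken[OF mx(1)] unfolding a_def[symmetric] by (meson order.trans less_trans)
      have "\<exists>w'\<in>D. l / 2 \<le> bdry_dist D w' \<and> P w' w \<le> ennreal C + ennreal (k * ((1 + h1) * ((ln 2 + B) / 2)))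
         \<and> P z' w \<le> ennreal C + ennreal (k * ((1 + h1) * ((ln 2 + B) / 2)))"
      proof (cases "b < \<delta>2")
        case True
        then obtain w' where w': "w' \<in> D" "l / 2 \<le> bdry_dist D w'" "P w' w \<le> ennreal (k * ((1 + h1) * ((ln 2 + B) / 2)))"
          using \<delta>2(2)[OF w _ l(1,3)] weaken[OF mx(2)] unfolding b_def[symmetric] by (meson order.trans)
        have "P z' w \<le> P z' w' + P w' w" by (rule disc_dominated_triangle[OF P z'(1) w'(1) w])
        also have "\<dots> \<le> ennreal C + ennreal (k * ((1 + h1) * ((ln 2 + B) / 2)))"
          using C(2)[OF z'(1) w'(1) z'(2) w'(2)] w'(3) by (rule add_mono)
        finally show ?thesis using w' by (meson add_increasing zero_le order.trans)
      next
        case False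
        then have "l / 2 \<le> bdry_dist D w" using l by (simp add: b_def)
        then show ?thesis using C(2)[OF z'(1) w z'(2)] C(2)[OF w w] w by (meson add_increasing2 zero_le order.trans)
      qed
      then have zw': "P z' w \<le> ennreal C + ennreal (k * ((1 + h1) * ((ln 2 + B) / 2)))" by blast
      have "P z w \<le> P z z' + P z' w" by (rule disc_dominated_triangle[OF P z z'(1) w])
      also have "\<dots> \<le> ennreal (k * ((1 + h1) * ((ln 2 + A) / 2))) + (ennreal C + ennreal (k * ((1 + h1) * ((ln 2 + B) / 2))))"
        using z'(3) zw' by (rule add_mono)
      also have "\<dots> = ennreal (k * ((1 + h1) * ((ln 2 + A) / 2)) + (C + k * ((1 + h1) * ((ln 2 + B) / 2))))"
        using k h1 AB0 C(1) by (simp add: ennreal_plus[symmetric] del: ennreal_plus)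
      also have "k * ((1 + h1) * ((ln 2 + A) / 2)) + (C + k * ((1 + h1) * ((ln 2 + B) / 2)))
         = k * ((1 + h / 4) * ((A + B) / 2 + Q))"
        unfolding C'(2) by (simp add: Q_def h1_def algebra_simps add_divide_distrib)
      also have "ennreal \<dots> \<le> ennreal (k * ((1 + h) * s))"
      proof (intro ennreal_leI absorb_constant[OF h less_imp_le[OF k] s0, of Q])
        have AB: "(A + B) / 2 \<le> s"
          using s_fun_ge_ln[of D z w] ab zw by (simp add: A_def B_def a_def b_def L_def s_def)
        then show "(A + B) / 2 + Q \<le> s + Q" by simp
        have "exp (ln 2 + 2 * Q / h1) \<le> l / a"
          using dz ab unfolding a_def[symmetric] \<delta>_def exp_minus by (simp add: field_simps)
        also have "\<dots> \<le> L / a" using L ab by (intro divide_right_mono) auto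
        finally have "ln 2 + 2 * Q / h1 \<le> A" unfolding A_def using L ab by (subst ln_ge_iff) auto
        then have "2 * (Q / h1) \<le> A - ln 2" by simp
        then have "Q / h1 \<le> s" using AB AB0(2) by argo
        then show "Q \<le> h / 4 * s" using h by (simp add: h1_def field_simps)
      qed
      finally show ?thesis by (simp add: s_def)
    qed
  qed
qed

section \<open>Comparison of the three distances with s\<close>

text \<open>The second alternative is the situation of the uniform statement, in which w is arbitrary.\<close>

definition near_pair :: "complex set \<Rightarrow> complex set \<Rightarrow> real \<Rightarrow> complex \<Rightarrow> complex \<Rightarrow> bool"
  where "near_pair D S \<delta> z w \<longleftrightarrow> infdist z S < \<delta> \<and>
    (infdist w S < \<delta> \<and> cmod (z - w) < \<delta> \<or> S = frontier D \<and> bounded D)"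

lemma near_pair_mono: "near_pair D S \<delta> z w \<Longrightarrow> \<delta> \<le> \<delta>' \<Longrightarrow> near_pair D S \<delta>' z w"
  by (auto simp: near_pair_def)

lemma near_pair_dist_bound:
  "\<exists>M. \<forall>z\<in>D. \<forall>w\<in>D. near_pair D S 1 z w \<longrightarrow> cmod (z - w) \<le> M"
proof (cases "bounded D")
  case True
  then obtain B where B: "\<And>x. x \<in> D \<Longrightarrow> cmod x \<le> B" unfolding bounded_iff by blast
  have "cmod (z - w) \<le> B + B" if "z \<in> D" "w \<in> D" for z w
    using B[OF that(1)] B[OF that(2)] norm_triangle_ineq4[of z w] by linarith
  then show ?thesis by blast
next
  case False
  then show ?thesis by (intro exI[of _ 1]) (auto simp: near_pair_def)
qed

lemma disc_dominated_upper:
  assumes P: "disc_dominated D S k P" and flat: "flat_along D S" and D: "domain D" and h: "0 < h" "h \<le> 1" and k: "0 < k"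
    and loc: "\<And>x. x \<in> D \<Longrightarrow> \<exists>e>0. \<exists>C. \<forall>y\<in>ball x e. y \<in> D \<and> P x y \<le> ennreal C \<and> P y x \<le> ennreal C"
  shows "\<exists>\<delta>>0. \<forall>z\<in>D. \<forall>w\<in>D. near_pair D S \<delta> z w \<longrightarrow> P z w \<le> ennreal (k * ((1 + h) * s_fun D z w))"
proof (cases "S = frontier D \<and> bounded D")
  case True
  then have S: "S = frontier D" and b: "bounded D" by auto
  obtain \<delta> where "0 < \<delta>" "\<forall>z\<in>D. \<forall>w\<in>D. bdry_dist D z < \<delta> \<longrightarrow> P z w \<le> ennreal (k * ((1 + h) * s_fun D z w))"
    using disc_dominated_upper_uniform[OF P[unfolded S] flat[unfolded S] D b h k loc] by blast
  then show ?thesis unfolding near_pair_def bdry_dist_def S by blast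
next
  case False
  then show ?thesis using disc_dominated_upper_near[OF P flat D h] unfolding near_pair_def by blast
qed

lemma kobayashi_disc_dominated:
  assumes D: "domain D"
  shows "disc_dominated D S 1 (\<lambda>z w. ennreal (kobayashi_dist D z w))"
proof -
  have tri: "ennreal (kobayashi_dist D x z) \<le> ennreal (kobayashi_dist D x y) + ennreal (kobayashi_dist D y z)"
    if m: "x \<in> D" "y \<in> D" "z \<in> D" for x y z
  proof -
    have "kobayashi_dist D x z \<le> kobayashi_dist D x y + kobayashi_dist D y z"
      "0 \<le> kobayashi_dist D x y" "0 \<le> kobayashi_dist D y z"
      using kobayashi_pseudodistance[OF D] m unfolding pseudodistance_on_def by blast+
    then show ?thesis by (subst ennreal_plus[symmetric]) (auto intro: ennreal_leI simp del: ennreal_plus)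
  qed
  have "ennreal (kobayashi_dist D z w) \<le> ennreal (1 * disc_dist c r z w)"
    if "0 < r" "ball c r \<subseteq> D" "z \<in> ball c r" "w \<in> ball c r" for c r z w
    using kobayashi_le_disc_dist[OF D that(2,1,3,4)] by (simp add: ennreal_leI)
  then show ?thesis unfolding disc_dominated_def using tri by (intro conjI exI[of _ 1]) auto
qed

lemma kobayashi_locally_bounded:
  assumes D: "domain D" and fr: "frontier D \<noteq> {}" and x: "x \<in> D"
  shows "\<exists>e>0. \<exists>C. \<forall>y\<in>ball x e. y \<in> D \<and> ennreal (kobayashi_dist D x y) \<le> ennreal C \<and> ennreal (kobayashi_dist D y x) \<le> ennreal C"
proof -
  define d where "d = bdry_dist D x"
  have d: "0 < d" unfolding d_def using D x fr by (intro bdry_dist_pos) (auto simp: domain_def)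
  have B: "ball x d \<subseteq> D" unfolding d_def by (rule ball_bdry_dist_subset[OF x])
  show ?thesis
  proof (rule exI[of _ "d / 2"], rule conjI, use d in simp, rule exI[of _ "arsinh 1"], rule ballI)
    fix y assume "y \<in> ball x (d / 2)"
    then have yd: "cmod (x - y) < d / 2" and y: "y \<in> ball x d" using d by (auto simp: dist_norm)
    define r where "r = cmod (x - y)"
    have r: "0 \<le> r" "r < d / 2" using yd by (auto simp: r_def)
    have "r\<^sup>2 \<le> (d / 2)\<^sup>2" using r by (intro power_mono) auto
    then have r2: "r\<^sup>2 \<le> d\<^sup>2 / 4" by (simp add: power_divide)
    have d2: "0 < d\<^sup>2" using d by simp
    have pos: "0 < d\<^sup>2 * (d\<^sup>2 - r\<^sup>2)" using d2 r2 by (intro mult_pos_pos) linarith+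
    have "(d * r)\<^sup>2 \<le> d\<^sup>2 * (d\<^sup>2 - r\<^sup>2)" unfolding power_mult_distrib using d2 r2 by (intro mult_left_mono) linarith+
    then have "d * r \<le> sqrt (d\<^sup>2 * (d\<^sup>2 - r\<^sup>2))" by (rule real_le_rsqrt)
    then have "d * r / sqrt (d\<^sup>2 * (d\<^sup>2 - r\<^sup>2)) \<le> 1" using pos by (simp only: divide_le_eq_1) simp
    then have "disc_dist x d x y \<le> arsinh 1"
      unfolding disc_dist_def using arsinh_mono by (simp add: r_def norm_minus_commute)
    then have k: "kobayashi_dist D x y \<le> arsinh 1"
      using kobayashi_le_disc_dist[OF D B d _ y, of x] d by simp
    have "kobayashi_dist D y x = kobayashi_dist D x y"
      using kobayashi_pseudodistance[OF D] x y B unfolding pseudodistance_on_def by (metis subsetD)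
    then show "y \<in> D \<and> ennreal (kobayashi_dist D x y) \<le> ennreal (arsinh 1) \<and> ennreal (kobayashi_dist D y x) \<le> ennreal (arsinh 1)"
      using k y B by (auto intro: ennreal_leI)
  qed
qed

lemma kobayashi_upper_bound:
  assumes flat: "flat_along D S" and D: "domain D" and h: "0 < h" "h \<le> 1"
  shows "\<exists>\<delta>>0. \<forall>z\<in>D. \<forall>w\<in>D. near_pair D S \<delta> z w \<longrightarrow> kobayashi_dist D z w \<le> (1 + h) * s_fun D z w"
proof -
  have fr: "frontier D \<noteq> {}" using flat by (auto simp: flat_along_def)
  have "(0::real) < 1" by simp
  from disc_dominated_upper[OF kobayashi_disc_dominated[OF D, of S] flat D h this kobayashi_locally_bounded[OF D fr]]
  obtain \<delta> where \<delta>: "0 < \<delta>" "\<And>z w. z \<in> D \<Longrightarrow> w \<in> D \<Longrightarrow> near_pair D S \<delta> z w \<Longrightarrow>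
      ennreal (kobayashi_dist D z w) \<le> ennreal (1 * ((1 + h) * s_fun D z w))" by blast
  have "0 \<le> (1 + h) * s_fun D z w" for z w using h s_fun_nonneg[of D z w] by simp
  then show ?thesis using \<delta> by (intro exI[of _ \<delta>]) (simp add: ennreal_le_iff)
qed

lemma bergman_upper_bound:
  assumes flat: "flat_along D S" and D: "domain D" and h: "0 < h" "h \<le> 1"
  shows "\<exists>\<delta>>0. \<forall>z\<in>D. \<forall>w\<in>D. near_pair D S \<delta> z w \<longrightarrow>
    weighted_dist D (bergman_metric D) z w \<le> ennreal (sqrt 2 * ((1 + h) * s_fun D z w))"
proof -
  have oD: "open D" and fr: "frontier D \<noteq> {}" using flat D by (auto simp: flat_along_def domain_def)
  define h1 where "h1 = h / 4"
  have h1: "0 < h1" "h1 \<le> 1" using h by (auto simp: h1_def)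
  obtain \<rho> \<delta> where \<rho>: "0 < \<delta>" "\<rho> \<in> borel_measurable borel" "\<And>x. x \<in> D \<Longrightarrow> bergman_metric D x \<le> \<rho> x"
     "\<And>x. x \<in> D \<Longrightarrow> infdist x S < \<delta> \<Longrightarrow> \<rho> x \<le> (1 + h1) / sqrt 2 / bdry_dist D x"
     "\<And>x. x \<in> D \<Longrightarrow> \<exists>e>0. \<exists>C. \<forall>y\<in>ball x e. y \<in> D \<and> \<rho> y \<le> C"
    using bergman_weight[OF flat D h1] by blast
  define \<kappa> where "\<kappa> = (1 + h1) / sqrt 2"
  have \<kappa>: "0 < \<kappa>" using h1 by (simp add: \<kappa>_def)
  have k: "2 * \<kappa> = sqrt 2 * (1 + h1)" using real_sqrt_mult_self[of 2] by (simp add: \<kappa>_def field_simps)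
  have ball: "weighted_dist D \<rho> z w \<le> ennreal (2 * \<kappa> * disc_dist c r z w)"
    if "0 < r" "ball c r \<subseteq> D" "\<forall>x\<in>ball c r. infdist x S < \<delta>" "z \<in> ball c r" "w \<in> ball c r" for c r z w
    using \<rho>(4) that \<kappa> by (intro weighted_dist_le_disc_dist[OF oD fr]) (auto simp: \<kappa>_def subset_iff)
  have P: "disc_dominated D S (2 * \<kappa>) (weighted_dist D \<rho>)"
    unfolding disc_dominated_def
  proof (intro conjI ballI)
    show "0 \<le> 2 * \<kappa>" using \<kappa> by simp
    show "weighted_dist D \<rho> x z \<le> weighted_dist D \<rho> x y + weighted_dist D \<rho> y z" for x y z
      by (rule weighted_dist_triangle[OF \<rho>(2)])
    show "\<exists>\<delta>>0. \<forall>c r z w. 0 < r \<longrightarrow> ball c r \<subseteq> D \<longrightarrow> (\<forall>x\<in>ball c r. infdist x S < \<delta>) \<longrightarrow>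
       z \<in> ball c r \<longrightarrow> w \<in> ball c r \<longrightarrow> weighted_dist D \<rho> z w \<le> ennreal (2 * \<kappa> * disc_dist c r z w)"
      using ball \<rho>(1) by blast
  qed
  have loc: "\<exists>e>0. \<exists>C. \<forall>y\<in>ball x e. y \<in> D \<and> weighted_dist D \<rho> x y \<le> ennreal C \<and> weighted_dist D \<rho> y x \<le> ennreal C"
    if x: "x \<in> D" for x
  proof -
    obtain e C where e: "0 < e" "\<And>y. y \<in> ball x e \<Longrightarrow> y \<in> D" "\<And>y. y \<in> ball x e \<Longrightarrow> \<rho> y \<le> C" using \<rho>(5)[OF x] by blast
    have "weighted_dist D \<rho> u v \<le> ennreal (max 0 C * (2 * e))" if uv: "u \<in> ball x e" "v \<in> ball x e" for u v
    proof -
      have seg: "closed_segment u v \<subseteq> ball x e" using uv by (rule closed_segment_subset[OF _ _ convex_ball])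
      then have "weighted_dist D \<rho> u v \<le> ennreal (C * cmod (v - u))"
        using e by (intro weighted_dist_le_segment) auto
      also have "\<dots> \<le> ennreal (max 0 C * (2 * e))"
      proof (intro ennreal_leI mult_mono)
        show "cmod (v - u) \<le> 2 * e" using uv dist_triangle2[of v u x] by (simp add: dist_norm norm_minus_commute)
      qed auto
      finally show ?thesis .
    qed
    then show ?thesis using e by (intro exI[of _ e] conjI exI[of _ "max 0 C * (2 * e)"] ballI) auto
  qed
  have k0: "0 < 2 * \<kappa>" using \<kappa> by simp
  obtain \<delta>' where \<delta>': "0 < \<delta>'" "\<And>z w. z \<in> D \<Longrightarrow> w \<in> D \<Longrightarrow> near_pair D S \<delta>' z w \<Longrightarrow>
      weighted_dist D \<rho> z w \<le> ennreal (2 * \<kappa> * ((1 + h1) * s_fun D z w))"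
    using disc_dominated_upper[OF P flat D h1 k0 loc] by blast
  have "weighted_dist D (bergman_metric D) z w \<le> ennreal (sqrt 2 * ((1 + h) * s_fun D z w))"
    if zw: "z \<in> D" "w \<in> D" "near_pair D S \<delta>' z w" for z w
  proof -
    have "weighted_dist D (bergman_metric D) z w \<le> weighted_dist D \<rho> z w" by (rule weighted_dist_mono[OF \<rho>(3)])
    also have "\<dots> \<le> ennreal (2 * \<kappa> * ((1 + h1) * s_fun D z w))" by (rule \<delta>'(2)[OF zw])
    also have "2 * \<kappa> * ((1 + h1) * s_fun D z w) = sqrt 2 * ((1 + h / 4) * ((1 + h1) * s_fun D z w))"
      unfolding k by (simp add: h1_def)
    also have "ennreal \<dots> \<le> ennreal (sqrt 2 * ((1 + h) * s_fun D z w))"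
      using s_fun_nonneg[of D z w]
      by (intro ennreal_leI absorb_constant[OF h, where C = "h / 4 * s_fun D z w"]) (auto simp: h1_def algebra_simps)
    finally show ?thesis .
  qed
  then show ?thesis using \<delta>'(1) by blast
qed

text \<open>The bounds of c from below and of k from above apply to both distances, as \<open>c \<le> k\<close>. The bounds of the Bergman
  length show that the infimum of lengths is finite, so its value as a real number is the genuine one.\<close>

lemma distances_comparable:
  assumes flat: "flat_along D S" and D: "domain D" and \<eta>: "0 < \<eta>" "\<eta> \<le> 1"
    and p: "p \<in> {caratheodory_dist D, kobayashi_dist D, (\<lambda>z w. bergman_dist D z w / sqrt 2)}"
  shows "\<exists>\<delta>>0. \<forall>z\<in>D. \<forall>w\<in>D. near_pair D S \<delta> z w \<longrightarrow>
    (1 - \<eta>) * s_fun D z w \<le> p z w \<and> p z w \<le> (1 + \<eta>) * s_fun D z w"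
proof -
  obtain M where M: "\<And>z w. z \<in> D \<Longrightarrow> w \<in> D \<Longrightarrow> near_pair D S 1 z w \<Longrightarrow> cmod (z - w) \<le> M"
    using near_pair_dist_bound[of D S] by blast
  obtain \<delta>c where \<delta>c: "0 < \<delta>c" "\<And>z w. z \<in> D \<Longrightarrow> w \<in> D \<Longrightarrow> infdist z S < \<delta>c \<Longrightarrow> infdist w S < \<delta>c \<or> S = frontier D \<Longrightarrow>
      cmod (z - w) \<le> M \<Longrightarrow> (1 - \<eta>) * s_fun D z w \<le> caratheodory_dist D z w"
    using caratheodory_lower_bound[OF flat D \<eta>, of M] by blast
  obtain \<delta>b where \<delta>b: "0 < \<delta>b" "\<And>z w \<gamma>. z \<in> D \<Longrightarrow> w \<in> D \<Longrightarrow> infdist z S < \<delta>b \<Longrightarrow> infdist w S < \<delta>b \<or> S = frontier D \<Longrightarrow>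
      cmod (z - w) \<le> M \<Longrightarrow> curve_in D z w \<gamma> \<Longrightarrow> ennreal (sqrt 2 * ((1 - \<eta>) * s_fun D z w)) \<le> bergman_length D \<gamma>"
    using bergman_lower_bound[OF flat D \<eta>, of M] by blast
  obtain \<delta>k where \<delta>k: "0 < \<delta>k" "\<And>z w. z \<in> D \<Longrightarrow> w \<in> D \<Longrightarrow> near_pair D S \<delta>k z w \<Longrightarrow> kobayashi_dist D z w \<le> (1 + \<eta>) * s_fun D z w"
    using kobayashi_upper_bound[OF flat D \<eta>] by blast
  obtain \<delta>u where \<delta>u: "0 < \<delta>u" "\<And>z w. z \<in> D \<Longrightarrow> w \<in> D \<Longrightarrow> near_pair D S \<delta>u z w \<Longrightarrow>
      weighted_dist D (bergman_metric D) z w \<le> ennreal (sqrt 2 * ((1 + \<eta>) * s_fun D z w))"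
    using bergman_upper_bound[OF flat D \<eta>] by blast
  define \<delta> where "\<delta> = min (min \<delta>c \<delta>b) (min (min \<delta>k \<delta>u) 1)"
  have \<delta>: "0 < \<delta>" "\<delta> \<le> \<delta>c" "\<delta> \<le> \<delta>b" "\<delta> \<le> \<delta>k" "\<delta> \<le> \<delta>u" "\<delta> \<le> 1" using \<delta>c \<delta>b \<delta>k \<delta>u by (auto simp: \<delta>_def)
  show ?thesis
  proof (rule exI[of _ \<delta>], intro conjI[OF \<delta>(1)] ballI impI)
    fix z w assume z: "z \<in> D" and w: "w \<in> D" and np: "near_pair D S \<delta> z w"
    have zw: "cmod (z - w) \<le> M" by (rule M[OF z w near_pair_mono[OF np \<delta>(6)]])
    have inf: "infdist z S < \<delta>" "infdist w S < \<delta> \<or> S = frontier D" using np by (auto simp: near_pair_def)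
    have "infdist z S < \<delta>c" "infdist w S < \<delta>c \<or> S = frontier D" using inf \<delta>(2) by auto
    then have c: "(1 - \<eta>) * s_fun D z w \<le> caratheodory_dist D z w" using \<delta>c(2)[OF z w _ _ zw] by blast
    have ck: "caratheodory_dist D z w \<le> kobayashi_dist D z w" by (rule caratheodory_le_kobayashi[OF D z w])
    have k: "kobayashi_dist D z w \<le> (1 + \<eta>) * s_fun D z w" by (rule \<delta>k(2)[OF z w near_pair_mono[OF np \<delta>(4)]])
    have u: "weighted_dist D (bergman_metric D) z w \<le> ennreal (sqrt 2 * ((1 + \<eta>) * s_fun D z w))"
      by (rule \<delta>u(2)[OF z w near_pair_mono[OF np \<delta>(5)]])
    have infb: "infdist z S < \<delta>b" "infdist w S < \<delta>b \<or> S = frontier D" using inf \<delta>(3) by auto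
    have l: "ennreal (sqrt 2 * ((1 - \<eta>) * s_fun D z w)) \<le> weighted_dist D (bergman_metric D) z w"
      unfolding weighted_dist_def bergman_length_eq[symmetric]
      by (rule INF_greatest) (use \<delta>b(2)[OF z w infb zw] in auto)
    have "weighted_dist D (bergman_metric D) z w < top" using u ennreal_less_top by (rule le_less_trans)
    then obtain b where b: "weighted_dist D (bergman_metric D) z w = ennreal b" "0 \<le> b"
      by (metis ennreal_cases infinity_ennreal_def less_irrefl)
    have s0: "0 \<le> (1 + \<eta>) * s_fun D z w" using \<eta> s_fun_nonneg[of D z w] by simp
    have "sqrt 2 * ((1 - \<eta>) * s_fun D z w) \<le> b" using l unfolding b(1) by (simp only: ennreal_le_iff[OF b(2)])
    moreover have "b \<le> sqrt 2 * ((1 + \<eta>) * s_fun D z w)"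
      using u s0 unfolding b(1) by (subst (asm) ennreal_le_iff) auto
    moreover have "bergman_dist D z w = b" unfolding bergman_dist_eq b(1) using b(2) by simp
    ultimately have bb: "(1 - \<eta>) * s_fun D z w \<le> bergman_dist D z w / sqrt 2" "bergman_dist D z w / sqrt 2 \<le> (1 + \<eta>) * s_fun D z w"
      by (simp_all add: le_divide_eq divide_le_eq mult_ac)
    show "(1 - \<eta>) * s_fun D z w \<le> p z w \<and> p z w \<le> (1 + \<eta>) * s_fun D z w"
      using p c ck k bb by auto
  qed
qed

lemma distance_ratio_near_1:
  assumes flat: "flat_along D S" and D: "domain D" and \<eta>: "0 < \<eta>"
    and p: "p \<in> {caratheodory_dist D, kobayashi_dist D, (\<lambda>z w. bergman_dist D z w / sqrt 2)}"
  shows "\<exists>\<delta>>0. \<forall>z\<in>D. \<forall>w\<in>D - {z}. near_pair D S \<delta> z w \<longrightarrow> \<bar>p z w / s_fun D z w - 1\<bar> < \<eta>"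
proof -
  have oD: "open D" and fr: "frontier D \<noteq> {}" using flat D by (auto simp: flat_along_def domain_def)
  define h where "h = min (\<eta> / 2) 1"
  have h: "0 < h" "h \<le> 1" "h < \<eta>" using \<eta> by (auto simp: h_def)
  obtain \<delta> where \<delta>: "0 < \<delta>" "\<And>z w. z \<in> D \<Longrightarrow> w \<in> D \<Longrightarrow> near_pair D S \<delta> z w \<Longrightarrow>
    (1 - h) * s_fun D z w \<le> p z w \<and> p z w \<le> (1 + h) * s_fun D z w"
    using distances_comparable[OF flat D h(1,2) p] by blast
  have "\<bar>p z w / s_fun D z w - 1\<bar> < \<eta>" if z: "z \<in> D" and w: "w \<in> D - {z}" and np: "near_pair D S \<delta> z w" for z w
  proof -
    have s: "0 < s_fun D z w" using z w by (intro s_fun_pos bdry_dist_pos[OF oD _ fr]) auto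
    have "1 - h \<le> p z w / s_fun D z w" "p z w / s_fun D z w \<le> 1 + h"
      using \<delta>(2)[OF z _ np] w s by (auto simp: le_divide_eq divide_le_eq)
    then show ?thesis using h(3) by linarith
  qed
  then show ?thesis using \<delta>(1) by blast
qed

lemma flat_along_point:
  assumes a: "a \<in> frontier D" and C1: "C1_smooth_boundary_point D a"
  shows "flat_along D {a}"
  unfolding flat_along_def
proof (intro conjI allI impI)
  fix \<epsilon> :: real assume \<epsilon>: "0 < \<epsilon>"
  then have \<epsilon>': "0 < min \<epsilon> (1 / 2)" "min \<epsilon> (1 / 2) \<le> 1 / 2" by auto
  obtain r where r: "0 < r" "\<forall>p\<in>frontier D \<inter> ball a r. \<exists>n. has_cones D (min \<epsilon> (1 / 2)) r p n"
    using C1_smooth_boundary_point_has_cones[OF C1 \<epsilon>'] by blast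
  show "\<exists>r>0. \<forall>p\<in>frontier D. infdist p {a} < r \<longrightarrow> (\<exists>n. has_cones D \<epsilon> r p n)"
  proof (rule exI[of _ r], intro conjI[OF r(1)] ballI impI)
    fix p assume "p \<in> frontier D" "infdist p {a} < r"
    then have "p \<in> frontier D \<inter> ball a r" by (simp add: dist_commute)
    then show "\<exists>n. has_cones D \<epsilon> r p n" using r(2) has_cones_mono[of D "min \<epsilon> (1 / 2)" r p _ \<epsilon> r] by fastforce
  qed
qed (use a in auto)

lemma flat_along_frontier:
  assumes C1: "C1_smooth_domain D" and b: "bounded D"
  shows "flat_along D (frontier D)"
  unfolding flat_along_def
proof (intro conjI allI impI)
  show "frontier D \<noteq> {}"
    using C1 b not_bounded_UNIV unfolding frontier_eq_empty by (auto simp: C1_smooth_domain_def domain_def)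
  fix \<epsilon> :: real assume \<epsilon>: "0 < \<epsilon>"
  then have \<epsilon>': "0 < min \<epsilon> (1 / 2)" "min \<epsilon> (1 / 2) \<le> 1 / 2" by auto
  obtain r where r: "0 < r" "\<forall>p\<in>frontier D. \<exists>n. has_cones D (min \<epsilon> (1 / 2)) r p n"
    using compact_frontier_has_cones[OF C1 b \<epsilon>'] by blast
  show "\<exists>r>0. \<forall>p\<in>frontier D. infdist p (frontier D) < r \<longrightarrow> (\<exists>n. has_cones D \<epsilon> r p n)"
  proof (rule exI[of _ r], intro conjI[OF r(1)] ballI impI)
    fix p assume "p \<in> frontier D"
    then show "\<exists>n. has_cones D \<epsilon> r p n" using r(2) has_cones_mono[of D "min \<epsilon> (1 / 2)" r p _ \<epsilon> r] by fastforce
  qed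
qed simp

theorem proposition7:
  fixes D :: "complex set" and p :: "complex \<Rightarrow> complex \<Rightarrow> real"
  assumes "domain D"
    and "p \<in> {caratheodory_dist D, kobayashi_dist D, (\<lambda>z w. bergman_dist D z w / sqrt 2)}"
  shows "(\<forall>a\<in>frontier D. C1_smooth_boundary_point D a \<longrightarrow>
            ((\<lambda>(z, w). p z w / s_fun D z w) \<longlongrightarrow> 1)
              (at (a, a) within {(z, w). z \<in> D \<and> w \<in> D \<and> z \<noteq> w})) \<and>
         (C1_smooth_domain D \<and> bounded D \<longrightarrow>
            (\<forall>\<eta>>0. \<exists>\<delta>>0. \<forall>z\<in>D. bdry_dist D z < \<delta> \<longrightarrow>
               (\<forall>w\<in>D - {z}. \<bar>p z w / s_fun D z w - 1\<bar> < \<eta>)))"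
proof (intro conjI ballI impI allI)
  fix a assume a: "a \<in> frontier D" and C1: "C1_smooth_boundary_point D a"
  note flat = flat_along_point[OF a C1]
  show "((\<lambda>(z, w). p z w / s_fun D z w) \<longlongrightarrow> 1) (at (a, a) within {(z, w). z \<in> D \<and> w \<in> D \<and> z \<noteq> w})"
  proof (rule tendstoI)
    fix \<eta> :: real assume \<eta>: "0 < \<eta>"
    obtain \<delta> where \<delta>: "0 < \<delta>" "\<And>z w. z \<in> D \<Longrightarrow> w \<in> D - {z} \<Longrightarrow> near_pair D {a} \<delta> z w \<Longrightarrow> \<bar>p z w / s_fun D z w - 1\<bar> < \<eta>"
      using distance_ratio_near_1[OF flat assms(1) \<eta> assms(2)] by blast
    have "dist (p z w / s_fun D z w) 1 < \<eta>"
      if zw: "z \<in> D" "w \<in> D" "z \<noteq> w" and d: "dist (z, w) (a, a) < \<delta> / 2" for z w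
    proof -
      have "dist z a < \<delta> / 2" "dist w a < \<delta> / 2"
        using d dist_fst_le[of "(z, w)" "(a, a)"] dist_snd_le[of "(z, w)" "(a, a)"] by auto
      then have "near_pair D {a} \<delta> z w"
        using dist_triangle_half_l[of z a \<delta> w] \<delta>(1) by (auto simp: near_pair_def dist_norm)
      then show ?thesis using \<delta>(2)[OF zw(1)] zw by (simp add: dist_real_def)
    qed
    then show "\<forall>\<^sub>F x in at (a, a) within {(z, w). z \<in> D \<and> w \<in> D \<and> z \<noteq> w}. dist (case x of (z, w) \<Rightarrow> p z w / s_fun D z w) 1 < \<eta>"
      unfolding eventually_at using \<delta>(1) by (intro exI[of _ "\<delta> / 2"]) auto
  qed
next
  fix \<eta> :: real assume C1: "C1_smooth_domain D \<and> bounded D" and \<eta>: "0 < \<eta>"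
  then have flat: "flat_along D (frontier D)" by (intro flat_along_frontier) auto
  obtain \<delta> where "0 < \<delta>" "\<And>z w. z \<in> D \<Longrightarrow> w \<in> D - {z} \<Longrightarrow> near_pair D (frontier D) \<delta> z w \<Longrightarrow> \<bar>p z w / s_fun D z w - 1\<bar> < \<eta>"
    using distance_ratio_near_1[OF flat assms(1) \<eta> assms(2)] by blast
  then show "\<exists>\<delta>>0. \<forall>z\<in>D. bdry_dist D z < \<delta> \<longrightarrow> (\<forall>w\<in>D - {z}. \<bar>p z w / s_fun D z w - 1\<bar> < \<eta>)"
    using C1 by (intro exI[of _ \<delta>]) (auto simp: near_pair_def bdry_dist_def)
qed

end
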